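(* There is a polynomial-time randomized algorithm for FTFP which always outputs a feasible integral solution and whose expected cost is at most $(1+2/e)\cdot\mathrm{LP}^\ast\le(1+2/e)\cdot\mathrm{OPT}$, where $\mathrm{LP}^\ast$ is the optimal value of the LP relaxation and $\mathrm{OPT}$ the optimal integral cost.
   Context: FTFP (Fault-Tolerant Facility Placement): given a finite set $\mathbb{F}$ of sites and a finite set $\mathbb{C}$ of clients, an opening cost $f_i\ge 0$ for each site $i$, connection costs $d_{ij}\ge 0$ forming a metric (symmetric, triangle inequality), and a positive integer demand $r_j$ for each client $j$. Any number of facilities may be opened at a site; a feasible integral solution consists of nonnegative integers $y_i$ (facilities opened at site $i$) and $x_{ij}$ (connections of $j$ to facilities at site $i$) with $x_{ij}\le y_i$ and $\sum_{i}x_{ij}\ge r_j$, so that each client is connected to $r_j$ distinct facilities; its cost is $\sum_i f_iy_i+\sum_{i,j}d_{ij}x_{ij}$. The LP relaxation is the same program with real $x_{ij},y_i\ge 0$. *)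

theory Defs
  imports "HOL-Probability.Probability" "HOL-Computational_Algebra.Polynomial"
    "HOL-Library.Log_Nat"
begin

section \<open>Randomized random-access programs with logarithmic cost\<close>

text \<open>
  The machine has an unbounded memory of natural numbers with indirect addressing
  (\<open>Mem e\<close> reads the cell whose address is the value of \<open>e\<close>). \<open>Sub\<close> is truncated
  subtraction and \<open>Div\<close> is integer division.
\<close>

datatype expr =
    Const nat
  | Mem expr
  | Add expr expr
  | Sub expr expr
  | Mul expr expr
  | Div expr expr

text \<open>
  \<open>Assign a e\<close> stores the value of \<open>e\<close> in the cell with address \<open>a\<close>; \<open>Draw a e\<close> stores
  there a fresh uniformly distributed element of \<open>{0..n}\<close>, where \<open>n\<close> is the value of
  \<open>e\<close> (so \<open>Draw a (Const 1)\<close> is a fair coin). A test succeeds iff its value is nonzero.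
\<close>

datatype com =
    Skip
  | Assign expr expr
  | Draw expr expr
  | Seq com com
  | Cond expr com com
  | While expr com

type_synonym memory = "nat \<Rightarrow> nat"

primrec eval :: "memory \<Rightarrow> expr \<Rightarrow> nat" where
  "eval m (Const n) = n"
| "eval m (Mem e) = m (eval m e)"
| "eval m (Add a b) = eval m a + eval m b"
| "eval m (Sub a b) = eval m a - eval m b"
| "eval m (Mul a b) = eval m a * eval m b"
| "eval m (Div a b) = eval m a div eval m b"

definition nat_size :: "nat \<Rightarrow> nat" where
  "nat_size n = 1 + floorlog 2 n"

text \<open>
  Logarithmic cost criterion: every node of an expression is charged the binary length of
  its value. Since operands and addresses are nodes themselves, their lengths are charged too.
\<close>

primrec eval_cost :: "memory \<Rightarrow> expr \<Rightarrow> nat" where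
  "eval_cost m (Const n) = nat_size n"
| "eval_cost m (Mem e) = eval_cost m e + nat_size (eval m (Mem e))"
| "eval_cost m (Add a b) = eval_cost m a + eval_cost m b + nat_size (eval m (Add a b))"
| "eval_cost m (Sub a b) = eval_cost m a + eval_cost m b + nat_size (eval m (Sub a b))"
| "eval_cost m (Mul a b) = eval_cost m a + eval_cost m b + nat_size (eval m (Mul a b))"
| "eval_cost m (Div a b) = eval_cost m a + eval_cost m b + nat_size (eval m (Div a b))"

text \<open>
  A configuration consists of the stack of commands still to be executed, the memory, and the
  time consumed so far. It is halted iff the stack is empty.
\<close>

type_synonym config = "com list \<times> memory \<times> nat"

fun step :: "config \<Rightarrow> config pmf" where
  "step ([], m, t) = return_pmf ([], m, t)"
| "step (Skip # k, m, t) = return_pmf (k, m, t + 1)"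
| "step (Assign a e # k, m, t) =
     return_pmf (k, m(eval m a := eval m e), t + 1 + eval_cost m a + eval_cost m e)"
| "step (Draw a e # k, m, t) =
     map_pmf (\<lambda>v. (k, m(eval m a := v), t + 1 + eval_cost m a + eval_cost m e))
       (pmf_of_set {0..eval m e})"
| "step (Seq c c' # k, m, t) = return_pmf (c # c' # k, m, t + 1)"
| "step (Cond e c c' # k, m, t) =
     return_pmf ((if eval m e \<noteq> 0 then c else c') # k, m, t + 1 + eval_cost m e)"
| "step (While e c # k, m, t) =
     return_pmf (if eval m e \<noteq> 0 then c # While e c # k else k, m, t + 1 + eval_cost m e)"

primrec run :: "nat \<Rightarrow> config \<Rightarrow> config pmf" where
  "run 0 s = return_pmf s"
| "run (Suc n) s = bind_pmf (step s) (run n)"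

definition init_config :: "com \<Rightarrow> nat list \<Rightarrow> config" where
  "init_config P xs = ([P], \<lambda>a. if a < length xs then xs ! a else 0, 0)"

text \<open>
  Every step takes at least one unit of time, so a computation of total time at most \<open>T\<close>
  has halted after \<open>T\<close> steps. The bound is a worst-case bound over all random choices.
\<close>

definition halts_within :: "com \<Rightarrow> nat list \<Rightarrow> nat \<Rightarrow> bool" where
  "halts_within P xs T \<longleftrightarrow>
     (\<forall>(k, m, t) \<in> set_pmf (run T (init_config P xs)). k = [] \<and> t \<le> T)"

text \<open>Distribution of the final memory, for a program that halts on \<open>xs\<close> in bounded time.\<close>

definition outcome :: "com \<Rightarrow> nat list \<Rightarrow> memory pmf" where
  "outcome P xs =
     map_pmf (\<lambda>(k, m, t). m) (run (LEAST T. halts_within P xs T) (init_config P xs))"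

definition input_size :: "nat list \<Rightarrow> nat" where
  "input_size xs = (\<Sum>x\<leftarrow>xs. nat_size x)"

definition poly_time_on :: "nat list set \<Rightarrow> com \<Rightarrow> bool" where
  "poly_time_on X P \<longleftrightarrow>
     (\<exists>p :: nat poly. \<forall>xs \<in> X. halts_within P xs (poly p (input_size xs)))"

lemma finite_set_pmf_step: "finite (set_pmf (step s))"
  by (cases s rule: step.cases) auto

text \<open>All computations have finite support, so expectations over them always exist.\<close>

lemma finite_set_pmf_run: "finite (set_pmf (run n s))"
  by (induction n arbitrary: s) (auto simp: finite_set_pmf_step)

lemma finite_set_pmf_outcome: "finite (set_pmf (outcome P xs))"
  by (simp add: outcome_def finite_set_pmf_run)


section \<open>Fault-tolerant facility placement\<close>

text \<open>
  Sites and clients are numbered from 0. The distance lives on the disjoint union of sites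
  (\<open>Inl\<close>) and clients (\<open>Inr\<close>); distinct points may be at distance 0, so that a site and a
  client can share a location.
\<close>

record ftfp =
  num_sites :: nat
  num_clients :: nat
  open_cost :: "nat \<Rightarrow> rat"
  distance :: "nat + nat \<Rightarrow> nat + nat \<Rightarrow> rat"
  demand :: "nat \<Rightarrow> nat"

definition points :: "ftfp \<Rightarrow> (nat + nat) set" where
  "points I = {..<num_sites I} <+> {..<num_clients I}"

abbreviation conn_cost :: "ftfp \<Rightarrow> nat \<Rightarrow> nat \<Rightarrow> rat" where
  "conn_cost I i j \<equiv> distance I (Inl i) (Inr j)"

definition is_metric_on :: "'p set \<Rightarrow> ('p \<Rightarrow> 'p \<Rightarrow> rat) \<Rightarrow> bool" where
  "is_metric_on S d \<longleftrightarrow>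
     (\<forall>p\<in>S. d p p = 0) \<and>
     (\<forall>p\<in>S. \<forall>q\<in>S. 0 \<le> d p q \<and> d p q = d q p) \<and>
     (\<forall>p\<in>S. \<forall>q\<in>S. \<forall>s\<in>S. d p s \<le> d p q + d q s)"

text \<open>The last condition says that the instance is feasible.\<close>

definition ftfp_instance :: "ftfp \<Rightarrow> bool" where
  "ftfp_instance I \<longleftrightarrow>
     (\<forall>i < num_sites I. 0 \<le> open_cost I i) \<and>
     is_metric_on (points I) (distance I) \<and>
     (\<forall>j < num_clients I. 0 < demand I j) \<and>
     (0 < num_clients I \<longrightarrow> 0 < num_sites I)"

text \<open>
  At type \<open>nat\<close> these are the constraints of the integer program, at type \<open>real\<close> those
  of its LP relaxation.
\<close>

definition feasible ::
    "ftfp \<Rightarrow> (nat \<Rightarrow> 'a :: linordered_semidom) \<Rightarrow> (nat \<Rightarrow> nat \<Rightarrow> 'a) \<Rightarrow> bool" where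
  "feasible I y x \<longleftrightarrow>
     (\<forall>i < num_sites I. 0 \<le> y i) \<and>
     (\<forall>i < num_sites I. \<forall>j < num_clients I. 0 \<le> x i j \<and> x i j \<le> y i) \<and>
     (\<forall>j < num_clients I. of_nat (demand I j) \<le> (\<Sum>i < num_sites I. x i j))"

definition cost :: "ftfp \<Rightarrow> (nat \<Rightarrow> real) \<Rightarrow> (nat \<Rightarrow> nat \<Rightarrow> real) \<Rightarrow> real" where
  "cost I y x =
     (\<Sum>i < num_sites I. real_of_rat (open_cost I i) * y i) +
     (\<Sum>i < num_sites I. \<Sum>j < num_clients I. real_of_rat (conn_cost I i j) * x i j)"

definition int_cost :: "ftfp \<Rightarrow> (nat \<Rightarrow> nat) \<Rightarrow> (nat \<Rightarrow> nat \<Rightarrow> nat) \<Rightarrow> real" where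
  "int_cost I y x = cost I (\<lambda>i. real (y i)) (\<lambda>i j. real (x i j))"

definition LP_opt :: "ftfp \<Rightarrow> real" where
  "LP_opt I = Inf {cost I y x | y x. feasible I y x}"

definition OPT :: "ftfp \<Rightarrow> real" where
  "OPT I = Inf {int_cost I y x | y x. feasible I y x}"


subsection \<open>Binary encoding of instances and solutions\<close>

text \<open>
  Nonnegative rationals are encoded by numerator and denominator in lowest terms. Of the
  metric, only the connection costs between sites and clients are part of the input.
\<close>

definition encode_rat :: "rat \<Rightarrow> nat list" where
  "encode_rat q = [nat (fst (quotient_of q)), nat (snd (quotient_of q))]"

definition encode :: "ftfp \<Rightarrow> nat list" where
  "encode I =
     [num_sites I, num_clients I] @
     concat (map (\<lambda>i. encode_rat (open_cost I i)) [0..<num_sites I]) @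
     concat (map (\<lambda>i. concat (map (\<lambda>j. encode_rat (conn_cost I i j)) [0..<num_clients I]))
       [0..<num_sites I]) @
     map (demand I) [0..<num_clients I]"

text \<open>
  The solution is read off the final memory from address 0 on: first all \<open>y i\<close>, then the
  matrix \<open>x i j\<close> row by row.
\<close>

definition out_y :: "ftfp \<Rightarrow> memory \<Rightarrow> nat \<Rightarrow> nat" where
  "out_y I m i = m i"

definition out_x :: "ftfp \<Rightarrow> memory \<Rightarrow> nat \<Rightarrow> nat \<Rightarrow> nat" where
  "out_x I m i j = m (num_sites I + i * num_clients I + j)"

end

theory Submission
  imports Defs
begin

text \<open>
  Scale all costs to integers. A fractional solution is a combination of stars (a site together
  with a set of clients). Multiplicative weights on the clients produce one of cost at most
  \<open>1 + \<epsilon>\<close> times \<open>LP\<^sup>*\<close>: in every round the star of least ratio of cost to weight is bought, and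
  this ratio is bounded by weak duality. The integral part of every star is opened outright. The rest
  is cut into \<open>atoms\<close> of LP mass \<open>1/N\<close>, where every client with residual demand \<open>r\<close> sees at least
  \<open>r * N\<close> of them.

  An atom is opened with probability \<open>1/L\<close>, where \<open>N/L = 19/11\<close> is just below \<open>1 + 2/e\<close>, so
  facilities cost \<open>19/11\<close> times their fractional cost. To guarantee feasibility, disjoint clusters of
  \<open>L\<close> atoms are formed greedily in the order of increasing radius, and exactly one atom of each
  cluster is opened; the demands of a client are assigned different clusters, whose atoms are at
  distance at most \<open>3 * \<beta>\<close> where \<open>\<beta>\<close> is the radius of the \<open>L\<close> nearest remaining atoms.

  A client connects each demand to the nearest open atom of a set of \<open>N\<close> atoms, or to its cluster if
  that is nearer. No atom among \<open>a\<close> given ones is open with probability at most \<open>exp (- a / L)\<close>, and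
  integrating over the distance bounds the expected connection cost again by \<open>19/11\<close> times the
  fractional one; at \<open>\<gamma> = 19/11\<close> this uses \<open>1 + 1/e + 2 * exp (- \<gamma>) \<le> \<gamma>\<close>. The margin between
  \<open>19/11\<close> and \<open>1 + 2/e\<close> absorbs \<open>\<epsilon>\<close>.

  All loops of the program have polynomially bounded ranges, and each assignment lengthens the
  numbers in memory only additively, so that the bit sizes remain polynomial.
\<close>

section \<open>Structured programs over memory banks\<close>

text \<open>Demands are written in binary, so facilities cannot be treated one by one. Opening the
  integral part of a star outright leaves fewer than \<open>NN\<close> atoms per star, and taking
  the least demand of a star as its amount limits the number of stars to \<open>n * NN\<close>. The
  LP optimum is never computed. The cost bound of the weights phase holds simultaneously for every
  \<open>Z\<close> that bounds all dual solutions, hence for the cost of every feasible fractional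
  solution, and the infimum is taken only at the end. Integer arithmetic asks for a rational
  \<gamma>. The inequality that fixes it and the target ratio leave an interval of about 1.7245 to
  1.7357; 19/11 = 1.7273 lies inside with room on both sides. The assignment of demands used in the
  analysis is not executed: the program connects greedily to the nearest open facilities, which
  costs at most as much as any assignment to distinct open atoms. All random numbers are drawn in
  one block, so that everything before and after it is a deterministic function of the
  memory.\<close>

lemma run_add: "run (a + b) s = bind_pmf (run a s) (run b)"
  by (induction a arbitrary: s) (auto simp: bind_return_pmf bind_assoc_pmf intro!: bind_pmf_cong)

lemma run_halted: "run a ([], m, t) = return_pmf ([], m, t)"
  by (induction a) (simp_all add: bind_return_pmf)

text \<open>Only deterministic fragments are described. Because of \<open>s \<le> t\<close> one time
  bound also limits the number of machine steps, and the arbitrary stack \<open>k\<close> makes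
  fragments composable.\<close>

definition exec :: "com \<Rightarrow> memory \<Rightarrow> memory \<Rightarrow> nat \<Rightarrow> bool" where
  "exec c m m' t \<longleftrightarrow>
     (\<exists>s \<le> t. \<forall>k t0. run s (c # k, m, t0) = return_pmf (k, m', t0 + t))"

lemma exec_Skip: "exec Skip m m 1"
  unfolding exec_def by (rule exI[of _ 1]) (simp add: bind_return_pmf)

lemma exec_Assign:
  "exec (Assign a e) m (m(eval m a := eval m e)) (1 + eval_cost m a + eval_cost m e)"
  unfolding exec_def by (rule exI[of _ 1]) (simp add: bind_return_pmf)

lemma exec_Seq:
  assumes "exec c m m' t" "exec d m' m'' t'"
  shows "exec (Seq c d) m m'' (1 + t + t')"
proof -
  obtain s where s: "s \<le> t" "\<And>k t0. run s (c # k, m, t0) = return_pmf (k, m', t0 + t)"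
    using assms(1) by (auto simp: exec_def)
  obtain s' where s': "s' \<le> t'" "\<And>k t0. run s' (d # k, m', t0) = return_pmf (k, m'', t0 + t')"
    using assms(2) by (auto simp: exec_def)
  show ?thesis
    unfolding exec_def
    by (rule exI[of _ "Suc (s + s')"])
      (use s s' in \<open>simp add: bind_return_pmf run_add\<close>)
qed

lemma exec_Cond:
  assumes "exec (if eval m e \<noteq> 0 then c else d) m m' t"
  shows "exec (Cond e c d) m m' (1 + eval_cost m e + t)"
proof -
  obtain s where s: "s \<le> t"
    "\<And>k t0. run s ((if eval m e \<noteq> 0 then c else d) # k, m, t0) = return_pmf (k, m', t0 + t)"
    using assms by (auto simp: exec_def)
  show ?thesis
    unfolding exec_def
    by (rule exI[of _ "Suc s"]) (use s in \<open>simp add: bind_return_pmf\<close>)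
qed

lemma exec_While_False:
  assumes "eval m e = 0"
  shows "exec (While e c) m m (1 + eval_cost m e)"
  unfolding exec_def
  by (rule exI[of _ 1]) (use assms in \<open>simp add: bind_return_pmf\<close>)

lemma exec_While_True:
  assumes "eval m e \<noteq> 0" "exec c m m' t" "exec (While e c) m' m'' t'"
  shows "exec (While e c) m m'' (1 + eval_cost m e + t + t')"
proof -
  obtain s where s: "s \<le> t" "\<And>k t0. run s (c # k, m, t0) = return_pmf (k, m', t0 + t)"
    using assms(2) by (auto simp: exec_def)
  obtain s' where s': "s' \<le> t'"
    "\<And>k t0. run s' (While e c # k, m', t0) = return_pmf (k, m'', t0 + t')"
    using assms(3) by (auto simp: exec_def)
  show ?thesis
    unfolding exec_def
    by (rule exI[of _ "Suc (s + s')"])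
      (use s s' assms(1) in \<open>simp add: bind_return_pmf run_add\<close>)
qed

section \<open>Bit lengths of values and the cost of expressions\<close>

primrec expr_weight :: "expr \<Rightarrow> nat" where
  "expr_weight (Const c) = c + 1"
| "expr_weight (Mem e) = expr_weight e + 1"
| "expr_weight (Add a b) = expr_weight a + expr_weight b + 1"
| "expr_weight (Sub a b) = expr_weight a + expr_weight b + 1"
| "expr_weight (Mul a b) = expr_weight a + expr_weight b + 1"
| "expr_weight (Div a b) = expr_weight a + expr_weight b + 1"

lemma nat_le_two_power: "(n :: nat) \<le> 2 ^ n"
  using less_exp[of n] by linarith

lemma add_le_two_power:
  assumes "(x :: nat) \<le> 2 ^ a" "y \<le> 2 ^ b" "a \<le> c" "b \<le> c"
  shows "x + y \<le> 2 ^ (c + 1)"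
proof -
  have "x \<le> 2 ^ c" "y \<le> 2 ^ c"
    using assms order_trans power_increasing one_le_numeral by metis+
  thus ?thesis by simp
qed

lemma mult_le_two_power:
  assumes "(x :: nat) \<le> 2 ^ a" "y \<le> 2 ^ b" "a + b \<le> c"
  shows "x * y \<le> 2 ^ c"
proof -
  have "x * y \<le> 2 ^ a * 2 ^ b" using assms by (intro mult_mono) auto
  also have "\<dots> \<le> 2 ^ c" using assms(3) by (simp add: power_add[symmetric])
  finally show ?thesis .
qed

lemma le_two_power_mono: "(x :: nat) \<le> 2 ^ a \<Longrightarrow> a \<le> c \<Longrightarrow> x \<le> 2 ^ c"
  by (meson order_trans power_increasing one_le_numeral)

lemma nat_size_le:
  assumes "v \<le> 2 ^ p" shows "nat_size v \<le> p + 2"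
proof -
  have "v < 2 ^ (p + 1)" using assms by (simp add: less_le_trans le_less_trans)
  hence "floorlog 2 v \<le> p + 1" by (intro floorlog_leI) auto
  thus ?thesis by (simp add: nat_size_def)
qed

lemma eval_le:
  assumes "\<forall>a. m a \<le> 2 ^ b"
  shows "eval m e \<le> 2 ^ (expr_weight e * (b + 1))"
proof (induction e)
  case (Const c)
  have "c \<le> (c + 1) * (b + 1)" by simp
  from le_two_power_mono[OF nat_le_two_power this] show ?case by simp
next
  case (Mem e)
  have "b \<le> expr_weight (Mem e) * (b + 1)" by simp
  from le_two_power_mono[OF assms[rule_format] this] show ?case by (simp only: eval.simps)
next
  case (Add x y)
  have "eval m x + eval m y
      \<le> 2 ^ (expr_weight x * (b + 1) + expr_weight y * (b + 1) + 1)"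
    by (rule add_le_two_power[OF Add.IH]) auto
  thus ?case unfolding eval.simps by (rule le_two_power_mono) (simp add: algebra_simps)
next
  case (Sub x y)
  have "eval m x - eval m y \<le> eval m x" by simp
  also have "\<dots> \<le> 2 ^ (expr_weight (Sub x y) * (b + 1))"
    by (rule le_two_power_mono[OF Sub.IH(1)]) (simp add: algebra_simps)
  finally show ?case by simp
next
  case (Mul x y)
  show ?case unfolding eval.simps
    by (rule mult_le_two_power[OF Mul.IH]) (simp add: algebra_simps)
next
  case (Div x y)
  have "eval m x div eval m y \<le> eval m x" by simp
  also have "\<dots> \<le> 2 ^ (expr_weight (Div x y) * (b + 1))"
    by (rule le_two_power_mono[OF Div.IH(1)]) (simp add: algebra_simps)
  finally show ?case by simp
qed

lemma eval_cost_le: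
  assumes "\<forall>a. m a \<le> 2 ^ b"
  shows "eval_cost m e \<le> 3 * expr_weight e ^ 2 * (b + 1)"
proof -
  \<comment> \<open>\<open>W\<close> stays fixed during the induction: at most
    \<open>expr_weight e\<close> nodes are charged, each with the length bound of the whole
    expression. This is where the quadratic bound comes from.\<close>
  have *: "eval_cost m e \<le> expr_weight e * (W * (b + 1) + 2)" if "expr_weight e \<le> W" for W
    using that
  proof (induction e)
    case (Const c)
    have "nat_size (eval m (Const c)) \<le> W * (b + 1) + 2"
      using nat_size_le[OF eval_le[OF assms, where e = "Const c"]] mult_le_mono1[OF Const, of "b + 1"]
      by linarith
    thus ?case by (simp add: trans_le_add1)
  next
    case (Mem e)
    have "nat_size (eval m (Mem e)) \<le> W * (b + 1) + 2"
      using nat_size_le[OF eval_le[OF assms, where e = "Mem e"]] mult_le_mono1[OF Mem.prems, of "b + 1"]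
      by linarith
    thus ?case using Mem by (simp add: algebra_simps)
  next
    case (Add x y)
    have "nat_size (eval m (Add x y)) \<le> W * (b + 1) + 2"
      using nat_size_le[OF eval_le[OF assms, where e = "Add x y"]] mult_le_mono1[OF Add.prems, of "b + 1"]
      by linarith
    thus ?case using Add by (simp add: algebra_simps)
  next
    case (Sub x y)
    have "nat_size (eval m (Sub x y)) \<le> W * (b + 1) + 2"
      using nat_size_le[OF eval_le[OF assms, where e = "Sub x y"]] mult_le_mono1[OF Sub.prems, of "b + 1"]
      by linarith
    thus ?case using Sub by (simp add: algebra_simps)
  next
    case (Mul x y)
    have "nat_size (eval m (Mul x y)) \<le> W * (b + 1) + 2"
      using nat_size_le[OF eval_le[OF assms, where e = "Mul x y"]] mult_le_mono1[OF Mul.prems, of "b + 1"]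
      by linarith
    thus ?case using Mul by (simp add: algebra_simps)
  next
    case (Div x y)
    have "nat_size (eval m (Div x y)) \<le> W * (b + 1) + 2"
      using nat_size_le[OF eval_le[OF assms, where e = "Div x y"]] mult_le_mono1[OF Div.prems, of "b + 1"]
      by linarith
    thus ?case using Div by (simp add: algebra_simps)
  qed
  have pos: "1 \<le> expr_weight e" by (cases e) auto
  have "eval_cost m e \<le> expr_weight e * (expr_weight e * (b + 1) + 2)" using *[OF order_refl] .
  also have "\<dots> \<le> expr_weight e * (expr_weight e * (b + 1) + 2 * (expr_weight e * (b + 1)))"
    using pos by (intro mult_le_mono add_le_mono) auto
  also have "\<dots> = 3 * expr_weight e ^ 2 * (b + 1)" by (simp add: power2_eq_square algebra_simps)
  finally show ?thesis .
qed

section \<open>A language of bounded loops over memory banks, and its compiler\<close>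

datatype bexpr =
    Num nat
  | Cell nat bexpr
  | Inp bexpr
  | Plus bexpr bexpr (infixl "\<oplus>" 65)
  | Minus bexpr bexpr (infixl "\<ominus>" 65)
  | Times bexpr bexpr (infixl "\<otimes>" 70)
  | Quot bexpr bexpr (infixl "\<oslash>" 70)

datatype bcom =
    Nop
  | Store nat bexpr bexpr
  | Then bcom bcom (infixr ";;" 60)
  | Ite bexpr bcom bcom
  | For nat bexpr bcom

type_synonym banks = "nat \<Rightarrow> nat \<Rightarrow> nat"

definition nbanks :: nat where "nbanks = 64"

text \<open>The length of an encoded instance with \<open>inp 0\<close> sites and
  \<open>inp 1\<close> clients, hence the first address free for the banks.\<close>

definition base :: "memory \<Rightarrow> nat" where
  "base inp = 2 + (2 * inp 0 + (2 * (inp 0 * inp 1) + inp 1))"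

text \<open>The banks are interleaved behind the input, cell \<open>i\<close> of bank
  \<open>k\<close> at offset \<open>nbanks * i + k\<close>; so each of them is unbounded without any
  knowledge of the sizes of the others.\<close>

definition flat :: "memory \<Rightarrow> banks \<Rightarrow> memory" where
  "flat inp \<sigma> a = (if a < base inp then inp a
     else \<sigma> ((a - base inp) mod nbanks) ((a - base inp) div nbanks))"

definition put :: "nat \<Rightarrow> nat \<Rightarrow> nat \<Rightarrow> banks \<Rightarrow> banks" where
  "put k i v \<sigma> = \<sigma>(k := (\<sigma> k)(i := v))"

primrec ev :: "memory \<Rightarrow> banks \<Rightarrow> bexpr \<Rightarrow> nat" where
  "ev inp \<sigma> (Num c) = c"
| "ev inp \<sigma> (Cell k e) = \<sigma> k (ev inp \<sigma> e)"
| "ev inp \<sigma> (Inp e) = flat inp \<sigma> (ev inp \<sigma> e)"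
| "ev inp \<sigma> (a \<oplus> b) = ev inp \<sigma> a + ev inp \<sigma> b"
| "ev inp \<sigma> (a \<ominus> b) = ev inp \<sigma> a - ev inp \<sigma> b"
| "ev inp \<sigma> (a \<otimes> b) = ev inp \<sigma> a * ev inp \<sigma> b"
| "ev inp \<sigma> (a \<oslash> b) = ev inp \<sigma> a div ev inp \<sigma> b"

definition bump :: "nat \<Rightarrow> banks \<Rightarrow> banks" where
  "bump k \<sigma> = put k 0 (Suc (\<sigma> k 0)) \<sigma>"

primrec sem :: "memory \<Rightarrow> bcom \<Rightarrow> banks \<Rightarrow> banks" where
  "sem inp Nop \<sigma> = \<sigma>"
| "sem inp (Store k i e) \<sigma> = put k (ev inp \<sigma> i) (ev inp \<sigma> e) \<sigma>"
| "sem inp (c ;; d) \<sigma> = sem inp d (sem inp c \<sigma>)"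
| "sem inp (Ite e c d) \<sigma> = (if ev inp \<sigma> e \<noteq> 0 then sem inp c \<sigma> else sem inp d \<sigma>)"
| "sem inp (For k e c) \<sigma> = ((\<lambda>\<tau>. bump k (sem inp c \<tau>)) ^^ ev inp \<sigma> e) (put k 0 0 \<sigma>)"

abbreviation mem_at :: "nat \<Rightarrow> expr" where "mem_at a \<equiv> Mem (Const a)"

definition base_expr :: expr where
  "base_expr = Add (Const 2) (Add (Mul (Const 2) (mem_at 0))
     (Add (Mul (Const 2) (Mul (mem_at 0) (mem_at 1))) (mem_at 1)))"

definition cell_addr :: "nat \<Rightarrow> expr \<Rightarrow> expr" where
  "cell_addr k e = Add base_expr (Add (Mul (Const nbanks) e) (Const k))"

primrec cexpr :: "bexpr \<Rightarrow> expr" where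
  "cexpr (Num c) = Const c"
| "cexpr (Cell k e) = Mem (cell_addr k (cexpr e))"
| "cexpr (Inp e) = Mem (cexpr e)"
| "cexpr (a \<oplus> b) = Add (cexpr a) (cexpr b)"
| "cexpr (a \<ominus> b) = Sub (cexpr a) (cexpr b)"
| "cexpr (a \<otimes> b) = Mul (cexpr a) (cexpr b)"
| "cexpr (a \<oslash> b) = Div (cexpr a) (cexpr b)"

primrec ccom :: "bcom \<Rightarrow> com" where
  "ccom Nop = Skip"
| "ccom (Store k i e) = Assign (cell_addr k (cexpr i)) (cexpr e)"
| "ccom (c ;; d) = Seq (ccom c) (ccom d)"
| "ccom (Ite e c d) = Cond (cexpr e) (ccom c) (ccom d)"
| "ccom (For k e c) =
     Seq (Assign (cell_addr k (Const 0)) (Const 0))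
       (While (Sub (cexpr e) (Mem (cell_addr k (Const 0))))
         (Seq (ccom c)
           (Assign (cell_addr k (Const 0)) (Add (Mem (cell_addr k (Const 0))) (Const 1)))))"

text \<open>\<open>Inp\<close> can address any cell of the flat memory, the banks included; hence
  \<open>UNIV\<close>, which also keeps it out of loop bounds.\<close>

primrec bank_set :: "bexpr \<Rightarrow> nat set" where
  "bank_set (Num c) = {}"
| "bank_set (Cell k e) = insert k (bank_set e)"
| "bank_set (Inp e) = UNIV"
| "bank_set (a \<oplus> b) = bank_set a \<union> bank_set b"
| "bank_set (a \<ominus> b) = bank_set a \<union> bank_set b"
| "bank_set (a \<otimes> b) = bank_set a \<union> bank_set b"
| "bank_set (a \<oslash> b) = bank_set a \<union> bank_set b"

primrec banks_ok :: "bexpr \<Rightarrow> bool" where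
  "banks_ok (Num c) \<longleftrightarrow> True"
| "banks_ok (Cell k e) \<longleftrightarrow> k < nbanks \<and> banks_ok e"
| "banks_ok (Inp e) \<longleftrightarrow> banks_ok e"
| "banks_ok (a \<oplus> b) \<longleftrightarrow> banks_ok a \<and> banks_ok b"
| "banks_ok (a \<ominus> b) \<longleftrightarrow> banks_ok a \<and> banks_ok b"
| "banks_ok (a \<otimes> b) \<longleftrightarrow> banks_ok a \<and> banks_ok b"
| "banks_ok (a \<oslash> b) \<longleftrightarrow> banks_ok a \<and> banks_ok b"

primrec written :: "bcom \<Rightarrow> nat set" where
  "written Nop = {}"
| "written (Store k i e) = {k}"
| "written (c ;; d) = written c \<union> written d"
| "written (Ite e c d) = written c \<union> written d"
| "written (For k e c) = insert k (written c)"

text \<open>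
  The value of an expression is at most \<open>2 ^ (deg * b + O(b0))\<close> if the banks in \<open>W\<close> hold
  values below \<open>2 ^ b\<close> and the other banks values below \<open>2 ^ b0\<close>. A program that only stores
  expressions of degree at most 1 therefore lengthens the numbers in memory only additively
  in each step.
\<close>

primrec deg :: "nat set \<Rightarrow> bexpr \<Rightarrow> nat" where
  "deg W (Num c) = 0"
| "deg W (Cell k e) = (if k \<in> W then 1 else 0)"
| "deg W (Inp e) = 1"
| "deg W (a \<oplus> b) = max (deg W a) (deg W b)"
| "deg W (a \<ominus> b) = deg W a"
| "deg W (a \<otimes> b) = deg W a + deg W b"
| "deg W (a \<oslash> b) = deg W a"

text \<open>The conditions on \<open>For\<close> fix the number of iterations on entry: the body
  cannot change the counter, and the bound reads no bank of \<open>W\<close>. Degrees are restricted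
  for stored values only; tests may multiply long numbers, since their values are not kept.\<close>

primrec wf :: "nat set \<Rightarrow> bcom \<Rightarrow> bool" where
  "wf W Nop \<longleftrightarrow> True"
| "wf W (Store k i e) \<longleftrightarrow> k \<in> W \<and> k < nbanks \<and> banks_ok i \<and> banks_ok e \<and> deg W e \<le> 1"
| "wf W (c ;; d) \<longleftrightarrow> wf W c \<and> wf W d"
| "wf W (Ite e c d) \<longleftrightarrow> banks_ok e \<and> wf W c \<and> wf W d"
| "wf W (For k e c) \<longleftrightarrow> k \<in> W \<and> k < nbanks \<and> k \<notin> written c \<and> banks_ok e \<and>
     bank_set e \<inter> W = {} \<and> wf W c"

primrec loop_bounds :: "bcom \<Rightarrow> bexpr set" where
  "loop_bounds Nop = {}"
| "loop_bounds (Store k i e) = {}"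
| "loop_bounds (c ;; d) = loop_bounds c \<union> loop_bounds d"
| "loop_bounds (Ite e c d) = loop_bounds c \<union> loop_bounds d"
| "loop_bounds (For k e c) = insert e (loop_bounds c)"

text \<open>\<open>U\<close> is a common upper bound for the values of all loop bounds. In this and
  the following measures the two branches of a conditional are added, a crude substitute for their
  maximum.\<close>

primrec stores :: "nat \<Rightarrow> bcom \<Rightarrow> nat" where
  "stores U Nop = 0"
| "stores U (Store k i e) = 1"
| "stores U (c ;; d) = stores U c + stores U d"
| "stores U (Ite e c d) = stores U c + stores U d"
| "stores U (For k e c) = U * (stores U c + 1)"

primrec steps :: "nat \<Rightarrow> bcom \<Rightarrow> nat" where
  "steps U Nop = 1"
| "steps U (Store k i e) = 1"
| "steps U (c ;; d) = 1 + steps U c + steps U d"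
| "steps U (Ite e c d) = 1 + steps U c + steps U d"
| "steps U (For k e c) = 3 + U * (steps U c + 3)"

primrec bweight :: "bexpr \<Rightarrow> nat" where
  "bweight (Num c) = c + 1"
| "bweight (Cell k e) = bweight e + 1"
| "bweight (Inp e) = bweight e + 1"
| "bweight (a \<oplus> b) = bweight a + bweight b + 1"
| "bweight (a \<ominus> b) = bweight a + bweight b + 1"
| "bweight (a \<otimes> b) = bweight a + bweight b + 1"
| "bweight (a \<oslash> b) = bweight a + bweight b + 1"

primrec growth :: "bcom \<Rightarrow> nat" where
  "growth Nop = 0"
| "growth (Store k i e) = bweight e"
| "growth (c ;; d) = growth c + growth d"
| "growth (Ite e c d) = growth c + growth d"
| "growth (For k e c) = 1 + growth c"

definition ecost :: "expr \<Rightarrow> nat" where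
  "ecost e = 3 * expr_weight e ^ 2"

primrec unit_cost :: "bcom \<Rightarrow> nat" where
  "unit_cost Nop = 0"
| "unit_cost (Store k i e) = ecost (cell_addr k (cexpr i)) + ecost (cexpr e)"
| "unit_cost (c ;; d) = unit_cost c + unit_cost d"
| "unit_cost (Ite e c d) = ecost (cexpr e) + unit_cost c + unit_cost d"
| "unit_cost (For k e c) =
     ecost (cell_addr k (Const 0)) + ecost (Const 0)
     + ecost (Add (Mem (cell_addr k (Const 0))) (Const 1))
     + ecost (Sub (cexpr e) (Mem (cell_addr k (Const 0)))) + unit_cost c"

lemma put_same [simp]: "put k i v \<sigma> k = (\<sigma> k)(i := v)"
  by (simp add: put_def)

lemma put_other [simp]: "l \<noteq> k \<Longrightarrow> put k i v \<sigma> l = \<sigma> l"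
  by (simp add: put_def)

lemma bump_same [simp]: "bump k \<sigma> k = (\<sigma> k)(0 := Suc (\<sigma> k 0))"
  by (simp add: bump_def)

lemma bump_other [simp]: "l \<noteq> k \<Longrightarrow> bump k \<sigma> l = \<sigma> l"
  by (simp add: bump_def)

lemma base_ge: "2 \<le> base inp"
  by (simp add: base_def)

lemma flat_less [simp]: "a < base inp \<Longrightarrow> flat inp \<sigma> a = inp a"
  by (simp add: flat_def)

lemma flat_cell:
  assumes "k < nbanks"
  shows "flat inp \<sigma> (base inp + (nbanks * i + k)) = \<sigma> k i"
proof -
  have "0 < nbanks" using assms by simp
  thus ?thesis using assms by (simp add: flat_def)
qed

lemma flat_put:
  assumes "k < nbanks"
  shows "flat inp (put k i v \<sigma>) = (flat inp \<sigma>)(base inp + (nbanks * i + k) := v)"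
proof
  fix a
  have pos: "0 < nbanks" using assms by simp
  show "flat inp (put k i v \<sigma>) a = ((flat inp \<sigma>)(base inp + (nbanks * i + k) := v)) a"
  proof (cases "a < base inp")
    case False
    define c where "c = a - base inp"
    have a: "a = base inp + c" using False c_def by simp
    have "c mod nbanks = k \<and> c div nbanks = i \<longleftrightarrow> c = nbanks * i + k"
      using assms pos by (metis add.commute div_mult_self2 div_eq_0_iff mod_less mod_mult_self2
          mult_div_mod_eq add_0_left mod_mult_self3 not_gr_zero div_less add.right_neutral
          mult.commute div_mult_self4 mod_mult_self4)
    thus ?thesis using a by (auto simp: flat_def put_def)
  qed simp
qed

lemma eval_base_expr: "eval (flat inp \<sigma>) base_expr = base inp"
  using base_ge[of inp] by (simp add: base_expr_def) (simp add: base_def)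

lemma eval_cell_addr:
  "eval (flat inp \<sigma>) (cell_addr k e) = base inp + (nbanks * eval (flat inp \<sigma>) e + k)"
  by (simp add: cell_addr_def eval_base_expr)

lemma eval_cexpr: "banks_ok e \<Longrightarrow> eval (flat inp \<sigma>) (cexpr e) = ev inp \<sigma> e"
  by (induction e) (simp_all add: eval_cell_addr flat_cell)

lemma ev_cong: "(\<And>k. k \<in> bank_set e \<Longrightarrow> \<sigma> k = \<tau> k) \<Longrightarrow> ev inp \<sigma> e = ev inp \<tau> e"
proof (induction e)
  case (Inp e)
  hence "\<sigma> = \<tau>" by auto
  thus ?case by simp
qed auto

lemma sem_unwritten: "k \<notin> written c \<Longrightarrow> sem inp c \<sigma> k = \<sigma> k"
proof (induction c arbitrary: \<sigma>)
  case (For l e c)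
  have "((\<lambda>\<tau>. bump l (sem inp c \<tau>)) ^^ x) (put l 0 0 \<sigma>) k = \<sigma> k" for x
    using For by (induction x) auto
  thus ?case by simp
qed auto

lemma wf_written: "wf W c \<Longrightarrow> written c \<subseteq> W"
  by (induction c) auto

lemma sem_For_rule:
  assumes "k \<notin> written c"
    and "P 0 (put k 0 0 \<sigma>)"
    and "\<And>i \<tau>. i < ev inp \<sigma> e \<Longrightarrow> \<tau> k 0 = i \<Longrightarrow> P i \<tau> \<Longrightarrow> P (Suc i) (bump k (sem inp c \<tau>))"
  shows "P (ev inp \<sigma> e) (sem inp (For k e c) \<sigma>)"
proof -
  have "i \<le> ev inp \<sigma> e \<Longrightarrow>
      P i (((\<lambda>\<tau>. bump k (sem inp c \<tau>)) ^^ i) (put k 0 0 \<sigma>)) \<and>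
      ((\<lambda>\<tau>. bump k (sem inp c \<tau>)) ^^ i) (put k 0 0 \<sigma>) k 0 = i" for i
    by (induction i) (use assms in \<open>auto simp: sem_unwritten\<close>)
  thus ?thesis by simp
qed

lemma ev_le:
  assumes "\<forall>k i. \<sigma> k i \<le> 2 ^ b" "\<forall>a. inp a \<le> 2 ^ b" "\<forall>k i. k \<notin> W \<longrightarrow> \<sigma> k i \<le> 2 ^ b0"
  shows "ev inp \<sigma> e \<le> 2 ^ (deg W e * b + bweight e * (b0 + 1))"
proof (induction e)
  case (Num c)
  have "c \<le> (c + 1) * (b0 + 1)" by simp
  from le_two_power_mono[OF nat_le_two_power this] show ?case by simp
next
  case (Cell k e)
  show ?case
  proof (cases "k \<in> W")
    case True
    hence "b \<le> deg W (Cell k e) * b + bweight (Cell k e) * (b0 + 1)" by simp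
    from le_two_power_mono[OF assms(1)[rule_format] this] show ?thesis by (simp only: ev.simps)
  next
    case False
    have "b0 \<le> deg W (Cell k e) * b + bweight (Cell k e) * (b0 + 1)" by simp
    from le_two_power_mono[OF assms(3)[rule_format, OF False] this] show ?thesis by (simp only: ev.simps)
  qed
next
  case (Inp e)
  have "flat inp \<sigma> (ev inp \<sigma> e) \<le> 2 ^ b" using assms by (simp add: flat_def)
  moreover have "b \<le> deg W (Inp e) * b + bweight (Inp e) * (b0 + 1)" by simp
  ultimately show ?case using le_two_power_mono by (metis ev.simps(3))
next
  case (Plus x y)
  define c where "c = max (deg W x) (deg W y) * b + (bweight x + bweight y) * (b0 + 1)"
  have "deg W x * b + bweight x * (b0 + 1) \<le> c" "deg W y * b + bweight y * (b0 + 1) \<le> c"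
    unfolding c_def by (intro add_le_mono mult_le_mono1; simp)+
  from add_le_two_power[OF Plus.IH this] have "ev inp \<sigma> x + ev inp \<sigma> y \<le> 2 ^ (c + 1)" .
  moreover have "c + 1 \<le> deg W (x \<oplus> y) * b + bweight (x \<oplus> y) * (b0 + 1)"
    unfolding c_def by (simp add: algebra_simps)
  ultimately show ?case using le_two_power_mono by (metis ev.simps(4))
next
  case (Minus x y)
  have "ev inp \<sigma> x - ev inp \<sigma> y \<le> ev inp \<sigma> x" by simp
  also have "\<dots> \<le> 2 ^ (deg W (x \<ominus> y) * b + bweight (x \<ominus> y) * (b0 + 1))"
    by (rule le_two_power_mono[OF Minus.IH(1)]) (simp add: algebra_simps)
  finally show ?case by simp
next
  case (Times x y)
  show ?case unfolding ev.simps
    by (rule mult_le_two_power[OF Times.IH]) (simp add: algebra_simps)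
next
  case (Quot x y)
  have "ev inp \<sigma> x div ev inp \<sigma> y \<le> ev inp \<sigma> x" by simp
  also have "\<dots> \<le> 2 ^ (deg W (x \<oslash> y) * b + bweight (x \<oslash> y) * (b0 + 1))"
    by (rule le_two_power_mono[OF Quot.IH(1)]) (simp add: algebra_simps)
  finally show ?case by simp
qed

lemma flat_le:
  assumes "\<forall>k i. \<sigma> k i \<le> 2 ^ b" "\<forall>a. inp a \<le> 2 ^ b"
  shows "\<forall>a. flat inp \<sigma> a \<le> 2 ^ b"
  using assms by (simp add: flat_def)

lemma eval_cost_flat_le:
  assumes "\<forall>k i. \<sigma> k i \<le> 2 ^ b" "\<forall>a. inp a \<le> 2 ^ b" "b \<le> b'"
  shows "eval_cost (flat inp \<sigma>) e \<le> ecost e * (b' + 1)"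
proof -
  have "eval_cost (flat inp \<sigma>) e \<le> 3 * expr_weight e ^ 2 * (b + 1)"
    by (rule eval_cost_le) (rule flat_le[OF assms(1,2)])
  also have "\<dots> \<le> ecost e * (b' + 1)" unfolding ecost_def using assms(3) by (intro mult_le_mono2) simp
  finally show ?thesis .
qed


lemma wf_loop_bounds: "wf W c \<Longrightarrow> e \<in> loop_bounds c \<Longrightarrow> bank_set e \<inter> W = {}"
  by (induction c) auto

lemma ev_loop_bound:
  assumes "wf W c" "e \<in> loop_bounds c" "\<And>k. k \<notin> W \<Longrightarrow> \<tau> k = \<sigma> k"
  shows "ev inp \<tau> e = ev inp \<sigma> e"
  by (rule ev_cong) (use wf_loop_bounds[OF assms(1,2)] assms(3) in auto)

lemma sem_unwritten_wf: "wf W c \<Longrightarrow> k \<notin> W \<Longrightarrow> sem inp c \<sigma> k = \<sigma> k"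
  using sem_unwritten wf_written by blast

text \<open>Simulation and resource bounds are proved together, because the time for an expression
  depends on the lengths reached so far. A store lengthens the numbers by at most \<open>g\<close>
  bits; \<open>b'\<close> is an a priori bound on all lengths up to the end, so that every step
  costs at most \<open>1 + K * (b' + 1)\<close>. The banks outside \<open>W\<close> keep their own
  bound \<open>b0\<close>.\<close>

lemma exec_ccom:
  assumes "wf W c"
    and "\<forall>k i. \<sigma> k i \<le> 2 ^ b" "\<forall>a. inp a \<le> 2 ^ b"
    and "\<forall>k i. k \<notin> W \<longrightarrow> \<sigma> k i \<le> 2 ^ b0"
    and "\<And>e. e \<in> loop_bounds c \<Longrightarrow> ev inp \<sigma> e \<le> U"
    and "growth c * (b0 + 1) \<le> g" "b + stores U c * g \<le> b'" "unit_cost c \<le> K"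
  shows "(\<exists>t \<le> steps U c * (1 + K * (b' + 1)).
           exec (ccom c) (flat inp \<sigma>) (flat inp (sem inp c \<sigma>)) t) \<and>
         (\<forall>k i. sem inp c \<sigma> k i \<le> 2 ^ (b + stores U c * g))"
  using assms
proof (induction c arbitrary: \<sigma> b)
  case Nop
  show ?case using exec_Skip Nop.prems(2) by (auto intro!: exI[of _ 1])
next
  case (Store k i e)
  let ?m = "flat inp \<sigma>"
  have wf: "k \<in> W" "k < nbanks" "banks_ok i" "banks_ok e" "deg W e \<le> 1"
    using Store.prems(1) by auto
  have "b \<le> b'" using Store.prems(7) by simp
  note cost = eval_cost_flat_le[OF Store.prems(2,3) this]
  let ?t = "1 + eval_cost ?m (cell_addr k (cexpr i)) + eval_cost ?m (cexpr e)"
  have "?t \<le> 1 + (ecost (cell_addr k (cexpr i)) + ecost (cexpr e)) * (b' + 1)"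
    using cost[of "cell_addr k (cexpr i)"] cost[of "cexpr e"] by (simp add: algebra_simps)
  also have "\<dots> \<le> 1 + K * (b' + 1)"
    using Store.prems(8) by (intro add_left_mono mult_le_mono1) simp
  finally have t: "?t \<le> steps U (Store k i e) * (1 + K * (b' + 1))" by simp
  have ex: "exec (ccom (Store k i e)) ?m (flat inp (sem inp (Store k i e) \<sigma>)) ?t"
    using exec_Assign[of "cell_addr k (cexpr i)" "cexpr e" ?m] wf
    by (simp add: flat_put eval_cell_addr eval_cexpr)
  \<comment> \<open>Degree at most 1 is used here: \<open>b\<close> enters the bound on the value
    with coefficient at most 1, and \<open>g\<close> covers the rest.\<close>
  have v: "ev inp \<sigma> e \<le> 2 ^ (b + g)"
  proof (rule le_two_power_mono[OF ev_le[OF Store.prems(2-4)]])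
    have "deg W e * b \<le> b" using wf(5) by (cases "deg W e") auto
    thus "deg W e * b + bweight e * (b0 + 1) \<le> b + g"
      using Store.prems(6) by (intro add_mono) simp_all
  qed
  have "\<sigma> l x \<le> 2 ^ (b + g)" for l x
    by (rule le_two_power_mono[OF Store.prems(2)[rule_format]]) simp
  hence "sem inp (Store k i e) \<sigma> l x \<le> 2 ^ (b + stores U (Store k i e) * g)" for l x
    using v by (simp add: put_def)
  thus ?case using t ex by blast
next
  case (Then c d)
  let ?\<tau> = "sem inp c \<sigma>" and ?b = "b + stores U c * g" and ?K = "1 + K * (b' + 1)"
  have wf: "wf W c" "wf W d" using Then.prems(1) by auto
  have gr: "growth c * (b0 + 1) \<le> g" "growth d * (b0 + 1) \<le> g"
    using Then.prems(6) by (simp_all add: algebra_simps)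
  have st: "?b + stores U d * g \<le> b'" "?b \<le> b'"
    using Then.prems(7) by (simp_all add: algebra_simps)
  have K: "unit_cost c \<le> K" "unit_cost d \<le> K" using Then.prems(8) by simp_all
  have c: "(\<exists>t \<le> steps U c * ?K. exec (ccom c) (flat inp \<sigma>) (flat inp ?\<tau>) t) \<and>
      (\<forall>k i. ?\<tau> k i \<le> 2 ^ ?b)"
    by (rule Then.IH(1)[OF wf(1) Then.prems(2-4) _ gr(1) st(2) K(1)]) (use Then.prems(5) in auto)
  have inp: "\<forall>a. inp a \<le> 2 ^ ?b" using le_two_power_mono[OF Then.prems(3)[rule_format]] by simp
  have ro: "\<forall>k i. k \<notin> W \<longrightarrow> ?\<tau> k i \<le> 2 ^ b0"
    using Then.prems(4) sem_unwritten_wf[OF wf(1)] by simp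
  have "ev inp ?\<tau> e \<le> U" if "e \<in> loop_bounds d" for e
    using ev_loop_bound[OF wf(2) that, of ?\<tau> \<sigma>] sem_unwritten_wf[OF wf(1)] Then.prems(5) that by auto
  hence d: "(\<exists>t \<le> steps U d * ?K. exec (ccom d) (flat inp ?\<tau>) (flat inp (sem inp d ?\<tau>)) t) \<and>
      (\<forall>k i. sem inp d ?\<tau> k i \<le> 2 ^ (?b + stores U d * g))"
    using Then.IH(2)[OF wf(2) _ inp ro _ gr(2) st(1) K(2)] c by blast
  obtain t where t: "t \<le> steps U c * ?K" "exec (ccom c) (flat inp \<sigma>) (flat inp ?\<tau>) t"
    using c by blast
  obtain t' where t': "t' \<le> steps U d * ?K"
    "exec (ccom d) (flat inp ?\<tau>) (flat inp (sem inp d ?\<tau>)) t'"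
    using d by blast
  have "1 + t + t' \<le> ?K + steps U c * ?K + steps U d * ?K" using t(1) t'(1) by linarith
  hence "1 + t + t' \<le> steps U (c ;; d) * ?K" by (simp add: algebra_simps)
  moreover have "exec (ccom (c ;; d)) (flat inp \<sigma>) (flat inp (sem inp (c ;; d) \<sigma>)) (1 + t + t')"
    using exec_Seq[OF t(2) t'(2)] by simp
  ultimately show ?case using d by (auto simp: algebra_simps)
next
  case (Ite e c d)
  let ?m = "flat inp \<sigma>" and ?K = "1 + K * (b' + 1)"
  have wf: "wf W c" "wf W d" "banks_ok e" using Ite.prems(1) by auto
  have gr: "growth c * (b0 + 1) \<le> g" "growth d * (b0 + 1) \<le> g"
    using Ite.prems(6) by (simp_all add: algebra_simps)
  have st: "b + stores U c * g \<le> b'" "b + stores U d * g \<le> b'" "b \<le> b'"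
    using Ite.prems(7) by (simp_all add: algebra_simps)
  have K: "unit_cost c \<le> K" "unit_cost d \<le> K" "ecost (cexpr e) \<le> K"
    using Ite.prems(8) by simp_all
  have c: "(\<exists>t \<le> steps U c * ?K. exec (ccom c) ?m (flat inp (sem inp c \<sigma>)) t) \<and>
      (\<forall>k i. sem inp c \<sigma> k i \<le> 2 ^ (b + stores U c * g))"
    by (rule Ite.IH(1)[OF wf(1) Ite.prems(2-4) _ gr(1) st(1) K(1)]) (use Ite.prems(5) in auto)
  have d: "(\<exists>t \<le> steps U d * ?K. exec (ccom d) ?m (flat inp (sem inp d \<sigma>)) t) \<and>
      (\<forall>k i. sem inp d \<sigma> k i \<le> 2 ^ (b + stores U d * g))"
    by (rule Ite.IH(2)[OF wf(2) Ite.prems(2-4) _ gr(2) st(2) K(2)]) (use Ite.prems(5) in auto)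
  have cost: "eval_cost ?m (cexpr e) \<le> K * (b' + 1)"
    using eval_cost_flat_le[OF Ite.prems(2,3) st(3), of "cexpr e"] mult_le_mono1[OF K(3)]
    by (meson order_trans)
  have "\<exists>t \<le> steps U c * ?K + steps U d * ?K.
      exec (if eval ?m (cexpr e) \<noteq> 0 then ccom c else ccom d) ?m
        (flat inp (sem inp (Ite e c d) \<sigma>)) t"
    using c d wf(3) by (auto simp: eval_cexpr intro: trans_le_add1 trans_le_add2)
  then obtain t where t: "t \<le> steps U c * ?K + steps U d * ?K"
    "exec (if eval ?m (cexpr e) \<noteq> 0 then ccom c else ccom d) ?m
        (flat inp (sem inp (Ite e c d) \<sigma>)) t" by blast
  have "1 + eval_cost ?m (cexpr e) + t \<le> ?K + (steps U c * ?K + steps U d * ?K)"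
    using t(1) cost by linarith
  hence "1 + eval_cost ?m (cexpr e) + t \<le> steps U (Ite e c d) * ?K" by (simp add: algebra_simps)
  moreover have "exec (ccom (Ite e c d)) ?m (flat inp (sem inp (Ite e c d) \<sigma>))
      (1 + eval_cost ?m (cexpr e) + t)"
    using exec_Cond[OF t(2)] by simp
  moreover have "sem inp (Ite e c d) \<sigma> k i \<le> 2 ^ (b + stores U (Ite e c d) * g)" for k i
  proof -
    have "sem inp c \<sigma> k i \<le> 2 ^ (b + stores U (Ite e c d) * g)"
      by (rule le_two_power_mono[OF conjunct2[OF c, rule_format]]) (simp add: algebra_simps)
    moreover have "sem inp d \<sigma> k i \<le> 2 ^ (b + stores U (Ite e c d) * g)"
      by (rule le_two_power_mono[OF conjunct2[OF d, rule_format]]) (simp add: algebra_simps)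
    ultimately show ?thesis by simp
  qed
  ultimately show ?case by blast
next
  case (For k e c)
  let ?K = "1 + K * (b' + 1)" and ?n = "ev inp \<sigma> e"
  have wf: "k \<in> W" "k < nbanks" "k \<notin> written c" "banks_ok e" "bank_set e \<inter> W = {}" "wf W c"
    using For.prems(1) by auto
  define f where "f = (\<lambda>\<tau>. bump k (sem inp c \<tau>))"
  define \<tau> where "\<tau> x = (f ^^ x) (put k 0 0 \<sigma>)" for x
  have \<tau>0: "\<tau> 0 = put k 0 0 \<sigma>" and \<tau>S: "\<tau> (Suc x) = f (\<tau> x)" for x by (simp_all add: \<tau>_def)
  have \<tau>n: "sem inp (For k e c) \<sigma> = \<tau> ?n" by (simp add: \<tau>_def f_def)
  have ro: "\<tau> x l = \<sigma> l" if "l \<notin> W" for x l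
  proof -
    have "l \<noteq> k" using that wf(1) by auto
    thus ?thesis
      using that by (induction x) (auto simp: \<tau>0 \<tau>S f_def sem_unwritten_wf[OF wf(6)])
  qed
  have cnt: "\<tau> x k 0 = x" for x
    by (induction x) (auto simp: \<tau>0 \<tau>S f_def sem_unwritten wf(3))
  have eve: "ev inp (\<tau> x) e = ?n" for x
    by (rule ev_cong) (use ro wf(5) in auto)
  have nU: "?n \<le> U" using For.prems(5) by simp
  have g1: "1 \<le> g" "growth c * (b0 + 1) \<le> g" using For.prems(6) by (simp_all add: algebra_simps)
  \<comment> \<open>The summand 1 pays for the increment of the counter, which may need one more
    bit; \<open>1 \<le> g\<close> suffices for it.\<close>
  let ?b = "\<lambda>x. b + x * (stores U c + 1) * g"
  have bx: "?b x + (stores U c + 1) * g = ?b (Suc x)" for x by (simp add: algebra_simps)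
  have bU: "?b x \<le> b + stores U (For k e c) * g" if "x \<le> U" for x
    unfolding stores.simps using that by (intro add_left_mono mult_le_mono1)
  have inp: "\<forall>a. inp a \<le> 2 ^ ?b x" for x
    using le_two_power_mono[OF For.prems(3)[rule_format]] by simp
  have body: "(\<exists>t \<le> steps U c * ?K. exec (ccom c) (flat inp (\<tau> x)) (flat inp (sem inp c (\<tau> x))) t) \<and>
      (\<forall>l i. sem inp c (\<tau> x) l i \<le> 2 ^ (?b x + stores U c * g))"
    if "x < ?n" "\<forall>l i. \<tau> x l i \<le> 2 ^ ?b x" for x
  proof (rule For.IH[OF wf(6) that(2) inp])
    show "\<forall>l i. l \<notin> W \<longrightarrow> \<tau> x l i \<le> 2 ^ b0" using For.prems(4) ro by simp
    show "ev inp (\<tau> x) e' \<le> U" if "e' \<in> loop_bounds c" for e'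
      using ev_loop_bound[OF wf(6) that, of "\<tau> x" \<sigma>] ro For.prems(5) that by auto
    have "?b x + stores U c * g \<le> ?b (Suc x)" by (simp add: algebra_simps)
    also have "\<dots> \<le> b'" using bU[of "Suc x"] nU that(1) For.prems(7) by linarith
    finally show "?b x + stores U c * g \<le> b'" .
    show "growth c * (b0 + 1) \<le> g" by (rule g1(2))
    show "unit_cost c \<le> K" using For.prems(8) by simp
  qed
  have bits: "\<forall>l i. \<tau> x l i \<le> 2 ^ ?b x" if "x \<le> ?n" for x
    using that
  proof (induction x)
    case 0
    show ?case using For.prems(2) by (simp add: \<tau>0 put_def)
  next
    case (Suc x)
    hence s: "sem inp c (\<tau> x) l i \<le> 2 ^ (?b x + stores U c * g)" for l i using body[of x] by auto
    have le: "?b x + stores U c * g + 1 \<le> ?b (Suc x)" using g1(1) by (simp add: algebra_simps)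
    have "Suc (sem inp c (\<tau> x) k 0) \<le> 2 ^ (?b x + stores U c * g + 1)"
      using add_le_two_power[OF s[of k 0], of 1 0 "?b x + stores U c * g"] by simp
    hence "Suc (sem inp c (\<tau> x) k 0) \<le> 2 ^ ?b (Suc x)" by (rule le_two_power_mono) (rule le)
    moreover have "sem inp c (\<tau> x) l i \<le> 2 ^ ?b (Suc x)" for l i
      by (rule le_two_power_mono[OF s]) (use le in simp)
    ultimately show ?case by (auto simp: \<tau>S f_def bump_def put_def)
  qed
  have bb: "?b x \<le> b'" if "x \<le> ?n" for x using bU[of x] nU that For.prems(7) by linarith
  note cost = eval_cost_flat_le[OF bits inp bb]
  let ?a = "cell_addr k (Const 0)"
  let ?w = "Sub (cexpr e) (Mem ?a)" and ?i = "Add (Mem ?a) (Const 1)"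
  have K: "ecost ?a + ecost (Const 0) + ecost ?i + ecost ?w \<le> K" using For.prems(8) by simp
  have Kw: "ecost ?w * (b' + 1) \<le> K * (b' + 1)"
    and Ki: "(ecost ?a + ecost ?i) * (b' + 1) \<le> K * (b' + 1)"
    and K0: "(ecost ?a + ecost (Const 0)) * (b' + 1) \<le> K * (b' + 1)"
    by (rule mult_le_mono1; use K in linarith)+
  have evw: "eval (flat inp (\<tau> x)) ?w = ?n - x" for x
    using wf by (simp add: eval_cexpr eve eval_cell_addr flat_cell[of k inp "\<tau> x" 0, simplified] cnt)
  have loop: "y \<le> ?n \<Longrightarrow> \<exists>t \<le> (y * (steps U c + 3) + 1) * ?K.
      exec (While ?w (Seq (ccom c) (Assign ?a ?i))) (flat inp (\<tau> (?n - y))) (flat inp (\<tau> ?n)) t" for y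
  proof (induction y)
    case 0
    have "1 + eval_cost (flat inp (\<tau> ?n)) ?w \<le> ?K" using cost[of ?n ?w] Kw by simp
    thus ?case using exec_While_False[of "flat inp (\<tau> ?n)" ?w] evw[of ?n] by auto
  next
    case (Suc y)
    define x where "x = ?n - Suc y"
    have x: "x < ?n" "?n - y = Suc x" "?n - Suc y = x" using Suc.prems x_def by auto
    obtain t where t: "t \<le> (y * (steps U c + 3) + 1) * ?K"
      "exec (While ?w (Seq (ccom c) (Assign ?a ?i))) (flat inp (\<tau> (Suc x))) (flat inp (\<tau> ?n)) t"
      using Suc x by auto
    obtain t1 where t1: "t1 \<le> steps U c * ?K"
      "exec (ccom c) (flat inp (\<tau> x)) (flat inp (sem inp c (\<tau> x))) t1"
      using body[of x] bits[of x] x by auto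
    let ?s = "sem inp c (\<tau> x)"
    have sbits: "\<forall>l i. ?s l i \<le> 2 ^ (?b x + stores U c * g)" using body[of x] bits[of x] x by auto
    have sb': "?b x + stores U c * g \<le> b'"
      using bb[of "Suc x"] x by (simp add: algebra_simps)
    have inps: "\<forall>a. inp a \<le> 2 ^ (?b x + stores U c * g)"
      using le_two_power_mono[OF For.prems(3)[rule_format]] by simp
    let ?t2 = "1 + eval_cost (flat inp ?s) ?a + eval_cost (flat inp ?s) ?i"
    have "?t2 \<le> ?K"
      using eval_cost_flat_le[OF sbits inps sb', of ?a] eval_cost_flat_le[OF sbits inps sb', of ?i] Ki
      unfolding add_mult_distrib by linarith
    moreover have t2: "exec (Assign ?a ?i) (flat inp ?s) (flat inp (\<tau> (Suc x))) ?t2"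
      using exec_Assign[of ?a ?i "flat inp ?s"] wf(2) flat_cell[of k inp ?s 0]
      by (simp add: \<tau>S f_def bump_def flat_put eval_cell_addr)
    moreover have "1 + x + y \<le> (z + 2) * k" if "y \<le> k" "x \<le> z * k" "1 \<le> k" for x y z k :: nat
      using that by (simp add: algebra_simps)
    ultimately have t12: "1 + t1 + ?t2 \<le> (steps U c + 2) * ?K"
      using t1(1) by simp
    have w: "1 + eval_cost (flat inp (\<tau> x)) ?w \<le> ?K" using cost[of x ?w] Kw x by simp
    have "exec (While ?w (Seq (ccom c) (Assign ?a ?i))) (flat inp (\<tau> x)) (flat inp (\<tau> ?n))
        (1 + eval_cost (flat inp (\<tau> x)) ?w + (1 + t1 + ?t2) + t)"
      by (rule exec_While_True[OF _ exec_Seq[OF t1(2) t2] t(2)]) (use evw[of x] x in simp)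
    moreover have "1 + eval_cost (flat inp (\<tau> x)) ?w + (1 + t1 + ?t2) + t
        \<le> (Suc y * (steps U c + 3) + 1) * ?K"
    proof -
      have "1 + eval_cost (flat inp (\<tau> x)) ?w + (1 + t1 + ?t2) + t
          \<le> ?K + (steps U c + 2) * ?K + (y * (steps U c + 3) + 1) * ?K"
        using t12 w t(1) by linarith
      also have "\<dots> = (Suc y * (steps U c + 3) + 1) * ?K" by (simp add: algebra_simps)
      finally show ?thesis .
    qed
    ultimately show ?case using x(3) by metis
  qed
  obtain t where t: "t \<le> (?n * (steps U c + 3) + 1) * ?K"
      "exec (While ?w (Seq (ccom c) (Assign ?a ?i))) (flat inp (\<tau> 0)) (flat inp (\<tau> ?n)) t"
    using loop[of ?n] by auto
  let ?t0 = "1 + eval_cost (flat inp \<sigma>) ?a + eval_cost (flat inp \<sigma>) (Const 0)"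
  have "b \<le> b'" using For.prems(7) by simp
  note cost0 = eval_cost_flat_le[OF For.prems(2,3) this]
  have t0: "?t0 \<le> ?K"
    using cost0[of ?a] cost0[of "Const 0"] K0 unfolding add_mult_distrib by linarith
  have "exec (Assign ?a (Const 0)) (flat inp \<sigma>) (flat inp (\<tau> 0)) ?t0"
    using exec_Assign[of ?a "Const 0" "flat inp \<sigma>"] wf(2) by (simp add: \<tau>0 flat_put eval_cell_addr)
  from exec_Seq[OF this t(2)]
  have "exec (ccom (For k e c)) (flat inp \<sigma>) (flat inp (sem inp (For k e c) \<sigma>)) (1 + ?t0 + t)"
    using \<tau>n by simp
  moreover have "1 + ?t0 + t \<le> steps U (For k e c) * ?K"
  proof -
    have "1 + ?t0 + t \<le> ?K + ?K + (?n * (steps U c + 3) + 1) * ?K" using t0 t(1) by linarith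
    also have "\<dots> \<le> ?K + ?K + (U * (steps U c + 3) + 1) * ?K"
      using nU by (intro add_left_mono mult_le_mono1 add_right_mono)
    also have "\<dots> = steps U (For k e c) * ?K" by (simp add: algebra_simps)
    finally show ?thesis .
  qed
  moreover have "sem inp (For k e c) \<sigma> l i \<le> 2 ^ (b + stores U (For k e c) * g)" for l i
    unfolding \<tau>n by (rule le_two_power_mono[OF bits[rule_format] bU]) (use nU in auto)
  ultimately show ?case by blast
qed

definition phase_bits :: "bcom \<Rightarrow> nat \<Rightarrow> nat \<Rightarrow> nat" where
  "phase_bits c U b = b + stores U c * (growth c * (b + 1))"

definition phase_time :: "bcom \<Rightarrow> nat \<Rightarrow> nat \<Rightarrow> nat" where
  "phase_time c U b = steps U c * (1 + unit_cost c * (phase_bits c U b + 1))"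

text \<open>With \<open>b0 = b\<close>, banks that a phase only reads count as short even if an
  earlier phase made them long. This restart allows products of earlier results to be stored with
  degree 0, and polynomial bounds survive because the number of phases is fixed.\<close>

lemma exec_phase:
  assumes "wf W c" "\<forall>k i. \<sigma> k i \<le> 2 ^ b" "\<forall>a. inp a \<le> 2 ^ b"
    and "\<And>e. e \<in> loop_bounds c \<Longrightarrow> ev inp \<sigma> e \<le> U"
  shows "\<exists>t \<le> phase_time c U b. exec (ccom c) (flat inp \<sigma>) (flat inp (sem inp c \<sigma>)) t"
    and "\<forall>k i. sem inp c \<sigma> k i \<le> 2 ^ phase_bits c U b"
  using exec_ccom[OF assms(1-3) _ assms(4) order_refl order_refl order_refl, of b] assms(2)
  unfolding phase_bits_def phase_time_def by blast+

section \<open>Polynomially bounded functions\<close>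

definition poly_bounded :: "(nat \<Rightarrow> nat) \<Rightarrow> bool" where
  "poly_bounded f \<longleftrightarrow> (\<exists>p :: nat poly. \<forall>x. f x \<le> poly p x)"

lemma poly_bounded_const: "poly_bounded (\<lambda>_. c)"
  unfolding poly_bounded_def by (rule exI[of _ "[:c:]"]) simp

lemma poly_bounded_id: "poly_bounded (\<lambda>x. x)"
  unfolding poly_bounded_def by (rule exI[of _ "[:0, 1:]"]) simp

lemma poly_bounded_add:
  assumes "poly_bounded f" "poly_bounded g" shows "poly_bounded (\<lambda>x. f x + g x)"
proof -
  obtain p q :: "nat poly" where "\<And>x. f x \<le> poly p x" "\<And>x. g x \<le> poly q x"
    using assms unfolding poly_bounded_def by blast
  thus ?thesis unfolding poly_bounded_def
    by (intro exI[of _ "p + q"]) (simp add: add_mono)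
qed

lemma poly_bounded_mult:
  assumes "poly_bounded f" "poly_bounded g" shows "poly_bounded (\<lambda>x. f x * g x)"
proof -
  obtain p q :: "nat poly" where "\<And>x. f x \<le> poly p x" "\<And>x. g x \<le> poly q x"
    using assms unfolding poly_bounded_def by blast
  thus ?thesis unfolding poly_bounded_def
    by (intro exI[of _ "p * q"]) (simp add: mult_le_mono)
qed

lemmas poly_bounded_intros =
  poly_bounded_const poly_bounded_id poly_bounded_add poly_bounded_mult

lemma poly_bounded_stores: "poly_bounded u \<Longrightarrow> poly_bounded (\<lambda>x. stores (u x) c)"
  by (induction c) (auto intro!: poly_bounded_intros simp del: mult_Suc_right add_Suc_right)

lemma poly_bounded_steps: "poly_bounded u \<Longrightarrow> poly_bounded (\<lambda>x. steps (u x) c)"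
proof (induction c)
  case (For k e c)
  show ?case unfolding steps.simps by (intro poly_bounded_intros For)
qed (auto simp only: steps.simps intro!: poly_bounded_intros)

lemma poly_bounded_phase_bits:
  "poly_bounded u \<Longrightarrow> poly_bounded f \<Longrightarrow> poly_bounded (\<lambda>x. phase_bits c (u x) (f x))"
  unfolding phase_bits_def by (intro poly_bounded_intros poly_bounded_stores)

lemma poly_bounded_phase_time:
  "poly_bounded u \<Longrightarrow> poly_bounded f \<Longrightarrow> poly_bounded (\<lambda>x. phase_time c (u x) (f x))"
  unfolding phase_time_def
  by (intro poly_bounded_intros poly_bounded_steps poly_bounded_phase_bits)

section \<open>Randomized connection of one client\<close>

lemma e_ge: "2718 / 1000 \<le> exp (1::real)"
  using abs_le_D2[OF e_approx_32] by simp

text \<open>The 11th power of \<open>exp (19 / 11)\<close> is \<open>exp 1 ^ 19\<close>, so bounds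
  on \<open>exp 1\<close> reduce the claim to a comparison of rational powers.\<close>

lemma exp_root_bounds:
  assumes "0 < a" "a \<le> exp (1::real)" "exp (1::real) \<le> b" "0 < c" "0 < d"
    and "c ^ 11 \<le> a ^ 19" "b ^ 19 \<le> d ^ 11"
  shows "c \<le> exp (19 / 11)" "exp (19 / 11) \<le> d"
proof -
  have e: "exp (19 / 11 :: real) ^ 11 = exp 1 ^ 19"
    by (simp add: exp_of_nat_mult[symmetric])
  have "c ^ 11 \<le> exp (19 / 11 :: real) ^ 11"
    unfolding e using assms by (meson order_trans power_mono less_imp_le)
  thus "c \<le> exp (19 / 11)" using assms(4) by (simp add: power_mono_iff)
  have "exp (19 / 11 :: real) ^ 11 \<le> d ^ 11"
    unfolding e using assms by (meson order_trans power_mono exp_ge_zero)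
  thus "exp (19 / 11) \<le> d" using assms(5) by (simp add: power_mono_iff)
qed

text \<open>With \<open>N / L = 19 / 11\<close> this bounds the probability that a demand finds no
  open atom among the \<open>N\<close> atoms of its own set.\<close>

definition q0 :: real where "q0 = exp (- (19 / 11))"

text \<open>Three digits are really used: the upper bound enters the case of a single demand, which
  has a margin below 0.001; the lower bound makes the coefficient
  \<open>11 / 19 + 46 / 19 * q0\<close> in the case of several demands reach 1.\<close>

lemma q0_bounds: "0 < q0" "174 / 1000 \<le> q0" "q0 \<le> 1795 / 10000"
proof -
  have *: "5572 / 1000 \<le> exp (19 / 11 :: real)" "exp (19 / 11 :: real) \<le> 5747 / 1000"
    using exp_root_bounds[of "2718 / 1000" "272 / 100" "5572 / 1000" "5747 / 1000"] e_ge e_less_272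
    by (auto simp: power_divide)
  have q: "q0 = 1 / exp (19 / 11)" by (simp add: q0_def exp_minus field_simps)
  show "0 < q0" by (simp add: q0_def)
  show "174 / 1000 \<le> q0" "q0 \<le> 1795 / 10000" unfolding q using *
    by (auto simp: field_simps)
qed

text \<open>The term 1/500 is the loss caused by the finite step size of the weight updates; 1/10000
  absorbs the cost terms that are linear in the number of clients.\<close>

lemma ratio_const: "19 / 11 * (1 + 1 / 500 + 1 / 10000) \<le> 1 + 2 / exp (1::real)"
  using e_less_272 by (simp add: field_simps)

lemma exp_minus_plus_mono: "0 \<le> x \<Longrightarrow> x \<le> y \<Longrightarrow> exp (- x) + x \<le> exp (- y) + (y::real)"
proof -
  assume "0 \<le> x" "x \<le> y"
  have "exp (- x) - exp (- y) = exp (- x) * (1 - exp (- (y - x)))"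
    by (simp add: right_diff_distrib exp_add[symmetric])
  also have "\<dots> \<le> 1 * (y - x)"
  proof (rule mult_mono)
    show "1 - exp (- (y - x)) \<le> y - x" using exp_ge_add_one_self[of "- (y - x)"] by linarith
  qed (use \<open>0 \<le> x\<close> \<open>x \<le> y\<close> in auto)
  finally show ?thesis by simp
qed

lemma exp_chord:
  assumes "0 \<le> x" "x \<le> 19 / 11"
  shows "exp (- x) \<le> 1 - x * (11 / 19) * (1 - q0)"
proof -
  define u where "u = x * (11 / 19)"
  have u: "0 \<le> u" "u \<le> 1" using assms by (auto simp: u_def)
  have "exp ((1 - u) *\<^sub>R 0 + u *\<^sub>R (- (19 / 11))) \<le> (1 - u) * exp 0 + u * exp (- (19 / 11) :: real)"
    by (rule convex_onD[OF exp_convex, of u]) (use u in auto)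
  thus ?thesis by (simp add: u_def q0_def algebra_simps)
qed

text \<open>
  The inequality that determines the constant 19/11. For one demand it is sharp at \<open>X = 1\<close>;
  for several demands the chord of the exponential function suffices.
\<close>

lemma threshold_inequality:
  assumes "1 \<le> r" "\<And>k. k < r \<Longrightarrow> 0 \<le> x k \<and> x k \<le> 19 / 11" "X = (\<Sum>k<r. x k)"
    and "c \<le> real r" "X < real r \<Longrightarrow> c \<le> real r - X + 1" "real r \<le> X \<Longrightarrow> c \<le> 0"
  shows "(\<Sum>k<r. exp (- x k) - q0) + 3 * q0 * c \<le> 19 / 11 * real r - X"
proof (cases "r = 1")
  case True
  have X: "X = x 0" "0 \<le> X" "X \<le> 19 / 11" using assms True by auto
  have sum: "(\<Sum>k<r. exp (- x k) - q0) = exp (- X) - q0" and r1: "real r = 1"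
    using True X by auto
  show ?thesis
  proof (cases "X < 1")
    case True': True
    \<comment> \<open>After \<open>X\<close> is moved to the left, the left side increases with
      \<open>X\<close>, so that \<open>X = 1\<close> is the worst case: what remains is
      \<open>1 + 1/e + 2 * q0 \<le> 19 / 11\<close>.\<close>
    have "exp (- X) + X \<le> exp (- 1) + 1" using exp_minus_plus_mono[of X 1] X True' by simp
    moreover have "exp (- 1 :: real) \<le> 36792 / 100000" using e_ge by (simp add: exp_minus field_simps)
    moreover have "3 * q0 * c \<le> 3 * q0 * 1"
      using assms(4) q0_bounds True by (intro mult_left_mono) auto
    ultimately show ?thesis unfolding sum r1 using q0_bounds by linarith
  next
    case False
    have "exp (- X) + X \<le> q0 + 19 / 11"
      using exp_minus_plus_mono[of X "19 / 11"] X by (simp add: q0_def)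
    moreover have "3 * q0 * c \<le> 0"
      using assms(6) q0_bounds True False by (intro mult_nonneg_nonpos) auto
    ultimately show ?thesis unfolding sum r1 by linarith
  qed
next
  case False
  hence r: "2 \<le> real r" using assms(1) by simp
  have X0: "0 \<le> X" unfolding assms(3) using assms(2) by (intro sum_nonneg) auto
  have XU: "X \<le> 19 / 11 * real r"
    unfolding assms(3) using sum_mono[of "{..<r}" x "\<lambda>_. 19 / 11"] assms(2) by simp
  have "(\<Sum>k<r. exp (- x k) - q0) \<le> (\<Sum>k<r. (1 - q0) - x k * (11 / 19 * (1 - q0)))"
  proof (rule sum_mono)
    fix k assume "k \<in> {..<r}"
    thus "exp (- x k) - q0 \<le> (1 - q0) - x k * (11 / 19 * (1 - q0))"
      using exp_chord[of "x k"] assms(2)[of k] by (simp add: algebra_simps)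
  qed
  also have "\<dots> = real r * (1 - q0) - X * (11 / 19 * (1 - q0))"
    by (simp add: sum_subtractf sum_distrib_right assms(3))
  finally have S: "(\<Sum>k<r. exp (- x k) - q0) \<le> real r * (1 - q0) - X * (11 / 19 * (1 - q0))" .
  show ?thesis
  proof (cases "X < real r")
    case True
    have "q0 * c \<le> q0 * (real r - X + 1)"
      using assms(5)[OF True] q0_bounds(1) by (intro mult_left_mono) auto
    hence "(\<Sum>k<r. exp (- x k) - q0) + 3 * q0 * c
        \<le> real r * (1 - q0) - X * (11 / 19 * (1 - q0)) + 3 * (q0 * (real r - X + 1))"
      using S by simp
    also have "\<dots> = real r * (1 + 2 * q0) - X * (11 / 19 + 46 / 19 * q0) + 3 * q0"
      by (simp add: field_simps)
    \<comment> \<open>The loss \<open>3 * q0\<close>, due to the summand 1 in the bound on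
      \<open>c\<close>, is absorbed by the slack that grows with \<open>r\<close>;
      \<open>r \<ge> 2\<close> is enough for this, while \<open>r = 1\<close> needs the separate
      treatment above.\<close>
    also have "\<dots> \<le> real r * (136 / 100) - X * 1 + 3 * (1795 / 10000)"
      using X0 r q0_bounds by (intro add_mono diff_mono mult_left_mono) auto
    also have "\<dots> \<le> 19 / 11 * real r - X" using r by simp
    finally show ?thesis .
  next
    case False
    have "q0 * c \<le> 0" using assms(6) q0_bounds False by (simp add: mult_nonneg_nonpos)
    moreover have "real r * (1 - q0) - X * (11 / 19 * (1 - q0))
        = (19 / 11 * real r - X) * (11 / 19 * (1 - q0))"
      by (simp add: field_simps)
    moreover have "(19 / 11 * real r - X) * (11 / 19 * (1 - q0)) \<le> (19 / 11 * real r - X) * 1"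
      using XU q0_bounds by (intro mult_left_mono) auto
    ultimately show ?thesis using S by simp
  qed
qed

section \<open>Connection cost as a sum over distance thresholds\<close>

lemma layer_cake: "d \<le> \<Theta> \<Longrightarrow> real d = (\<Sum>\<theta><\<Theta>. of_bool (\<theta> < d))"
proof -
  assume "d \<le> \<Theta>"
  hence "{..<\<Theta>} \<inter> {\<theta>. \<theta> < d} = {..<d}" by auto
  thus ?thesis by (simp add: of_bool_def sum.If_cases)
qed

text \<open>Each exponential is split into \<open>q0\<close> and a nonnegative excess. The excesses
  are extended to all thresholds \<theta>; the constants \<open>q0\<close>, summed over
  \<open>3 * bet k\<close> thresholds, are rewritten as \<open>3 * q0\<close> summed over
  \<open>bet k\<close> thresholds. Now \<open>threshold_inequality\<close> applies at each single
  \<theta>, and its right-hand sides add up to the layer-cake form of the sum of distances.\<close>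

lemma demand_cost_bound:
  fixes \<delta> :: "nat \<Rightarrow> nat" and S :: "nat \<Rightarrow> nat set"
  assumes M: "0 < M" "N = 19 * M" "L = 11 * M"
    and S: "\<And>k. k < r \<Longrightarrow> finite (S k) \<and> card (S k) = N"
    and disj: "\<And>k l. k < r \<Longrightarrow> l < r \<Longrightarrow> k \<noteq> l \<Longrightarrow> S k \<inter> S l = {}"
    and bet: "\<And>k. k < r \<Longrightarrow> card {t \<in> (\<Union>k<r. S k). \<delta> t < bet k} < Suc k * L"
  shows "(\<Sum>k<r. \<Sum>\<theta><3 * bet k. exp (- real (card {t \<in> S k. \<delta> t \<le> \<theta>}) / real L))
    \<le> (\<Sum>t\<in>(\<Union>k<r. S k). real (\<delta> t)) / real L"
proof (cases "r = 0")
  case False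
  let ?Q = "\<Union>k<r. S k"
  have finQ: "finite ?Q" using S by auto
  have L0: "0 < real L" using M by simp
  define \<Theta> where "\<Theta> = (\<Sum>k<r. 3 * bet k) + (\<Sum>t\<in>?Q. \<delta> t)"
  have \<Theta>b: "3 * bet k \<le> \<Theta>" if "k < r" for k
    unfolding \<Theta>_def using member_le_sum[of k "{..<r}" "\<lambda>k. 3 * bet k"] that by simp
  have \<Theta>d: "\<delta> t \<le> \<Theta>" if "t \<in> ?Q" for t
    unfolding \<Theta>_def using member_le_sum[of t ?Q \<delta>] that finQ by simp
  define a where "a k \<theta> = card {t \<in> S k. \<delta> t \<le> \<theta>}" for k \<theta>
  define x where "x \<theta> k = real (a k \<theta>) / real L" for k \<theta>
  have aN: "a k \<theta> \<le> N" if "k < r" for k \<theta>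
    unfolding a_def using S[OF that] card_mono[of "S k" "{t \<in> S k. \<delta> t \<le> \<theta>}"] by auto
  have NL: "real N / real L = 19 / 11" using M by simp
  have x: "0 \<le> x \<theta> k" "x \<theta> k \<le> 19 / 11" if "k < r" for k \<theta>
    unfolding x_def NL[symmetric] using aN[OF that] L0 by (auto intro!: divide_right_mono)
  have q0x: "q0 \<le> exp (- x \<theta> k)" if "k < r" for k \<theta>
    using x[OF that] by (simp add: q0_def)
  have asum: "(\<Sum>k<r. a k \<theta>) = card {t \<in> ?Q. \<delta> t \<le> \<theta>}" for \<theta>
  proof -
    have "{t \<in> ?Q. \<delta> t \<le> \<theta>} = (\<Union>k<r. {t \<in> S k. \<delta> t \<le> \<theta>})" by auto
    also have "card \<dots> = (\<Sum>k<r. a k \<theta>)"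
      unfolding a_def by (rule card_UN_disjoint) (use S disj in auto)
    finally show ?thesis by simp
  qed
  have Qcard: "card ?Q = r * N"
  proof -
    have "card ?Q = (\<Sum>k<r. card (S k))" by (rule card_UN_disjoint) (use S disj in auto)
    thus ?thesis using S by simp
  qed
  define X where "X \<theta> = (\<Sum>k<r. x \<theta> k)" for \<theta>
  have X: "X \<theta> = real (card {t \<in> ?Q. \<delta> t \<le> \<theta>}) / real L" for \<theta>
    unfolding X_def x_def sum_divide_distrib[symmetric] asum[symmetric] by simp
  have step: "(\<Sum>k<r. exp (- x \<theta> k) - q0) + 3 * q0 * (\<Sum>k<r. of_bool (\<theta> < bet k))
      \<le> 19 / 11 * real r - X \<theta>" for \<theta>
  proof (rule threshold_inequality)
    show "1 \<le> r" using False by simp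
    show "\<And>k. k < r \<Longrightarrow> 0 \<le> x \<theta> k \<and> x \<theta> k \<le> 19 / 11" using x by simp
    let ?K = "{k \<in> {..<r}. \<theta> < bet k}"
    have c: "(\<Sum>k<r. of_bool (\<theta> < bet k) :: real) = real (card ?K)"
      by (simp add: of_bool_def sum.If_cases Int_def)
    show "(\<Sum>k<r. of_bool (\<theta> < bet k)) \<le> real r"
    proof -
      have "?K \<subseteq> {..<r}" by auto
      from card_mono[OF _ this] show ?thesis unfolding c by simp
    qed
    have k: "X \<theta> < real (Suc k)" if "k \<in> ?K" for k
    proof -
      have "card {t \<in> ?Q. \<delta> t \<le> \<theta>} \<le> card {t \<in> ?Q. \<delta> t < bet k}"
        using that finQ by (intro card_mono) auto
      also have "\<dots> < Suc k * L" using bet that by simp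
      finally have "real (card {t \<in> ?Q. \<delta> t \<le> \<theta>}) < real (Suc k) * real L"
        by (metis of_nat_less_iff of_nat_mult)
      thus ?thesis unfolding X using L0 by (simp add: field_simps)
    qed
    show "(\<Sum>k<r. of_bool (\<theta> < bet k)) \<le> real r - X \<theta> + 1" if "X \<theta> < real r"
    proof -
      define f where "f = nat \<lfloor>X \<theta>\<rfloor>"
      have X0: "0 \<le> X \<theta>" unfolding X by simp
      have f: "real f \<le> X \<theta>" "X \<theta> < real f + 1" using X0 unfolding f_def by linarith+
      \<comment> \<open>\<open>\<theta> < bet k\<close> means that fewer than
        \<open>Suc k * L\<close> atoms lie within \<theta>, so \<open>k\<close> is at least the
        integral part of \<open>X \<theta>\<close>. The rounding is the reason for the summand
        1.\<close>
      have "?K \<subseteq> {f..<r}" using k f by force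
      hence "card ?K \<le> card {f..<r}" by (intro card_mono) auto
      hence "card ?K \<le> r - f" by simp
      moreover have "f < r" using f that by linarith
      ultimately have "real (card ?K) \<le> real r - real f" by linarith
      thus ?thesis unfolding c using f by linarith
    qed
    show "(\<Sum>k<r. of_bool (\<theta> < bet k)) \<le> (0::real)" if "real r \<le> X \<theta>"
    proof -
      have "?K = {}" using k that by fastforce
      thus ?thesis unfolding c by simp
    qed
  qed (simp add: X_def)
  have "(\<Sum>k<r. \<Sum>\<theta><3 * bet k. exp (- real (card {t \<in> S k. \<delta> t \<le> \<theta>}) / real L))
      = (\<Sum>k<r. \<Sum>\<theta><\<Theta>. of_bool (\<theta> < 3 * bet k) * exp (- x \<theta> k))"
  proof (rule sum.cong[OF refl])
    fix k assume k: "k \<in> {..<r}"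
    have "{..<\<Theta>} \<inter> {\<theta>. \<theta> < 3 * bet k} = {..<3 * bet k}" using \<Theta>b[of k] k by auto
    thus "(\<Sum>\<theta><3 * bet k. exp (- real (card {t \<in> S k. \<delta> t \<le> \<theta>}) / real L))
      = (\<Sum>\<theta><\<Theta>. of_bool (\<theta> < 3 * bet k) * exp (- x \<theta> k))"
      by (simp add: of_bool_def if_distribR if_distrib[of "\<lambda>z. z * _"] sum.If_cases x_def a_def cong: if_cong)
  qed
  also have "\<dots> \<le> (\<Sum>k<r. \<Sum>\<theta><\<Theta>. (exp (- x \<theta> k) - q0) + q0 * of_bool (\<theta> < 3 * bet k))"
    by (intro sum_mono) (use q0x q0_bounds in \<open>auto simp: of_bool_def\<close>)
  also have "\<dots> = (\<Sum>k<r. (\<Sum>\<theta><\<Theta>. exp (- x \<theta> k) - q0) + q0 * real (3 * bet k))"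
  proof (intro sum.cong refl)
    fix k assume "k \<in> {..<r}"
    hence "3 * bet k \<le> \<Theta>" using \<Theta>b[of k] by simp
    from layer_cake[OF this]
    show "(\<Sum>\<theta><\<Theta>. (exp (- x \<theta> k) - q0) + q0 * of_bool (\<theta> < 3 * bet k))
      = (\<Sum>\<theta><\<Theta>. exp (- x \<theta> k) - q0) + q0 * real (3 * bet k)"
      by (simp only: sum.distrib sum_distrib_left[symmetric])
  qed
  also have "\<dots> = (\<Sum>k<r. (\<Sum>\<theta><\<Theta>. exp (- x \<theta> k) - q0) + 3 * q0 * (\<Sum>\<theta><\<Theta>. of_bool (\<theta> < bet k)))"
  proof (intro sum.cong refl)
    fix k assume "k \<in> {..<r}"
    hence "bet k \<le> \<Theta>" using \<Theta>b[of k] by simp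
    from layer_cake[OF this]
    show "(\<Sum>\<theta><\<Theta>. exp (- x \<theta> k) - q0) + q0 * real (3 * bet k)
      = (\<Sum>\<theta><\<Theta>. exp (- x \<theta> k) - q0) + 3 * q0 * (\<Sum>\<theta><\<Theta>. of_bool (\<theta> < bet k))" by simp
  qed
  also have "\<dots> = (\<Sum>\<theta><\<Theta>. (\<Sum>k<r. exp (- x \<theta> k) - q0) + 3 * q0 * (\<Sum>k<r. of_bool (\<theta> < bet k)))"
    unfolding sum.distrib sum_distrib_left by (subst (1 2) sum.swap) simp
  also have "\<dots> \<le> (\<Sum>\<theta><\<Theta>. 19 / 11 * real r - X \<theta>)" by (rule sum_mono[OF step])
  also have "\<dots> = (\<Sum>\<theta><\<Theta>. \<Sum>t\<in>?Q. of_bool (\<theta> < \<delta> t) / real L)"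
  proof (intro sum.cong refl)
    fix \<theta>
    have eq: "{t \<in> ?Q. \<theta> < \<delta> t} = ?Q - {t \<in> ?Q. \<delta> t \<le> \<theta>}" by auto
    have fin: "finite {t \<in> ?Q. \<delta> t \<le> \<theta>}" by (rule rev_finite_subset[OF finQ]) auto
    have "card {t \<in> ?Q. \<theta> < \<delta> t} = card ?Q - card {t \<in> ?Q. \<delta> t \<le> \<theta>}"
      unfolding eq by (rule card_Diff_subset[OF fin]) auto
    moreover have "card {t \<in> ?Q. \<delta> t \<le> \<theta>} \<le> card ?Q" using finQ by (intro card_mono) auto
    ultimately have "real (card {t \<in> ?Q. \<theta> < \<delta> t}) = real r * real N - real (card {t \<in> ?Q. \<delta> t \<le> \<theta>})"
      by (simp add: Qcard of_nat_diff)
    moreover have "(\<Sum>t\<in>?Q. of_bool (\<theta> < \<delta> t) / real L) = real (card {t \<in> ?Q. \<theta> < \<delta> t}) / real L"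
      using finQ by (simp add: sum_divide_distrib[symmetric] of_bool_def sum.If_cases Int_def)
    ultimately have "(\<Sum>t\<in>?Q. of_bool (\<theta> < \<delta> t) / real L) = real r * (real N / real L) - X \<theta>"
      unfolding X by (simp add: diff_divide_distrib)
    thus "19 / 11 * real r - X \<theta> = (\<Sum>t\<in>?Q. of_bool (\<theta> < \<delta> t) / real L)"
      unfolding NL by simp
  qed
  also have "\<dots> = (\<Sum>t\<in>?Q. real (\<delta> t)) / real L"
  proof -
    have "(\<Sum>\<theta><\<Theta>. \<Sum>t\<in>?Q. of_bool (\<theta> < \<delta> t) / real L) = (\<Sum>t\<in>?Q. (\<Sum>\<theta><\<Theta>. of_bool (\<theta> < \<delta> t)) / real L)"
      unfolding sum_divide_distrib by (rule sum.swap)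
    also have "\<dots> = (\<Sum>t\<in>?Q. real (\<delta> t) / real L)"
      by (intro sum.cong refl) (use layer_cake[OF \<Theta>d] in simp)
    finally show ?thesis by (simp add: sum_divide_distrib)
  qed
  finally show ?thesis .
qed simp

text \<open>The sets are enlarged to size \<open>N\<close> one after the other. While one grows, the
  other \<open>r - 1\<close> sets occupy at most \<open>(r - 1) * N\<close> elements, which leaves
  \<open>N\<close> elements of \<open>P\<close> outside them.\<close>

lemma extend_disjoint_family:
  fixes A :: "nat \<Rightarrow> 'a set"
  assumes "finite P" "\<And>k. k < r \<Longrightarrow> A k \<subseteq> P \<and> card (A k) \<le> N"
    and "\<And>k l. k < r \<Longrightarrow> l < r \<Longrightarrow> k \<noteq> l \<Longrightarrow> A k \<inter> A l = {}" "r * N \<le> card P"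
  obtains S where "\<And>k. k < r \<Longrightarrow> A k \<subseteq> S k \<and> S k \<subseteq> P \<and> card (S k) = N"
    "\<And>k l. k < r \<Longrightarrow> l < r \<Longrightarrow> k \<noteq> l \<Longrightarrow> S k \<inter> S l = {}"
proof -
  have "i \<le> r \<Longrightarrow> \<exists>S. (\<forall>k<r. A k \<subseteq> S k \<and> S k \<subseteq> P \<and> card (S k) \<le> N) \<and>
      (\<forall>k<i. card (S k) = N) \<and> (\<forall>k<r. \<forall>l<r. k \<noteq> l \<longrightarrow> S k \<inter> S l = {})" for i
  proof (induction i)
    case 0
    show ?case using assms by (intro exI[of _ A]) auto
  next
    case (Suc i)
    then obtain S where S: "\<forall>k<r. A k \<subseteq> S k \<and> S k \<subseteq> P \<and> card (S k) \<le> N"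
      "\<forall>k<i. card (S k) = N" "\<forall>k<r. \<forall>l<r. k \<noteq> l \<longrightarrow> S k \<inter> S l = {}" by auto
    have i: "i < r" using Suc.prems by simp
    let ?O = "\<Union>k\<in>{..<r} - {i}. S k"
    have fin: "finite (S k)" if "k < r" for k using S(1) assms(1) that finite_subset by blast
    have finO: "finite ?O" using fin by auto
    have "card ?O \<le> (\<Sum>k\<in>{..<r} - {i}. card (S k))" by (rule card_UN_le) simp
    also have "\<dots> \<le> (\<Sum>k\<in>{..<r} - {i}. N)" using S(1) by (intro sum_mono) auto
    also have "\<dots> = (r - 1) * N" using i by simp
    finally have "card ?O + N \<le> r * N" using i by (cases r) auto
    hence "N \<le> card P - card ?O" using assms(4) by linarith
    also have "\<dots> \<le> card (P - ?O)" by (rule diff_card_le_card_Diff[OF finO])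
    finally have "N \<le> card (P - ?O)" .
    moreover have sub: "S i \<subseteq> P - ?O" using S(1,3) i by fastforce
    ultimately obtain B where B: "S i \<subseteq> B" "B \<subseteq> P - ?O" "card B = N"
      using exists_subset_between[of "S i" N "P - ?O"] S(1) i assms(1) by auto
    have AB: "A i \<subseteq> B" "B \<subseteq> P" using S(1) B(1,2) i by blast+
    show ?case
    proof (intro exI[of _ "S(i := B)"] conjI allI impI)
      fix k l assume "k < r" "l < r" "k \<noteq> l"
      thus "(S(i := B)) k \<inter> (S(i := B)) l = {}" using S(3) B(2) by (cases "k = i"; cases "l = i") auto
    qed (use S AB B i in \<open>auto simp: less_Suc_eq\<close>)
  qed
  from this[of r] obtain S where "\<forall>k<r. A k \<subseteq> S k \<and> S k \<subseteq> P \<and> card (S k) \<le> N"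
    "\<forall>k<r. card (S k) = N" "\<forall>k<r. \<forall>l<r. k \<noteq> l \<longrightarrow> S k \<inter> S l = {}" by auto
  thus ?thesis by (intro that[of S]) auto
qed


section \<open>Independent uniform draws\<close>

definition draws :: "nat \<Rightarrow> nat \<Rightarrow> (nat \<Rightarrow> nat) pmf" where
  "draws J L = Pi_pmf {..<J} 0 (\<lambda>_. pmf_of_set {0..L - 1})"

lemma set_draws: "set_pmf (draws J L) = PiE_dflt {..<J} 0 (\<lambda>_. {0..L - 1})"
  unfolding draws_def by (subst set_Pi_pmf) (auto simp: set_pmf_of_set)

lemma finite_set_draws: "finite (set_pmf (draws J L))"
  unfolding set_draws by (intro finite_PiE_dflt) auto

lemma draws_less: "\<omega> \<in> set_pmf (draws J L) \<Longrightarrow> x < J \<Longrightarrow> 0 < L \<Longrightarrow> \<omega> x < L"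
  unfolding set_draws PiE_dflt_def by (auto dest!: spec[of _ x])

lemma prob_uniform_compl:
  assumes "0 < L" "B \<subseteq> {..<L}"
  shows "measure_pmf.prob (pmf_of_set {0..L - 1}) (- B) = 1 - real (card B) / real L"
proof -
  have B: "{0..L - 1} \<inter> B = B" using assms by auto
  have "measure_pmf.prob (pmf_of_set {0..L - 1}) B = real (card B) / real L"
    by (subst measure_pmf_of_set) (use assms B in auto)
  thus ?thesis using measure_pmf.prob_compl[of B "pmf_of_set {0..L - 1}"]
    by (simp add: Compl_eq_Diff_UNIV)
qed

lemma prob_draw_eq:
  assumes "0 < L" "x < J" "v < L"
  shows "measure_pmf.prob (draws J L) {\<omega>. \<omega> x = v} = 1 / real L"
proof -
  have "{\<omega>. \<omega> x = v} = Pi {..<J} (\<lambda>y. if y = x then {v} else (UNIV :: nat set))"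
    using assms(2) by (auto simp: Pi_def)
  hence "measure_pmf.prob (draws J L) {\<omega>. \<omega> x = v}
      = (\<Prod>y<J. measure_pmf.prob (pmf_of_set {0..L - 1}) (if y = x then {v} else UNIV))"
    unfolding draws_def by (simp add: measure_Pi_pmf_Pi)
  also have "\<dots> = (\<Prod>y<J. if y = x then measure_pmf.prob (pmf_of_set {0..L - 1}) {v} else 1)"
    by (intro prod.cong) auto
  also have "\<dots> = measure_pmf.prob (pmf_of_set {0..L - 1}) {v}" using assms(2) by simp
  also have "\<dots> = 1 / real L"
    using assms by (subst measure_pmf_of_set) auto
  finally show ?thesis .
qed

text \<open>Single atoms and clusters are treated alike: atom \<open>t\<close> is open iff draw
  number \<open>slot t\<close> equals \<open>val t\<close>. Atoms sharing a slot exclude each other,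
  which gives \<open>1 - card (B x) / L\<close>; distinct slots are independent, and
  \<open>1 - x \<le> exp (- x)\<close> merges all slots into one exponential.\<close>

lemma prob_draws_miss:
  fixes slot val :: "'a \<Rightarrow> nat"
  assumes "0 < L" "finite A" "\<And>t. t \<in> A \<Longrightarrow> slot t < J \<and> val t < L"
    and "inj_on (\<lambda>t. (slot t, val t)) A"
  shows "measure_pmf.prob (draws J L) {\<omega>. \<forall>t\<in>A. \<omega> (slot t) \<noteq> val t} \<le> exp (- real (card A) / real L)"
proof -
  define B where "B x = val ` {t \<in> A. slot t = x}" for x
  have cB: "card (B x) = card {t \<in> A. slot t = x}" for x
    unfolding B_def by (rule card_image) (use assms(4) in \<open>auto simp: inj_on_def\<close>)
  have BL: "B x \<subseteq> {..<L}" for x unfolding B_def using assms(3) by auto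
  have "{\<omega>. \<forall>t\<in>A. \<omega> (slot t) \<noteq> val t} = Pi {..<J} (\<lambda>x. - B x)"
    unfolding B_def using assms(3) by (auto simp: Pi_def)
  hence "measure_pmf.prob (draws J L) {\<omega>. \<forall>t\<in>A. \<omega> (slot t) \<noteq> val t}
      = (\<Prod>x<J. measure_pmf.prob (pmf_of_set {0..L - 1}) (- B x))"
    unfolding draws_def by (simp add: measure_Pi_pmf_Pi)
  also have "\<dots> = (\<Prod>x<J. 1 - real (card (B x)) / real L)"
    using prob_uniform_compl[OF assms(1) BL] by simp
  also have "\<dots> \<le> (\<Prod>x<J. exp (- real (card (B x)) / real L))"
  proof (rule prod_mono)
    fix x
    have "card (B x) \<le> L" using card_mono[OF _ BL[of x]] by simp
    hence "real (card (B x)) / real L \<le> 1" using assms(1) by simp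
    thus "0 \<le> 1 - real (card (B x)) / real L \<and>
        1 - real (card (B x)) / real L \<le> exp (- real (card (B x)) / real L)"
      using exp_ge_add_one_self[of "- real (card (B x)) / real L"] by simp
  qed
  also have "\<dots> = exp (- (\<Sum>x<J. real (card (B x))) / real L)"
    by (simp add: exp_sum[symmetric] sum_negf sum_divide_distrib)
  also have "(\<Sum>x<J. real (card (B x))) = real (card A)"
  proof -
    have "(\<Sum>x<J. \<Sum>t\<in>{t \<in> A. slot t = x}. 1) = (\<Sum>t\<in>A. (1::nat))"
      by (rule sum.group) (use assms in auto)
    thus ?thesis unfolding cB by (simp flip: of_nat_sum)
  qed
  finally show ?thesis .
qed

lemma expectation_sum_finite:
  assumes "finite (set_pmf p)"
  shows "measure_pmf.expectation p (\<lambda>\<omega>. \<Sum>x\<in>A. f x \<omega>) = (\<Sum>x\<in>A. measure_pmf.expectation p (f x :: _ \<Rightarrow> real))"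
  by (rule Bochner_Integration.integral_sum) (rule integrable_measure_pmf_finite[OF assms])

lemma expectation_of_bool:
  "measure_pmf.expectation p (\<lambda>\<omega>. of_bool (Q \<omega>)) = measure_pmf.prob p {\<omega>. Q \<omega>}"
proof -
  have "(\<lambda>\<omega>. of_bool (Q \<omega>) :: real) = indicator {\<omega>. Q \<omega>}" by (auto simp: indicator_def)
  thus ?thesis by simp
qed

lemma expectation_mono_finite:
  assumes "finite (set_pmf p)" "\<And>\<omega>. \<omega> \<in> set_pmf p \<Longrightarrow> f \<omega> \<le> (g \<omega> :: real)"
  shows "measure_pmf.expectation p f \<le> measure_pmf.expectation p g"
  by (rule integral_mono_AE)
    (use assms in \<open>auto simp: integrable_measure_pmf_finite AE_measure_pmf_iff\<close>)

text \<open>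
  Each demand \<open>k\<close> takes the nearest open atom of its own set \<open>S k\<close> unless that is farther than
  \<open>3 * bet k\<close>, in which case it takes the open atom of its cluster \<open>C k\<close>. Since \<open>S k\<close> contains
  all atoms of \<open>C k\<close> in the neighbourhood \<open>P\<close> of the client, the fallback atom lies outside
  \<open>P\<close>, so that the demands of one client never collide.
\<close>

lemma demand_assignment:
  fixes S C :: "nat \<Rightarrow> 'a set" and \<delta> :: "'a \<Rightarrow> nat"
  assumes S: "\<And>k. k < r \<Longrightarrow> P \<inter> C k \<subseteq> S k \<and> S k \<subseteq> P \<and> finite (S k)"
    and disjS: "\<And>k l. k < r \<Longrightarrow> l < r \<Longrightarrow> k \<noteq> l \<Longrightarrow> S k \<inter> S l = {}"
    and disjC: "\<And>k l. k < r \<Longrightarrow> l < r \<Longrightarrow> k \<noteq> l \<Longrightarrow> C k \<inter> C l = {}"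
    and C: "\<And>k t. k < r \<Longrightarrow> t \<in> C k \<Longrightarrow> \<delta> t \<le> 3 * bet k"
    and Op: "\<And>k. k < r \<Longrightarrow> C k \<inter> Op \<noteq> {}"
  obtains a where "inj_on a {..<r}" "\<And>k. k < r \<Longrightarrow> a k \<in> Op"
    "\<And>k \<theta>. k < r \<Longrightarrow> \<theta> < \<delta> (a k) \<Longrightarrow> \<theta> < 3 * bet k \<and> (\<forall>t\<in>S k. \<delta> t \<le> \<theta> \<longrightarrow> t \<notin> Op)"
proof -
  have "\<exists>x. x \<in> Op \<and> (x \<in> S k \<or> x \<in> C k \<and> x \<notin> P) \<and> \<delta> x \<le> 3 * bet k \<and>
      (\<forall>t \<in> S k \<inter> Op. \<delta> x \<le> \<delta> t)" if k: "k < r" for k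
  proof (cases "\<exists>t \<in> S k \<inter> Op. \<delta> t \<le> 3 * bet k")
    case True
    hence ne: "S k \<inter> Op \<noteq> {}" by auto
    obtain x where x: "x \<in> S k \<inter> Op" "\<forall>t \<in> S k \<inter> Op. \<delta> x \<le> \<delta> t"
      using ex_is_arg_min_if_finite[of "S k \<inter> Op" \<delta>] S[OF k] ne by (auto simp: is_arg_min_linorder)
    have "\<delta> x \<le> 3 * bet k" using True x(2) order_trans by blast
    thus ?thesis using x by (intro exI[of _ x]) simp
  next
    case False
    obtain x where x: "x \<in> C k" "x \<in> Op" using Op[OF k] by auto
    hence "\<delta> x \<le> 3 * bet k" using C[OF k] by auto
    moreover from this have "x \<notin> P" using False S[OF k] x by auto
    moreover have "\<forall>t \<in> S k \<inter> Op. \<delta> x \<le> \<delta> t"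
      using False \<open>\<delta> x \<le> 3 * bet k\<close> by (meson nat_le_linear order_trans)
    ultimately show ?thesis using x by (intro exI[of _ x]) simp
  qed
  then obtain a where a: "\<And>k. k < r \<Longrightarrow> a k \<in> Op \<and> (a k \<in> S k \<or> a k \<in> C k \<and> a k \<notin> P) \<and>
      \<delta> (a k) \<le> 3 * bet k \<and> (\<forall>t \<in> S k \<inter> Op. \<delta> (a k) \<le> \<delta> t)" by metis
  show ?thesis
  proof (rule that[of a])
    show "inj_on a {..<r}"
    proof (rule inj_onI)
      fix k l assume kl: "k \<in> {..<r}" "l \<in> {..<r}" "a k = a l"
      show "k = l"
      proof (rule ccontr)
        assume "k \<noteq> l"
        hence d: "S k \<inter> S l = {}" "C k \<inter> C l = {}" using disjS disjC kl by auto
        have "a k \<in> S k \<or> a k \<in> C k \<and> a k \<notin> P" "a k \<in> S l \<or> a k \<in> C l \<and> a k \<notin> P"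
          using a[of k] a[of l] kl by auto
        thus False using d S[of k] S[of l] kl by blast
      qed
    qed
    show "a k \<in> Op" if "k < r" for k using a[OF that] by simp
    show "\<theta> < 3 * bet k \<and> (\<forall>t\<in>S k. \<delta> t \<le> \<theta> \<longrightarrow> t \<notin> Op)" if "k < r" "\<theta> < \<delta> (a k)" for k \<theta>
    proof -
      have "\<delta> (a k) \<le> 3 * bet k" "\<forall>t \<in> S k \<inter> Op. \<delta> (a k) \<le> \<delta> t" using a[OF that(1)] by auto
      thus ?thesis using that(2) by (meson IntI leD order_le_less_trans less_le_trans)
    qed
  qed
qed

text \<open>About \<open>cst\<close> it is only assumed that it does not exceed the cost of any
  injective assignment to open atoms. So the bound covers the greedy connection of the program,
  although the proof builds an assignment of its own for every outcome.\<close>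

theorem client_expected_cost:
  fixes slot val \<delta> :: "nat \<Rightarrow> nat" and cst :: "(nat \<Rightarrow> nat) \<Rightarrow> nat" and C :: "nat \<Rightarrow> nat set"
  assumes M: "0 < M" "N = 19 * M" "L = 11 * M"
    and P: "finite P" "r * N \<le> card P" "\<And>t. t \<in> P \<Longrightarrow> slot t < J \<and> val t < L"
    and inj: "inj_on (\<lambda>t. (slot t, val t)) P"
    and C: "\<And>k. k < r \<Longrightarrow> finite (C k) \<and> card (C k) = L"
    and disjC: "\<And>k l. k < r \<Longrightarrow> l < r \<Longrightarrow> k \<noteq> l \<Longrightarrow> C k \<inter> C l = {}"
    and Op: "\<And>k \<omega>. k < r \<Longrightarrow> \<omega> \<in> set_pmf (draws J L) \<Longrightarrow> \<exists>t\<in>C k. \<omega> (slot t) = val t"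
    and far: "\<And>k t. k < r \<Longrightarrow> t \<in> C k \<Longrightarrow> \<delta> t \<le> 3 * bet k"
    and bet: "\<And>k. k < r \<Longrightarrow> card {t \<in> P. \<delta> t < bet k} < Suc k * L"
    and cst: "\<And>\<omega> a. \<omega> \<in> set_pmf (draws J L) \<Longrightarrow> inj_on a {..<r} \<Longrightarrow>
        (\<And>k. k < r \<Longrightarrow> \<omega> (slot (a k)) = val (a k) \<and> a k \<in> P \<union> (\<Union>k<r. C k)) \<Longrightarrow>
        cst \<omega> \<le> (\<Sum>k<r. \<delta> (a k))"
  shows "measure_pmf.expectation (draws J L) (\<lambda>\<omega>. real (cst \<omega>)) \<le> (\<Sum>t\<in>P. real (\<delta> t)) / real L"
proof -
  have L0: "0 < L" using M by simp
  have LN: "L \<le> N" using M by simp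
  have PC: "P \<inter> C k \<subseteq> P \<and> card (P \<inter> C k) \<le> N" if "k < r" for k
    using card_mono[of "C k" "P \<inter> C k"] C[OF that] LN by auto
  have disjPC: "(P \<inter> C k) \<inter> (P \<inter> C l) = {}" if "k < r" "l < r" "k \<noteq> l" for k l
    using disjC[OF that] by auto
  obtain S where S: "\<And>k. k < r \<Longrightarrow> P \<inter> C k \<subseteq> S k \<and> S k \<subseteq> P \<and> card (S k) = N"
    and disjS: "\<And>k l. k < r \<Longrightarrow> l < r \<Longrightarrow> k \<noteq> l \<Longrightarrow> S k \<inter> S l = {}"
    using extend_disjoint_family[of P r "\<lambda>k. P \<inter> C k" N, OF P(1) PC disjPC P(2)] by blast
  have finS: "finite (S k)" if "k < r" for k using S[OF that] P(1) finite_subset by blast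
  define bad where "bad k \<theta> \<omega> \<longleftrightarrow> (\<forall>t\<in>{t \<in> S k. \<delta> t \<le> \<theta>}. \<omega> (slot t) \<noteq> val t)" for k \<theta> \<omega>
  let ?p = "draws J L"
  \<comment> \<open>The distance \<open>\<delta> (a k)\<close> counts the thresholds below it; each
    of them is below \<open>3 * bet k\<close>, and no atom of \<open>S k\<close> within it is
    open.\<close>
  have pw: "real (cst \<omega>) \<le> (\<Sum>k<r. \<Sum>\<theta><3 * bet k. of_bool (bad k \<theta> \<omega>))"
    if \<omega>: "\<omega> \<in> set_pmf ?p" for \<omega>
  proof -
    define Op' where "Op' = {t \<in> P \<union> (\<Union>k<r. C k). \<omega> (slot t) = val t}"
    obtain a where a: "inj_on a {..<r}" "\<And>k. k < r \<Longrightarrow> a k \<in> Op'"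
      "\<And>k \<theta>. k < r \<Longrightarrow> \<theta> < \<delta> (a k) \<Longrightarrow> \<theta> < 3 * bet k \<and> (\<forall>t\<in>S k. \<delta> t \<le> \<theta> \<longrightarrow> t \<notin> Op')"
    proof (rule demand_assignment[of r P C S \<delta> bet Op'])
      show "C k \<inter> Op' \<noteq> {}" if "k < r" for k using Op[OF that \<omega>] that by (auto simp: Op'_def)
    qed (use S finS disjS disjC far in auto)
    have "cst \<omega> \<le> (\<Sum>k<r. \<delta> (a k))"
      by (rule cst[OF \<omega> a(1)]) (use a(2) in \<open>auto simp: Op'_def\<close>)
    hence "real (cst \<omega>) \<le> (\<Sum>k<r. real (\<delta> (a k)))" by (simp flip: of_nat_sum)
    also have "\<dots> \<le> (\<Sum>k<r. \<Sum>\<theta><3 * bet k. of_bool (bad k \<theta> \<omega>))"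
    proof (rule sum_mono)
      fix k assume "k \<in> {..<r}"
      hence k: "k < r" by simp
      have "\<delta> (a k) \<le> 3 * bet k"
        using a(3)[OF k, of "3 * bet k"] by (meson not_le less_irrefl)
      from layer_cake[OF this] have "real (\<delta> (a k)) = (\<Sum>\<theta><3 * bet k. of_bool (\<theta> < \<delta> (a k)))" .
      also have "\<dots> \<le> (\<Sum>\<theta><3 * bet k. of_bool (bad k \<theta> \<omega>))"
      proof (rule sum_mono)
        fix \<theta>
        have "bad k \<theta> \<omega>" if "\<theta> < \<delta> (a k)"
          using a(3)[OF k that] S[OF k] by (auto simp: bad_def Op'_def)
        thus "of_bool (\<theta> < \<delta> (a k)) \<le> (of_bool (bad k \<theta> \<omega>) :: real)" by simp
      qed
      finally show "real (\<delta> (a k)) \<le> (\<Sum>\<theta><3 * bet k. of_bool (bad k \<theta> \<omega>))" .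
    qed
    finally show ?thesis .
  qed
  have "measure_pmf.expectation ?p (\<lambda>\<omega>. real (cst \<omega>))
      \<le> measure_pmf.expectation ?p (\<lambda>\<omega>. \<Sum>k<r. \<Sum>\<theta><3 * bet k. of_bool (bad k \<theta> \<omega>))"
    by (rule expectation_mono_finite[OF finite_set_draws pw])
  also have "\<dots> = (\<Sum>k<r. \<Sum>\<theta><3 * bet k. measure_pmf.prob ?p {\<omega>. bad k \<theta> \<omega>})"
    unfolding expectation_sum_finite[OF finite_set_draws] expectation_of_bool ..
  also have "\<dots> \<le> (\<Sum>k<r. \<Sum>\<theta><3 * bet k. exp (- real (card {t \<in> S k. \<delta> t \<le> \<theta>}) / real L))"
    unfolding bad_def
  proof (intro sum_mono prob_draws_miss)
    fix k \<theta> assume "k \<in> {..<r}"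
    hence k: "k < r" by simp
    show "finite {t \<in> S k. \<delta> t \<le> \<theta>}" using finS[OF k] by simp
    show "\<And>t. t \<in> {t \<in> S k. \<delta> t \<le> \<theta>} \<Longrightarrow> slot t < J \<and> val t < L" using S[OF k] P(3) by blast
    show "inj_on (\<lambda>t. (slot t, val t)) {t \<in> S k. \<delta> t \<le> \<theta>}"
      by (rule inj_on_subset[OF inj]) (use S[OF k] in auto)
  qed (rule L0)
  also have "\<dots> \<le> (\<Sum>t\<in>(\<Union>k<r. S k). real (\<delta> t)) / real L"
  proof (rule demand_cost_bound[OF M])
    fix k assume k: "k < r"
    have "card {t \<in> (\<Union>k<r. S k). \<delta> t < bet k} \<le> card {t \<in> P. \<delta> t < bet k}"
      using S P(1) by (intro card_mono) auto
    thus "card {t \<in> (\<Union>k<r. S k). \<delta> t < bet k} < Suc k * L" using bet[OF k] by simp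
  qed (use S finS disjS in auto)
  also have "\<dots> \<le> (\<Sum>t\<in>P. real (\<delta> t)) / real L"
    using S P(1) by (intro divide_right_mono sum_mono2) auto
  finally show ?thesis .
qed

section \<open>Multiplicative weights on stars\<close>

text \<open>Distances between two sites or two clients are not part of the input.
  \<open>four_point\<close> is the trace of the triangle inequality on site-client distances, for
  the path from \<open>i\<close> through \<open>j'\<close> and \<open>i'\<close> to
  \<open>j\<close>.\<close>

locale ftfp_data =
  fixes n m :: nat and F :: "nat \<Rightarrow> nat" and D :: "nat \<Rightarrow> nat \<Rightarrow> nat" and r :: "nat \<Rightarrow> nat"
  assumes r_pos: "j < n \<Longrightarrow> 0 < r j"
    and four_point: "i < m \<Longrightarrow> i' < m \<Longrightarrow> j < n \<Longrightarrow> j' < n \<Longrightarrow> D i j \<le> D i j' + D i' j' + D i' j"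
    and sites_ne: "0 < n \<Longrightarrow> 0 < m"
begin

text \<open>The factor \<open>n + 1\<close> makes the additive term \<open>1000 * n + 1\<close> in
  the cost of the weights phase at most \<open>MM / 1000\<close>, which is negligible against
  \<open>NN\<close>. The ratio of \<open>NN\<close> to \<open>LL\<close> is exactly 19/11.\<close>

definition MM :: nat where "MM = 1000000 * (n + 1)"
definition NN :: nat where "NN = 19 * MM"
definition LL :: nat where "LL = 11 * MM"
text \<open>A common multiple of the demands, so that weight updates by fractions with denominator
  \<open>r j\<close> stay integral.\<close>

definition RP :: nat where "RP = (\<Prod>j<n. r j)"

lemma MM_pos: "0 < MM" and NN_pos: "0 < NN" and LL_pos: "0 < LL"
  by (simp_all add: MM_def NN_def LL_def)

lemma RP_pos: "0 < RP"
  unfolding RP_def using r_pos by (intro prod_pos) auto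

lemma RP_div: "j < n \<Longrightarrow> RP div r j * r j = RP"
  unfolding RP_def by (rule dvd_div_mult_self) (auto intro!: dvd_prodI)

definition active :: "(nat \<Rightarrow> nat) \<Rightarrow> nat set" where
  "active H = {j. j < n \<and> H j < NN * r j}"

text \<open>For fixed \<open>i\<close> these are the prefixes of the active clients in the order of
  \<open>D i j / W j\<close>, compared by cross-multiplication. Only \<open>m * n\<close> stars have
  to be examined instead of exponentially many.\<close>

definition star :: "(nat \<Rightarrow> nat) \<Rightarrow> (nat \<Rightarrow> nat) \<Rightarrow> nat \<Rightarrow> nat \<Rightarrow> nat set" where
  "star W H i l = {j \<in> active H. D i j * W l \<le> D i l * W j}"

definition star_cost :: "nat \<Rightarrow> nat set \<Rightarrow> nat" where
  "star_cost i S = F i + (\<Sum>j\<in>S. D i j)"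

definition best_star :: "(nat \<Rightarrow> nat) \<Rightarrow> (nat \<Rightarrow> nat) \<Rightarrow> nat \<Rightarrow> nat \<Rightarrow> bool" where
  "best_star W H i l \<longleftrightarrow> i < m \<and> l \<in> active H \<and>
     (\<forall>i'<m. \<forall>l'\<in>active H.
        star_cost i (star W H i l) * sum W (star W H i' l')
        \<le> star_cost i' (star W H i' l') * sum W (star W H i l))"

text \<open>\<alpha> ranges over the feasible solutions of the LP dual, in which the variables
  belonging to \<open>x i j \<le> y i\<close> have been eliminated as
  \<open>max 0 (\<alpha> j - D i j)\<close>. By weak duality the cost of every feasible fractional
  solution qualifies as \<open>Z\<close>.\<close>

definition dual_bound :: "real \<Rightarrow> bool" where
  "dual_bound Z \<longleftrightarrow> (\<forall>\<alpha>. (\<forall>j<n. 0 \<le> \<alpha> j) \<longrightarrow>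
     (\<forall>i<m. (\<Sum>j<n. max 0 (\<alpha> j - real (D i j))) \<le> real (F i)) \<longrightarrow>
     (\<Sum>j<n. real (r j) * \<alpha> j) \<le> Z)"

lemma finite_active [simp]: "finite (active H)"
  by (simp add: active_def)

lemma finite_star [simp]: "finite (star W H i l)"
  by (simp add: star_def)

lemma star_self: "l \<in> active H \<Longrightarrow> l \<in> star W H i l"
  by (simp add: star_def)

text \<open>
  The optimal star ratio scales the weights to a feasible dual solution: for the site \<open>i'\<close> the
  clients with positive slack form one of the candidate stars.
\<close>

lemma best_star_dual:
  assumes Z: "dual_bound Z" and b: "best_star W H i l" and W: "\<And>j. j < n \<Longrightarrow> 0 < W j"
  shows "real (star_cost i (star W H i l)) * (\<Sum>j\<in>active H. real (r j) * real (W j))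
    \<le> Z * real (sum W (star W H i l))"
proof -
  let ?S = "star W H i l"
  have l: "l \<in> active H" "l < n" using b by (auto simp: best_star_def active_def)
  have Wpos: "0 < W j" if "j \<in> active H" for j using W that by (auto simp: active_def)
  have SW: "0 < sum W ?S"
    using sum_pos2[of ?S l W] star_self[OF l(1)] Wpos[OF l(1)] by simp
  define lam where "lam = real (star_cost i ?S) / real (sum W ?S)"
  have lam0: "0 \<le> lam" by (simp add: lam_def del: of_nat_sum)
  define \<alpha> where "\<alpha> j = (if j \<in> active H then lam * real (W j) else 0)" for j
  have "(\<Sum>j<n. real (r j) * \<alpha> j) \<le> Z"
  proof (rule Z[unfolded dual_bound_def, rule_format])
    show "0 \<le> \<alpha> j" for j using lam0 by (simp add: \<alpha>_def)
    fix i' assume i': "i' < m"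
    define T where "T = {j \<in> active H. real (D i' j) < lam * real (W j)}"
    have finT: "finite T" by (simp add: T_def)
    have "(\<Sum>j<n. max 0 (\<alpha> j - real (D i' j))) = (\<Sum>j\<in>T. lam * real (W j) - real (D i' j))"
      by (rule sum.mono_neutral_cong_right) (auto simp: T_def \<alpha>_def active_def max_def)
    also have "\<dots> \<le> real (F i')"
    proof (cases "T = {}")
      case False
      have "\<exists>l'. is_arg_min (\<lambda>j. - (real (D i' j) / real (W j))) (\<lambda>j. j \<in> T) l'"
        by (rule ex_is_arg_min_if_finite[OF finT False])
      then obtain l' where l': "l' \<in> T"
        "\<And>j. j \<in> T \<Longrightarrow> real (D i' j) / real (W j) \<le> real (D i' l') / real (W l')"
        by (auto simp: is_arg_min_linorder)
      have la: "l' \<in> active H" using l' by (simp add: T_def)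
      have mem: "D i' j * W l' \<le> D i' l' * W j \<longleftrightarrow>
          real (D i' j) / real (W j) \<le> real (D i' l') / real (W l')" if "j \<in> active H" for j
      proof -
        have "D i' j * W l' \<le> D i' l' * W j \<longleftrightarrow> real (D i' j) * real (W l') \<le> real (D i' l') * real (W j)"
          by (metis of_nat_le_iff of_nat_mult)
        also have "\<dots> \<longleftrightarrow> real (D i' j) / real (W j) \<le> real (D i' l') / real (W l')"
          using Wpos[OF that] Wpos[OF la] by (simp add: field_simps)
        finally show ?thesis .
      qed
      have "star W H i' l' = T"
      proof (rule set_eqI)
        fix j
        show "j \<in> star W H i' l' \<longleftrightarrow> j \<in> T"
        proof (cases "j \<in> active H")
          case True
          have "real (D i' l') / real (W l') < lam"
            using l'(1) Wpos[OF la] by (simp add: T_def field_simps)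
          moreover have "j \<in> T \<longleftrightarrow> real (D i' j) / real (W j) < lam"
            using True Wpos[OF True] by (simp add: T_def field_simps)
          ultimately show ?thesis using mem[OF True] l'(2)[of j] True by (auto simp: star_def)
        qed (auto simp: star_def T_def)
      qed
      hence "star_cost i ?S * sum W T \<le> star_cost i' T * sum W ?S"
        using b i' la by (auto simp: best_star_def)
      hence "real (star_cost i ?S) * real (sum W T) \<le> real (star_cost i' T) * real (sum W ?S)"
        by (metis of_nat_le_iff of_nat_mult)
      hence "lam * real (sum W T) \<le> real (star_cost i' T)"
        using SW by (simp add: lam_def field_simps del: of_nat_sum)
      thus ?thesis
        by (simp add: star_cost_def sum_subtractf sum_distrib_left)
    qed simp
    finally show "(\<Sum>j<n. max 0 (\<alpha> j - real (D i' j))) \<le> real (F i')" .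
  qed
  also have "(\<Sum>j<n. real (r j) * \<alpha> j) = (\<Sum>j\<in>active H. real (r j) * (lam * real (W j)))"
    by (rule sum.mono_neutral_cong_right) (auto simp: \<alpha>_def active_def)
  also have "\<dots> = lam * (\<Sum>j\<in>active H. real (r j) * real (W j))"
    by (simp add: sum_distrib_left ac_simps)
  finally show ?thesis using SW by (simp add: lam_def field_simps del: of_nat_sum)
qed

text \<open>The weight of a member is multiplied by \<open>1 - c / (1000 * r j)\<close> and every
  other weight by 1; the common factor \<open>1000 * RP\<close> clears the denominators.\<close>

definition upd_W :: "nat set \<Rightarrow> nat \<Rightarrow> (nat \<Rightarrow> nat) \<Rightarrow> nat \<Rightarrow> nat" where
  "upd_W S c W j = (if j \<in> S then W j * (1000 * RP - RP div r j * c) else W j * (1000 * RP))"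

definition upd_H :: "nat set \<Rightarrow> nat \<Rightarrow> (nat \<Rightarrow> nat) \<Rightarrow> nat \<Rightarrow> nat" where
  "upd_H S c H j = (if j \<in> S then H j + c else H j)"

text \<open>\<open>s\<close> is the accumulated scale of the integer weights, and
  \<open>r j * W j / s\<close>, initially 1, is the actual weight of a client. The potential, the
  total weight of the active clients, shrinks with the cost \<open>c\<close>, whereas the weight of
  a single client cannot fall faster than its coverage grows; together this bounds \<open>c\<close>.
  The last clause counts rounds: its sum cannot exceed \<open>n * NN\<close>.\<close>

definition mwu_inv :: "real \<Rightarrow> nat \<Rightarrow> (nat \<Rightarrow> nat) \<Rightarrow> (nat \<Rightarrow> nat) \<Rightarrow> nat \<Rightarrow> bool" where
  "mwu_inv Z k W H c \<longleftrightarrow>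
     (\<exists>s > 0. (\<forall>j<n. exp (- (1002 / 1000000 * real (H j) / real (r j))) \<le> real (r j) * real (W j) / s) \<and>
       (0 < Z \<longrightarrow> (\<Sum>j\<in>active H. real (r j) * real (W j) / s) \<le> exp (real n - real c / (1000 * Z)))) \<and>
     real c \<le> Z * (1000 * real n + real NN * (1002 / 1000) + 1) \<and>
     (active H = {} \<or> k \<le> (\<Sum>j<n. min NN (H j div r j)))"

lemma mwu_inv_W_pos: "mwu_inv Z k W H c \<Longrightarrow> j < n \<Longrightarrow> 0 < W j"
proof (rule ccontr)
  assume "mwu_inv Z k W H c" "j < n" "\<not> 0 < W j"
  then obtain s where "exp (- (1002 / 1000000 * real (H j) / real (r j))) \<le> real (r j) * real (W j) / s"
    by (auto simp: mwu_inv_def)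
  hence "exp (- (1002 / 1000000 * real (H j) / real (r j))) \<le> 0" using \<open>\<not> 0 < W j\<close> by simp
  thus False by (simp add: not_le[symmetric])
qed

lemma mwu_inv_init:
  assumes "0 \<le> Z" "\<And>j. j < n \<Longrightarrow> W j = RP div r j" "\<And>j. j < n \<Longrightarrow> H j = 0"
  shows "mwu_inv Z 0 W H 0"
proof -
  have v: "real (r j) * real (W j) / real RP = 1" if "j < n" for j
  proof -
    have "real (W j) * real (r j) = real RP" using assms(2)[OF that] RP_div[OF that] by (metis of_nat_mult)
    thus ?thesis using RP_pos by (simp add: field_simps)
  qed
  have "(\<Sum>j\<in>active H. real (r j) * real (W j) / real RP) = real (card (active H))"
  proof -
    have "(\<Sum>j\<in>active H. real (r j) * real (W j) / real RP) = (\<Sum>j\<in>active H. 1)"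
      by (rule sum.cong[OF refl v]) (simp add: active_def)
    thus ?thesis by simp
  qed
  also have "card (active H) \<le> card {..<n}" by (rule card_mono) (auto simp: active_def)
  also have "real (card {..<n}) \<le> exp (real n)" using exp_ge_add_one_self[of "real n"] unfolding card_lessThan by linarith
  finally have "(\<Sum>j\<in>active H. real (r j) * real (W j) / real RP) \<le> exp (real n)" by simp
  moreover have "exp (- (1002 / 1000000 * real (H j) / real (r j))) \<le> real (r j) * real (W j) / real RP"
    if "j < n" for j unfolding v[OF that] using assms(3)[OF that] by simp
  ultimately show ?thesis unfolding mwu_inv_def using assms(1) RP_pos
    by (intro conjI exI[of _ "real RP"]) auto
qed

lemma mwu_inv_skip:
  "mwu_inv Z k W H c \<Longrightarrow> active H = {} \<Longrightarrow> mwu_inv Z (Suc k) W H c"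
  unfolding mwu_inv_def by blast

text \<open>A reverse of the usual \<open>1 - x \<le> exp (- x)\<close>. The factor 1002/1000 is the
  price for steps of size up to 1/1000 and becomes the final loss of 1/500.\<close>

lemma exp_le_one_minus:
  assumes "0 \<le> x" "x \<le> 1 / (1000::real)"
  shows "exp (- (1002 / 1000 * x)) \<le> 1 - x"
proof -
  have "0 < 1 - x" using assms by simp
  have "1 / (1 - x) \<le> 1 + 1002 / 1000 * x"
  proof -
    have "x * x \<le> x * (1 / 1000)" using assms by (intro mult_left_mono)
    hence "1 \<le> (1 + 1002 / 1000 * x) * (1 - x)" using assms by (simp add: algebra_simps)
    thus ?thesis using \<open>0 < 1 - x\<close> by (simp add: field_simps)
  qed
  also have "\<dots> \<le> exp (1002 / 1000 * x)" by (rule exp_ge_add_one_self)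
  finally have "1 / (1 - x) \<le> exp (1002 / 1000 * x)" .
  hence "1 / exp (1002 / 1000 * x) \<le> 1 - x" using \<open>0 < 1 - x\<close> by (simp add: field_simps)
  thus ?thesis by (simp add: exp_minus field_simps)
qed

text \<open>By \<open>best_star_dual\<close>, the potential falls by at least the fraction of the
  cost of the round to \<open>1000 * Z\<close>. The least demand of the star is chosen as amount
  \<open>a\<close>: then no weight falls by more than one thousandth of itself, and still one member
  gains a full unit of coverage.\<close>

lemma mwu_inv_step:
  assumes Z: "0 \<le> Z" "dual_bound Z" and inv: "mwu_inv Z k W H c" and b: "best_star W H i l"
    and S: "S = star W H i l" and a: "a = Min (r ` S)"
    and W': "\<And>j. j < n \<Longrightarrow> W' j = upd_W S a W j" and H': "\<And>j. j < n \<Longrightarrow> H' j = upd_H S a H j"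
  shows "mwu_inv Z (Suc k) W' H' (c + star_cost i S * a)"
proof -
  obtain s where s: "0 < s"
    and v: "\<And>j. j < n \<Longrightarrow> exp (- (1002 / 1000000 * real (H j) / real (r j))) \<le> real (r j) * real (W j) / s"
    and pot: "0 < Z \<Longrightarrow> (\<Sum>j\<in>active H. real (r j) * real (W j) / s) \<le> exp (real n - real c / (1000 * Z))"
    and cZ: "real c \<le> Z * (1000 * real n + real NN * (1002 / 1000) + 1)"
    and cnt: "active H = {} \<or> k \<le> (\<Sum>j<n. min NN (H j div r j))"
    using inv unfolding mwu_inv_def by blast
  have Wpos: "0 < W j" if "j < n" for j using mwu_inv_W_pos[OF inv that] .
  have l: "l \<in> active H" "l < n" using b by (auto simp: best_star_def active_def)
  have lS: "l \<in> S" unfolding S by (rule star_self[OF l(1)])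
  have Sact: "S \<subseteq> active H" unfolding S by (auto simp: star_def)
  have Sn: "j < n" if "j \<in> S" for j using Sact that by (auto simp: active_def)
  have finS: "finite S" by (simp add: S)
  have a_le: "a \<le> r j" if "j \<in> S" for j unfolding a using finS that by simp
  have a_in: "\<exists>j\<in>S. r j = a"
  proof -
    have "a \<in> r ` S" unfolding a using finS lS by (intro Min_in) auto
    thus ?thesis by auto
  qed
  define v0 where "v0 j = real (r j) * real (W j) / s" for j
  have v0pos: "0 < v0 j" if "j < n" for j using Wpos[OF that] r_pos[OF that] s by (simp add: v0_def)
  define s' where "s' = s * (1000 * real RP)"
  have s': "0 < s'" using s RP_pos by (simp add: s'_def)
  define x where "x j = (if j \<in> S then real a / (1000 * real (r j)) else 0)" for j
  have x: "0 \<le> x j" "x j \<le> 1 / 1000" if "j < n" for j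
    using a_le[of j] r_pos[OF that] by (auto simp: x_def field_simps)
  have v': "real (r j) * real (W' j) / s' = v0 j * (1 - x j)" if j: "j < n" for j
  proof (cases "j \<in> S")
    case True
    have "RP div r j * a \<le> RP div r j * r j" using a_le[OF True] by simp
    hence le: "RP div r j * a \<le> 1000 * RP" using RP_div[OF j] by linarith
    have "real (RP div r j) = real RP / real (r j)"
      using RP_div[OF j] r_pos[OF j] by (metis nonzero_mult_div_cancel_right of_nat_0_less_iff of_nat_mult less_numeral_extra(3))
    hence "real (1000 * RP - RP div r j * a) = 1000 * real RP * (1 - x j)"
      using le True r_pos[OF j] by (simp add: of_nat_diff x_def field_simps)
    hence "real (W' j) = real (W j) * (1000 * real RP * (1 - x j))"
      using W'[OF j] True by (simp only: upd_W_def if_True of_nat_mult)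
    thus ?thesis using RP_pos s by (simp add: v0_def s'_def)
  next
    case False
    thus ?thesis using W'[OF j] RP_pos s by (simp add: upd_W_def x_def v0_def s'_def)
  qed
  have act': "active H' \<subseteq> active H" unfolding active_def using H' by (auto simp: upd_H_def split: if_splits)
  have c1: "exp (- (1002 / 1000000 * real (H' j) / real (r j))) \<le> real (r j) * real (W' j) / s'" if j: "j < n" for j
  proof -
    have "real (H' j) = real (H j) + 1000 * x j * real (r j)"
      using H'[OF j] r_pos[OF j] by (auto simp: upd_H_def x_def)
    hence "exp (- (1002 / 1000000 * real (H' j) / real (r j)))
        = exp (- (1002 / 1000000 * real (H j) / real (r j))) * exp (- (1002 / 1000 * x j))"
      using r_pos[OF j] by (simp add: exp_add[symmetric] field_simps)
    also have "\<dots> \<le> v0 j * (1 - x j)"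
      using v[OF j] exp_le_one_minus[OF x[OF j]] v0pos[OF j] by (intro mult_mono) (auto simp: v0_def)
    finally show ?thesis using v'[OF j] by simp
  qed
  define \<Phi> where "\<Phi> = (\<Sum>j\<in>active H. v0 j)"
  define w where "w = real (sum W S) / s"
  let ?c = "real (star_cost i S)"
  have w0: "0 \<le> w" using s by (simp add: w_def del: of_nat_sum)
  have \<Phi>pos: "0 < \<Phi>" unfolding \<Phi>_def
    using l v0pos by (intro sum_pos2[of _ l]) (auto simp: active_def less_imp_le)
  have dual: "?c * \<Phi> \<le> Z * w"
  proof -
    have "?c * (\<Sum>j\<in>active H. real (r j) * real (W j)) \<le> Z * real (sum W S)"
      unfolding S by (rule best_star_dual[OF Z(2) b Wpos])
    hence "?c * (\<Sum>j\<in>active H. real (r j) * real (W j)) / s \<le> Z * real (sum W S) / s"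
      using s by (intro divide_right_mono) auto
    thus ?thesis by (simp add: \<Phi>_def v0_def w_def sum_divide_distrib[symmetric])
  qed
  have vx: "(\<Sum>j\<in>active H. v0 j * x j) = real a * w / 1000"
  proof -
    have "(\<Sum>j\<in>active H. v0 j * x j) = (\<Sum>j\<in>S. v0 j * x j)"
      by (rule sum.mono_neutral_right) (use Sact in \<open>auto simp: x_def\<close>)
    also have "\<dots> = (\<Sum>j\<in>S. real a * (real (W j) / s) / 1000)"
    proof (intro sum.cong refl)
      fix j assume j: "j \<in> S"
      thus "v0 j * x j = real a * (real (W j) / s) / 1000"
        using r_pos[OF Sn[OF j]] by (simp add: x_def v0_def)
    qed
    finally show ?thesis by (simp add: w_def sum_distrib_left sum_divide_distrib)
  qed
  have aw: "real a * w \<le> \<Phi>"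
  proof -
    have "real a * w = (\<Sum>j\<in>S. real a * (real (W j) / s))"
      by (simp add: w_def sum_distrib_left sum_divide_distrib)
    also have "\<dots> \<le> (\<Sum>j\<in>S. v0 j)"
      by (rule sum_mono) (use a_le s in \<open>auto simp: v0_def intro!: divide_right_mono mult_right_mono\<close>)
    also have "\<dots> \<le> \<Phi>" unfolding \<Phi>_def
      by (rule sum_mono2) (use Sact v0pos in \<open>auto simp: active_def less_imp_le\<close>)
    finally show ?thesis .
  qed
  \<comment> \<open>One round costs at most \<open>Z\<close>, since \<open>a * w\<close> is at most
    the potential. This limits the overshoot of the last round, the summand 1 in the cost
    bound.\<close>
  have ca: "?c * real a \<le> Z"
  proof -
    have "?c * real a * \<Phi> = ?c * \<Phi> * real a" by simp
    also have "\<dots> \<le> Z * w * real a" using dual by (intro mult_right_mono) auto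
    also have "\<dots> = Z * (real a * w)" by simp
    also have "\<dots> \<le> Z * \<Phi>" using aw Z(1) by (intro mult_left_mono)
    finally show ?thesis using \<Phi>pos by simp
  qed
  have c2: "(\<Sum>j\<in>active H'. real (r j) * real (W' j) / s')
      \<le> exp (real n - real (c + star_cost i S * a) / (1000 * Z))" if Zp: "0 < Z"
  proof -
    have "(\<Sum>j\<in>active H'. real (r j) * real (W' j) / s') = (\<Sum>j\<in>active H'. v0 j * (1 - x j))"
      by (rule sum.cong[OF refl v']) (simp add: active_def)
    also have "\<dots> \<le> (\<Sum>j\<in>active H. v0 j * (1 - x j))"
    proof (rule sum_mono2[OF finite_active act'])
      fix j assume "j \<in> active H - active H'"
      hence "j < n" by (simp add: active_def)
      from v0pos[OF this] x[OF this] show "0 \<le> v0 j * (1 - x j)" by simp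
    qed
    also have "\<dots> = \<Phi> - real a * w / 1000"
      unfolding vx[symmetric] \<Phi>_def by (simp add: right_diff_distrib sum_subtractf)
    also have "\<dots> \<le> \<Phi> * (1 - ?c * real a / (1000 * Z))"
    proof -
      have "?c * real a * \<Phi> \<le> Z * (real a * w)" using mult_right_mono[OF dual, of "real a"] by (simp add: ac_simps)
      thus ?thesis using Zp by (simp add: field_simps)
    qed
    also have "\<dots> \<le> \<Phi> * exp (- (?c * real a / (1000 * Z)))"
      using exp_ge_add_one_self[of "- (?c * real a / (1000 * Z))"] \<Phi>pos by (intro mult_left_mono) auto
    also have "\<dots> \<le> exp (real n - real c / (1000 * Z)) * exp (- (?c * real a / (1000 * Z)))"
      using pot[OF Zp] by (intro mult_right_mono) (auto simp: \<Phi>_def v0_def)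
    also have "\<dots> = exp (real n - real (c + star_cost i S * a) / (1000 * Z))"
      by (simp add: exp_add[symmetric] add_divide_distrib)
    finally show ?thesis .
  qed
  have c3: "real (c + star_cost i S * a) \<le> Z * (1000 * real n + real NN * (1002 / 1000) + 1)"
  proof (cases "Z = 0")
    case True
    thus ?thesis using cZ ca by simp
  next
    case False
    hence Zp: "0 < Z" using Z(1) by simp
    \<comment> \<open>The client \<open>l\<close> is still active before this round, so its weight
      bounds the potential from below; the upper bound on the potential then limits the cost
      \<open>c\<close> spent so far.\<close>
    have "H l < NN * r l" using l by (simp add: active_def)
    hence "real (H l) \<le> real NN * real (r l)" by (metis less_imp_le of_nat_le_iff of_nat_mult)
    hence "real (H l) / real (r l) \<le> real NN" using r_pos[OF l(2)] by (simp add: field_simps)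
    hence "exp (- (1002 / 1000000 * real NN)) \<le> exp (- (1002 / 1000000 * real (H l) / real (r l)))"
      by simp
    also have "\<dots> \<le> v0 l" using v[OF l(2)] by (simp add: v0_def)
    also have "\<dots> \<le> \<Phi>" unfolding \<Phi>_def
      by (rule member_le_sum) (use l v0pos in \<open>auto simp: active_def less_imp_le\<close>)
    also have "\<dots> \<le> exp (real n - real c / (1000 * Z))" using pot[OF Zp] by (simp add: \<Phi>_def v0_def)
    finally have "real c / (1000 * Z) \<le> real n + 1002 / 1000000 * real NN" by simp
    hence "real c \<le> (real n + 1002 / 1000000 * real NN) * (1000 * Z)" using Zp by (simp add: field_simps)
    thus ?thesis using ca by (simp add: algebra_simps)
  qed
  have c4: "active H' = {} \<or> Suc k \<le> (\<Sum>j<n. min NN (H' j div r j))"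
  proof -
    have k: "k \<le> (\<Sum>j<n. min NN (H j div r j))" using cnt l by auto
    obtain j where j: "j \<in> S" "r j = a" using a_in by auto
    have jn: "j < n" using Sn j by simp
    \<comment> \<open>The member with \<open>r j = a\<close> gains exactly one unit of
      \<open>H j div r j\<close>, and being active it was still below the cap
      \<open>NN\<close>.\<close>
    have "(\<Sum>j<n. min NN (H j div r j)) < (\<Sum>j<n. min NN (H' j div r j))"
    proof (rule sum_strict_mono_ex1)
      show "\<forall>j\<in>{..<n}. min NN (H j div r j) \<le> min NN (H' j div r j)"
      proof
        fix j assume "j \<in> {..<n}"
        hence "H j \<le> H' j" using H'[of j] by (simp add: upd_H_def)
        thus "min NN (H j div r j) \<le> min NN (H' j div r j)"
          by (intro min.mono div_le_mono) auto
      qed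
      have "H j < NN * r j" using Sact j by (auto simp: active_def)
      hence "H j div r j < NN" using r_pos[OF jn] by (simp add: less_mult_imp_div_less)
      moreover have "H' j div r j = Suc (H j div r j)"
        using H'[OF jn] j r_pos[OF jn] by (simp add: upd_H_def)
      ultimately show "\<exists>j\<in>{..<n}. min NN (H j div r j) < min NN (H' j div r j)"
        using jn by (intro bexI[of _ j]) auto
    qed simp
    thus ?thesis using k by linarith
  qed
  show ?thesis unfolding mwu_inv_def using s' c1 c2 c3 c4 by blast
qed

lemma mwu_inv_end:
  assumes "mwu_inv Z (n * NN) W H c"
  shows "active H = {}" and "real c \<le> Z * (1000 * real n + real NN * (1002 / 1000) + 1)"
proof -
  show "real c \<le> Z * (1000 * real n + real NN * (1002 / 1000) + 1)"
    using assms by (simp add: mwu_inv_def)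
  show "active H = {}"
  proof (rule ccontr)
    assume ne: "active H \<noteq> {}"
    then obtain l where l: "l < n" "H l < NN * r l" by (auto simp: active_def)
    have "H l div r l < NN" using l r_pos[OF l(1)] by (simp add: less_mult_imp_div_less)
    hence "(\<Sum>j<n. min NN (H j div r j)) < (\<Sum>j<n. NN)"
      using l by (intro sum_strict_mono_ex1) (auto intro!: bexI[of _ l])
    thus False using assms ne by (simp add: mwu_inv_def)
  qed
qed

end

section \<open>Clustering of the atoms\<close>

text \<open>An element of \<open>Q\<close> at the greatest distance has all of \<open>Q\<close>
  within its distance. So a threshold that catches enough atoms can be taken to be the distance of
  an atom.\<close>

lemma exists_max_within:
  fixes \<delta> :: "'a \<Rightarrow> nat"
  assumes "finite A" "Q \<subseteq> A" "0 < L" "L \<le> card Q"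
  obtains t where "t \<in> Q" "L \<le> card {v \<in> A. \<delta> v \<le> \<delta> t}"
proof -
  have fin: "finite Q" using assms finite_subset by blast
  have "Q \<noteq> {}" using assms by auto
  hence "Max (\<delta> ` Q) \<in> \<delta> ` Q" using fin by (intro Max_in) auto
  then obtain t where t: "t \<in> Q" "\<delta> t = Max (\<delta> ` Q)" by auto
  have t2: "\<delta> v \<le> \<delta> t" if "v \<in> Q" for v using fin that t(2) by simp
  have "card Q \<le> card {v \<in> A. \<delta> v \<le> \<delta> t}" using t2 assms by (intro card_mono) auto
  thus ?thesis using that[OF t(1)] assms by simp
qed

locale ftfp_atoms = ftfp_data +
  fixes T :: nat and site :: "nat \<Rightarrow> nat" and P0 :: "nat \<Rightarrow> nat set" and RR :: "nat \<Rightarrow> nat"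
  assumes P0_sub: "j < n \<Longrightarrow> P0 j \<subseteq> {..<T}"
    and site_less: "j < n \<Longrightarrow> t \<in> P0 j \<Longrightarrow> site t < m"
    and P0_card: "j < n \<Longrightarrow> NN * RR j \<le> card (P0 j)"
begin

definition \<delta> :: "nat \<Rightarrow> nat \<Rightarrow> nat" where "\<delta> j t = D (site t) j"

definition cluster :: "(nat \<Rightarrow> nat) \<Rightarrow> nat \<Rightarrow> nat set" where
  "cluster CL q = {t. t < T \<and> CL t = q}"

definition crowded :: "(nat \<Rightarrow> nat set) \<Rightarrow> nat \<Rightarrow> nat \<Rightarrow> bool" where
  "crowded P j d \<longleftrightarrow> LL \<le> card {v \<in> P j. \<delta> j v \<le> d}"

text \<open>\<open>ctr\<close>, \<open>rad\<close>, \<open>kap\<close> and \<open>bet\<close> are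
  ghost data not stored by the program: centre and radius of a cluster, and for the
  \<open>k\<close>-th demand of \<open>j\<close> its cluster and the radius at which it was served.
  The clause on \<open>rad q\<close> records the greedy order: no unfinished client has a crowded
  distance below the radius of an existing cluster.\<close>

definition cl_core ::
  "nat \<Rightarrow> (nat \<Rightarrow> nat set) \<Rightarrow> (nat \<Rightarrow> nat) \<Rightarrow> (nat \<Rightarrow> nat) \<Rightarrow> (nat \<Rightarrow> nat) \<Rightarrow>
   (nat \<Rightarrow> nat) \<Rightarrow> (nat \<Rightarrow> nat) \<Rightarrow> (nat \<Rightarrow> nat \<Rightarrow> nat) \<Rightarrow> (nat \<Rightarrow> nat \<Rightarrow> nat) \<Rightarrow> bool" where
  "cl_core s P CL RK KJ ctr rad kap bet \<longleftrightarrow>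
     (\<forall>j<n. KJ j \<le> RR j) \<and>
     (\<forall>t<T. CL t \<le> s) \<and>
     (\<forall>q>0. cluster CL q \<noteq> {} \<longrightarrow> bij_betw RK (cluster CL q) {..<LL} \<and>
        ctr q < n \<and> (\<forall>t\<in>cluster CL q. site t < m \<and> \<delta> (ctr q) t \<le> rad q) \<and>
        (\<forall>j<n. KJ j < RR j \<longrightarrow> (\<forall>t\<in>P j. crowded P j (\<delta> j t) \<longrightarrow> rad q \<le> \<delta> j t))) \<and>
     (\<forall>j<n. inj_on (kap j) {..<KJ j} \<and> P j = P0 j - (\<Union>k<KJ j. cluster CL (kap j k)) \<and>
        (\<forall>k<KJ j. 0 < kap j k \<and> cluster CL (kap j k) \<noteq> {} \<and>
           (\<forall>t\<in>cluster CL (kap j k). \<delta> j t \<le> 3 * bet j k) \<and>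
           card {t \<in> P0 j. \<delta> j t < bet j k} < Suc k * LL))"

text \<open>The second conjunct measures progress: as long as a demand is unserved, every round so
  far has served one.\<close>

definition cl_inv ::
  "nat \<Rightarrow> (nat \<Rightarrow> nat set) \<Rightarrow> (nat \<Rightarrow> nat) \<Rightarrow> (nat \<Rightarrow> nat) \<Rightarrow> (nat \<Rightarrow> nat) \<Rightarrow> bool" where
  "cl_inv s P CL RK KJ \<longleftrightarrow> (\<exists>ctr rad kap bet. cl_core s P CL RK KJ ctr rad kap bet) \<and>
     ((\<forall>j<n. KJ j = RR j) \<or> (\<Sum>j<n. KJ j) = s)"

lemma finite_P0: "j < n \<Longrightarrow> finite (P0 j)"
  using P0_sub finite_subset by blast

lemma finite_cluster [simp]: "finite (cluster CL q)"
  by (simp add: cluster_def)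

lemma cl_inv_init:
  assumes "\<And>j. j < n \<Longrightarrow> P j = P0 j" "\<And>t. t < T \<Longrightarrow> CL t = 0" "\<And>j. j < n \<Longrightarrow> KJ j = 0"
  shows "cl_inv 0 P CL RK KJ"
proof -
  have "cluster CL q = {}" if "0 < q" for q using assms(2) that by (auto simp: cluster_def)
  hence "cl_core 0 P CL RK KJ ctr rad kap bet" for ctr rad kap bet
    unfolding cl_core_def using assms by simp
  moreover have "(\<Sum>j<n. KJ j) = 0" using assms(3) by simp
  ultimately show ?thesis unfolding cl_inv_def by blast
qed

lemma cl_coreD:
  assumes "cl_core s P CL RK KJ ctr rad kap bet"
  shows "j < n \<Longrightarrow> KJ j \<le> RR j" "t < T \<Longrightarrow> CL t \<le> s"
    and "0 < q \<Longrightarrow> cluster CL q \<noteq> {} \<Longrightarrow> bij_betw RK (cluster CL q) {..<LL}"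
    and "0 < q \<Longrightarrow> cluster CL q \<noteq> {} \<Longrightarrow> ctr q < n"
    and "0 < q \<Longrightarrow> t \<in> cluster CL q \<Longrightarrow> site t < m \<and> \<delta> (ctr q) t \<le> rad q"
    and "0 < q \<Longrightarrow> cluster CL q \<noteq> {} \<Longrightarrow> j < n \<Longrightarrow> KJ j < RR j \<Longrightarrow> t \<in> P j \<Longrightarrow>
      crowded P j (\<delta> j t) \<Longrightarrow> rad q \<le> \<delta> j t"
    and "j < n \<Longrightarrow> inj_on (kap j) {..<KJ j}"
    and "j < n \<Longrightarrow> P j = P0 j - (\<Union>k<KJ j. cluster CL (kap j k))"
    and "j < n \<Longrightarrow> k < KJ j \<Longrightarrow> 0 < kap j k"
    and "j < n \<Longrightarrow> k < KJ j \<Longrightarrow> cluster CL (kap j k) \<noteq> {}"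
    and "j < n \<Longrightarrow> k < KJ j \<Longrightarrow> t \<in> cluster CL (kap j k) \<Longrightarrow> \<delta> j t \<le> 3 * bet j k"
    and "j < n \<Longrightarrow> k < KJ j \<Longrightarrow> card {t \<in> P0 j. \<delta> j t < bet j k} < Suc k * LL"
proof -
  note c = assms[unfolded cl_core_def]
  note c1 = conjunct1[OF c] and c2 = conjunct1[OF conjunct2[OF c]]
    and c3 = conjunct1[OF conjunct2[OF conjunct2[OF c]]]
    and c4 = conjunct2[OF conjunct2[OF conjunct2[OF c]]]
  show "j < n \<Longrightarrow> KJ j \<le> RR j" using c1 by simp
  show "t < T \<Longrightarrow> CL t \<le> s" using c2 by simp
  show "0 < q \<Longrightarrow> cluster CL q \<noteq> {} \<Longrightarrow> bij_betw RK (cluster CL q) {..<LL}"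
    "0 < q \<Longrightarrow> cluster CL q \<noteq> {} \<Longrightarrow> ctr q < n"
    "0 < q \<Longrightarrow> cluster CL q \<noteq> {} \<Longrightarrow> j < n \<Longrightarrow> KJ j < RR j \<Longrightarrow> t \<in> P j \<Longrightarrow>
      crowded P j (\<delta> j t) \<Longrightarrow> rad q \<le> \<delta> j t"
    using c3 by simp_all
  show "0 < q \<Longrightarrow> t \<in> cluster CL q \<Longrightarrow> site t < m \<and> \<delta> (ctr q) t \<le> rad q"
    using c3[rule_format, of q] by blast
  show "j < n \<Longrightarrow> inj_on (kap j) {..<KJ j}"
    "j < n \<Longrightarrow> k < KJ j \<Longrightarrow> 0 < kap j k"
    "j < n \<Longrightarrow> k < KJ j \<Longrightarrow> cluster CL (kap j k) \<noteq> {}"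
    "j < n \<Longrightarrow> k < KJ j \<Longrightarrow> t \<in> cluster CL (kap j k) \<Longrightarrow> \<delta> j t \<le> 3 * bet j k"
    "j < n \<Longrightarrow> k < KJ j \<Longrightarrow> card {t \<in> P0 j. \<delta> j t < bet j k} < Suc k * LL"
    using c4[rule_format, of j] by auto
  show "j < n \<Longrightarrow> P j = P0 j - (\<Union>k<KJ j. cluster CL (kap j k))"
    using c4[rule_format, of j] by blast
qed

text \<open>Each served demand has removed one cluster of exactly \<open>LL\<close> atoms, so any
  count in the pool lags behind the count in \<open>P0 j\<close> by at most \<open>LL\<close> per
  served demand.\<close>

lemma cl_core_pool:
  assumes "cl_core s P CL RK KJ ctr rad kap bet" "j < n"
  shows "finite (P j)" "P j \<subseteq> P0 j" "card {t \<in> P0 j. Q t} \<le> card {t \<in> P j. Q t} + KJ j * LL"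
proof -
  note P = cl_coreD(8)[OF assms]
  have c: "card (cluster CL (kap j k)) = LL" if "k < KJ j" for k
    using bij_betw_same_card[OF cl_coreD(3)[OF assms(1) cl_coreD(9)[OF assms that] cl_coreD(10)[OF assms that]]]
    by simp
  show "P j \<subseteq> P0 j" using P by auto
  thus fin: "finite (P j)" using finite_P0[OF assms(2)] finite_subset by blast
  have "{t \<in> P0 j. Q t} \<subseteq> {t \<in> P j. Q t} \<union> (\<Union>k<KJ j. cluster CL (kap j k))" using P by auto
  hence "card {t \<in> P0 j. Q t} \<le> card ({t \<in> P j. Q t} \<union> (\<Union>k<KJ j. cluster CL (kap j k)))"
    using fin by (intro card_mono) auto
  also have "\<dots> \<le> card {t \<in> P j. Q t} + card (\<Union>k<KJ j. cluster CL (kap j k))" by (rule card_Un_le)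
  also have "card (\<Union>k<KJ j. cluster CL (kap j k)) \<le> (\<Sum>k<KJ j. card (cluster CL (kap j k)))"
    by (rule card_UN_le) simp
  also have "(\<Sum>k<KJ j. card (cluster CL (kap j k))) = KJ j * LL" using c by simp
  finally show "card {t \<in> P0 j. Q t} \<le> card {t \<in> P j. Q t} + KJ j * LL" by simp
qed

text \<open>Since \<open>LL \<le> NN\<close>, the initial pool has \<open>LL\<close> atoms for each
  residual demand, and each served demand used up at most \<open>LL\<close>. An unserved demand thus
  leaves \<open>LL\<close> atoms in the pool.\<close>

lemma cl_inv_found:
  assumes "cl_inv s P CL RK KJ" "j < n" "KJ j < RR j"
  shows "\<exists>t\<in>P j. crowded P j (\<delta> j t)"
proof -
  obtain ctr rad kap bet where c: "cl_core s P CL RK KJ ctr rad kap bet"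
    using assms(1) by (auto simp: cl_inv_def)
  have "NN * RR j \<le> card {t \<in> P0 j. True}" using P0_card[OF assms(2)] by simp
  also have "\<dots> \<le> card {t \<in> P j. True} + KJ j * LL" by (rule cl_core_pool(3)[OF c assms(2)])
  finally have "NN * RR j \<le> card (P j) + KJ j * LL" by simp
  moreover have "LL * RR j \<le> NN * RR j" by (simp add: LL_def NN_def)
  moreover have "LL * Suc (KJ j) \<le> LL * RR j" using assms(3) by (intro mult_le_mono2) simp
  moreover have "LL * Suc (KJ j) = LL + KJ j * LL" by simp
  ultimately have "LL \<le> card (P j)" by linarith
  then obtain t where "t \<in> P j" "LL \<le> card {v \<in> P j. \<delta> j v \<le> \<delta> j t}"
    using exists_max_within[of "P j" "P j" LL] cl_core_pool(1)[OF c assms(2)] LL_pos by blast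
  thus ?thesis by (auto simp: crowded_def)
qed

text \<open>Any cluster that contains a pool atom \<open>a\<close> within \<open>d\<close> will do:
  through \<open>a\<close> and the centre its atoms are at distance at most
  \<open>d + 2 * rad q \<le> 3 * d\<close>. Removing it from the pool only shrinks crowded sets, so
  the order of the radii persists.\<close>

lemma cl_core_assign:
  assumes core: "cl_core s P CL RK KJ ctr rad kap bet"
    and p: "p < n" "KJ p < RR p"
    and small: "card {t \<in> P p. \<delta> p t < d} < LL"
    and a: "a \<in> P p" "\<delta> p a \<le> d" "CL a = q" "0 < q" "rad q \<le> d"
    and P': "\<And>j. j < n \<Longrightarrow> P' j = (if j = p then P p - cluster CL q else P j)"
    and KJ': "\<And>j. j < n \<Longrightarrow> KJ' j = (if j = p then Suc (KJ p) else KJ j)"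
  shows "cl_core s P' CL RK KJ' ctr rad
    (\<lambda>j k. if j = p \<and> k = KJ p then q else kap j k) (\<lambda>j k. if j = p \<and> k = KJ p then d else bet j k)"
proof -
  note pool = cl_core_pool[OF core]
  have aT: "a < T" "a \<in> P0 p" using a(1) pool(2)[OF p(1)] P0_sub[OF p(1)] by auto
  have aq: "a \<in> cluster CL q" using a(3) aT by (simp add: cluster_def)
  have q: "ctr q < n" "\<And>t. t \<in> cluster CL q \<Longrightarrow> site t < m \<and> \<delta> (ctr q) t \<le> rad q"
    using cl_coreD(4)[OF core a(4)] cl_coreD(5)[OF core a(4)] aq by auto
  have sub: "P' j \<subseteq> P j" if "j < n" for j using P'[OF that] by auto
  have crowd: "crowded P j d'" if "j < n" "crowded P' j d'" for j d'
  proof -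
    have "card {v \<in> P' j. \<delta> j v \<le> d'} \<le> card {v \<in> P j. \<delta> j v \<le> d'}"
      using sub[OF that(1)] pool(1)[OF that(1)] by (intro card_mono) auto
    thus ?thesis using that(2) by (simp add: crowded_def)
  qed
  note Pp = cl_coreD(8)[OF core p(1)]
  \<comment> \<open>\<open>a\<close> is still in the pool, from which all clusters used by
    \<open>p\<close> before were removed.\<close>
  have notin: "kap p k \<noteq> q" if "k < KJ p" for k using a(1) aq that unfolding Pp by auto
  have far: "\<delta> p t \<le> 3 * d" if "t \<in> cluster CL q" for t
  proof -
    have "\<delta> p t \<le> \<delta> (ctr q) t + \<delta> (ctr q) a + \<delta> p a"
      unfolding \<delta>_def using four_point[of "site t" "site a" p "ctr q"] q(1) q(2)[OF that] q(2)[OF aq] p(1)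
      by simp
    thus ?thesis using q(2)[OF that] q(2)[OF aq] a(2,5) by linarith
  qed
  have cnt: "card {t \<in> P0 p. \<delta> p t < d} < Suc (KJ p) * LL"
    using pool(3)[OF p(1), of "\<lambda>t. \<delta> p t < d"] small by simp
  show ?thesis
    unfolding cl_core_def
  proof (intro conjI allI impI)
    fix j assume "j < n"
    thus "KJ' j \<le> RR j" using KJ' cl_coreD(1)[OF core] p by auto
  next
    fix t assume "t < T"
    thus "CL t \<le> s" by (rule cl_coreD(2)[OF core])
  next
    fix q' assume q': "0 < q'" "cluster CL q' \<noteq> {}"
    thus "bij_betw RK (cluster CL q') {..<LL}" "ctr q' < n"
      "\<forall>t\<in>cluster CL q'. site t < m \<and> \<delta> (ctr q') t \<le> rad q'"
      using cl_coreD(3-5)[OF core] by blast+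
    fix j assume j: "j < n" "KJ' j < RR j"
    hence "KJ j < RR j" using KJ'[OF j(1)] by (auto split: if_splits)
    thus "\<forall>t\<in>P' j. crowded P' j (\<delta> j t) \<longrightarrow> rad q' \<le> \<delta> j t"
      using cl_coreD(6)[OF core q' j(1)] sub[OF j(1)] crowd[OF j(1)] by blast
  next
    fix j assume j: "j < n"
    let ?kap = "\<lambda>k. if j = p \<and> k = KJ p then q else kap j k"
    note inj = cl_coreD(7)[OF core j]
    show "inj_on ?kap {..<KJ' j}"
    proof (cases "j = p")
      case True
      have "inj_on ?kap (insert (KJ p) {..<KJ p})"
        using inj notin True by (auto simp: inj_on_def)
      thus ?thesis using KJ'[OF j] True by (simp add: lessThan_Suc)
    qed (use inj KJ'[OF j] in simp)
    show "P' j = P0 j - (\<Union>k<KJ' j. cluster CL (?kap k))"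
    proof (cases "j = p")
      case True
      have "(\<Union>k<KJ' j. cluster CL (?kap k)) = cluster CL q \<union> (\<Union>k<KJ p. cluster CL (kap p k))"
        using KJ'[OF j] True by (auto simp: lessThan_Suc)
      thus ?thesis using P'[OF j] True Pp by auto
    next
      case False
      thus ?thesis using P'[OF j] KJ'[OF j] cl_coreD(8)[OF core j] by simp
    qed
    fix k assume k: "k < KJ' j"
    consider (new) "j = p" "k = KJ p" | (old) "\<not> (j = p \<and> k = KJ p)" "k < KJ j"
      using k KJ'[OF j] by (cases "j = p"; cases "k = KJ p") auto
    hence *: "0 < ?kap k \<and> cluster CL (?kap k) \<noteq> {} \<and>
        (\<forall>t\<in>cluster CL (?kap k). \<delta> j t \<le> 3 * (if j = p \<and> k = KJ p then d else bet j k)) \<and>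
        card {t \<in> P0 j. \<delta> j t < (if j = p \<and> k = KJ p then d else bet j k)} < Suc k * LL"
    proof cases
      case new
      thus ?thesis
        using a(4) aq far cnt by auto
    next
      case old
      have "0 < kap j k \<and> cluster CL (kap j k) \<noteq> {} \<and>
        (\<forall>t\<in>cluster CL (kap j k). \<delta> j t \<le> 3 * bet j k) \<and> card {t \<in> P0 j. \<delta> j t < bet j k} < Suc k * LL"
        using cl_coreD(9-12)[OF core j old(2)] by blast
      thus ?thesis
        unfolding if_not_P[OF old(1)] .
    qed
    show "0 < ?kap k" "cluster CL (?kap k) \<noteq> {}"
      "\<forall>t\<in>cluster CL (?kap k). \<delta> j t \<le> 3 * (if j = p \<and> k = KJ p then d else bet j k)"
      "card {t \<in> P0 j. \<delta> j t < (if j = p \<and> k = KJ p then d else bet j k)} < Suc k * LL"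
      using * by blast+
  qed
qed

text \<open>Minimality of \<open>d\<close> over all unfinished clients is the radius clause for the
  new cluster. The older clusters keep their atoms because those in \<open>B\<close> were
  unclustered.\<close>

lemma cl_core_new_cluster:
  assumes core: "cl_core s P CL RK KJ ctr rad kap bet"
    and p: "p < n"
    and min: "\<And>j t. j < n \<Longrightarrow> KJ j < RR j \<Longrightarrow> t \<in> P j \<Longrightarrow> crowded P j (\<delta> j t) \<Longrightarrow> d \<le> \<delta> j t"
    and B: "B \<subseteq> P p" "\<And>t. t \<in> B \<Longrightarrow> \<delta> p t \<le> d \<and> CL t = 0" "bij_betw RK' B {..<LL}"
    and CL': "\<And>t. t < T \<Longrightarrow> CL' t = (if t \<in> B then Suc s else CL t)"
    and RK': "\<And>t. t < T \<Longrightarrow> t \<notin> B \<Longrightarrow> RK' t = RK t"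
  shows "cl_core (Suc s) P CL' RK' KJ (ctr(Suc s := p)) (rad(Suc s := d)) kap bet"
    and "cluster CL' (Suc s) = B"
proof -
  have BT: "B \<subseteq> {..<T}" using B(1) cl_core_pool(2)[OF core p] P0_sub[OF p] by auto
  have Bsite: "site t < m" if "t \<in> B" for t
    using that B(1) cl_core_pool(2)[OF core p] site_less[OF p] by auto
  note CLs = cl_coreD(2)[OF core]
  show new: "cluster CL' (Suc s) = B"
  proof (rule set_eqI)
    fix t show "t \<in> cluster CL' (Suc s) \<longleftrightarrow> t \<in> B"
      using BT CLs[of t] CL'[of t] by (cases "t < T") (auto simp: cluster_def)
  qed
  have old: "cluster CL' q = cluster CL q" if "0 < q" "q \<noteq> Suc s" for q
  proof (rule set_eqI)
    fix t show "t \<in> cluster CL' q \<longleftrightarrow> t \<in> cluster CL q"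
      using that CL'[of t] B(2)[of t] by (cases "t \<in> B") (auto simp: cluster_def)
  qed
  have empty: "cluster CL (Suc s) = {}" using CLs by (force simp: cluster_def)
  have kap: "kap j k \<noteq> Suc s \<and> 0 < kap j k" if "j < n" "k < KJ j" for j k
    using cl_coreD(9)[OF core that] cl_coreD(10)[OF core that] empty by auto
  have kcl: "cluster CL' (kap j k) = cluster CL (kap j k)" if "j < n" "k < KJ j" for j k
    using old kap[OF that] by simp
  show "cl_core (Suc s) P CL' RK' KJ (ctr(Suc s := p)) (rad(Suc s := d)) kap bet"
    unfolding cl_core_def
  proof (intro conjI allI impI)
    fix j assume "j < n"
    thus "KJ j \<le> RR j" "inj_on (kap j) {..<KJ j}" using cl_coreD(1,7)[OF core] by auto
  next
    fix t assume "t < T"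
    thus "CL' t \<le> Suc s" using CL' CLs[of t] by auto
  next
    fix q assume q: "0 < q" "cluster CL' q \<noteq> {}"
    have *: "bij_betw RK' (cluster CL' q) {..<LL} \<and> (ctr(Suc s := p)) q < n \<and>
      (\<forall>t\<in>cluster CL' q. site t < m \<and> \<delta> ((ctr(Suc s := p)) q) t \<le> (rad(Suc s := d)) q) \<and>
      (\<forall>j<n. KJ j < RR j \<longrightarrow> (\<forall>t\<in>P j. crowded P j (\<delta> j t) \<longrightarrow> (rad(Suc s := d)) q \<le> \<delta> j t))"
    proof (cases "q = Suc s")
      case True
      thus ?thesis using new B(2,3) p Bsite min by auto
    next
      case False
      note cq = old[OF q(1) False]
      have "RK' t = RK t" if "t \<in> cluster CL q" for t
      proof -
        have "t < T" "t \<notin> B" using that q(1) B(2) by (auto simp: cluster_def)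
        thus ?thesis by (rule RK')
      qed
      hence "bij_betw RK' (cluster CL q) {..<LL} \<longleftrightarrow> bij_betw RK (cluster CL q) {..<LL}"
        by (rule bij_betw_cong)
      thus ?thesis using cl_coreD(3-6)[OF core] q False unfolding cq by simp
    qed
    show "bij_betw RK' (cluster CL' q) {..<LL}" "(ctr(Suc s := p)) q < n"
      "\<forall>t\<in>cluster CL' q. site t < m \<and> \<delta> ((ctr(Suc s := p)) q) t \<le> (rad(Suc s := d)) q"
      using * by auto
    show "\<forall>t\<in>P j. crowded P j (\<delta> j t) \<longrightarrow> (rad(Suc s := d)) q \<le> \<delta> j t" if "j < n" "KJ j < RR j" for j
      using * that by blast
  next
    fix j assume j: "j < n"
    show "P j = P0 j - (\<Union>k<KJ j. cluster CL' (kap j k))"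
      using cl_coreD(8)[OF core j] kcl[OF j] by simp
    fix k assume k: "k < KJ j"
    show "0 < kap j k" "cluster CL' (kap j k) \<noteq> {}"
      "\<forall>t\<in>cluster CL' (kap j k). \<delta> j t \<le> 3 * bet j k" "card {t \<in> P0 j. \<delta> j t < bet j k} < Suc k * LL"
      unfolding kcl[OF j k] using cl_coreD(9-12)[OF core j k] by blast+
  qed
qed

lemma cl_core_mono: "cl_core s P CL RK KJ ctr rad kap bet \<Longrightarrow> cl_core (Suc s) P CL RK KJ ctr rad kap bet"
  unfolding cl_core_def by (auto simp: le_Suc_eq)

lemma cl_inv_skip:
  assumes "cl_inv s P CL RK KJ" "\<And>j. j < n \<Longrightarrow> \<not> KJ j < RR j"
  shows "cl_inv (Suc s) P CL RK KJ"
proof -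
  obtain ctr rad kap bet where c: "cl_core s P CL RK KJ ctr rad kap bet"
    using assms(1) by (auto simp: cl_inv_def)
  hence "\<forall>j<n. KJ j = RR j" using assms(2) cl_coreD(1)[OF c] by (metis le_neq_implies_less)
  thus ?thesis unfolding cl_inv_def using cl_core_mono[OF c] by blast
qed

lemma cl_inv_step:
  assumes inv: "cl_inv s P CL RK KJ"
    and p: "p < n" "KJ p < RR p" "crowded P p d"
    and min: "\<And>j t. j < n \<Longrightarrow> KJ j < RR j \<Longrightarrow> t \<in> P j \<Longrightarrow> crowded P j (\<delta> j t) \<Longrightarrow> d \<le> \<delta> j t"
    and cases: "((\<exists>a\<in>P p. \<delta> p a \<le> d \<and> CL a = q) \<and> 0 < q \<and>
         (\<forall>t<T. CL' t = CL t \<and> RK' t = RK t)) \<or>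
       (\<exists>B \<subseteq> P p. q = Suc s \<and> (\<forall>t\<in>B. \<delta> p t \<le> d \<and> CL t = 0) \<and> bij_betw RK' B {..<LL} \<and>
         (\<forall>t<T. CL' t = (if t \<in> B then Suc s else CL t) \<and> (t \<notin> B \<longrightarrow> RK' t = RK t)))"
    and P': "\<And>j. j < n \<Longrightarrow> P' j = (if j = p then P p - cluster CL' q else P j)"
    and KJ': "\<And>j. j < n \<Longrightarrow> KJ' j = (if j = p then Suc (KJ p) else KJ j)"
  shows "cl_inv (Suc s) P' CL' RK' KJ'"
proof -
  obtain ctr rad kap bet where core: "cl_core s P CL RK KJ ctr rad kap bet"
    using inv by (auto simp: cl_inv_def)
  note fin = cl_core_pool(1)[OF core p(1)]
  \<comment> \<open>With \<open>LL\<close> pool atoms strictly nearer than \<open>d\<close>, one of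
    them would be crowded at a distance below the minimum.\<close>
  have small: "card {t \<in> P p. \<delta> p t < d} < LL"
  proof (rule ccontr)
    assume "\<not> card {t \<in> P p. \<delta> p t < d} < LL"
    hence "LL \<le> card {t \<in> P p. \<delta> p t < d}" by simp
    then obtain t where "t \<in> {t \<in> P p. \<delta> p t < d}" "LL \<le> card {v \<in> P p. \<delta> p v \<le> \<delta> p t}"
      using exists_max_within[of "P p" "{t \<in> P p. \<delta> p t < d}" LL] fin LL_pos by blast
    thus False using min[of p t] p by (auto simp: crowded_def)
  qed
  have "\<exists>ctr rad kap bet. cl_core (Suc s) P' CL' RK' KJ' ctr rad kap bet"
    using cases
  proof
    assume A: "(\<exists>a\<in>P p. \<delta> p a \<le> d \<and> CL a = q) \<and> 0 < q \<and> (\<forall>t<T. CL' t = CL t \<and> RK' t = RK t)"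
    then obtain a where a: "a \<in> P p" "\<delta> p a \<le> d" "CL a = q" "0 < q"
      and CL': "\<And>t. t < T \<Longrightarrow> CL' t = CL t" and RK': "\<And>t. t < T \<Longrightarrow> RK' t = RK t" by blast
    have cl: "cluster CL' q' = cluster CL q'" for q' unfolding cluster_def using CL' by auto
    have aq: "cluster CL q \<noteq> {}"
      using a cl_core_pool(2)[OF core p(1)] P0_sub[OF p(1)] by (auto simp: cluster_def)
    \<comment> \<open>The radius clause speaks of distances of atoms, so a crowded atom within
      \<open>d\<close> has to be produced before it yields \<open>rad q \<le> d\<close>.\<close>
    obtain t where t: "t \<in> {v \<in> P p. \<delta> p v \<le> d}" "LL \<le> card {v \<in> P p. \<delta> p v \<le> \<delta> p t}"
      using exists_max_within[of "P p" "{v \<in> P p. \<delta> p v \<le> d}" LL] fin LL_pos p(3)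
      unfolding crowded_def by blast
    have "rad q \<le> \<delta> p t" using cl_coreD(6)[OF core a(4) aq p(1,2), of t] t by (simp add: crowded_def)
    hence rad: "rad q \<le> d" using t by simp
    have core': "cl_core s P CL' RK' KJ ctr rad kap bet"
    proof -
      have "bij_betw RK' (cluster CL q') {..<LL} \<longleftrightarrow> bij_betw RK (cluster CL q') {..<LL}" for q'
        by (rule bij_betw_cong) (use RK' in \<open>auto simp: cluster_def\<close>)
      thus ?thesis using core CL' unfolding cl_core_def cl by simp
    qed
    have "CL' a = q" using a CL' cl_core_pool(2)[OF core p(1)] P0_sub[OF p(1)] by auto
    from cl_core_mono[OF cl_core_assign[OF core' p(1,2) small a(1,2) this a(4) rad P' KJ']]
    show ?thesis by blast
  next
    assume "\<exists>B \<subseteq> P p. q = Suc s \<and> (\<forall>t\<in>B. \<delta> p t \<le> d \<and> CL t = 0) \<and> bij_betw RK' B {..<LL} \<and>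
         (\<forall>t<T. CL' t = (if t \<in> B then Suc s else CL t) \<and> (t \<notin> B \<longrightarrow> RK' t = RK t))"
    then obtain B where B: "B \<subseteq> P p" "\<And>t. t \<in> B \<Longrightarrow> \<delta> p t \<le> d \<and> CL t = 0" "bij_betw RK' B {..<LL}"
      and q: "q = Suc s" and CL': "\<And>t. t < T \<Longrightarrow> CL' t = (if t \<in> B then Suc s else CL t)"
      and RK': "\<And>t. t < T \<Longrightarrow> t \<notin> B \<Longrightarrow> RK' t = RK t" by blast
    have new1: "cl_core (Suc s) P CL' RK' KJ (ctr(Suc s := p)) (rad(Suc s := d)) kap bet"
      by (rule cl_core_new_cluster(1)[OF core p(1) min B CL' RK'])
    have new2: "cluster CL' (Suc s) = B"
      by (rule cl_core_new_cluster(2)[OF core p(1) min B CL' RK'])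
    have "B \<noteq> {}" using B(3) LL_pos by (auto simp: bij_betw_def)
    then obtain a where a: "a \<in> B" by blast
    have "a \<in> cluster CL' (Suc s)" using a using new2 by simp
    hence "CL' a = q" by (simp add: cluster_def q)
    moreover have "0 < q" "(rad(Suc s := d)) q \<le> d" using q by simp_all
    ultimately show ?thesis
      using cl_core_assign[OF new1 p(1,2) small subsetD[OF B(1) a] conjunct1[OF B(2)[OF a]] _ _ _ P' KJ']
      by blast
  qed
  moreover have "(\<Sum>j<n. KJ' j) = Suc s"
  proof -
    have "(\<Sum>j<n. KJ j) = s" using inv p unfolding cl_inv_def by auto
    moreover have "(\<Sum>j<n. KJ' j) = (\<Sum>j<n. KJ j + (if j = p then 1 else 0))"
      by (rule sum.cong) (use KJ' in auto)
    ultimately show ?thesis using p(1) by (simp add: sum.distrib)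
  qed
  ultimately show ?thesis unfolding cl_inv_def by blast
qed

text \<open>If a demand were unserved, all \<open>s\<close> rounds would have served one each,
  although \<open>s\<close> is at least the total residual demand.\<close>

lemma cl_inv_end:
  assumes inv: "cl_inv s P CL RK KJ" and s: "(\<Sum>j<n. RR j) \<le> s" and j: "j < n"
  shows "(\<forall>t<T. CL t \<le> s) \<and> (\<exists>kap bet. inj_on kap {..<RR j} \<and> (\<forall>k<RR j. 0 < kap k \<and>
    (\<forall>t\<in>cluster CL (kap k). \<delta> j t \<le> 3 * bet k \<and> site t < m) \<and>
    bij_betw RK (cluster CL (kap k)) {..<LL} \<and> card {t \<in> P0 j. \<delta> j t < bet k} < Suc k * LL))"
proof -
  obtain ctr rad kap bet where core: "cl_core s P CL RK KJ ctr rad kap bet"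
    using inv by (auto simp: cl_inv_def)
  have le: "\<forall>j<n. KJ j \<le> RR j" using cl_coreD(1)[OF core] by blast
  have "\<forall>j<n. KJ j = RR j"
  proof (rule ccontr)
    assume ne: "\<not> (\<forall>j<n. KJ j = RR j)"
    hence "(\<Sum>j<n. KJ j) = s" using inv by (auto simp: cl_inv_def)
    moreover have "(\<Sum>j<n. KJ j) < (\<Sum>j<n. RR j)"
      using ne le by (intro sum_strict_mono_ex1) (auto simp: le_less)
    ultimately show False using s by simp
  qed
  hence KJ: "KJ j = RR j" using j by simp
  have "inj_on (kap j) {..<RR j}" using cl_coreD(7)[OF core j] KJ by simp
  moreover have "0 < kap j k \<and> (\<forall>t\<in>cluster CL (kap j k). \<delta> j t \<le> 3 * bet j k \<and> site t < m) \<and>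
    bij_betw RK (cluster CL (kap j k)) {..<LL} \<and> card {t \<in> P0 j. \<delta> j t < bet j k} < Suc k * LL"
    if "k < RR j" for k
  proof -
    have k: "k < KJ j" using that KJ by simp
    show ?thesis
      using cl_coreD(9-12)[OF core j k] cl_coreD(3,5)[OF core cl_coreD(9)[OF core j k]] by blast
  qed
  moreover have "\<forall>t<T. CL t \<le> s" using cl_coreD(2)[OF core] by blast
  ultimately show ?thesis by blast
qed

lemma cl_inv_bij:
  "cl_inv s P CL RK KJ \<Longrightarrow> 0 < q \<Longrightarrow> cluster CL q \<noteq> {} \<Longrightarrow> bij_betw RK (cluster CL q) {..<LL}"
  unfolding cl_inv_def cl_core_def by blast

end

section \<open>The program\<close>

text \<open>
  Banks used as scalars or arrays: \<open>bNS\<close>, \<open>bNC\<close>, \<open>bNM\<close> hold the dimensions \<open>m\<close>, \<open>n\<close>, \<open>m * n\<close>;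
  \<open>bNN\<close>, \<open>bLL\<close> the numbers of atoms per unit of LP mass and per cluster; \<open>bKN\<close>, \<open>bTN\<close>, \<open>bSN\<close>,
  \<open>bJN\<close> the numbers of stars, atoms, clustering steps and random draws; \<open>bFN\<close>, \<open>bFD\<close>, \<open>bDN\<close>,
  \<open>bDD\<close> numerators and denominators of the costs; \<open>bR\<close> the demands; \<open>bQ\<close>, \<open>bRP\<close> the products of
  all denominators and of all demands; \<open>bF\<close>, \<open>bD\<close> the costs multiplied by \<open>bQ\<close>; \<open>bG\<close> the quotients
  of \<open>bRP\<close> by the demands; \<open>bW\<close>, \<open>bH\<close> the weights and the coverage of the clients; \<open>bST\<close>, \<open>bMB\<close>,
  \<open>bAM\<close> site, members and amount of every chosen star; \<open>bY\<close>, \<open>bX\<close>, \<open>bCV\<close> the integral part of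
  the LP solution; \<open>bOK\<close>, \<open>bAS\<close>, \<open>bP\<close> validity and site of every atom and the pools of the clients;
  \<open>bRR\<close>, \<open>bKJ\<close> the residual demands and how many of them already have a cluster; \<open>bCL\<close>, \<open>bRK\<close>
  the cluster of an atom (0 for none) and its rank there; \<open>bRD\<close> the random draws; \<open>bYO\<close>, \<open>bXO\<close>
  the randomly opened facilities and the connections to them; \<open>bOUT\<close> the output. Loop counters
  start with \<open>v\<close>, the other banks are temporary.
\<close>

abbreviation (input) "bNS \<equiv> 2 :: nat"
abbreviation (input) "bNC \<equiv> 3 :: nat"
abbreviation (input) "bNM \<equiv> 4 :: nat"
abbreviation (input) "bNN \<equiv> 5 :: nat"
abbreviation (input) "bLL \<equiv> 6 :: nat"
abbreviation (input) "bKN \<equiv> 7 :: nat"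
abbreviation (input) "bTN \<equiv> 8 :: nat"
abbreviation (input) "bSN \<equiv> 9 :: nat"
abbreviation (input) "bJN \<equiv> 10 :: nat"
abbreviation (input) "bFN \<equiv> 11 :: nat"
abbreviation (input) "bFD \<equiv> 12 :: nat"
abbreviation (input) "bDN \<equiv> 13 :: nat"
abbreviation (input) "bDD \<equiv> 14 :: nat"
abbreviation (input) "bR \<equiv> 15 :: nat"
abbreviation (input) "bQ \<equiv> 16 :: nat"
abbreviation (input) "bRP \<equiv> 17 :: nat"
abbreviation (input) "bF \<equiv> 18 :: nat"
abbreviation (input) "bD \<equiv> 19 :: nat"
abbreviation (input) "bG \<equiv> 20 :: nat"
abbreviation (input) "bW \<equiv> 21 :: nat"
abbreviation (input) "bH \<equiv> 22 :: nat"
abbreviation (input) "vI \<equiv> 23 :: nat"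
abbreviation (input) "vJ \<equiv> 24 :: nat"
abbreviation (input) "vK \<equiv> 25 :: nat"
abbreviation (input) "bBF \<equiv> 26 :: nat"
abbreviation (input) "bBC \<equiv> 27 :: nat"
abbreviation (input) "bBW \<equiv> 28 :: nat"
abbreviation (input) "bBT \<equiv> 29 :: nat"
abbreviation (input) "bSC \<equiv> 30 :: nat"
abbreviation (input) "bSW \<equiv> 31 :: nat"
abbreviation (input) "bMB \<equiv> 32 :: nat"
abbreviation (input) "bST \<equiv> 33 :: nat"
abbreviation (input) "bAM \<equiv> 34 :: nat"
abbreviation (input) "bRM \<equiv> 35 :: nat"
abbreviation (input) "bY \<equiv> 36 :: nat"
abbreviation (input) "bX \<equiv> 37 :: nat"
abbreviation (input) "bCV \<equiv> 38 :: nat"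
abbreviation (input) "bP \<equiv> 39 :: nat"
abbreviation (input) "bAS \<equiv> 40 :: nat"
abbreviation (input) "bOK \<equiv> 41 :: nat"
abbreviation (input) "bRR \<equiv> 42 :: nat"
abbreviation (input) "bKJ \<equiv> 43 :: nat"
abbreviation (input) "bCL \<equiv> 44 :: nat"
abbreviation (input) "bRK \<equiv> 45 :: nat"
abbreviation (input) "bCNT \<equiv> 46 :: nat"
abbreviation (input) "bBD \<equiv> 47 :: nat"
abbreviation (input) "bBP \<equiv> 48 :: nat"
abbreviation (input) "bKP \<equiv> 49 :: nat"
abbreviation (input) "vV \<equiv> 50 :: nat"
abbreviation (input) "bQQ \<equiv> 51 :: nat"
abbreviation (input) "bRD \<equiv> 52 :: nat"
abbreviation (input) "bYO \<equiv> 53 :: nat"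
abbreviation (input) "bXO \<equiv> 54 :: nat"
abbreviation (input) "bBI \<equiv> 55 :: nat"
abbreviation (input) "bOUT \<equiv> 56 :: nat"
abbreviation (input) "vU \<equiv> 57 :: nat"
abbreviation (input) "vP \<equiv> 58 :: nat"

abbreviation Var :: "nat \<Rightarrow> bexpr" where "Var k \<equiv> Cell k (Num 0)"
abbreviation SetV :: "nat \<Rightarrow> bexpr \<Rightarrow> bcom" where "SetV k e \<equiv> Store k (Num 0) e"
text \<open>Comparisons are truncated differences, nonzero iff the relation holds. On such values
  products act as conjunction and sums as disjunction.\<close>

abbreviation Less :: "bexpr \<Rightarrow> bexpr \<Rightarrow> bexpr" where "Less a b \<equiv> b \<ominus> a"
abbreviation Leq :: "bexpr \<Rightarrow> bexpr \<Rightarrow> bexpr" where "Leq a b \<equiv> (b \<oplus> Num 1) \<ominus> a"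
abbreviation Equ :: "bexpr \<Rightarrow> bexpr \<Rightarrow> bexpr" where "Equ a b \<equiv> Leq a b \<otimes> Leq b a"
abbreviation Neg :: "bexpr \<Rightarrow> bexpr" where "Neg a \<equiv> Num 1 \<ominus> a"
abbreviation Incr :: "nat \<Rightarrow> bexpr \<Rightarrow> bexpr \<Rightarrow> bcom" where "Incr k i e \<equiv> Store k i (Cell k i \<oplus> e)"
abbreviation When :: "bexpr \<Rightarrow> bcom \<Rightarrow> bcom" where "When e c \<equiv> Ite e c Nop"
abbreviation Cell2 :: "nat \<Rightarrow> bexpr \<Rightarrow> bexpr \<Rightarrow> bexpr" where
  "Cell2 k i j \<equiv> Cell k (i \<otimes> Var bNC \<oplus> j)"

text \<open>A phase of its own: the products of dimensions in \<open>prog_params\<close> have an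
  admissible degree only if the dimensions were written in an earlier phase.\<close>

definition prog_dims :: bcom where
  "prog_dims = SetV bNS (Inp (Num 0)) ;; SetV bNC (Inp (Num 1))"

abbreviation "eMM \<equiv> Num 1000000 \<otimes> (Var bNC \<oplus> Num 1)"
abbreviation "eNN \<equiv> Num 19 \<otimes> eMM"

definition prog_params :: bcom where
  "prog_params =
     SetV bNM (Var bNS \<otimes> Var bNC) ;;
     SetV bNN eNN ;;
     SetV bLL (Num 11 \<otimes> eMM) ;;
     SetV bKN (Var bNC \<otimes> eNN) ;;
     SetV bTN (Var bNC \<otimes> eNN \<otimes> eNN) ;;
     SetV bSN (Var bNC \<otimes> (Var bNC \<otimes> eNN)) ;;
     SetV bJN (Var bTN \<oplus> Var bSN)"

definition prog_input :: bcom where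
  "prog_input =
     For vI (Var bNS)
       (Store bFN (Var vI) (Inp (Num 2 \<oplus> Num 2 \<otimes> Var vI)) ;;
        Store bFD (Var vI) (Inp (Num 3 \<oplus> Num 2 \<otimes> Var vI))) ;;
     For vI (Var bNM)
       (Store bDN (Var vI) (Inp (Num 2 \<oplus> Num 2 \<otimes> Var bNS \<oplus> Num 2 \<otimes> Var vI)) ;;
        Store bDD (Var vI) (Inp (Num 3 \<oplus> Num 2 \<otimes> Var bNS \<oplus> Num 2 \<otimes> Var vI))) ;;
     For vJ (Var bNC)
       (Store bR (Var vJ) (Inp (Num 2 \<oplus> Num 2 \<otimes> Var bNS \<oplus> Num 2 \<otimes> Var bNM \<oplus> Var vJ)))"

definition prog_prods :: bcom where
  "prog_prods =
     SetV bQ (Num 1) ;;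
     For vI (Var bNS) (SetV bQ (Var bQ \<otimes> Cell bFD (Var vI))) ;;
     For vI (Var bNM) (SetV bQ (Var bQ \<otimes> Cell bDD (Var vI))) ;;
     SetV bRP (Num 1) ;;
     For vJ (Var bNC) (SetV bRP (Var bRP \<otimes> Cell bR (Var vJ)))"

definition prog_scale :: bcom where
  "prog_scale =
     For vI (Var bNS) (Store bF (Var vI) (Cell bFN (Var vI) \<otimes> (Var bQ \<oslash> Cell bFD (Var vI)))) ;;
     For vI (Var bNM) (Store bD (Var vI) (Cell bDN (Var vI) \<otimes> (Var bQ \<oslash> Cell bDD (Var vI)))) ;;
     For vJ (Var bNC)
       (Store bG (Var vJ) (Var bRP \<oslash> Cell bR (Var vJ)) ;;
        Store bW (Var vJ) (Var bRP \<oslash> Cell bR (Var vJ)))"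

abbreviation Row :: "bexpr \<Rightarrow> bexpr" where "Row t \<equiv> t \<oslash> Var bNC"
abbreviation Col :: "bexpr \<Rightarrow> bexpr" where "Col t \<equiv> t \<ominus> Row t \<otimes> Var bNC"
abbreviation Active :: "bexpr \<Rightarrow> bexpr" where
  "Active j \<equiv> Less (Cell bH j) (Var bNN \<otimes> Cell bR j)"
abbreviation InStar :: "bexpr \<Rightarrow> bexpr \<Rightarrow> bexpr" where
  "InStar t j \<equiv> Active j \<otimes> Leq (Cell2 bD (Row t) j \<otimes> Cell bW (Col t)) (Cell bD t \<otimes> Cell bW j)"

definition mwu_star :: bcom where
  "mwu_star =
     For vJ (Var bNC) (When (InStar (Var vI) (Var vJ))
       (Incr bSC (Num 0) (Cell2 bD (Row (Var vI)) (Var vJ)) ;; Incr bSW (Num 0) (Cell bW (Var vJ))))"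

definition mwu_search :: bcom where
  "mwu_search =
     For vI (Var bNM) (When (Active (Col (Var vI)))
       (SetV bSC (Cell bF (Row (Var vI))) ;; SetV bSW (Num 0) ;;
        mwu_star ;;
        When (Neg (Var bBF) \<oplus> Less (Var bSC \<otimes> Var bBW) (Var bBC \<otimes> Var bSW))
          (SetV bBF (Num 1) ;; SetV bBC (Var bSC) ;; SetV bBW (Var bSW) ;; SetV bBT (Var vI))))"

text \<open>The value 0 of \<open>bRM\<close> stands for no member seen so far, which is unambiguous
  because demands are positive.\<close>

definition mwu_record :: bcom where
  "mwu_record =
     For vJ (Var bNC) (When (InStar (Var bBT) (Var vJ))
       (Store bMB (Var vK \<otimes> Var bNC \<oplus> Var vJ) (Num 1) ;;
        When (Neg (Var bRM) \<oplus> Less (Cell bR (Var vJ)) (Var bRM)) (SetV bRM (Cell bR (Var vJ)))))"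

text \<open>The new factor has degree 0, as a truncated difference is bounded by its left operand.
  Hence a round lengthens the weights only by about the length of \<open>1000 * bRP\<close>.\<close>

definition mwu_update :: bcom where
  "mwu_update =
     For vJ (Var bNC) (Ite (Cell2 bMB (Var vK) (Var vJ))
       (Store bW (Var vJ) (Cell bW (Var vJ) \<otimes>
          (Num 1000 \<otimes> Var bRP \<ominus> Cell bG (Var vJ) \<otimes> Var bRM)) ;;
        Incr bH (Var vJ) (Var bRM))
       (Store bW (Var vJ) (Cell bW (Var vJ) \<otimes> (Num 1000 \<otimes> Var bRP))))"

text \<open>The range \<open>bKN = n * NN\<close> always suffices. Once no client is active, the
  remaining rounds record nothing and their amounts stay 0.\<close>

definition prog_mwu :: bcom where
  "prog_mwu =
     For vK (Var bKN)
       (SetV bBF (Num 0) ;;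
        mwu_search ;;
        When (Var bBF)
          (SetV bRM (Num 0) ;;
           mwu_record ;;
           Store bST (Var vK) (Row (Var bBT)) ;;
           Store bAM (Var vK) (Var bRM) ;;
           mwu_update))"

definition prog_split :: bcom where
  "prog_split =
     For vK (Var bKN)
       (SetV bQQ (Cell bAM (Var vK) \<oslash> Var bNN) ;;
        Incr bY (Cell bST (Var vK)) (Var bQQ) ;;
        For vJ (Var bNC) (When (Cell2 bMB (Var vK) (Var vJ))
          (Incr bX (Cell bST (Var vK) \<otimes> Var bNC \<oplus> Var vJ) (Var bQQ) ;;
           Incr bCV (Var vJ) (Var bQQ))))"

abbreviation "eAK \<equiv> Var vI \<oslash> Var bNN"

text \<open>Star \<open>k\<close> owns the \<open>NN\<close> atom numbers starting at
  \<open>k * NN\<close>, of which only the first \<open>bAM mod NN\<close> are valid. With blocks of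
  fixed length the loop range is known in advance, and the star of an atom is recovered by
  division.\<close>

definition prog_atoms :: bcom where
  "prog_atoms =
     For vI (Var bTN)
       (When (Less (Var vI \<ominus> eAK \<otimes> Var bNN)
                (Cell bAM eAK \<ominus> (Cell bAM eAK \<oslash> Var bNN) \<otimes> Var bNN))
         (Store bOK (Var vI) (Num 1) ;;
          Store bAS (Var vI) (Cell bST eAK) ;;
          For vJ (Var bNC) (Store bP (Var vI \<otimes> Var bNC \<oplus> Var vJ) (Cell2 bMB eAK (Var vJ))))) ;;
     For vJ (Var bNC) (Store bRR (Var vJ) (Cell bR (Var vJ) \<ominus> Cell bCV (Var vJ)))"

abbreviation Dist :: "bexpr \<Rightarrow> bexpr \<Rightarrow> bexpr" where "Dist t j \<equiv> Cell2 bD (Cell bAS t) j"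

definition cl_count :: bcom where
  "cl_count =
     For vV (Var bTN) (When (Cell2 bP (Var vV) (Var vP) \<otimes>
         Leq (Dist (Var vV) (Var vP)) (Dist (Var vI) (Var vP)))
       (Incr bCNT (Num 0) (Num 1)))"

definition cl_search_client :: bcom where
  "cl_search_client =
     For vI (Var bTN) (When (Cell2 bP (Var vI) (Var vP))
       (SetV bCNT (Num 0) ;;
        cl_count ;;
        When (Leq (Var bLL) (Var bCNT) \<otimes> (Neg (Var bBF) \<oplus> Less (Dist (Var vI) (Var vP)) (Var bBD)))
          (SetV bBF (Num 1) ;; SetV bBD (Dist (Var vI) (Var vP)) ;; SetV bBP (Var vP))))"

definition cl_search :: bcom where
  "cl_search =
     For vP (Var bNC) (When (Less (Cell bKJ (Var vP)) (Cell bRR (Var vP))) cl_search_client)"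

abbreviation Near :: "bexpr \<Rightarrow> bexpr" where
  "Near t \<equiv> Cell2 bP t (Var bBP) \<otimes> Leq (Dist t (Var bBP)) (Var bBD)"

definition cl_lookup :: bcom where
  "cl_lookup =
     For vI (Var bTN) (When (Near (Var vI) \<otimes> Cell bCL (Var vI)) (SetV bKP (Cell bCL (Var vI))))"

definition cl_create :: bcom where
  "cl_create =
     For vI (Var bTN) (When (Near (Var vI) \<otimes> Less (Var bCNT) (Var bLL))
       (Store bCL (Var vI) (Var vK \<oplus> Num 1) ;; Store bRK (Var vI) (Var bCNT) ;;
        Incr bCNT (Num 0) (Num 1)))"

definition cl_remove :: bcom where
  "cl_remove =
     For vI (Var bTN) (When (Equ (Cell bCL (Var vI)) (Var bKP))
       (Store bP (Var vI \<otimes> Var bNC \<oplus> Var bBP) (Num 0)))"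

text \<open>A cluster is named after the round that creates it, plus 1, since 0 in
  \<open>bCL\<close> means unclustered. The range \<open>bSN\<close> is an upper bound for the sum
  of all residual demands.\<close>

definition prog_cluster :: bcom where
  "prog_cluster =
     For vK (Var bSN)
       (SetV bBF (Num 0) ;;
        cl_search ;;
        When (Var bBF)
          (SetV bKP (Num 0) ;;
           cl_lookup ;;
           Ite (Var bKP) Nop (SetV bCNT (Num 0) ;; cl_create ;; SetV bKP (Var vK \<oplus> Num 1)) ;;
           cl_remove ;;
           Incr bKJ (Var bBP) (Num 1)))"

text \<open>An unclustered atom opens iff its own draw is 0. Cluster \<open>q\<close> uses the draw
  at \<open>bTN + (q - 1)\<close> and opens the atom whose rank is drawn. Either way a valid atom
  opens with probability \<open>1 / LL\<close>.\<close>

definition prog_open :: bcom where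
  "prog_open =
     For vI (Var bTN)
       (When (Cell bOK (Var vI) \<otimes>
           (Neg (Cell bCL (Var vI)) \<otimes> Neg (Cell bRD (Var vI)) \<oplus>
            Cell bCL (Var vI) \<otimes>
              Equ (Cell bRD (Var bTN \<oplus> (Cell bCL (Var vI) \<ominus> Num 1))) (Cell bRK (Var vI))))
         (Incr bYO (Cell bAS (Var vI)) (Num 1)))"

definition con_search :: bcom where
  "con_search =
     For vI (Var bNS)
       (When (Less (Cell2 bXO (Var vI) (Var vJ)) (Cell bYO (Var vI)) \<otimes>
           (Neg (Var bBF) \<oplus> Less (Cell2 bD (Var vI) (Var vJ)) (Var bBD)))
         (SetV bBF (Num 1) ;; SetV bBD (Cell2 bD (Var vI) (Var vJ)) ;; SetV bBI (Var vI)))"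

text \<open>The inner range is the uniform bound \<open>bKN\<close> on residual demands combined
  with a test; a range reading \<open>bRR\<close> at \<open>vJ\<close> would depend on a written
  bank and violate \<open>wf\<close>.\<close>

definition prog_connect :: bcom where
  "prog_connect =
     For vJ (Var bNC) (For vK (Var bKN) (When (Less (Var vK) (Cell bRR (Var vJ)))
       (SetV bBF (Num 0) ;;
        con_search ;;
        When (Var bBF) (Incr bXO (Var bBI \<otimes> Var bNC \<oplus> Var vJ) (Num 1)))))"

definition prog_output :: bcom where
  "prog_output =
     For vI (Var bNS) (Store bOUT (Var vI) (Cell bY (Var vI) \<oplus> Cell bYO (Var vI))) ;;
     For vI (Var bNM) (Store bOUT (Var bNS \<oplus> Var vI) (Cell bX (Var vI) \<oplus> Cell bXO (Var vI)))"

lemmas prog_defs = prog_dims_def prog_params_def prog_input_def prog_prods_def prog_scale_def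
  mwu_star_def mwu_search_def mwu_record_def mwu_update_def prog_mwu_def
  prog_split_def prog_atoms_def cl_count_def cl_search_client_def cl_search_def cl_lookup_def
  cl_create_def cl_remove_def prog_cluster_def prog_open_def con_search_def prog_connect_def
  prog_output_def

lemma wf_progs:
  "wf (written prog_dims) prog_dims" "wf (written prog_params) prog_params"
  "wf (written prog_input) prog_input" "wf (written prog_prods) prog_prods"
  "wf (written prog_scale) prog_scale" "wf (written prog_mwu) prog_mwu"
  "wf (written prog_split) prog_split" "wf (written prog_atoms) prog_atoms"
  "wf (written prog_cluster) prog_cluster" "wf (written prog_open) prog_open"
  "wf (written prog_connect) prog_connect" "wf (written prog_output) prog_output"
  by (simp_all add: prog_defs nbanks_def)

section \<open>Semantics of the preprocessing\<close>

text \<open>Supplies the fact that unwritten banks keep their contents, so that an invariant need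
  only mention what the loop changes.\<close>

lemma sem_For_frame:
  assumes "k \<notin> written c"
    and "P 0 (put k 0 0 \<sigma>)"
    and "\<And>i \<tau>. i < ev inp \<sigma> e \<Longrightarrow> \<tau> k 0 = i \<Longrightarrow>
      (\<And>l. l \<notin> written (For k e c) \<Longrightarrow> \<tau> l = \<sigma> l) \<Longrightarrow> P i \<tau> \<Longrightarrow> P (Suc i) (bump k (sem inp c \<tau>))"
  shows "P (ev inp \<sigma> e) (sem inp (For k e c) \<sigma>)"
proof -
  have "(\<forall>l. l \<notin> written (For k e c) \<longrightarrow> sem inp (For k e c) \<sigma> l = \<sigma> l) \<and>
      P (ev inp \<sigma> e) (sem inp (For k e c) \<sigma>)"
    by (rule sem_For_rule[where P = "\<lambda>i \<tau>. (\<forall>l. l \<notin> written (For k e c) \<longrightarrow> \<tau> l = \<sigma> l) \<and> P i \<tau>"])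
      (use assms in \<open>auto simp: sem_unwritten\<close>)
  thus ?thesis by blast
qed

definition init_banks :: banks where "init_banks = (\<lambda>_ _. 0)"

definition st_params :: "memory \<Rightarrow> banks" where
  "st_params inp = sem inp prog_params (sem inp prog_dims init_banks)"
definition st_input :: "memory \<Rightarrow> banks" where
  "st_input inp = sem inp prog_input (st_params inp)"
definition st_prods :: "memory \<Rightarrow> banks" where
  "st_prods inp = sem inp prog_prods (st_input inp)"
definition st_scale :: "memory \<Rightarrow> banks" where
  "st_scale inp = sem inp prog_scale (st_prods inp)"

lemma st_params_values:
  assumes "inp 0 = m" "inp 1 = n"
  shows "st_params inp bNS 0 = m" "st_params inp bNC 0 = n" "st_params inp bNM 0 = m * n"
    and "st_params inp bNN 0 = 19 * (1000000 * (n + 1))" "st_params inp bLL 0 = 11 * (1000000 * (n + 1))"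
    and "st_params inp bKN 0 = n * (19 * (1000000 * (n + 1)))"
    and "st_params inp bTN 0 = n * (19 * (1000000 * (n + 1))) * (19 * (1000000 * (n + 1)))"
    and "st_params inp bSN 0 = n * (n * (19 * (1000000 * (n + 1))))"
    and "st_params inp bJN 0 = n * (19 * (1000000 * (n + 1))) * (19 * (1000000 * (n + 1))) +
      n * (n * (19 * (1000000 * (n + 1))))"
  using base_ge[of inp] assms by (simp_all add: st_params_def prog_dims_def prog_params_def)

lemma st_params_zero: "k \<notin> {2..10} \<Longrightarrow> st_params inp k = (\<lambda>_. 0)"
proof -
  assume "k \<notin> {2..10}"
  hence "k \<notin> written prog_params" "k \<notin> written prog_dims" by (auto simp: prog_defs)
  thus ?thesis by (simp add: st_params_def sem_unwritten init_banks_def)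
qed

lemma st_input_values:
  assumes "inp 0 = m" "inp 1 = n"
  shows "i < m \<Longrightarrow> st_input inp bFN i = inp (2 + 2 * i)" "i < m \<Longrightarrow> st_input inp bFD i = inp (3 + 2 * i)"
    and "t < m * n \<Longrightarrow> st_input inp bDN t = inp (2 + 2 * m + 2 * t)"
    and "t < m * n \<Longrightarrow> st_input inp bDD t = inp (3 + 2 * m + 2 * t)"
    and "j < n \<Longrightarrow> st_input inp bR j = inp (2 + 2 * m + 2 * (m * n) + j)"
proof -
  let ?A = "For vI (Var bNS)
       (Store bFN (Var vI) (Inp (Num 2 \<oplus> Num 2 \<otimes> Var vI)) ;;
        Store bFD (Var vI) (Inp (Num 3 \<oplus> Num 2 \<otimes> Var vI)))"
  let ?B = "For vI (Var bNM)
       (Store bDN (Var vI) (Inp (Num 2 \<oplus> Num 2 \<otimes> Var bNS \<oplus> Num 2 \<otimes> Var vI)) ;;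
        Store bDD (Var vI) (Inp (Num 3 \<oplus> Num 2 \<otimes> Var bNS \<oplus> Num 2 \<otimes> Var vI)))"
  let ?C = "For vJ (Var bNC)
       (Store bR (Var vJ) (Inp (Num 2 \<oplus> Num 2 \<otimes> Var bNS \<oplus> Num 2 \<otimes> Var bNM \<oplus> Var vJ)))"
  let ?s = "st_params inp"
  define sA where "sA = sem inp ?A ?s"
  define sB where "sB = sem inp ?B sA"
  define sC where "sC = sem inp ?C sB"
  note v = st_params_values[OF assms]
  have base: "base inp = 2 + (2 * m + (2 * (m * n) + n))" using assms by (simp add: base_def)
  have st: "st_input inp = sC" by (simp only: st_input_def prog_input_def sem.simps sA_def sB_def sC_def)
  have "\<forall>x<ev inp ?s (Var bNS). sA bFN x = inp (2 + 2 * x) \<and> sA bFD x = inp (3 + 2 * x)"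
    unfolding sA_def
  proof (rule sem_For_frame[where P = "\<lambda>i \<tau>. \<forall>x<i. \<tau> bFN x = inp (2 + 2 * x) \<and> \<tau> bFD x = inp (3 + 2 * x)"],
      goal_cases)
    case (3 i \<tau>)
    have "2 + 2 * i < base inp" "3 + 2 * i < base inp" using 3(1) v base by simp_all
    thus ?case using 3 by (auto simp: less_Suc_eq)
  qed simp_all
  hence A: "\<forall>x<m. sA bFN x = inp (2 + 2 * x) \<and> sA bFD x = inp (3 + 2 * x)" using v by simp
  have frA: "sA l = ?s l" if "l \<notin> {vI, bFN, bFD}" for l unfolding sA_def by (rule sem_unwritten) (use that in simp)
  have "\<forall>x<ev inp sA (Var bNM). sB bDN x = inp (2 + 2 * m + 2 * x) \<and> sB bDD x = inp (3 + 2 * m + 2 * x)"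
    unfolding sB_def
  proof (rule sem_For_frame[where P = "\<lambda>i \<tau>. \<forall>x<i. \<tau> bDN x = inp (2 + 2 * m + 2 * x) \<and> \<tau> bDD x = inp (3 + 2 * m + 2 * x)"],
      goal_cases)
    case (3 i \<tau>)
    have "2 + 2 * m + 2 * i < base inp" "3 + 2 * m + 2 * i < base inp" using 3(1) v base frA by simp_all
    thus ?case using 3 frA v by (auto simp: less_Suc_eq)
  qed simp_all
  hence B: "\<forall>x<m * n. sB bDN x = inp (2 + 2 * m + 2 * x) \<and> sB bDD x = inp (3 + 2 * m + 2 * x)"
    using v frA by simp
  have frB: "sB l = sA l" if "l \<notin> {vI, bDN, bDD}" for l unfolding sB_def by (rule sem_unwritten) (use that in simp)
  have "\<forall>x<ev inp sB (Var bNC). sC bR x = inp (2 + 2 * m + 2 * (m * n) + x)"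
    unfolding sC_def
  proof (rule sem_For_frame[where P = "\<lambda>i \<tau>. \<forall>x<i. \<tau> bR x = inp (2 + 2 * m + 2 * (m * n) + x)"],
      goal_cases)
    case (3 i \<tau>)
    have "2 + 2 * m + 2 * (m * n) + i < base inp" using 3(1) v base frA frB by simp
    thus ?case using 3 frA frB v by (auto simp: less_Suc_eq)
  qed simp_all
  hence C: "\<forall>x<n. sC bR x = inp (2 + 2 * m + 2 * (m * n) + x)" using v frA frB by simp
  have frC: "sC l = sB l" if "l \<notin> {vJ, bR}" for l unfolding sC_def by (rule sem_unwritten) (use that in simp)
  show "i < m \<Longrightarrow> st_input inp bFN i = inp (2 + 2 * i)" "i < m \<Longrightarrow> st_input inp bFD i = inp (3 + 2 * i)"
    "t < m * n \<Longrightarrow> st_input inp bDN t = inp (2 + 2 * m + 2 * t)"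
    "t < m * n \<Longrightarrow> st_input inp bDD t = inp (3 + 2 * m + 2 * t)"
    "j < n \<Longrightarrow> st_input inp bR j = inp (2 + 2 * m + 2 * (m * n) + j)"
    unfolding st using A B C frA frB frC by simp_all
qed

lemma st_input_unwritten: "k \<notin> {11..15} \<union> {23, 24} \<Longrightarrow> st_input inp k = st_params inp k"
  unfolding st_input_def by (rule sem_unwritten) (auto simp: prog_input_def)

lemma st_prods_unwritten: "k \<notin> {16, 17, 23, 24} \<Longrightarrow> st_prods inp k = st_input inp k"
  unfolding st_prods_def by (rule sem_unwritten) (simp add: prog_prods_def)

lemma st_scale_unwritten: "k \<notin> {18, 19, 20, 21, 23, 24} \<Longrightarrow> st_scale inp k = st_prods inp k"
  unfolding st_scale_def by (rule sem_unwritten) (simp add: prog_scale_def)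

lemma st_prods_values:
  assumes "inp 0 = m" "inp 1 = n"
  shows "st_prods inp bQ 0 = (\<Prod>i<m. inp (3 + 2 * i)) * (\<Prod>t<m * n. inp (3 + 2 * m + 2 * t))"
    and "st_prods inp bRP 0 = (\<Prod>j<n. inp (2 + 2 * m + 2 * (m * n) + j))"
proof -
  let ?s0 = "st_input inp"
  let ?s = "sem inp (SetV bQ (Num 1)) ?s0"
  let ?A = "For vI (Var bNS) (SetV bQ (Var bQ \<otimes> Cell bFD (Var vI)))"
  let ?B = "For vI (Var bNM) (SetV bQ (Var bQ \<otimes> Cell bDD (Var vI)))"
  let ?C = "For vJ (Var bNC) (SetV bRP (Var bRP \<otimes> Cell bR (Var vJ)))"
  note v = st_params_values[OF assms] st_input_unwritten
  note iv = st_input_values[OF assms]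
  define sA where "sA = sem inp ?A ?s"
  define sB where "sB = sem inp ?B sA"
  define sB' where "sB' = sem inp (SetV bRP (Num 1)) sB"
  define sC where "sC = sem inp ?C sB'"
  have st: "st_prods inp = sC"
    by (simp only: st_prods_def prog_prods_def sem.simps sA_def sB_def sB'_def sC_def)
  have "sA bQ 0 = (\<Prod>x<ev inp ?s (Var bNS). inp (3 + 2 * x))" unfolding sA_def
  proof (rule sem_For_frame[where P = "\<lambda>i \<tau>. \<tau> bQ 0 = (\<Prod>x<i. inp (3 + 2 * x))"], goal_cases)
    case (3 i \<tau>)
    thus ?case using v iv by simp
  qed simp_all
  hence A: "sA bQ 0 = (\<Prod>x<m. inp (3 + 2 * x))" using v by simp
  have frA: "sA l = ?s0 l" if "l \<notin> {vI, bQ}" for l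
    unfolding sA_def by (subst sem_unwritten) (use that in simp_all)
  have "sB bQ 0 = sA bQ 0 * (\<Prod>x<ev inp sA (Var bNM). inp (3 + 2 * m + 2 * x))" unfolding sB_def
  proof (rule sem_For_frame[where P = "\<lambda>i \<tau>. \<tau> bQ 0 = sA bQ 0 * (\<Prod>x<i. inp (3 + 2 * m + 2 * x))"], goal_cases)
    case (3 i \<tau>)
    thus ?case using v iv frA by simp
  qed simp_all
  hence B: "sB bQ 0 = (\<Prod>i<m. inp (3 + 2 * i)) * (\<Prod>t<m * n. inp (3 + 2 * m + 2 * t))"
    using A v frA by simp
  have frB: "sB l = sA l" if "l \<notin> {vI, bQ}" for l
    unfolding sB_def by (rule sem_unwritten) (use that in simp)
  have frB': "sB' l = sB l" if "l \<noteq> bRP" for l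
    unfolding sB'_def by (rule sem_unwritten) (use that in simp)
  have "sC bRP 0 = (\<Prod>x<ev inp sB' (Var bNC). inp (2 + 2 * m + 2 * (m * n) + x))" unfolding sC_def
  proof (rule sem_For_frame[where P = "\<lambda>i \<tau>. \<tau> bRP 0 = (\<Prod>x<i. inp (2 + 2 * m + 2 * (m * n) + x))"], goal_cases)
    case 2
    show ?case by (simp add: sB'_def)
  next
    case (3 i \<tau>)
    thus ?case using v iv frA frB frB' by simp
  qed simp_all
  thus "st_prods inp bRP 0 = (\<Prod>j<n. inp (2 + 2 * m + 2 * (m * n) + j))"
    unfolding st using v frA frB frB' by simp
  have frC: "sC l = sB' l" if "l \<notin> {vJ, bRP}" for l
    unfolding sC_def by (rule sem_unwritten) (use that in simp)
  show "st_prods inp bQ 0 = (\<Prod>i<m. inp (3 + 2 * i)) * (\<Prod>t<m * n. inp (3 + 2 * m + 2 * t))"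
    unfolding st using B frC frB' by simp
qed

lemma st_scale_values:
  assumes "inp 0 = m" "inp 1 = n"
  shows "i < m \<Longrightarrow> st_scale inp bF i = inp (2 + 2 * i) * (st_prods inp bQ 0 div inp (3 + 2 * i))"
    and "t < m * n \<Longrightarrow> st_scale inp bD t = inp (2 + 2 * m + 2 * t) * (st_prods inp bQ 0 div inp (3 + 2 * m + 2 * t))"
    and "j < n \<Longrightarrow> st_scale inp bG j = st_prods inp bRP 0 div inp (2 + 2 * m + 2 * (m * n) + j)"
    and "j < n \<Longrightarrow> st_scale inp bW j = st_prods inp bRP 0 div inp (2 + 2 * m + 2 * (m * n) + j)"
proof -
  let ?s = "st_prods inp"
  let ?A = "For vI (Var bNS) (Store bF (Var vI) (Cell bFN (Var vI) \<otimes> (Var bQ \<oslash> Cell bFD (Var vI))))"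
  let ?B = "For vI (Var bNM) (Store bD (Var vI) (Cell bDN (Var vI) \<otimes> (Var bQ \<oslash> Cell bDD (Var vI))))"
  let ?C = "For vJ (Var bNC)
       (Store bG (Var vJ) (Var bRP \<oslash> Cell bR (Var vJ)) ;;
        Store bW (Var vJ) (Var bRP \<oslash> Cell bR (Var vJ)))"
  note v = st_params_values[OF assms] st_input_unwritten st_prods_unwritten st_input_values[OF assms]
  define sA where "sA = sem inp ?A ?s"
  define sB where "sB = sem inp ?B sA"
  define sC where "sC = sem inp ?C sB"
  have st: "st_scale inp = sC" by (simp only: st_scale_def prog_scale_def sem.simps sA_def sB_def sC_def)
  let ?f = "\<lambda>x. inp (2 + 2 * x) * (?s bQ 0 div inp (3 + 2 * x))"
  let ?g = "\<lambda>x. inp (2 + 2 * m + 2 * x) * (?s bQ 0 div inp (3 + 2 * m + 2 * x))"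
  let ?h = "\<lambda>x. ?s bRP 0 div inp (2 + 2 * m + 2 * (m * n) + x)"
  have "\<forall>x<ev inp ?s (Var bNS). sA bF x = ?f x" unfolding sA_def
  proof (rule sem_For_frame[where P = "\<lambda>i \<tau>. \<forall>x<i. \<tau> bF x = ?f x"], goal_cases)
    case (3 i \<tau>)
    thus ?case using v by (auto simp: less_Suc_eq)
  qed simp_all
  hence A: "\<forall>x<m. sA bF x = ?f x" using v by simp
  have frA: "sA l = ?s l" if "l \<notin> {vI, bF}" for l unfolding sA_def by (rule sem_unwritten) (use that in simp)
  have "\<forall>x<ev inp sA (Var bNM). sB bD x = ?g x" unfolding sB_def
  proof (rule sem_For_frame[where P = "\<lambda>i \<tau>. \<forall>x<i. \<tau> bD x = ?g x"], goal_cases)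
    case (3 i \<tau>)
    thus ?case using v frA by (auto simp: less_Suc_eq)
  qed simp_all
  hence B: "\<forall>x<m * n. sB bD x = ?g x" using v frA by simp
  have frB: "sB l = sA l" if "l \<notin> {vI, bD}" for l unfolding sB_def by (rule sem_unwritten) (use that in simp)
  have "\<forall>x<ev inp sB (Var bNC). sC bG x = ?h x \<and> sC bW x = ?h x" unfolding sC_def
  proof (rule sem_For_frame[where P = "\<lambda>i \<tau>. \<forall>x<i. \<tau> bG x = ?h x \<and> \<tau> bW x = ?h x"], goal_cases)
    case (3 i \<tau>)
    thus ?case using v frA frB by (auto simp: less_Suc_eq)
  qed simp_all
  hence C: "\<forall>x<n. sC bG x = ?h x \<and> sC bW x = ?h x" using v frA frB by simp
  have frC: "sC l = sB l" if "l \<notin> {vJ, bG, bW}" for l unfolding sC_def by (rule sem_unwritten) (use that in simp)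
  show "i < m \<Longrightarrow> st_scale inp bF i = inp (2 + 2 * i) * (st_prods inp bQ 0 div inp (3 + 2 * i))"
    "t < m * n \<Longrightarrow> st_scale inp bD t = inp (2 + 2 * m + 2 * t) * (st_prods inp bQ 0 div inp (3 + 2 * m + 2 * t))"
    "j < n \<Longrightarrow> st_scale inp bG j = st_prods inp bRP 0 div inp (2 + 2 * m + 2 * (m * n) + j)"
    "j < n \<Longrightarrow> st_scale inp bW j = st_prods inp bRP 0 div inp (2 + 2 * m + 2 * (m * n) + j)"
    unfolding st using A B C frA frB frC by simp_all
qed

section \<open>Semantics of the multiplicative weights phase\<close>

context ftfp_data
begin

definition ok_data :: "banks \<Rightarrow> bool" where
  "ok_data \<sigma> \<longleftrightarrow> \<sigma> bNS 0 = m \<and> \<sigma> bNC 0 = n \<and> \<sigma> bNM 0 = m * n \<and> \<sigma> bNN 0 = NN \<and> \<sigma> bLL 0 = LL \<and>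
     \<sigma> bKN 0 = n * NN \<and> \<sigma> bTN 0 = n * NN * NN \<and> \<sigma> bSN 0 = n * (n * NN) \<and>
     (\<forall>j<n. \<sigma> bR j = r j) \<and> \<sigma> bRP 0 = RP \<and> (\<forall>i<m. \<sigma> bF i = F i) \<and>
     (\<forall>i<m. \<forall>j<n. \<sigma> bD (i * n + j) = D i j) \<and> (\<forall>j<n. \<sigma> bG j = RP div r j)"

lemma ok_dataD:
  assumes "ok_data \<sigma>"
  shows "\<sigma> bNS 0 = m" "\<sigma> bNC 0 = n" "\<sigma> bNM 0 = m * n" "\<sigma> bNN 0 = NN" "\<sigma> bLL 0 = LL"
    "\<sigma> bKN 0 = n * NN" "\<sigma> bTN 0 = n * NN * NN" "\<sigma> bSN 0 = n * (n * NN)"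
    "\<And>j. j < n \<Longrightarrow> \<sigma> bR j = r j" "\<sigma> bRP 0 = RP" "\<And>i. i < m \<Longrightarrow> \<sigma> bF i = F i"
    "\<And>i j. i < m \<Longrightarrow> j < n \<Longrightarrow> \<sigma> bD (i * n + j) = D i j" "\<And>j. j < n \<Longrightarrow> \<sigma> bG j = RP div r j"
  using assms unfolding ok_data_def by blast+

lemma ok_data_frame:
  assumes "ok_data \<sigma>" "\<And>l. l \<in> {2..20} \<Longrightarrow> \<tau> l = \<sigma> l"
  shows "ok_data \<tau>"
  using assms(1) unfolding ok_data_def by (simp add: assms(2))

lemma row_col: "(l::nat) < n \<Longrightarrow> (i * n + l) div n = i" "l < n \<Longrightarrow> i * n + l - i * n = l"
  by auto

lemma ev_InStar:
  assumes "ok_data \<tau>" "i < m" "l < n" "j < n" "\<tau> v 0 = i * n + l" "\<tau> w 0 = j"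
  shows "ev inp \<tau> (InStar (Var v) (Var w)) \<noteq> 0 \<longleftrightarrow> j \<in> star (\<tau> bW) (\<tau> bH) i l"
  using assms by (auto simp: ok_dataD row_col star_def active_def)

lemma sem_mwu_star:
  assumes ok: "ok_data \<sigma>" and i: "i < m" "l < n" "\<sigma> vI 0 = i * n + l"
  shows "sem inp mwu_star \<sigma> bSC 0 = \<sigma> bSC 0 + (\<Sum>j\<in>star (\<sigma> bW) (\<sigma> bH) i l. D i j)"
    and "sem inp mwu_star \<sigma> bSW 0 = \<sigma> bSW 0 + (\<Sum>j\<in>star (\<sigma> bW) (\<sigma> bH) i l. \<sigma> bW j)"
proof -
  let ?S = "star (\<sigma> bW) (\<sigma> bH) i l"
  let ?P = "\<lambda>x \<tau>. \<tau> bSC 0 = \<sigma> bSC 0 + (\<Sum>j\<in>?S \<inter> {..<x}. D i j) \<and>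
    \<tau> bSW 0 = \<sigma> bSW 0 + (\<Sum>j\<in>?S \<inter> {..<x}. \<sigma> bW j)"
  have "?P (ev inp \<sigma> (Var bNC)) (sem inp mwu_star \<sigma>)"
    unfolding mwu_star_def
  proof (rule sem_For_frame[where P = ?P], goal_cases)
    case (3 x \<tau>)
    have fr: "\<tau> k = \<sigma> k" if "k \<notin> {vJ, bSC, bSW}" for k by (rule 3(3)) (use that in simp)
    have x: "x < n" using 3(1) ok by (simp add: ok_dataD)
    have ok': "ok_data \<tau>" by (rule ok_data_frame[OF ok fr]) auto
    have t: "\<tau> vI 0 = i * n + l" using fr[of vI] i by simp
    note test = ev_InStar[OF ok' i(1,2) x t 3(2)]
    have W: "\<tau> bW = \<sigma> bW" "\<tau> bH = \<sigma> bH" by (simp_all add: fr)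
    show ?case
    proof (cases "x \<in> ?S")
      case True
      hence "?S \<inter> {..<Suc x} = insert x (?S \<inter> {..<x})" by (auto simp: less_Suc_eq)
      moreover have "ev inp \<tau> (InStar (Var vI) (Var vJ)) \<noteq> 0" using True test W by simp
      hence body: "sem inp (When (InStar (Var vI) (Var vJ)) c) \<tau> = sem inp c \<tau>" for c
        by (simp only: sem.simps if_True simp_thms)
      ultimately show ?thesis unfolding body using 3(2,4) ok' t x i
        by (simp add: ok_dataD row_col W)
    next
      case False
      hence "?S \<inter> {..<Suc x} = ?S \<inter> {..<x}" by (auto simp: less_Suc_eq)
      moreover have "ev inp \<tau> (InStar (Var vI) (Var vJ)) = 0" using False test W by auto
      ultimately show ?thesis using 3(4) by (simp del: ev.simps)
    qed
  qed simp_all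
  moreover have "?S \<inter> {..<n} = ?S" by (auto simp: star_def active_def)
  ultimately show "sem inp mwu_star \<sigma> bSC 0 = \<sigma> bSC 0 + (\<Sum>j\<in>?S. D i j)"
    "sem inp mwu_star \<sigma> bSW 0 = \<sigma> bSW 0 + (\<Sum>j\<in>?S. \<sigma> bW j)"
    using ok by (simp_all add: ok_dataD)
qed

text \<open>Transitivity for \<open>a / b < c / d\<close> and \<open>c / d \<le> e / f\<close> in
  cross-multiplied form: a new best star stays best against all stars examined before.\<close>

lemma fraction_trans:
  fixes a b c d e f :: nat
  assumes "a * d < c * b" "c * f \<le> e * d" "0 < d"
  shows "a * f \<le> e * b"
proof -
  have "(a * f) * d \<le> (c * f) * b" using mult_le_mono1[OF less_imp_le[OF assms(1)], of f] by (simp add: ac_simps)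
  also have "\<dots> \<le> (e * d) * b" using assms(2) by (rule mult_le_mono1)
  finally have "(a * f) * d \<le> (e * b) * d" by (simp add: ac_simps)
  thus ?thesis using assms(3) by simp
qed

definition search_inv :: "(nat \<Rightarrow> nat) \<Rightarrow> (nat \<Rightarrow> nat) \<Rightarrow> nat \<Rightarrow> banks \<Rightarrow> bool" where
  "search_inv W H x \<tau> \<longleftrightarrow>
     (let A = active H; S = (\<lambda>t. star W H (t div n) (t mod n)); b = \<tau> bBT 0 in
      (\<tau> bBF 0 = 0 \<and> (\<forall>t<x. t mod n \<notin> A)) \<or>
      (\<tau> bBF 0 = 1 \<and> b < x \<and> b mod n \<in> A \<and> \<tau> bBC 0 = star_cost (b div n) (S b) \<and>
       \<tau> bBW 0 = sum W (S b) \<and>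
       (\<forall>t<x. t mod n \<in> A \<longrightarrow> \<tau> bBC 0 * sum W (S t) \<le> star_cost (t div n) (S t) * \<tau> bBW 0)))"

lemma search_inv_cong:
  "search_inv W H x \<tau> \<Longrightarrow> \<tau>' bBF = \<tau> bBF \<Longrightarrow> \<tau>' bBT = \<tau> bBT \<Longrightarrow> \<tau>' bBC = \<tau> bBC \<Longrightarrow> \<tau>' bBW = \<tau> bBW \<Longrightarrow>
   search_inv W H x \<tau>'"
  by (simp add: search_inv_def)

lemma sem_mwu_search:
  assumes ok: "ok_data \<sigma>" and W: "\<And>j. j < n \<Longrightarrow> 0 < \<sigma> bW j" and BF: "\<sigma> bBF 0 = 0"
  shows "search_inv (\<sigma> bW) (\<sigma> bH) (m * n) (sem inp mwu_search \<sigma>)"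
proof -
  let ?P = "\<lambda>x \<tau>. search_inv (\<sigma> bW) (\<sigma> bH) x \<tau>"
  have "?P (ev inp \<sigma> (Var bNM)) (sem inp mwu_search \<sigma>)"
    unfolding mwu_search_def
  proof (rule sem_For_frame[where P = ?P], goal_cases)
    case 1 show ?case by (simp add: mwu_star_def)
  next
    case 2 show ?case using BF by (simp add: search_inv_def)
  next
    case (3 x \<tau>)
    have fr: "\<tau> k = \<sigma> k" if "k \<notin> {vI, vJ, bSC, bSW, bBF, bBC, bBW, bBT}" for k
      by (rule 3(3)) (use that in \<open>simp add: mwu_star_def\<close>)
    have xmn: "x < m * n" using 3(1) ok by (simp add: ok_dataD)
    hence n0: "0 < n" by (cases n) auto
    define i l where "i = x div n" and "l = x mod n"
    have i: "i < m" using xmn by (simp add: i_def less_mult_imp_div_less)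
    have l: "l < n" using n0 by (simp add: l_def)
    have x: "x = i * n + l" by (simp add: i_def l_def)
    have ok': "ok_data \<tau>" by (rule ok_data_frame[OF ok fr]) auto
    have WH: "\<tau> bW = \<sigma> bW" "\<tau> bH = \<sigma> bH" by (simp_all add: fr)
    let ?A = "active (\<sigma> bH)"
    let ?S = "\<lambda>t. star (\<sigma> bW) (\<sigma> bH) (t div n) (t mod n)"
    have test: "ev inp \<tau> (Active (Col (Var vI))) \<noteq> 0 \<longleftrightarrow> l \<in> ?A"
      using ok' 3(2) l by (simp add: ok_dataD x row_col WH active_def not_le)
    show ?case
    proof (cases "l \<in> ?A")
      case False
      hence "ev inp \<tau> (Active (Col (Var vI))) = 0" using test by auto
      hence b: "sem inp (When (Active (Col (Var vI))) c) \<tau> = \<tau>" for c by (simp del: ev.simps)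
      have "?P (Suc x) \<tau>" using 3(4) False unfolding search_inv_def Let_def
        by (auto simp: less_Suc_eq l_def)
      thus ?thesis unfolding b by (rule search_inv_cong) simp_all
    next
      case True
      define \<tau>1 where "\<tau>1 = sem inp mwu_star (sem inp (SetV bSW (Num 0)) (sem inp (SetV bSC (Cell bF (Row (Var vI)))) \<tau>))"
      let ?\<tau>0 = "sem inp (SetV bSW (Num 0)) (sem inp (SetV bSC (Cell bF (Row (Var vI)))) \<tau>)"
      have ok0: "ok_data ?\<tau>0" by (rule ok_data_frame[OF ok']) auto
      have vI0: "?\<tau>0 vI 0 = i * n + l" using 3(2) x by simp
      note ss = sem_mwu_star[OF ok0 i l vI0, of inp]
      have SC: "\<tau>1 bSC 0 = star_cost i (?S x)" and SW: "\<tau>1 bSW 0 = sum (\<sigma> bW) (?S x)"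
        unfolding \<tau>1_def using ss ok' 3(2) i l
        by (simp_all add: ok_dataD row_col x WH star_cost_def)
      have fr1: "\<tau>1 k = \<tau> k" if "k \<notin> {vJ, bSC, bSW}" for k
        unfolding \<tau>1_def by (subst sem_unwritten) (use that in \<open>simp_all add: mwu_star_def\<close>)
      let ?if = "When (Neg (Var bBF) \<oplus> Less (Var bSC \<otimes> Var bBW) (Var bBC \<otimes> Var bSW))
          (SetV bBF (Num 1) ;; SetV bBC (Var bSC) ;; SetV bBW (Var bSW) ;; SetV bBT (Var vI))"
      let ?\<tau>2 = "sem inp ?if \<tau>1"
      have "ev inp \<tau> (Active (Col (Var vI))) \<noteq> 0" using True test by simp
      hence body: "sem inp (When (Active (Col (Var vI)))
       (SetV bSC (Cell bF (Row (Var vI))) ;; SetV bSW (Num 0) ;; mwu_star ;; ?if)) \<tau> = ?\<tau>2"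
        by (simp only: sem.simps \<tau>1_def if_True simp_thms)
      have lx: "x mod n \<in> ?A" using True by (simp add: l_def)
      have posW: "0 < sum (\<sigma> bW) (?S t)" if "t mod n \<in> ?A" for t
        using that W by (intro sum_pos2[of _ "t mod n"]) (auto simp: star_self active_def)
      have "?P (Suc x) ?\<tau>2"
      proof (cases "\<tau> bBF 0 = 0 \<or> \<tau>1 bSC 0 * \<tau> bBW 0 < \<tau> bBC 0 * \<tau>1 bSW 0")
        case upd: True
        have vals: "?\<tau>2 bBF 0 = 1" "?\<tau>2 bBC 0 = \<tau>1 bSC 0" "?\<tau>2 bBW 0 = \<tau>1 bSW 0" "?\<tau>2 bBT 0 = x"
          using upd 3(2) by (auto simp: fr1)
        have "\<tau>1 bSC 0 * sum (\<sigma> bW) (?S t) \<le> star_cost (t div n) (?S t) * \<tau>1 bSW 0"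
          if t: "t < Suc x" "t mod n \<in> ?A" for t
        proof (cases "t = x")
          case True
          thus ?thesis unfolding SC SW by (simp add: i_def)
        next
          case False
          hence tx: "t < x" using t by simp
          have BF1: "\<tau> bBF 0 \<noteq> 0" using 3(4) tx t unfolding search_inv_def Let_def by auto
          hence lt: "\<tau>1 bSC 0 * \<tau> bBW 0 < \<tau> bBC 0 * \<tau>1 bSW 0" using upd by simp
          have old: "\<tau> bBC 0 * sum (\<sigma> bW) (?S t) \<le> star_cost (t div n) (?S t) * \<tau> bBW 0" "0 < \<tau> bBW 0"
            using 3(4) BF1 tx t posW unfolding search_inv_def Let_def by auto
          show ?thesis by (rule fraction_trans[OF lt old])
        qed
        thus ?thesis unfolding search_inv_def Let_def vals using SC SW lx by (simp add: i_def)
      next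
        case keep: False
        have st: "?\<tau>2 = \<tau>1" using keep by (simp add: fr1)
        have "?P (Suc x) \<tau>"
          using 3(4) keep SC SW unfolding search_inv_def Let_def by (auto simp: less_Suc_eq i_def)
        thus ?thesis unfolding st by (rule search_inv_cong) (simp_all add: fr1)
      qed
      thus ?thesis unfolding body by (rule search_inv_cong) simp_all
    qed
  qed
  thus ?thesis using ok by (simp add: ok_dataD)
qed

lemma search_inv_end:
  assumes "search_inv W H (m * n) \<tau>"
  shows "\<tau> bBF 0 = 0 \<and> active H = {} \<or>
    \<tau> bBF 0 = 1 \<and> best_star W H (\<tau> bBT 0 div n) (\<tau> bBT 0 mod n) \<and> \<tau> bBT 0 < m * n"
proof (cases "\<tau> bBF 0 = 0")
  case True
  have "l \<notin> active H" for l
  proof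
    assume l: "l \<in> active H"
    hence "l < n" "0 < n" by (auto simp: active_def)
    hence "l < m * n" "l mod n = l" using sites_ne by (auto intro: less_le_trans[of l n "m * n"])
    thus False using assms True l unfolding search_inv_def Let_def by auto
  qed
  thus ?thesis using True by auto
next
  case False
  let ?b = "\<tau> bBT 0"
  have s: "\<tau> bBF 0 = 1" "?b < m * n" "?b mod n \<in> active H"
    and min: "\<And>t. t < m * n \<Longrightarrow> t mod n \<in> active H \<Longrightarrow>
      star_cost (?b div n) (star W H (?b div n) (?b mod n)) * sum W (star W H (t div n) (t mod n))
      \<le> star_cost (t div n) (star W H (t div n) (t mod n)) * sum W (star W H (?b div n) (?b mod n))"
    using assms False unfolding search_inv_def Let_def by auto
  have "best_star W H (?b div n) (?b mod n)"
    unfolding best_star_def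
  proof (intro conjI allI impI ballI)
    show "?b div n < m" using s by (simp add: less_mult_imp_div_less)
    show "?b mod n \<in> active H" by (rule s)
    fix i' l' assume i': "i' < m" and l': "l' \<in> active H"
    hence ln: "l' < n" by (simp add: active_def)
    have "i' * n + l' < m * n"
    proof -
      have "i' * n + l' < Suc i' * n" using ln by simp
      also have "\<dots> \<le> m * n" using i' by (intro mult_le_mono1) simp
      finally show ?thesis .
    qed
    from min[OF this] show "star_cost (?b div n) (star W H (?b div n) (?b mod n)) * sum W (star W H i' l')
      \<le> star_cost i' (star W H i' l') * sum W (star W H (?b div n) (?b mod n))"
      using ln l' by simp
  qed
  thus ?thesis using s by simp
qed

lemma sem_mwu_record:
  assumes ok: "ok_data \<sigma>" and b: "\<sigma> bBT 0 = i * n + l" "i < m" "l < n" and RM: "\<sigma> bRM 0 = 0"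
    and S: "S = star (\<sigma> bW) (\<sigma> bH) i l" and k: "\<sigma> vK 0 = k"
  shows "S \<noteq> {} \<Longrightarrow> sem inp mwu_record \<sigma> bRM 0 = Min (r ` S)"
    and "sem inp mwu_record \<sigma> bMB y = (if \<exists>j\<in>S. y = k * n + j then 1 else \<sigma> bMB y)"
proof -
  let ?P = "\<lambda>x \<tau>. \<tau> bRM 0 = (if S \<inter> {..<x} = {} then 0 else Min (r ` (S \<inter> {..<x}))) \<and>
    (\<forall>y. \<tau> bMB y = (if \<exists>j\<in>S \<inter> {..<x}. y = k * n + j then 1 else \<sigma> bMB y))"
  have Sn: "S \<inter> {..<n} = S" unfolding S by (auto simp: star_def active_def)
  have "?P (ev inp \<sigma> (Var bNC)) (sem inp mwu_record \<sigma>)"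
    unfolding mwu_record_def
  proof (rule sem_For_frame[where P = ?P], goal_cases)
    case (3 x \<tau>)
    have fr: "\<tau> k = \<sigma> k" if "k \<notin> {vJ, bMB, bRM}" for k by (rule 3(3)) (use that in simp)
    have x: "x < n" using 3(1) ok by (simp add: ok_dataD)
    have ok': "ok_data \<tau>" by (rule ok_data_frame[OF ok fr]) auto
    have t: "\<tau> bBT 0 = i * n + l" using fr[of bBT] b by simp
    note test = ev_InStar[OF ok' b(2,3) x t 3(2)]
    have W: "\<tau> bW = \<sigma> bW" "\<tau> bH = \<sigma> bH" "\<tau> vK 0 = k" using k by (simp_all add: fr)
    show ?case
    proof (cases "x \<in> S")
      case True
      hence ins: "S \<inter> {..<Suc x} = insert x (S \<inter> {..<x})" by (auto simp: less_Suc_eq)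
      have e: "ev inp \<tau> (InStar (Var bBT) (Var vJ)) \<noteq> 0" using True test W S by simp
      have rx: "0 < r x" using r_pos[OF x] .
      let ?c = "Store bMB (Var vK \<otimes> Var bNC \<oplus> Var vJ) (Num 1) ;;
        When (Neg (Var bRM) \<oplus> Less (Cell bR (Var vJ)) (Var bRM)) (SetV bRM (Cell bR (Var vJ)))"
      have body: "sem inp (When (InStar (Var bBT) (Var vJ)) ?c) \<tau> = sem inp ?c \<tau>"
        using e by (simp only: sem.simps if_True simp_thms)
      have "sem inp ?c \<tau> bRM 0 = (if S \<inter> {..<Suc x} = {} then 0 else Min (r ` (S \<inter> {..<Suc x})))"
      proof (cases "S \<inter> {..<x} = {}")
        case True
        thus ?thesis using 3(2,4) ok' x rx unfolding ins by (simp add: ok_dataD)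
      next
        case False
        have "Min (r ` (S \<inter> {..<x})) \<in> r ` (S \<inter> {..<x})" using False by (intro Min_in) auto
        then obtain z where "z \<in> S" "z < x" "Min (r ` (S \<inter> {..<x})) = r z" by auto
        hence "0 < Min (r ` (S \<inter> {..<x}))" using r_pos[of z] x by simp
        hence pos: "0 < \<tau> bRM 0" using 3(4) False by simp
        have "Min (r ` insert x (S \<inter> {..<x})) = min (r x) (\<tau> bRM 0)"
          using 3(4) False by (subst image_insert, subst Min_insert) auto
        moreover have "sem inp ?c \<tau> bRM 0 = min (r x) (\<tau> bRM 0)"
          using 3(2) ok' x pos by (simp add: ok_dataD min_def)
        ultimately show ?thesis unfolding ins by simp
      qed
      moreover have "sem inp ?c \<tau> bMB y = (if \<exists>j\<in>S \<inter> {..<Suc x}. y = k * n + j then 1 else \<sigma> bMB y)" for y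
        using 3(2,4) ok' W unfolding ins by (auto simp: ok_dataD)
      ultimately show ?thesis unfolding body by simp
    next
      case False
      hence "S \<inter> {..<Suc x} = S \<inter> {..<x}" by (auto simp: less_Suc_eq)
      moreover have "ev inp \<tau> (InStar (Var bBT) (Var vJ)) = 0" using False test W S by auto
      ultimately show ?thesis using 3(4) by (simp del: ev.simps)
    qed
  qed (use RM in simp_all)
  hence "?P n (sem inp mwu_record \<sigma>)" using ok by (simp add: ok_dataD)
  thus "S \<noteq> {} \<Longrightarrow> sem inp mwu_record \<sigma> bRM 0 = Min (r ` S)"
    "sem inp mwu_record \<sigma> bMB y = (if \<exists>j\<in>S. y = k * n + j then 1 else \<sigma> bMB y)"
    unfolding Sn by simp_all
qed

lemma sem_mwu_update:
  assumes ok: "ok_data \<sigma>" and k: "\<sigma> vK 0 = k" and MB: "\<And>j. j < n \<Longrightarrow> \<sigma> bMB (k * n + j) \<noteq> 0 \<longleftrightarrow> j \<in> S"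
    and j: "j < n"
  shows "sem inp mwu_update \<sigma> bW j = upd_W S (\<sigma> bRM 0) (\<sigma> bW) j"
    and "sem inp mwu_update \<sigma> bH j = upd_H S (\<sigma> bRM 0) (\<sigma> bH) j"
proof -
  let ?P = "\<lambda>x \<tau>. (\<forall>j<n. \<tau> bW j = (if j < x then upd_W S (\<sigma> bRM 0) (\<sigma> bW) j else \<sigma> bW j)) \<and>
    (\<forall>j<n. \<tau> bH j = (if j < x then upd_H S (\<sigma> bRM 0) (\<sigma> bH) j else \<sigma> bH j))"
  have "?P (ev inp \<sigma> (Var bNC)) (sem inp mwu_update \<sigma>)"
    unfolding mwu_update_def
  proof (rule sem_For_frame[where P = ?P], goal_cases)
    case (3 x \<tau>)
    have fr: "\<tau> k = \<sigma> k" if "k \<notin> {vJ, bW, bH}" for k by (rule 3(3)) (use that in simp)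
    have x: "x < n" using 3(1) ok by (simp add: ok_dataD)
    have ok': "ok_data \<tau>" by (rule ok_data_frame[OF ok fr]) auto
    have W: "\<tau> bMB = \<sigma> bMB" "\<tau> vK 0 = k" "\<tau> bRM = \<sigma> bRM" using k by (simp_all add: fr)
    have Wx: "\<tau> bW x = \<sigma> bW x" "\<tau> bH x = \<sigma> bH x" using 3(4) x by auto
    show ?case
      using 3(2,4) MB[OF x] ok' x W Wx
      by (auto simp: ok_dataD upd_W_def upd_H_def less_Suc_eq)
  qed simp_all
  thus "sem inp mwu_update \<sigma> bW j = upd_W S (\<sigma> bRM 0) (\<sigma> bW) j"
    "sem inp mwu_update \<sigma> bH j = upd_H S (\<sigma> bRM 0) (\<sigma> bH) j"
    using ok j by (simp_all add: ok_dataD)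
qed

definition members :: "banks \<Rightarrow> nat \<Rightarrow> nat set" where
  "members \<tau> k = {j. j < n \<and> \<tau> bMB (k * n + j) \<noteq> 0}"

definition total_cost :: "banks \<Rightarrow> nat \<Rightarrow> nat" where
  "total_cost \<tau> k = (\<Sum>k'<k. star_cost (\<tau> bST k') (members \<tau> k') * \<tau> bAM k')"

text \<open>The quantifier over \<open>Z\<close> keeps the unknown optimum out of the program. The
  zero tails let later phases sum over all \<open>n * NN\<close> rounds, an idle round being a star
  of amount 0.\<close>

definition hist_inv :: "nat \<Rightarrow> banks \<Rightarrow> bool" where
  "hist_inv k \<tau> \<longleftrightarrow>
     (\<forall>Z\<ge>0. dual_bound Z \<longrightarrow> mwu_inv Z k (\<tau> bW) (\<tau> bH) (total_cost \<tau> k)) \<and>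
     (\<forall>j<n. 0 < \<tau> bW j) \<and>
     (\<forall>j<n. \<tau> bH j = (\<Sum>k'<k. if j \<in> members \<tau> k' then \<tau> bAM k' else 0)) \<and>
     (\<forall>k'. \<tau> bAM k' = 0 \<or> \<tau> bST k' < m) \<and>
     (\<forall>k'\<ge>k. \<tau> bAM k' = 0) \<and> (\<forall>y\<ge>k * n. \<tau> bMB y = 0)"

lemma hist_inv_cong:
  assumes "hist_inv k \<tau>" "\<And>l. l \<in> {bW, bH, bST, bAM, bMB} \<Longrightarrow> \<tau>' l = \<tau> l"
  shows "hist_inv k \<tau>'"
proof -
  have eqs: "\<tau>' bW = \<tau> bW" "\<tau>' bH = \<tau> bH" "\<tau>' bST = \<tau> bST" "\<tau>' bAM = \<tau> bAM" "\<tau>' bMB = \<tau> bMB"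
    using assms(2) by auto
  show ?thesis using assms(1) unfolding hist_inv_def total_cost_def members_def eqs .
qed

lemma index_less: "k' < k \<Longrightarrow> j < n \<Longrightarrow> k' * n + j < k * n"
proof -
  assume "k' < k" "j < n"
  have "k' * n + j < Suc k' * n" using \<open>j < n\<close> by simp
  also have "\<dots> \<le> k * n" using \<open>k' < k\<close> by (intro mult_le_mono1) simp
  finally show ?thesis .
qed

lemma upd_W_pos:
  assumes "\<And>j. j < n \<Longrightarrow> 0 < W j" "\<And>j. j \<in> S \<Longrightarrow> c \<le> r j" "j < n"
  shows "0 < upd_W S c W j"
proof -
  have "RP div r j * c < 1000 * RP" if "j \<in> S"
  proof -
    have "RP div r j * c \<le> RP div r j * r j" using assms(2)[OF that] by simp
    also have "\<dots> = RP" by (rule RP_div[OF assms(3)])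
    finally show ?thesis using RP_pos by linarith
  qed
  thus ?thesis using assms(1)[OF assms(3)] RP_pos by (simp add: upd_W_def)
qed

theorem sem_prog_mwu:
  assumes ok: "ok_data \<sigma>" and W: "\<And>j. j < n \<Longrightarrow> \<sigma> bW j = RP div r j"
    and zero: "\<sigma> bH = (\<lambda>_. 0)" "\<sigma> bAM = (\<lambda>_. 0)" "\<sigma> bMB = (\<lambda>_. 0)"
  shows "hist_inv (n * NN) (sem inp prog_mwu \<sigma>)"
proof -
  have "hist_inv (ev inp \<sigma> (Var bKN)) (sem inp prog_mwu \<sigma>)"
    unfolding prog_mwu_def
  proof (rule sem_For_frame[where P = hist_inv], goal_cases)
    case 1 show ?case by (simp add: mwu_search_def mwu_record_def mwu_update_def mwu_star_def)
  next
    case 2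
    have "0 < RP div r j" if "j < n" for j using RP_div[OF that] RP_pos by (cases "RP div r j") auto
    thus ?case using W zero mwu_inv_init[of _ "\<sigma> bW" "\<sigma> bH"]
      by (simp add: hist_inv_def total_cost_def members_def)
  next
    case (3 k \<tau>)
    have fr: "\<tau> l = \<sigma> l" if "l \<in> {2..20}" for l
      by (rule 3(3)) (use that in \<open>auto simp: mwu_search_def mwu_record_def mwu_update_def mwu_star_def\<close>)
    have ok': "ok_data \<tau>" by (rule ok_data_frame[OF ok fr])
    note inv = 3(4)[unfolded hist_inv_def]
    define \<tau>1 where "\<tau>1 = sem inp mwu_search (sem inp (SetV bBF (Num 0)) \<tau>)"
    have fr1: "\<tau>1 l = \<tau> l" if "l \<notin> {vI, vJ, bSC, bSW, bBF, bBC, bBW, bBT}" for l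
      unfolding \<tau>1_def by (subst sem_unwritten) (use that in \<open>simp_all add: mwu_search_def mwu_star_def\<close>)
    have ok0: "ok_data (sem inp (SetV bBF (Num 0)) \<tau>)" by (rule ok_data_frame[OF ok']) auto
    have "search_inv (\<tau> bW) (\<tau> bH) (m * n) \<tau>1"
      using sem_mwu_search[OF ok0, of inp] inv unfolding \<tau>1_def by simp
    note se = search_inv_end[OF this]
    let ?rest = "SetV bRM (Num 0) ;; mwu_record ;; Store bST (Var vK) (Row (Var bBT)) ;;
           Store bAM (Var vK) (Var bRM) ;; mwu_update"
    have body: "sem inp (SetV bBF (Num 0) ;; mwu_search ;; When (Var bBF) ?rest) \<tau> =
      (if \<tau>1 bBF 0 = 0 then \<tau>1 else sem inp ?rest \<tau>1)"
      by (simp add: \<tau>1_def del: sem.simps(1,2)) (simp only: sem.simps simp_thms)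
    show ?case
    proof (cases "\<tau>1 bBF 0 = 0")
      case True
      hence "active (\<tau> bH) = {}" using se by auto
      moreover have "members \<tau> k = {}" using inv by (auto simp: members_def)
      moreover have AMk: "\<tau> bAM k = 0" using inv by auto
      moreover have "\<tau> bMB y = 0" if "Suc k * n \<le> y" for y using inv that by simp
      ultimately have "hist_inv (Suc k) \<tau>"
        using inv mwu_inv_skip unfolding hist_inv_def by (simp add: total_cost_def)
      hence "hist_inv (Suc k) (bump vK \<tau>1)" by (rule hist_inv_cong) (auto simp: fr1)
      thus ?thesis unfolding body using True by simp
    next
      case False
      define i l where "i = \<tau>1 bBT 0 div n" and "l = \<tau>1 bBT 0 mod n"
      have best: "best_star (\<tau> bW) (\<tau> bH) i l" using se False by (auto simp: i_def l_def)
      have i: "i < m" and la: "l \<in> active (\<tau> bH)" using best by (auto simp: best_star_def)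
      have l: "l < n" using la by (simp add: active_def)
      have bt: "\<tau>1 bBT 0 = i * n + l" by (simp add: i_def l_def)
      define S where "S = star (\<tau> bW) (\<tau> bH) i l"
      define a where "a = Min (r ` S)"
      have lS: "l \<in> S" unfolding S_def by (rule star_self[OF la])
      have finS: "finite S" by (simp add: S_def)
      have Sn: "S \<subseteq> {..<n}" by (auto simp: S_def star_def active_def)
      have a_le: "a \<le> r j" if "j \<in> S" for j unfolding a_def using finS that by simp
      define \<tau>2 where "\<tau>2 = sem inp mwu_record (sem inp (SetV bRM (Num 0)) \<tau>1)"
      let ?\<tau>1' = "sem inp (SetV bRM (Num 0)) \<tau>1"
      have ok1: "ok_data ?\<tau>1'" by (rule ok_data_frame[OF ok']) (auto simp: fr1)
      have "\<tau> vK 0 = k" by (rule 3(2))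
      have rec: "\<tau>2 bRM 0 = a" "\<And>y. \<tau>2 bMB y = (if \<exists>j\<in>S. y = k * n + j then 1 else \<tau> bMB y)"
        unfolding \<tau>2_def a_def
        using sem_mwu_record[OF ok1, of i l S k inp] bt i l lS S_def 3(2) by (auto simp: fr1)
      have fr2: "\<tau>2 x = \<tau>1 x" if "x \<notin> {vJ, bMB, bRM}" for x
        unfolding \<tau>2_def by (subst sem_unwritten) (use that in \<open>simp_all add: mwu_record_def\<close>)
      define \<tau>3 where "\<tau>3 = sem inp (Store bAM (Var vK) (Var bRM)) (sem inp (Store bST (Var vK) (Row (Var bBT))) \<tau>2)"
      have n: "\<tau>2 bNC 0 = n" using ok' by (simp add: fr2 fr1 ok_dataD)
      have \<tau>3: "\<tau>3 bAM = (\<tau> bAM)(k := a)" "\<tau>3 bST = (\<tau> bST)(k := i)" "\<tau>3 bRM 0 = a" "\<tau>3 vK 0 = k"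
        "\<tau>3 bMB = \<tau>2 bMB" "\<tau>3 bW = \<tau> bW" "\<tau>3 bH = \<tau> bH"
        unfolding \<tau>3_def using 3(2) rec(1) n l bt by (auto simp: fr2 fr1 fun_eq_iff)
      have fr3: "\<tau>3 x = \<tau>2 x" if "x \<notin> {bAM, bST}" for x using that by (simp add: \<tau>3_def)
      have ok3: "ok_data \<tau>3" by (rule ok_data_frame[OF ok']) (auto simp: fr3 fr2 fr1)
      have MBk: "\<tau>3 bMB (k * n + j) \<noteq> 0 \<longleftrightarrow> j \<in> S" if "j < n" for j
        using inv unfolding \<tau>3(5) rec by auto
      define \<tau>4 where "\<tau>4 = sem inp mwu_update \<tau>3"
      have W': "\<tau>4 bW j = upd_W S a (\<tau> bW) j" "\<tau>4 bH j = upd_H S a (\<tau> bH) j" if "j < n" for j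
        using sem_mwu_update[OF ok3 \<tau>3(4) MBk that, of inp] \<tau>3 by (simp_all add: \<tau>4_def)
      have fr4: "\<tau>4 x = \<tau>3 x" if "x \<notin> {vJ, bW, bH}" for x
        unfolding \<tau>4_def by (rule sem_unwritten) (use that in \<open>simp add: mwu_update_def\<close>)
      have res: "sem inp ?rest \<tau>1 = \<tau>4" by (simp only: sem.simps \<tau>4_def \<tau>3_def \<tau>2_def)
      let ?\<tau> = "bump vK \<tau>4"
      have memk: "members ?\<tau> k = S"
        using MBk Sn by (auto simp: members_def fr4)
      have mem: "members ?\<tau> k' = members \<tau> k'" if "k' < k" for k'
      proof -
        have "?\<tau> bMB (k' * n + j) = \<tau> bMB (k' * n + j)" if j: "j < n" for j
          using index_less[OF \<open>k' < k\<close> j] Sn by (auto simp: fr4 \<tau>3 rec)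
        thus ?thesis by (auto simp: members_def)
      qed
      have tc: "total_cost ?\<tau> (Suc k) = total_cost \<tau> k + star_cost i S * a"
      proof -
        have "(\<Sum>k'<k. star_cost (?\<tau> bST k') (members ?\<tau> k') * ?\<tau> bAM k') = total_cost \<tau> k"
          unfolding total_cost_def by (rule sum.cong) (auto simp: mem fr4 \<tau>3)
        thus ?thesis by (simp add: total_cost_def memk fr4 \<tau>3)
      qed
      have "hist_inv (Suc k) ?\<tau>"
        unfolding hist_inv_def
      proof (intro conjI allI impI)
        fix Z :: real assume Z: "0 \<le> Z" "dual_bound Z"
        hence "mwu_inv Z k (\<tau> bW) (\<tau> bH) (total_cost \<tau> k)" using inv by blast
        from mwu_inv_step[OF Z this best S_def a_def, of "?\<tau> bW" "?\<tau> bH"]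
        show "mwu_inv Z (Suc k) (?\<tau> bW) (?\<tau> bH) (total_cost ?\<tau> (Suc k))"
          unfolding tc using W' by simp
      next
        fix j assume "j < n"
        thus "0 < ?\<tau> bW j" using upd_W_pos[of "\<tau> bW" S a j] W' inv a_le by simp
      next
        fix j assume j: "j < n"
        have "(\<Sum>k'<k. if j \<in> members ?\<tau> k' then ?\<tau> bAM k' else 0) = \<tau> bH j"
        proof -
          have "(\<Sum>k'<k. if j \<in> members ?\<tau> k' then ?\<tau> bAM k' else 0) =
              (\<Sum>k'<k. if j \<in> members \<tau> k' then \<tau> bAM k' else 0)"
            by (rule sum.cong) (auto simp: mem fr4 \<tau>3)
          thus ?thesis using inv j by simp
        qed
        thus "?\<tau> bH j = (\<Sum>k'<Suc k. if j \<in> members ?\<tau> k' then ?\<tau> bAM k' else 0)"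
          using W'(2)[OF j] by (simp add: memk upd_H_def fr4 \<tau>3)
      next
        fix k'
        show "?\<tau> bAM k' = 0 \<or> ?\<tau> bST k' < m" using inv i by (auto simp: fr4 \<tau>3)
      next
        fix k' assume "Suc k \<le> k'"
        thus "?\<tau> bAM k' = 0" using inv by (auto simp: fr4 \<tau>3)
      next
        fix y assume y: "Suc k * n \<le> y"
        have "y \<noteq> k * n + j" if "j \<in> S" for j using y Sn that by auto
        thus "?\<tau> bMB y = 0" using inv y by (auto simp: fr4 \<tau>3 rec)
      qed
      thus ?thesis unfolding body res using False by simp
    qed
  qed
  thus ?thesis using ok by (simp add: ok_dataD)
qed

end

section \<open>Semantics of the rounding phases\<close>

lemma idx_eq: "j < (n::nat) \<Longrightarrow> j' < n \<Longrightarrow> i * n + j = i' * n + j' \<longleftrightarrow> i = i' \<and> j = j'"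
proof
  assume "j < n" "j' < n" "i * n + j = i' * n + j'"
  hence "(i * n + j) div n = (i' * n + j') div n" "(i * n + j) mod n = (i' * n + j') mod n" by simp_all
  thus "i = i' \<and> j = j'" using \<open>j < n\<close> \<open>j' < n\<close> by simp
qed simp

text \<open>Converts sums over valid atoms into sums over stars, block \<open>k\<close> holding the
  atoms of star \<open>k\<close>.\<close>

lemma sum_blocks:
  fixes g :: "nat \<Rightarrow> 'a :: comm_semiring_1"
  assumes "0 < N" "\<And>k. k < K \<Longrightarrow> c k \<le> N"
  shows "(\<Sum>t<K * N. if t mod N < c (t div N) then g (t div N) else 0) = (\<Sum>k<K. of_nat (c k) * g k)"
proof -
  let ?f = "\<lambda>t. if t mod N < c (t div N) then g (t div N) else 0"
  have "(\<Sum>t<K * N. ?f t) = (\<Sum>k<K. sum ?f {k * N..<k * N + N})" by (rule sum.nat_group[symmetric])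
  also have "\<dots> = (\<Sum>k<K. of_nat (c k) * g k)"
  proof (rule sum.cong[OF refl])
    fix k assume k: "k \<in> {..<K}"
    have "sum ?f {k * N..<k * N + N} = (\<Sum>u\<in>{0..<N}. ?f (u + k * N))"
      using sum.shift_bounds_nat_ivl[of ?f 0 "k * N" N] by (simp add: add.commute)
    also have "\<dots> = (\<Sum>u\<in>{0..<N}. if u < c k then g k else 0)"
      by (rule sum.cong) (use assms(1) in auto)
    also have "\<dots> = (\<Sum>u\<in>{..<c k}. g k)"
      by (rule sum.mono_neutral_cong_right) (use assms(2)[of k] k in auto)
    finally show "sum ?f {k * N..<k * N + N} = of_nat (c k) * g k" by simp
  qed
  finally show ?thesis .
qed

context ftfp_data
begin

lemma sem_prog_split:
  assumes ok: "ok_data \<sigma>" and zero: "\<sigma> bY = (\<lambda>_. 0)" "\<sigma> bX = (\<lambda>_. 0)" "\<sigma> bCV = (\<lambda>_. 0)"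
  shows "sem inp prog_split \<sigma> bY i = (\<Sum>k<n * NN. if \<sigma> bST k = i then \<sigma> bAM k div NN else 0)"
    and "j < n \<Longrightarrow> sem inp prog_split \<sigma> bX (i * n + j) =
      (\<Sum>k<n * NN. if \<sigma> bST k = i \<and> j \<in> members \<sigma> k then \<sigma> bAM k div NN else 0)"
    and "j < n \<Longrightarrow> sem inp prog_split \<sigma> bCV j =
      (\<Sum>k<n * NN. if j \<in> members \<sigma> k then \<sigma> bAM k div NN else 0)"
proof -
  let ?P = "\<lambda>x \<tau>. (\<forall>i. \<tau> bY i = (\<Sum>k<x. if \<sigma> bST k = i then \<sigma> bAM k div NN else 0)) \<and>
    (\<forall>i. \<forall>j<n. \<tau> bX (i * n + j) = (\<Sum>k<x. if \<sigma> bST k = i \<and> j \<in> members \<sigma> k then \<sigma> bAM k div NN else 0)) \<and>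
    (\<forall>j<n. \<tau> bCV j = (\<Sum>k<x. if j \<in> members \<sigma> k then \<sigma> bAM k div NN else 0))"
  have "?P (ev inp \<sigma> (Var bKN)) (sem inp prog_split \<sigma>)"
    unfolding prog_split_def
  proof (rule sem_For_frame[where P = ?P], goal_cases)
    case (3 k \<tau>)
    have fr: "\<tau> l = \<sigma> l" if "l \<notin> {vK, vJ, bQQ, bY, bX, bCV}" for l by (rule 3(3)) (use that in simp)
    have ok': "ok_data \<tau>" by (rule ok_data_frame[OF ok fr]) auto
    let ?q = "\<sigma> bAM k div NN"
    let ?A = "SetV bQQ (Cell bAM (Var vK) \<oslash> Var bNN)"
    let ?B = "Incr bY (Cell bST (Var vK)) (Var bQQ)"
    let ?C = "For vJ (Var bNC) (When (Cell2 bMB (Var vK) (Var vJ))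
          (Incr bX (Cell bST (Var vK) \<otimes> Var bNC \<oplus> Var vJ) (Var bQQ) ;; Incr bCV (Var vJ) (Var bQQ)))"
    define \<tau>1 where "\<tau>1 = sem inp ?B (sem inp ?A \<tau>)"
    define \<tau>2 where "\<tau>2 = sem inp ?C \<tau>1"
    have fr1: "\<tau>1 l = \<tau> l" if "l \<notin> {bQQ, bY}" for l
      using that by (simp add: \<tau>1_def)
    have ok1: "ok_data \<tau>1" by (rule ok_data_frame[OF ok' fr1]) auto
    have v1: "\<tau>1 bQQ 0 = ?q" "\<tau>1 bY = (\<tau> bY)(\<sigma> bST k := \<tau> bY (\<sigma> bST k) + ?q)" "\<tau>1 vK 0 = k"
      "\<tau>1 bST k = \<sigma> bST k"
      using 3(2) ok by (simp_all add: \<tau>1_def fr ok_dataD)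
    have MB: "\<tau>1 bMB = \<sigma> bMB" by (simp add: fr1 fr)
    let ?Q = "\<lambda>y \<rho>. (\<forall>i. \<forall>j<n. \<rho> bX (i * n + j) = \<tau> bX (i * n + j) + (if j < y \<and> \<sigma> bST k = i \<and> j \<in> members \<sigma> k then ?q else 0)) \<and>
      (\<forall>j<n. \<rho> bCV j = \<tau> bCV j + (if j < y \<and> j \<in> members \<sigma> k then ?q else 0))"
    have "?Q (ev inp \<tau>1 (Var bNC)) \<tau>2"
      unfolding \<tau>2_def
    proof (rule sem_For_frame[where P = ?Q], goal_cases)
      case 2 show ?case by (simp add: fr1)
    next
      case (3 y \<rho>)
      have frr: "\<rho> l = \<tau>1 l" if "l \<notin> {vJ, bX, bCV}" for l by (rule 3(3)) (use that in simp)
      have y: "y < n" using 3(1) ok1 by (simp add: ok_dataD)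
      have mem: "\<rho> bMB (k * n + y) \<noteq> 0 \<longleftrightarrow> y \<in> members \<sigma> k"
        using y by (simp add: members_def frr MB)
      have v: "\<rho> vK 0 = k" "\<rho> bNC 0 = n" "\<rho> bQQ 0 = ?q" "\<rho> bST k = \<sigma> bST k"
        using v1 ok1 by (simp_all add: frr ok_dataD)
      show ?case
      proof (cases "y \<in> members \<sigma> k")
        case True
        thus ?thesis using 3(2,4) mem v y by (auto simp: idx_eq less_Suc_eq)
      next
        case False
        thus ?thesis using 3(2,4) mem v by (auto simp: less_Suc_eq)
      qed
    qed simp_all
    hence Q: "?Q n \<tau>2" using ok1 by (simp add: ok_dataD)
    have Y2: "\<tau>2 bY = \<tau>1 bY" unfolding \<tau>2_def by (rule sem_unwritten) simp
    have body: "sem inp (?A ;; ?B ;; ?C) \<tau> = \<tau>2" by (simp only: sem.simps \<tau>2_def \<tau>1_def)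
    show ?case unfolding body using 3(4) Q Y2 v1 by auto
  qed (use zero in simp_all)
  hence "?P (n * NN) (sem inp prog_split \<sigma>)" using ok by (simp add: ok_dataD)
  thus "sem inp prog_split \<sigma> bY i = (\<Sum>k<n * NN. if \<sigma> bST k = i then \<sigma> bAM k div NN else 0)"
    "j < n \<Longrightarrow> sem inp prog_split \<sigma> bX (i * n + j) =
      (\<Sum>k<n * NN. if \<sigma> bST k = i \<and> j \<in> members \<sigma> k then \<sigma> bAM k div NN else 0)"
    "j < n \<Longrightarrow> sem inp prog_split \<sigma> bCV j =
      (\<Sum>k<n * NN. if j \<in> members \<sigma> k then \<sigma> bAM k div NN else 0)"
    by blast+
qed

definition valid_atom :: "banks \<Rightarrow> nat \<Rightarrow> bool" where
  "valid_atom \<sigma> t \<longleftrightarrow> t mod NN < \<sigma> bAM (t div NN) mod NN"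

lemma sem_prog_atoms:
  assumes ok: "ok_data \<sigma>" and zero: "\<sigma> bOK = (\<lambda>_. 0)" "\<sigma> bP = (\<lambda>_. 0)"
  shows "t < n * NN * NN \<Longrightarrow> sem inp prog_atoms \<sigma> bOK t \<noteq> 0 \<longleftrightarrow> valid_atom \<sigma> t"
    and "t < n * NN * NN \<Longrightarrow> valid_atom \<sigma> t \<Longrightarrow> sem inp prog_atoms \<sigma> bAS t = \<sigma> bST (t div NN)"
    and "t < n * NN * NN \<Longrightarrow> j < n \<Longrightarrow>
      sem inp prog_atoms \<sigma> bP (t * n + j) \<noteq> 0 \<longleftrightarrow> valid_atom \<sigma> t \<and> j \<in> members \<sigma> (t div NN)"
    and "j < n \<Longrightarrow> sem inp prog_atoms \<sigma> bRR j = r j - \<sigma> bCV j"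
proof -
  let ?P = "\<lambda>x \<tau>. (\<forall>t. \<tau> bOK t \<noteq> 0 \<longleftrightarrow> t < x \<and> valid_atom \<sigma> t) \<and>
    (\<forall>t<x. valid_atom \<sigma> t \<longrightarrow> \<tau> bAS t = \<sigma> bST (t div NN)) \<and>
    (\<forall>t. \<forall>j<n. \<tau> bP (t * n + j) \<noteq> 0 \<longleftrightarrow> t < x \<and> valid_atom \<sigma> t \<and> j \<in> members \<sigma> (t div NN))"
  let ?C = "For vJ (Var bNC) (Store bP (Var vI \<otimes> Var bNC \<oplus> Var vJ) (Cell2 bMB eAK (Var vJ)))"
  let ?A = "For vI (Var bTN)
       (When (Less (Var vI \<ominus> eAK \<otimes> Var bNN)
                (Cell bAM eAK \<ominus> (Cell bAM eAK \<oslash> Var bNN) \<otimes> Var bNN))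
         (Store bOK (Var vI) (Num 1) ;; Store bAS (Var vI) (Cell bST eAK) ;; ?C))"
  let ?B = "For vJ (Var bNC) (Store bRR (Var vJ) (Cell bR (Var vJ) \<ominus> Cell bCV (Var vJ)))"
  define sA where "sA = sem inp ?A \<sigma>"
  have st: "sem inp prog_atoms \<sigma> = sem inp ?B sA" by (simp only: prog_atoms_def sem.simps sA_def)
  have "?P (ev inp \<sigma> (Var bTN)) sA"
    unfolding sA_def
  proof (rule sem_For_frame[where P = ?P], goal_cases)
    case (3 x \<tau>)
    have fr: "\<tau> l = \<sigma> l" if "l \<notin> {vI, vJ, bOK, bAS, bP}" for l by (rule 3(3)) (use that in simp)
    have ok': "ok_data \<tau>" by (rule ok_data_frame[OF ok fr]) auto
    have test: "ev inp \<tau> (Less (Var vI \<ominus> eAK \<otimes> Var bNN)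
        (Cell bAM eAK \<ominus> (Cell bAM eAK \<oslash> Var bNN) \<otimes> Var bNN)) \<noteq> 0 \<longleftrightarrow> valid_atom \<sigma> x"
      using 3(2) ok by (simp add: fr ok_dataD valid_atom_def minus_div_mult_eq_mod not_le)
    show ?case
    proof (cases "valid_atom \<sigma> x")
      case False
      hence "ev inp \<tau> (Less (Var vI \<ominus> eAK \<otimes> Var bNN)
        (Cell bAM eAK \<ominus> (Cell bAM eAK \<oslash> Var bNN) \<otimes> Var bNN)) = 0" using test by blast
      hence body: "sem inp (When (Less (Var vI \<ominus> eAK \<otimes> Var bNN)
        (Cell bAM eAK \<ominus> (Cell bAM eAK \<oslash> Var bNN) \<otimes> Var bNN)) c) \<tau> = \<tau>" for c
        by (simp only: sem.simps simp_thms if_False)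
      show ?thesis unfolding body using 3(4) False by (auto simp: less_Suc_eq)
    next
      case True
      have body: "sem inp (When (Less (Var vI \<ominus> eAK \<otimes> Var bNN)
        (Cell bAM eAK \<ominus> (Cell bAM eAK \<oslash> Var bNN) \<otimes> Var bNN)) c) \<tau> = sem inp c \<tau>" for c
        using test True by (simp only: sem.simps simp_thms if_True)
      define \<tau>1 where "\<tau>1 = sem inp (Store bAS (Var vI) (Cell bST eAK)) (sem inp (Store bOK (Var vI) (Num 1)) \<tau>)"
      have fr1: "\<tau>1 l = \<tau> l" if "l \<notin> {bOK, bAS}" for l using that by (simp add: \<tau>1_def)
      have ok1: "ok_data \<tau>1" by (rule ok_data_frame[OF ok' fr1]) auto
      have v1: "\<tau>1 bOK = (\<tau> bOK)(x := 1)" "\<tau>1 bAS = (\<tau> bAS)(x := \<sigma> bST (x div NN))" "\<tau>1 vI 0 = x"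
        "\<tau>1 bMB = \<sigma> bMB"
        using 3(2) ok by (auto simp: \<tau>1_def fr ok_dataD fun_eq_iff)
      define \<tau>2 where "\<tau>2 = sem inp ?C \<tau>1"
      let ?Q = "\<lambda>y \<rho>. \<forall>t. \<forall>j<n. \<rho> bP (t * n + j) = (if t = x \<and> j < y then \<sigma> bMB (x div NN * n + j) else \<tau> bP (t * n + j))"
      have "?Q (ev inp \<tau>1 (Var bNC)) \<tau>2"
        unfolding \<tau>2_def
      proof (rule sem_For_frame[where P = ?Q], goal_cases)
        case 2 show ?case by (simp add: fr1)
      next
        case (3 y \<rho>)
        have frr: "\<rho> l = \<tau>1 l" if "l \<notin> {vJ, bP}" for l by (rule 3(3)) (use that in simp)
        have y: "y < n" using 3(1) ok1 by (simp add: ok_dataD)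
        show ?case using 3(2,4) v1 ok1 y by (auto simp: frr ok_dataD idx_eq less_Suc_eq)
      qed simp_all
      hence Q: "?Q n \<tau>2" using ok1 by (simp add: ok_dataD)
      have fr2: "\<tau>2 l = \<tau>1 l" if "l \<notin> {vJ, bP}" for l unfolding \<tau>2_def by (rule sem_unwritten) (use that in simp)
      have b2: "sem inp (Store bOK (Var vI) (Num 1) ;; Store bAS (Var vI) (Cell bST eAK) ;; ?C) \<tau> = \<tau>2"
        by (simp only: sem.simps \<tau>2_def \<tau>1_def)
      have "bump vI \<tau>2 bOK = (\<tau> bOK)(x := 1)" "bump vI \<tau>2 bAS = (\<tau> bAS)(x := \<sigma> bST (x div NN))"
        "bump vI \<tau>2 bP = \<tau>2 bP"
        by (auto simp: fr2 v1 fun_eq_iff)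
      thus ?thesis unfolding body b2 using 3(4) Q True by (auto simp: less_Suc_eq members_def)
    qed
  qed (use zero in simp_all)
  hence A: "?P (n * NN * NN) sA" using ok by (simp add: ok_dataD)
  have frA: "sA l = \<sigma> l" if "l \<notin> {vI, vJ, bOK, bAS, bP}" for l unfolding sA_def by (rule sem_unwritten) (use that in simp)
  have "\<forall>j<ev inp sA (Var bNC). sem inp ?B sA bRR j = r j - \<sigma> bCV j"
  proof (rule sem_For_frame[where P = "\<lambda>x \<tau>. \<forall>j<x. \<tau> bRR j = r j - \<sigma> bCV j"], goal_cases)
    case (3 x \<tau>)
    thus ?case using ok by (auto simp: frA ok_dataD less_Suc_eq)
  qed simp_all
  thus "j < n \<Longrightarrow> sem inp prog_atoms \<sigma> bRR j = r j - \<sigma> bCV j" unfolding st using ok by (simp add: frA ok_dataD)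
  have frB: "sem inp ?B sA l = sA l" if "l \<notin> {vJ, bRR}" for l by (rule sem_unwritten) (use that in simp)
  have eqs: "sem inp prog_atoms \<sigma> bOK = sA bOK" "sem inp prog_atoms \<sigma> bAS = sA bAS"
    "sem inp prog_atoms \<sigma> bP = sA bP"
    unfolding st by (rule frB; simp)+
  show "t < n * NN * NN \<Longrightarrow> sem inp prog_atoms \<sigma> bOK t \<noteq> 0 \<longleftrightarrow> valid_atom \<sigma> t"
    "t < n * NN * NN \<Longrightarrow> valid_atom \<sigma> t \<Longrightarrow> sem inp prog_atoms \<sigma> bAS t = \<sigma> bST (t div NN)"
    "t < n * NN * NN \<Longrightarrow> j < n \<Longrightarrow>
      sem inp prog_atoms \<sigma> bP (t * n + j) \<noteq> 0 \<longleftrightarrow> valid_atom \<sigma> t \<and> j \<in> members \<sigma> (t div NN)"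
    unfolding eqs using A by simp_all
qed

end

lemma sem_Then_When:
  "sem inp (a ;; b ;; When (Var k) c) \<tau> =
     (if sem inp b (sem inp a \<tau>) k 0 = 0 then sem inp b (sem inp a \<tau>)
      else sem inp c (sem inp b (sem inp a \<tau>)))"
  by simp

lemma ev_Times_nonzero:
  "ev inp \<tau> (a \<otimes> b) \<noteq> 0 \<longleftrightarrow> ev inp \<tau> a \<noteq> 0 \<and> ev inp \<tau> b \<noteq> 0"
  by simp

section \<open>Execution of the clustering phase\<close>

context ftfp_atoms
begin

definition pool :: "banks \<Rightarrow> nat \<Rightarrow> nat set" where
  "pool \<tau> j = {t. t < T \<and> \<tau> bP (t * n + j) \<noteq> 0}"

definition ok_atoms :: "banks \<Rightarrow> bool" where
  "ok_atoms \<sigma> \<longleftrightarrow> ok_data \<sigma> \<and> T = n * NN * NN \<and> (\<forall>j<n. \<forall>t\<in>P0 j. \<sigma> bAS t = site t) \<and> (\<forall>j<n. \<sigma> bRR j = RR j)"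

lemma ok_atoms_frame:
  assumes "ok_atoms \<sigma>" "\<And>l. l \<in> {2..20} \<union> {bAS, bRR} \<Longrightarrow> \<tau> l = \<sigma> l"
  shows "ok_atoms \<tau>"
  using assms ok_data_frame[of \<sigma> \<tau>] unfolding ok_atoms_def by simp

lemma finite_pool [simp]: "finite (pool \<tau> j)"
  by (simp add: pool_def)

lemma pool_cong: "\<tau> bP = \<sigma> bP \<Longrightarrow> pool \<tau> = pool \<sigma>"
  by (simp add: pool_def fun_eq_iff)

lemma ok_atoms_dist:
  assumes "ok_atoms \<sigma>" "j < n" "t \<in> P0 j"
  shows "\<sigma> bD (\<sigma> bAS t * n + j) = \<delta> j t"
  using assms site_less[OF assms(2,3)] unfolding ok_atoms_def by (auto simp: ok_dataD \<delta>_def)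

lemma ok_atomsD:
  assumes "ok_atoms \<sigma>" shows "ok_data \<sigma>" "\<sigma> bTN 0 = T" "\<And>j. j < n \<Longrightarrow> \<sigma> bRR j = RR j"
  using assms by (auto simp: ok_atoms_def ok_dataD)

lemma sem_cl_count:
  assumes ok: "ok_atoms \<sigma>" and sub: "pool \<sigma> p \<subseteq> P0 p" and p: "\<sigma> vP 0 = p" "p < n"
    and t: "\<sigma> vI 0 = t" "t \<in> pool \<sigma> p" and 0: "\<sigma> bCNT 0 = 0"
  shows "sem inp cl_count \<sigma> bCNT 0 = card {v \<in> pool \<sigma> p. \<delta> p v \<le> \<delta> p t}"
proof -
  let ?S = "{v \<in> pool \<sigma> p. \<delta> p v \<le> \<delta> p t}"
  have "sem inp cl_count \<sigma> bCNT 0 = card (?S \<inter> {..<ev inp \<sigma> (Var bTN)})"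
    unfolding cl_count_def
  proof (rule sem_For_frame[where P = "\<lambda>x \<tau>. \<tau> bCNT 0 = card (?S \<inter> {..<x})"], goal_cases)
    case (3 x \<tau>)
    have fr: "\<tau> l = \<sigma> l" if "l \<notin> {vV, bCNT}" for l by (rule 3(3)) (use that in simp)
    have x: "x < T" using 3(1) ok by (simp add: ok_atomsD)
    have ok': "ok_atoms \<tau>" by (rule ok_atoms_frame[OF ok fr]) auto
    have dt: "\<sigma> bD (\<sigma> bAS t * n + p) = \<delta> p t" using ok_atoms_dist[OF ok p(2)] sub t by auto
    have dx: "\<sigma> bD (\<sigma> bAS x * n + p) = \<delta> p x" if "x \<in> pool \<sigma> p"
      using ok_atoms_dist[OF ok p(2)] sub that by auto
    have n: "\<sigma> bNC 0 = n" using ok by (simp add: ok_atomsD ok_dataD)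
    have test: "ev inp \<tau> (Cell2 bP (Var vV) (Var vP) \<otimes> Leq (Dist (Var vV) (Var vP)) (Dist (Var vI) (Var vP))) \<noteq> 0
        \<longleftrightarrow> x \<in> ?S"
      using 3(2) p t n dt dx x by (auto simp: fr pool_def)
    show ?case
    proof (cases "x \<in> ?S")
      case True
      hence "?S \<inter> {..<Suc x} = insert x (?S \<inter> {..<x})" by (auto simp: less_Suc_eq)
      hence "card (?S \<inter> {..<Suc x}) = Suc (card (?S \<inter> {..<x}))" by simp
      moreover have "ev inp \<tau> (Cell2 bP (Var vV) (Var vP) \<otimes> Leq (Dist (Var vV) (Var vP)) (Dist (Var vI) (Var vP))) \<noteq> 0"
        using True test by blast
      ultimately show ?thesis using 3(4) by (simp only: sem.simps if_True simp_thms) simp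
    next
      case False
      hence "?S \<inter> {..<Suc x} = ?S \<inter> {..<x}" by (auto simp: less_Suc_eq)
      moreover have "ev inp \<tau> (Cell2 bP (Var vV) (Var vP) \<otimes> Leq (Dist (Var vV) (Var vP)) (Dist (Var vI) (Var vP))) = 0"
        using False test by blast
      ultimately show ?thesis using 3(4) by (simp only: sem.simps if_False simp_thms) simp
    qed
  qed (use 0 in simp_all)
  moreover have "?S \<inter> {..<T} = ?S" by (auto simp: pool_def)
  ultimately show ?thesis using ok by (simp add: ok_atomsD)
qed

text \<open>The set \<open>C\<close> of candidates examined so far is a parameter, so that one
  invariant serves both the loop over atoms and the surrounding loop over clients.\<close>

definition best_inv :: "(nat \<times> nat) set \<Rightarrow> banks \<Rightarrow> bool" where
  "best_inv C \<tau> \<longleftrightarrow> (\<tau> bBF 0 = 0 \<and> C = {}) \<or>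
     (\<tau> bBF 0 = 1 \<and> (\<exists>t. (\<tau> bBP 0, t) \<in> C \<and> \<tau> bBD 0 = \<delta> (\<tau> bBP 0) t) \<and>
      (\<forall>(j, t)\<in>C. \<tau> bBD 0 \<le> \<delta> j t))"

lemma best_inv_cong:
  "best_inv C \<tau> \<Longrightarrow> \<tau>' bBF = \<tau> bBF \<Longrightarrow> \<tau>' bBD = \<tau> bBD \<Longrightarrow> \<tau>' bBP = \<tau> bBP \<Longrightarrow> best_inv C \<tau>'"
  by (simp add: best_inv_def)

definition cands :: "banks \<Rightarrow> nat \<Rightarrow> nat \<Rightarrow> (nat \<times> nat) set" where
  "cands \<sigma> p x = {(p, t) | t. t < x \<and> t \<in> pool \<sigma> p \<and> crowded (pool \<sigma>) p (\<delta> p t)}"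

lemma sem_cl_search_client:
  assumes ok: "ok_atoms \<sigma>" and sub: "pool \<sigma> p \<subseteq> P0 p" and p: "\<sigma> vP 0 = p" "p < n"
    and C: "best_inv C \<sigma>"
  shows "best_inv (C \<union> cands \<sigma> p T) (sem inp cl_search_client \<sigma>)"
proof -
  have "best_inv (C \<union> cands \<sigma> p (ev inp \<sigma> (Var bTN))) (sem inp cl_search_client \<sigma>)"
    unfolding cl_search_client_def
  proof (rule sem_For_frame[where P = "\<lambda>x \<tau>. best_inv (C \<union> cands \<sigma> p x) \<tau>"], goal_cases)
    case 1 show ?case by (simp add: cl_count_def)
  next
    case 2 show ?case using C by (simp add: best_inv_def cands_def)
  next
    case (3 x \<tau>)
    have fr: "\<tau> l = \<sigma> l" if "l \<notin> {vI, vV, bCNT, bBF, bBD, bBP}" for l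
      by (rule 3(3)) (use that in \<open>simp add: cl_count_def\<close>)
    have ok': "ok_atoms \<tau>" by (rule ok_atoms_frame[OF ok fr]) auto
    have pool: "pool \<tau> = pool \<sigma>" by (rule pool_cong) (simp add: fr)
    have x: "x < T" using 3(1) ok by (simp add: ok_atomsD)
    have n: "\<tau> bNC 0 = n" using ok' by (simp add: ok_atomsD ok_dataD)
    have vP: "\<tau> vP 0 = p" using p by (simp add: fr)
    have test: "ev inp \<tau> (Cell2 bP (Var vI) (Var vP)) \<noteq> 0 \<longleftrightarrow> x \<in> pool \<sigma> p"
      using 3(2) n vP x by (simp add: pool[symmetric] pool_def)
    show ?case
    proof (cases "x \<in> pool \<sigma> p")
      case False
      hence e0: "ev inp \<tau> (Cell2 bP (Var vI) (Var vP)) = 0" using test by blast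
      have "cands \<sigma> p (Suc x) = cands \<sigma> p x" using False by (auto simp: cands_def less_Suc_eq)
      thus ?thesis using 3(4) unfolding sem.simps e0 by (auto intro: best_inv_cong)
    next
      case True
      define \<tau>1 where "\<tau>1 = sem inp cl_count (sem inp (SetV bCNT (Num 0)) \<tau>)"
      have fr1: "\<tau>1 l = \<tau> l" if "l \<notin> {vV, bCNT}" for l
        unfolding \<tau>1_def by (subst sem_unwritten) (use that in \<open>simp_all add: cl_count_def\<close>)
      have ok0: "ok_atoms (sem inp (SetV bCNT (Num 0)) \<tau>)" by (rule ok_atoms_frame[OF ok']) auto
      have pool0: "pool (sem inp (SetV bCNT (Num 0)) \<tau>) = pool \<sigma>" unfolding pool[symmetric] by (rule pool_cong) simp
      have cnt: "\<tau>1 bCNT 0 = card {v \<in> pool \<sigma> p. \<delta> p v \<le> \<delta> p x}"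
        unfolding \<tau>1_def using sem_cl_count[OF ok0, of p x inp] pool0 sub vP p(2) 3(2) True by simp
      have d: "\<tau> bD (\<tau> bAS x * n + p) = \<delta> p x" using ok_atoms_dist[OF ok' p(2)] sub True by auto
      let ?cond = "Leq (Var bLL) (Var bCNT) \<otimes> (Neg (Var bBF) \<oplus> Less (Dist (Var vI) (Var vP)) (Var bBD))"
      let ?upd = "SetV bBF (Num 1) ;; SetV bBD (Dist (Var vI) (Var vP)) ;; SetV bBP (Var vP)"
      have e1: "ev inp \<tau> (Cell2 bP (Var vI) (Var vP)) \<noteq> 0" using True test by blast
      have body: "sem inp (When (Cell2 bP (Var vI) (Var vP)) (SetV bCNT (Num 0) ;; cl_count ;; When ?cond ?upd)) \<tau>
          = sem inp (When ?cond ?upd) \<tau>1"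
        using e1 by (simp only: sem.simps \<tau>1_def if_True simp_thms)
      have LL: "\<tau>1 bLL 0 = LL" using ok' by (simp add: fr1 ok_atomsD ok_dataD)
      have cond: "ev inp \<tau>1 ?cond \<noteq> 0 \<longleftrightarrow> crowded (pool \<sigma>) p (\<delta> p x) \<and> (\<tau> bBF 0 = 0 \<or> \<delta> p x < \<tau> bBD 0)"
        using cnt LL n vP d 3(2) by (auto simp: fr1 crowded_def)
      show ?thesis
      proof (cases "crowded (pool \<sigma>) p (\<delta> p x) \<and> (\<tau> bBF 0 = 0 \<or> \<delta> p x < \<tau> bBD 0)")
        case upd: True
        hence "sem inp (When ?cond ?upd) \<tau>1 = sem inp ?upd \<tau>1" using cond by (simp only: sem.simps if_True simp_thms)
        moreover have "sem inp ?upd \<tau>1 bBF 0 = 1" "sem inp ?upd \<tau>1 bBD 0 = \<delta> p x" "sem inp ?upd \<tau>1 bBP 0 = p"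
          using n vP d 3(2) by (simp_all add: fr1)
        moreover have "cands \<sigma> p (Suc x) = insert (p, x) (cands \<sigma> p x)"
          using upd True by (auto simp: cands_def less_Suc_eq)
        moreover have "\<delta> p x \<le> \<delta> j t" if "(j, t) \<in> C \<union> cands \<sigma> p x" for j t
        proof -
          have "\<tau> bBF 0 \<noteq> 0" using 3(4) that unfolding best_inv_def by auto
          hence "\<delta> p x < \<tau> bBD 0" "\<tau> bBD 0 \<le> \<delta> j t" using 3(4) upd that unfolding best_inv_def by auto
          thus ?thesis by simp
        qed
        ultimately show ?thesis unfolding body best_inv_def by auto
      next
        case keep: False
        hence "ev inp \<tau>1 ?cond = 0" using cond by blast
        hence st: "sem inp (When ?cond ?upd) \<tau>1 = \<tau>1" by (simp only: sem.simps if_False simp_thms)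
        have "best_inv (C \<union> cands \<sigma> p (Suc x)) \<tau>"
        proof (cases "crowded (pool \<sigma>) p (\<delta> p x)")
          case True
          hence "cands \<sigma> p (Suc x) = insert (p, x) (cands \<sigma> p x)"
            using \<open>x \<in> pool \<sigma> p\<close> by (auto simp: cands_def less_Suc_eq)
          thus ?thesis using 3(4) keep True unfolding best_inv_def by auto
        next
          case False
          hence "cands \<sigma> p (Suc x) = cands \<sigma> p x" by (auto simp: cands_def less_Suc_eq)
          thus ?thesis using 3(4) by simp
        qed
        thus ?thesis unfolding body st by (rule best_inv_cong) (simp_all add: fr1)
      qed
    qed
  qed
  thus ?thesis using ok by (simp add: ok_atomsD)
qed

definition all_cands :: "banks \<Rightarrow> nat \<Rightarrow> (nat \<times> nat) set" where
  "all_cands \<sigma> x = {(j, t). j < x \<and> \<sigma> bKJ j < RR j \<and> t \<in> pool \<sigma> j \<and> crowded (pool \<sigma>) j (\<delta> j t)}"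

lemma sem_cl_search:
  assumes ok: "ok_atoms \<sigma>" and sub: "\<And>j. j < n \<Longrightarrow> pool \<sigma> j \<subseteq> P0 j" and 0: "\<sigma> bBF 0 = 0"
  shows "best_inv (all_cands \<sigma> n) (sem inp cl_search \<sigma>)"
proof -
  have "best_inv (all_cands \<sigma> (ev inp \<sigma> (Var bNC))) (sem inp cl_search \<sigma>)"
    unfolding cl_search_def
  proof (rule sem_For_frame[where P = "\<lambda>x \<tau>. best_inv (all_cands \<sigma> x) \<tau>"], goal_cases)
    case 1 show ?case by (simp add: cl_search_client_def cl_count_def)
  next
    case 2 show ?case using 0 by (simp add: best_inv_def all_cands_def)
  next
    case (3 x \<tau>)
    have fr: "\<tau> l = \<sigma> l" if "l \<notin> {vP, vI, vV, bCNT, bBF, bBD, bBP}" for l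
      by (rule 3(3)) (use that in \<open>simp add: cl_search_client_def cl_count_def\<close>)
    have ok': "ok_atoms \<tau>" by (rule ok_atoms_frame[OF ok fr]) auto
    have pool: "pool \<tau> = pool \<sigma>" by (rule pool_cong) (simp add: fr)
    have x: "x < n" using 3(1) ok by (simp add: ok_atomsD ok_dataD)
    have test: "ev inp \<tau> (Less (Cell bKJ (Var vP)) (Cell bRR (Var vP))) \<noteq> 0 \<longleftrightarrow> \<sigma> bKJ x < RR x"
      using 3(2) ok' x by (simp add: fr ok_atomsD not_le[symmetric]) (simp add: fr[symmetric] ok_atomsD[OF ok'])
    show ?case
    proof (cases "\<sigma> bKJ x < RR x")
      case True
      have e: "ev inp \<tau> (Less (Cell bKJ (Var vP)) (Cell bRR (Var vP))) \<noteq> 0" using True test by blast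
      have "best_inv (all_cands \<sigma> x \<union> cands \<tau> x T) (sem inp cl_search_client \<tau>)"
        by (rule sem_cl_search_client[OF ok' _ 3(2) x 3(4)]) (use sub x pool in simp)
      moreover have "all_cands \<sigma> x \<union> cands \<tau> x T = all_cands \<sigma> (Suc x)"
        using True by (auto simp: all_cands_def cands_def less_Suc_eq pool pool_def)
      ultimately have "best_inv (all_cands \<sigma> (Suc x)) (sem inp cl_search_client \<tau>)" by simp
      thus ?thesis using e by (simp only: sem.simps if_True simp_thms) (auto elim: best_inv_cong)
    next
      case False
      hence e0: "ev inp \<tau> (Less (Cell bKJ (Var vP)) (Cell bRR (Var vP))) = 0" using test by blast
      have "all_cands \<sigma> (Suc x) = all_cands \<sigma> x" using False by (auto simp: all_cands_def less_Suc_eq)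
      hence "best_inv (all_cands \<sigma> (Suc x)) \<tau>" using 3(4) by simp
      thus ?thesis unfolding sem.simps e0 by (auto elim: best_inv_cong)
    qed
  qed
  thus ?thesis using ok by (simp add: ok_atomsD ok_dataD)
qed

definition near :: "banks \<Rightarrow> nat set" where
  "near \<sigma> = {t \<in> pool \<sigma> (\<sigma> bBP 0). \<delta> (\<sigma> bBP 0) t \<le> \<sigma> bBD 0}"

lemma ev_Near:
  assumes "ok_atoms \<tau>" "\<And>j. j < n \<Longrightarrow> pool \<tau> j \<subseteq> P0 j" "\<tau> bBP 0 < n" "\<tau> vI 0 = x" "x < T"
  shows "ev inp \<tau> (Near (Var vI)) \<noteq> 0 \<longleftrightarrow> x \<in> near \<tau>"
proof -
  have n: "\<tau> bNC 0 = n" using assms(1) by (simp add: ok_atomsD ok_dataD)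
  have "\<tau> bD (\<tau> bAS x * n + \<tau> bBP 0) = \<delta> (\<tau> bBP 0) x" if "x \<in> pool \<tau> (\<tau> bBP 0)"
    using ok_atoms_dist[OF assms(1,3)] assms(2)[OF assms(3)] that by auto
  thus ?thesis using assms(4,5) n by (auto simp: near_def pool_def)
qed

lemma near_cong: "\<tau> bP = \<sigma> bP \<Longrightarrow> \<tau> bBP = \<sigma> bBP \<Longrightarrow> \<tau> bBD = \<sigma> bBD \<Longrightarrow> near \<tau> = near \<sigma>"
  using pool_cong[of \<tau> \<sigma>] by (simp add: near_def)

lemma sem_cl_lookup:
  assumes ok: "ok_atoms \<sigma>" and sub: "\<And>j. j < n \<Longrightarrow> pool \<sigma> j \<subseteq> P0 j" and p: "\<sigma> bBP 0 < n" and 0: "\<sigma> bKP 0 = 0"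
  shows "(sem inp cl_lookup \<sigma> bKP 0 = 0 \<and> (\<forall>t\<in>near \<sigma>. \<sigma> bCL t = 0)) \<or>
    (sem inp cl_lookup \<sigma> bKP 0 \<noteq> 0 \<and> (\<exists>t\<in>near \<sigma>. \<sigma> bCL t = sem inp cl_lookup \<sigma> bKP 0))"
proof -
  let ?P = "\<lambda>x \<tau>. (\<tau> bKP 0 = 0 \<and> (\<forall>t\<in>near \<sigma>. t < x \<longrightarrow> \<sigma> bCL t = 0)) \<or>
    (\<tau> bKP 0 \<noteq> 0 \<and> (\<exists>t\<in>near \<sigma>. \<sigma> bCL t = \<tau> bKP 0))"
  have "?P (ev inp \<sigma> (Var bTN)) (sem inp cl_lookup \<sigma>)"
    unfolding cl_lookup_def
  proof (rule sem_For_frame[where P = ?P], goal_cases)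
    case (3 x \<tau>)
    have fr: "\<tau> l = \<sigma> l" if "l \<notin> {vI, bKP}" for l by (rule 3(3)) (use that in simp)
    have ok': "ok_atoms \<tau>" by (rule ok_atoms_frame[OF ok fr]) auto
    have pool: "pool \<tau> = pool \<sigma>" by (rule pool_cong) (simp add: fr)
    have nr: "near \<tau> = near \<sigma>" by (rule near_cong) (simp_all add: fr)
    have x: "x < T" using 3(1) ok by (simp add: ok_atomsD)
    have h1: "ev inp \<tau> (Near (Var vI)) \<noteq> 0 \<longleftrightarrow> x \<in> near \<sigma>"
      unfolding nr[symmetric] by (rule ev_Near[OF ok' _ _ 3(2) x]) (use sub p pool fr in simp_all)
    have h2: "ev inp \<tau> (Cell bCL (Var vI)) \<noteq> 0 \<longleftrightarrow> \<sigma> bCL x \<noteq> 0" using 3(2) by (simp add: fr)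
    have test: "ev inp \<tau> (Near (Var vI) \<otimes> Cell bCL (Var vI)) \<noteq> 0 \<longleftrightarrow> x \<in> near \<sigma> \<and> \<sigma> bCL x \<noteq> 0"
      using h1 h2 ev_Times_nonzero by metis
    show ?case
    proof (cases "x \<in> near \<sigma> \<and> \<sigma> bCL x \<noteq> 0")
      case True
      hence e: "ev inp \<tau> (Near (Var vI) \<otimes> Cell bCL (Var vI)) \<noteq> 0" using test by blast
      have b: "sem inp (When (Near (Var vI) \<otimes> Cell bCL (Var vI)) (SetV bKP (Cell bCL (Var vI)))) \<tau>
          = sem inp (SetV bKP (Cell bCL (Var vI))) \<tau>"
        using e by (simp only: sem.simps if_True simp_thms)
      show ?thesis unfolding b using True 3(2) by (auto simp: fr)
    next
      case False
      hence e0: "ev inp \<tau> (Near (Var vI) \<otimes> Cell bCL (Var vI)) = 0" using test by blast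
      show ?thesis unfolding sem.simps e0 using 3(4) False by (auto simp: less_Suc_eq)
    qed
  qed (use 0 in simp_all)
  thus ?thesis using ok by (auto simp: ok_atomsD near_def pool_def)
qed

text \<open>The counter is at once the rank of the next atom and the size of the set built so far.
  The test against \<open>LL\<close> stops it at exactly \<open>LL\<close> atoms, even if more of
  them are near.\<close>

lemma sem_cl_create:
  assumes ok: "ok_atoms \<sigma>" and sub: "\<And>j. j < n \<Longrightarrow> pool \<sigma> j \<subseteq> P0 j" and p: "\<sigma> bBP 0 < n" and 0: "\<sigma> bCNT 0 = 0"
    and k: "\<sigma> vK 0 = k" and card: "LL \<le> card (near \<sigma>)"
  shows "\<exists>B \<subseteq> near \<sigma>. bij_betw (sem inp cl_create \<sigma> bRK) B {..<LL} \<and>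
    (\<forall>t. sem inp cl_create \<sigma> bCL t = (if t \<in> B then Suc k else \<sigma> bCL t) \<and>
       (t \<notin> B \<longrightarrow> sem inp cl_create \<sigma> bRK t = \<sigma> bRK t))"
proof -
  let ?P = "\<lambda>x \<tau>. \<exists>B \<subseteq> near \<sigma> \<inter> {..<x}. \<tau> bCNT 0 = min LL (card (near \<sigma> \<inter> {..<x})) \<and>
    bij_betw (\<tau> bRK) B {..<\<tau> bCNT 0} \<and>
    (\<forall>t. \<tau> bCL t = (if t \<in> B then Suc k else \<sigma> bCL t) \<and> (t \<notin> B \<longrightarrow> \<tau> bRK t = \<sigma> bRK t))"
  have "?P (ev inp \<sigma> (Var bTN)) (sem inp cl_create \<sigma>)"
    unfolding cl_create_def
  proof (rule sem_For_frame[where P = ?P], goal_cases)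
    case 2 show ?case using 0 by (simp add: bij_betw_def)
  next
    case (3 x \<tau>)
    have fr: "\<tau> l = \<sigma> l" if "l \<notin> {vI, bCL, bRK, bCNT}" for l by (rule 3(3)) (use that in simp)
    have ok': "ok_atoms \<tau>" by (rule ok_atoms_frame[OF ok fr]) auto
    have pool: "pool \<tau> = pool \<sigma>" by (rule pool_cong) (simp add: fr)
    have nr: "near \<tau> = near \<sigma>" by (rule near_cong) (simp_all add: fr)
    have x: "x < T" using 3(1) ok by (simp add: ok_atomsD)
    have LL: "\<tau> bLL 0 = LL" using ok' by (simp add: ok_atomsD ok_dataD)
    have h1: "ev inp \<tau> (Near (Var vI)) \<noteq> 0 \<longleftrightarrow> x \<in> near \<sigma>"
      unfolding nr[symmetric] by (rule ev_Near[OF ok' _ _ 3(2) x]) (use sub p pool fr in simp_all)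
    have h2: "ev inp \<tau> (Less (Var bCNT) (Var bLL)) \<noteq> 0 \<longleftrightarrow> \<tau> bCNT 0 < LL" using LL by (simp add: not_le)
    have test: "ev inp \<tau> (Near (Var vI) \<otimes> Less (Var bCNT) (Var bLL)) \<noteq> 0 \<longleftrightarrow> x \<in> near \<sigma> \<and> \<tau> bCNT 0 < LL"
      using h1 h2 ev_Times_nonzero by metis
    obtain B where B: "B \<subseteq> near \<sigma> \<inter> {..<x}" "\<tau> bCNT 0 = min LL (card (near \<sigma> \<inter> {..<x}))"
      "bij_betw (\<tau> bRK) B {..<\<tau> bCNT 0}"
      "\<And>t. \<tau> bCL t = (if t \<in> B then Suc k else \<sigma> bCL t)" "\<And>t. t \<notin> B \<Longrightarrow> \<tau> bRK t = \<sigma> bRK t"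
      using 3(4) by blast
    have card_Suc: "card (near \<sigma> \<inter> {..<Suc x}) = (if x \<in> near \<sigma> then Suc else id) (card (near \<sigma> \<inter> {..<x}))"
    proof (cases "x \<in> near \<sigma>")
      case True
      hence "near \<sigma> \<inter> {..<Suc x} = insert x (near \<sigma> \<inter> {..<x})" by (auto simp: less_Suc_eq)
      thus ?thesis using True by simp
    next
      case False
      hence "near \<sigma> \<inter> {..<Suc x} = near \<sigma> \<inter> {..<x}" by (auto simp: less_Suc_eq)
      thus ?thesis using False by simp
    qed
    let ?c = "Store bCL (Var vI) (Var vK \<oplus> Num 1) ;; Store bRK (Var vI) (Var bCNT) ;; Incr bCNT (Num 0) (Num 1)"
    show ?case
    proof (cases "x \<in> near \<sigma> \<and> \<tau> bCNT 0 < LL")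
      case True
      hence e: "ev inp \<tau> (Near (Var vI) \<otimes> Less (Var bCNT) (Var bLL)) \<noteq> 0" using test by blast
      have b: "sem inp (When (Near (Var vI) \<otimes> Less (Var bCNT) (Var bLL)) ?c) \<tau> = sem inp ?c \<tau>"
        using e by (simp only: sem.simps if_True simp_thms)
      define \<tau>' where "\<tau>' = bump vI (sem inp ?c \<tau>)"
      have v: "\<tau>' bCL = (\<tau> bCL)(x := Suc k)" "\<tau>' bRK = (\<tau> bRK)(x := \<tau> bCNT 0)" "\<tau>' bCNT 0 = Suc (\<tau> bCNT 0)"
        using 3(2) k by (auto simp: \<tau>'_def fr fun_eq_iff)
      have xB: "x \<notin> B" using B(1) by auto
      have bij: "bij_betw (\<tau>' bRK) (insert x B) {..<\<tau>' bCNT 0}"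
      proof -
        have "bij_betw (\<tau>' bRK) B {..<\<tau> bCNT 0}"
          using B(3) xB by (subst bij_betw_cong[of B _ "\<tau> bRK"]) (auto simp: v)
        hence "bij_betw (\<tau>' bRK) (B \<union> {x}) ({..<\<tau> bCNT 0} \<union> {\<tau>' bRK x})"
          using xB by (subst notIn_Un_bij_betw3[symmetric]) (auto simp: v)
        thus ?thesis by (simp add: v lessThan_Suc)
      qed
      have "\<tau>' bCNT 0 = min LL (card (near \<sigma> \<inter> {..<Suc x}))" using True B(2) card_Suc v by (auto simp: min_def split: if_splits)
      moreover have "insert x B \<subseteq> near \<sigma> \<inter> {..<Suc x}" using True B(1) by auto
      moreover have "\<tau>' bCL t = (if t \<in> insert x B then Suc k else \<sigma> bCL t)"
        "t \<notin> insert x B \<Longrightarrow> \<tau>' bRK t = \<sigma> bRK t" for t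
        using B(4,5) by (auto simp: v)
      ultimately have "?P (Suc x) \<tau>'" using bij by (intro exI[of _ "insert x B"]) simp
      thus ?thesis unfolding b \<tau>'_def .
    next
      case False
      hence e0: "ev inp \<tau> (Near (Var vI) \<otimes> Less (Var bCNT) (Var bLL)) = 0" using test by blast
      have st: "sem inp (When (Near (Var vI) \<otimes> Less (Var bCNT) (Var bLL)) ?c) \<tau> = \<tau>"
        using e0 by (simp only: sem.simps if_False simp_thms)
      have "\<tau> bCNT 0 = min LL (card (near \<sigma> \<inter> {..<Suc x}))" using False B(2) card_Suc by auto
      moreover have "B \<subseteq> near \<sigma> \<inter> {..<Suc x}" using B(1) by auto
      ultimately have "?P (Suc x) \<tau>" using B(3-5) by (intro exI[of _ B]) simp
      thus ?thesis unfolding st by simp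
    qed
  qed simp_all
  moreover have "near \<sigma> \<inter> {..<T} = near \<sigma>" by (auto simp: near_def pool_def)
  ultimately show ?thesis using ok card by (auto simp: ok_atomsD min_def)
qed

lemma sem_cl_remove:
  assumes ok: "ok_atoms \<sigma>" and p: "\<sigma> bBP 0 = p" "p < n" and j: "j < n"
  shows "pool (sem inp cl_remove \<sigma>) j = (if j = p then pool \<sigma> p - cluster (\<sigma> bCL) (\<sigma> bKP 0) else pool \<sigma> j)"
proof -
  let ?P = "\<lambda>x \<tau>. \<forall>t. \<forall>j<n. \<tau> bP (t * n + j) = (if t < x \<and> j = p \<and> \<sigma> bCL t = \<sigma> bKP 0 then 0 else \<sigma> bP (t * n + j))"
  have "?P (ev inp \<sigma> (Var bTN)) (sem inp cl_remove \<sigma>)"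
    unfolding cl_remove_def
  proof (rule sem_For_frame[where P = ?P], goal_cases)
    case (3 x \<tau>)
    have fr: "\<tau> l = \<sigma> l" if "l \<notin> {vI, bP}" for l by (rule 3(3)) (use that in simp)
    have n: "\<sigma> bNC 0 = n" using ok by (simp add: ok_atomsD ok_dataD)
    show ?case
    proof (cases "\<sigma> bCL x = \<sigma> bKP 0")
      case True
      thus ?thesis using 3(2,4) p n by (auto simp: fr less_Suc_eq idx_eq)
    next
      case False
      hence "ev inp \<tau> (Equ (Cell bCL (Var vI)) (Var bKP)) = 0" using 3(2) by (auto simp: fr)
      hence "sem inp (When (Equ (Cell bCL (Var vI)) (Var bKP)) c) \<tau> = \<tau>" for c
        by (simp only: sem.simps if_False simp_thms)
      thus ?thesis using 3(4) False by (auto simp: less_Suc_eq)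
    qed
  qed simp_all
  hence "?P T (sem inp cl_remove \<sigma>)" using ok by (simp add: ok_atomsD)
  thus ?thesis using j p by (auto simp: pool_def cluster_def)
qed

theorem sem_prog_cluster:
  assumes ok: "ok_atoms \<sigma>" and pool: "\<And>j. j < n \<Longrightarrow> pool \<sigma> j = P0 j"
    and zero: "\<sigma> bKJ = (\<lambda>_. 0)" "\<sigma> bCL = (\<lambda>_. 0)"
  shows "\<exists>P KJ. cl_inv (n * (n * NN)) P (sem inp prog_cluster \<sigma> bCL) (sem inp prog_cluster \<sigma> bRK) KJ"
proof -
  let ?I = "\<lambda>s \<tau>. cl_inv s (pool \<tau>) (\<tau> bCL) (\<tau> bRK) (\<tau> bKJ)"
  have "?I (ev inp \<sigma> (Var bSN)) (sem inp prog_cluster \<sigma>)"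
    unfolding prog_cluster_def
  proof (rule sem_For_frame[where P = ?I], goal_cases)
    case 1 show ?case
      by (simp add: cl_search_def cl_search_client_def cl_count_def cl_lookup_def cl_create_def cl_remove_def)
  next
    case 2
    have "pool (put vK 0 0 \<sigma>) = pool \<sigma>" by (rule pool_cong) simp
    thus ?case using zero pool by (intro cl_inv_init) auto
  next
    case (3 s \<tau>)
    have fr: "\<tau> l = \<sigma> l" if "l \<in> {2..20} \<union> {bAS, bRR}" for l
      by (rule 3(3)) (use that in \<open>auto simp: cl_search_def cl_search_client_def cl_count_def cl_lookup_def
        cl_create_def cl_remove_def\<close>)
    have ok': "ok_atoms \<tau>" by (rule ok_atoms_frame[OF ok fr])
    have sub: "pool \<tau> j \<subseteq> P0 j" if "j < n" for j
    proof -
      obtain ctr rad kap bet where "cl_core s (pool \<tau>) (\<tau> bCL) (\<tau> bRK) (\<tau> bKJ) ctr rad kap bet"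
        using 3(4) by (auto simp: cl_inv_def)
      from cl_core_pool(2)[OF this that] show ?thesis .
    qed
    define \<tau>1 where "\<tau>1 = sem inp cl_search (sem inp (SetV bBF (Num 0)) \<tau>)"
    have fr1: "\<tau>1 l = \<tau> l" if "l \<notin> {vP, vI, vV, bCNT, bBF, bBD, bBP}" for l
      unfolding \<tau>1_def by (subst sem_unwritten)
        (use that in \<open>simp_all add: cl_search_def cl_search_client_def cl_count_def\<close>)
    let ?\<tau>0 = "sem inp (SetV bBF (Num 0)) \<tau>"
    have pool0: "pool ?\<tau>0 = pool \<tau>" by (rule pool_cong) simp
    have ok0: "ok_atoms ?\<tau>0" by (rule ok_atoms_frame[OF ok']) auto
    have "best_inv (all_cands ?\<tau>0 n) \<tau>1"
      unfolding \<tau>1_def by (rule sem_cl_search[OF ok0]) (use sub pool0 in simp_all)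
    moreover have "all_cands ?\<tau>0 n = all_cands \<tau> n" unfolding all_cands_def pool0 by simp
    ultimately have best: "best_inv (all_cands \<tau> n) \<tau>1" by simp
    let ?rest = "SetV bKP (Num 0) ;; cl_lookup ;;
           Ite (Var bKP) Nop (SetV bCNT (Num 0) ;; cl_create ;; SetV bKP (Var vK \<oplus> Num 1)) ;;
           cl_remove ;; Incr bKJ (Var bBP) (Num 1)"
    have body: "sem inp (SetV bBF (Num 0) ;; cl_search ;; When (Var bBF) ?rest) \<tau> =
      (if \<tau>1 bBF 0 = 0 then \<tau>1 else sem inp ?rest \<tau>1)"
      unfolding \<tau>1_def by (rule sem_Then_When)
    show ?case
    proof (cases "\<tau>1 bBF 0 = 0")
      case True
      hence e: "all_cands \<tau> n = {}" using best by (simp add: best_inv_def)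
      have "\<not> \<tau> bKJ j < RR j" if "j < n" for j
      proof
        assume "\<tau> bKJ j < RR j"
        from cl_inv_found[OF 3(4) that this] show False using e that \<open>\<tau> bKJ j < RR j\<close> by (auto simp: all_cands_def)
      qed
      from cl_inv_skip[OF 3(4) this] have "cl_inv (Suc s) (pool \<tau>) (\<tau> bCL) (\<tau> bRK) (\<tau> bKJ)" .
      moreover have "pool (bump vK \<tau>1) = pool \<tau>" by (rule pool_cong) (simp add: fr1)
      ultimately show ?thesis unfolding body using True by (simp add: fr1)
    next
      case False
      define p where "p = \<tau>1 bBP 0"
      define d where "d = \<tau>1 bBD 0"
      obtain t0 where t0: "(p, t0) \<in> all_cands \<tau> n" "d = \<delta> p t0"
        and min: "\<And>j t. (j, t) \<in> all_cands \<tau> n \<Longrightarrow> d \<le> \<delta> j t"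
      proof -
        have "\<exists>t. (p, t) \<in> all_cands \<tau> n \<and> d = \<delta> p t" "\<forall>(j, t)\<in>all_cands \<tau> n. d \<le> \<delta> j t"
          using best False unfolding best_inv_def p_def d_def by auto
        thus ?thesis using that by blast
      qed
      have p: "p < n" "\<tau> bKJ p < RR p" "crowded (pool \<tau>) p d" using t0 by (auto simp: all_cands_def)
      define \<tau>2 where "\<tau>2 = sem inp cl_lookup (sem inp (SetV bKP (Num 0)) \<tau>1)"
      let ?\<tau>1' = "sem inp (SetV bKP (Num 0)) \<tau>1"
      have pool1: "pool ?\<tau>1' = pool \<tau>" by (rule pool_cong) (simp add: fr1)
      have ok1: "ok_atoms ?\<tau>1'" by (rule ok_atoms_frame[OF ok']) (auto simp: fr1)
      have near1: "near ?\<tau>1' = {t \<in> pool \<tau> p. \<delta> p t \<le> d}" unfolding near_def pool1 p_def d_def by simp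
      have look: "(\<tau>2 bKP 0 = 0 \<and> (\<forall>t\<in>near ?\<tau>1'. \<tau> bCL t = 0)) \<or>
          (\<tau>2 bKP 0 \<noteq> 0 \<and> (\<exists>t\<in>near ?\<tau>1'. \<tau> bCL t = \<tau>2 bKP 0))"
        using sem_cl_lookup[OF ok1, of inp] sub pool1 p by (simp add: \<tau>2_def p_def fr1)
      have fr2: "\<tau>2 l = \<tau>1 l" if "l \<notin> {vI, bKP}" for l
        unfolding \<tau>2_def by (subst sem_unwritten) (use that in \<open>simp_all add: cl_lookup_def\<close>)
      let ?cr = "SetV bCNT (Num 0) ;; cl_create ;; SetV bKP (Var vK \<oplus> Num 1)"
      define \<tau>3 where "\<tau>3 = (if \<tau>2 bKP 0 = 0 then sem inp ?cr \<tau>2 else \<tau>2)"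
      have fr3: "\<tau>3 l = \<tau>2 l" if "l \<notin> {vI, bKP, bCNT, bCL, bRK}" for l
      proof -
        have w: "l \<notin> written ?cr" using that by (simp add: cl_create_def)
        show ?thesis
        proof (cases "\<tau>2 bKP 0 = 0")
          case True
          show ?thesis unfolding \<tau>3_def if_P[OF True] by (rule sem_unwritten[OF w])
        next
          case False
          show ?thesis unfolding \<tau>3_def if_not_P[OF False] ..
        qed
      qed
      define q where "q = \<tau>3 bKP 0"
      \<comment> \<open>The outcomes of the lookup are the alternatives of
        \<open>cl_inv_step\<close>: either a cluster meets the ball, or all atoms of the ball are
        unclustered and a new cluster can be cut out of it.\<close>
      have cases: "((\<exists>a\<in>pool \<tau> p. \<delta> p a \<le> d \<and> \<tau> bCL a = q) \<and> 0 < q \<and>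
         (\<forall>t<T. \<tau>3 bCL t = \<tau> bCL t \<and> \<tau>3 bRK t = \<tau> bRK t)) \<or>
       (\<exists>B \<subseteq> pool \<tau> p. q = Suc s \<and> (\<forall>t\<in>B. \<delta> p t \<le> d \<and> \<tau> bCL t = 0) \<and> bij_betw (\<tau>3 bRK) B {..<LL} \<and>
         (\<forall>t<T. \<tau>3 bCL t = (if t \<in> B then Suc s else \<tau> bCL t) \<and> (t \<notin> B \<longrightarrow> \<tau>3 bRK t = \<tau> bRK t)))"
      proof (cases "\<tau>2 bKP 0 = 0")
        case False
        have "\<tau>3 = \<tau>2" using False by (simp add: \<tau>3_def)
        thus ?thesis using look False near1 by (auto simp: q_def fr2 fr1)
      next
        case True
        let ?\<tau>2' = "sem inp (SetV bCNT (Num 0)) \<tau>2"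
        have \<tau>3: "\<tau>3 = sem inp (SetV bKP (Var vK \<oplus> Num 1)) (sem inp cl_create ?\<tau>2')"
          using True by (simp add: \<tau>3_def)
        have ok2: "ok_atoms ?\<tau>2'" by (rule ok_atoms_frame[OF ok']) (auto simp: fr2 fr1)
        have pool2: "pool ?\<tau>2' = pool \<tau>" by (rule pool_cong) (simp add: fr2 fr1)
        have near2: "near ?\<tau>2' = {t \<in> pool \<tau> p. \<delta> p t \<le> d}" unfolding near_def pool2 p_def d_def by (simp add: fr2)
        have LLc: "LL \<le> card (near ?\<tau>2')" unfolding near2 using p(3) by (simp add: crowded_def)
        have "\<exists>B \<subseteq> near ?\<tau>2'. bij_betw (sem inp cl_create ?\<tau>2' bRK) B {..<LL} \<and>
          (\<forall>t. sem inp cl_create ?\<tau>2' bCL t = (if t \<in> B then Suc s else ?\<tau>2' bCL t) \<and>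
             (t \<notin> B \<longrightarrow> sem inp cl_create ?\<tau>2' bRK t = ?\<tau>2' bRK t))"
          by (rule sem_cl_create[OF ok2 _ _ _ _ LLc]) (use sub pool2 p p_def 3(2) in \<open>simp_all add: fr2 fr1\<close>)
        then obtain B where B: "B \<subseteq> near ?\<tau>2'" "bij_betw (sem inp cl_create ?\<tau>2' bRK) B {..<LL}"
          "\<And>t. sem inp cl_create ?\<tau>2' bCL t = (if t \<in> B then Suc s else ?\<tau>2' bCL t)"
          "\<And>t. t \<notin> B \<Longrightarrow> sem inp cl_create ?\<tau>2' bRK t = ?\<tau>2' bRK t" by blast
        have "sem inp cl_create ?\<tau>2' vK 0 = s" using 3(2) by (subst sem_unwritten) (simp_all add: cl_create_def fr2 fr1)
        hence q: "q = Suc s" by (simp add: q_def \<tau>3)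
        have CL: "\<tau>3 bCL = sem inp cl_create ?\<tau>2' bCL" "\<tau>3 bRK = sem inp cl_create ?\<tau>2' bRK" by (simp_all add: \<tau>3)
        have z: "\<tau> bCL t = 0" if "t \<in> B" for t using look True B(1) near1 near2 that by auto
        show ?thesis
          by (rule disjI2, rule exI[of _ B])
            (use B q z near2 in \<open>auto simp: CL fr2 fr1\<close>)
      qed
      define \<tau>4 where "\<tau>4 = sem inp cl_remove \<tau>3"
      have ok3: "ok_atoms \<tau>3" by (rule ok_atoms_frame[OF ok']) (auto simp: fr3 fr2 fr1)
      have bp: "\<tau>3 bBP 0 = p" by (simp add: fr3 fr2 p_def)
      have pool3: "pool \<tau>3 = pool \<tau>" by (rule pool_cong) (simp add: fr3 fr2 fr1)
      have pool4: "pool \<tau>4 j = (if j = p then pool \<tau> p - cluster (\<tau>3 bCL) q else pool \<tau> j)" if "j < n" for j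
        using sem_cl_remove[OF ok3 bp p(1) that, of inp] by (simp add: \<tau>4_def pool3 q_def)
      have fr4: "\<tau>4 l = \<tau>3 l" if "l \<notin> {vI, bP}" for l
        unfolding \<tau>4_def by (rule sem_unwritten) (use that in \<open>simp add: cl_remove_def\<close>)
      define \<tau>5 where "\<tau>5 = bump vK (sem inp (Incr bKJ (Var bBP) (Num 1)) \<tau>4)"
      have res: "bump vK (sem inp ?rest \<tau>1) = \<tau>5"
        unfolding \<tau>5_def \<tau>4_def \<tau>3_def \<tau>2_def by (simp add: sem_unwritten)
      have v5: "\<tau>5 bCL = \<tau>3 bCL" "\<tau>5 bRK = \<tau>3 bRK" "\<tau>5 bKJ = (\<tau> bKJ)(p := Suc (\<tau> bKJ p))"
        by (auto simp: \<tau>5_def fr4 fr3 fr2 fr1 p_def fun_eq_iff)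
      have pool5: "pool \<tau>5 = pool \<tau>4" by (rule pool_cong) (simp add: \<tau>5_def)
      have "cl_inv (Suc s) (pool \<tau>5) (\<tau>3 bCL) (\<tau>3 bRK) (\<tau>5 bKJ)"
      proof (rule cl_inv_step[OF 3(4) p _ cases])
        show "d \<le> \<delta> j t" if "j < n" "\<tau> bKJ j < RR j" "t \<in> pool \<tau> j" "crowded (pool \<tau>) j (\<delta> j t)" for j t
          by (rule min) (use that in \<open>simp add: all_cands_def\<close>)
        show "pool \<tau>5 j = (if j = p then pool \<tau> p - cluster (\<tau>3 bCL) q else pool \<tau> j)" if "j < n" for j
          using pool4[OF that] pool5 by simp
        show "\<tau>5 bKJ j = (if j = p then Suc (\<tau> bKJ p) else \<tau> bKJ j)" for j by (simp add: v5)
      qed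
      thus ?thesis unfolding body using False res v5 by simp
    qed
  qed
  thus ?thesis using ok by (auto simp: ok_atomsD ok_dataD)
qed

end

section \<open>Semantics of opening and connecting\<close>

context ftfp_data
begin

definition opened :: "banks \<Rightarrow> nat \<Rightarrow> bool" where
  "opened \<sigma> t \<longleftrightarrow> \<sigma> bOK t \<noteq> 0 \<and>
     (if \<sigma> bCL t = 0 then \<sigma> bRD t = 0 else \<sigma> bRD (n * NN * NN + (\<sigma> bCL t - 1)) = \<sigma> bRK t)"

lemma sem_prog_open:
  assumes ok: "ok_data \<sigma>" and zero: "\<sigma> bYO = (\<lambda>_. 0)"
  shows "sem inp prog_open \<sigma> bYO i = card {t. t < n * NN * NN \<and> opened \<sigma> t \<and> \<sigma> bAS t = i}"
proof -
  let ?P = "\<lambda>x \<tau>. \<forall>i. \<tau> bYO i = card {t. t < x \<and> opened \<sigma> t \<and> \<sigma> bAS t = i}"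
  have "?P (ev inp \<sigma> (Var bTN)) (sem inp prog_open \<sigma>)"
    unfolding prog_open_def
  proof (rule sem_For_frame[where P = ?P], goal_cases)
    case (3 x \<tau>)
    have fr: "\<tau> l = \<sigma> l" if "l \<notin> {vI, bYO}" for l by (rule 3(3)) (use that in simp)
    let ?e = "Cell bOK (Var vI) \<otimes>
           (Neg (Cell bCL (Var vI)) \<otimes> Neg (Cell bRD (Var vI)) \<oplus>
            Cell bCL (Var vI) \<otimes>
              Equ (Cell bRD (Var bTN \<oplus> (Cell bCL (Var vI) \<ominus> Num 1))) (Cell bRK (Var vI)))"
    have test: "ev inp \<tau> ?e \<noteq> 0 \<longleftrightarrow> opened \<sigma> x"
      using 3(2) ok by (auto simp: fr ok_dataD opened_def)
    show ?case
    proof (cases "opened \<sigma> x")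
      case True
      have eq: "{t. t < Suc x \<and> opened \<sigma> t \<and> \<sigma> bAS t = i} =
          (if \<sigma> bAS x = i then insert x else id) {t. t < x \<and> opened \<sigma> t \<and> \<sigma> bAS t = i}" for i
        using True by (auto simp: less_Suc_eq)
      have e: "ev inp \<tau> ?e \<noteq> 0" using True test by blast
      have b: "sem inp (When ?e c) \<tau> = sem inp c \<tau>" for c using e by (simp only: sem.simps if_True simp_thms)
      show ?thesis unfolding b eq using 3(2,4) by (auto simp: fr)
    next
      case False
      hence e0: "ev inp \<tau> ?e = 0" using test by blast
      have b: "sem inp (When ?e c) \<tau> = \<tau>" for c using e0 by (simp only: sem.simps if_False simp_thms)
      have "{t. t < Suc x \<and> opened \<sigma> t \<and> \<sigma> bAS t = i} = {t. t < x \<and> opened \<sigma> t \<and> \<sigma> bAS t = i}" for i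
        using False by (auto simp: less_Suc_eq)
      thus ?thesis unfolding b using 3(4) by simp
    qed
  qed (use zero in simp_all)
  thus ?thesis using ok by (simp add: ok_dataD)
qed

definition greedy_inv :: "(nat \<Rightarrow> nat) \<Rightarrow> nat \<Rightarrow> nat \<Rightarrow> (nat \<Rightarrow> nat) \<Rightarrow> bool" where
  "greedy_inv Y j k x \<longleftrightarrow> (\<forall>i<m. x i \<le> Y i) \<and> (\<Sum>i<m. x i) = min k (\<Sum>i<m. Y i) \<and>
     (\<exists>\<theta>. (\<forall>i<m. D i j < \<theta> \<longrightarrow> x i = Y i) \<and> (\<forall>i<m. 0 < x i \<longrightarrow> D i j \<le> \<theta>))"

text \<open>Complementary slackness with price \<theta>: each product
  \<open>(D i j - \<theta>) * (x i - x' i)\<close> is at most 0, and \<open>x\<close> connects no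
  more units than \<open>x'\<close>.\<close>

lemma greedy_inv_optimal:
  assumes "greedy_inv Y j k x" "\<And>i. i < m \<Longrightarrow> x' i \<le> Y i" "(\<Sum>i<m. x' i) = k"
  shows "(\<Sum>i<m. D i j * x i) \<le> (\<Sum>i<m. D i j * x' i)"
proof -
  obtain \<theta> where \<theta>: "\<And>i. i < m \<Longrightarrow> D i j < \<theta> \<Longrightarrow> x i = Y i" "\<And>i. i < m \<Longrightarrow> 0 < x i \<Longrightarrow> D i j \<le> \<theta>"
    using assms(1) by (auto simp: greedy_inv_def)
  have xY: "x i \<le> Y i" if "i < m" for i using assms(1) that by (auto simp: greedy_inv_def)
  have s: "(\<Sum>i<m. x i) \<le> (\<Sum>i<m. x' i)" using assms(1,3) by (auto simp: greedy_inv_def)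
  have "(int (D i j) - int \<theta>) * (int (x i) - int (x' i)) \<le> 0" if i: "i < m" for i
  proof (cases "D i j < \<theta>")
    case True
    thus ?thesis using \<theta>(1)[OF i] assms(2)[OF i] by (intro mult_nonpos_nonneg) auto
  next
    case False
    show ?thesis
    proof (cases "0 < x i")
      case True
      thus ?thesis using \<theta>(2)[OF i] False by simp
    next
      case False': False
      thus ?thesis using False by (intro mult_nonneg_nonpos) auto
    qed
  qed
  hence "(\<Sum>i<m. (int (D i j) - int \<theta>) * (int (x i) - int (x' i))) \<le> 0" by (intro sum_nonpos) auto
  moreover have "(\<Sum>i<m. (int (D i j) - int \<theta>) * (int (x i) - int (x' i))) =
      (int (\<Sum>i<m. D i j * x i) - int (\<Sum>i<m. D i j * x' i)) - int \<theta> * (int (\<Sum>i<m. x i) - int (\<Sum>i<m. x' i))"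
    by (simp add: algebra_simps sum.distrib sum_subtractf sum_distrib_left)
  moreover have "int \<theta> * (int (\<Sum>i<m. x i) - int (\<Sum>i<m. x' i)) \<le> 0"
    using s by (intro mult_nonneg_nonpos) (auto simp del: of_nat_sum)
  ultimately show ?thesis by linarith
qed

text \<open>The distance of the chosen site becomes the threshold: nearer sites are saturated by
  minimality, and the old threshold was not larger because site \<open>i\<close> was
  unsaturated.\<close>

lemma greedy_inv_step:
  assumes g: "greedy_inv Y j k x" and i: "i < m" "x i < Y i"
    and min: "\<And>i'. i' < m \<Longrightarrow> x i' < Y i' \<Longrightarrow> D i j \<le> D i' j"
  shows "greedy_inv Y j (Suc k) (x(i := Suc (x i)))"
proof -
  obtain \<theta> where \<theta>: "\<And>i. i < m \<Longrightarrow> D i j < \<theta> \<Longrightarrow> x i = Y i" "\<And>i. i < m \<Longrightarrow> 0 < x i \<Longrightarrow> D i j \<le> \<theta>"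
    using g by (auto simp: greedy_inv_def)
  have xY: "x i' \<le> Y i'" if "i' < m" for i' using g that by (auto simp: greedy_inv_def)
  have s: "(\<Sum>i<m. x i) = min k (\<Sum>i<m. Y i)" using g by (simp add: greedy_inv_def)
  have lt: "(\<Sum>i<m. x i) < (\<Sum>i<m. Y i)"
    using i xY by (intro sum_strict_mono_ex1) auto
  have "(\<Sum>i'<m. (x(i := Suc (x i))) i') = (\<Sum>i'<m. x i' + (if i' = i then 1 else 0))"
    by (rule sum.cong) auto
  also have "\<dots> = Suc (\<Sum>i<m. x i)" using i by (simp add: sum.distrib)
  finally have sum: "(\<Sum>i'<m. (x(i := Suc (x i))) i') = min (Suc k) (\<Sum>i<m. Y i)" using s lt by simp
  have th: "\<theta> \<le> D i j" using \<theta>(1)[OF i(1)] i(2) by (cases "D i j < \<theta>") auto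
  have a: "(x(i := Suc (x i))) i' = Y i'" if "i' < m" "D i' j < D i j" for i'
    using min[OF that(1)] that xY[OF that(1)] by fastforce
  have b: "D i' j \<le> D i j" if "i' < m" "0 < (x(i := Suc (x i))) i'" for i'
    using that \<theta>(2)[OF that(1)] th by (cases "i' = i") auto
  show ?thesis unfolding greedy_inv_def using sum xY i a b by (intro conjI exI[of _ "D i j"]) auto
qed

lemma greedy_inv_stuck:
  assumes g: "greedy_inv Y j k x" and full: "\<And>i. i < m \<Longrightarrow> \<not> x i < Y i"
  shows "greedy_inv Y j (Suc k) x"
proof -
  have "x i = Y i" if "i < m" for i using g full[OF that] that by (auto simp: greedy_inv_def)
  hence "(\<Sum>i<m. x i) = (\<Sum>i<m. Y i)" by simp
  thus ?thesis using g by (auto simp: greedy_inv_def)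
qed

lemma sem_con_search:
  fixes inp :: memory and \<sigma> :: banks
  assumes ok: "ok_data \<sigma>" and j: "\<sigma> vJ 0 = j" "j < n" and 0: "\<sigma> bBF 0 = 0"
  defines "\<tau> \<equiv> sem inp con_search \<sigma>"
  shows "(\<tau> bBF 0 = 0 \<and> (\<forall>i<m. \<not> \<sigma> bXO (i * n + j) < \<sigma> bYO i)) \<or>
    (\<tau> bBF 0 = 1 \<and> \<tau> bBI 0 < m \<and> \<sigma> bXO (\<tau> bBI 0 * n + j) < \<sigma> bYO (\<tau> bBI 0) \<and>
     (\<forall>i<m. \<sigma> bXO (i * n + j) < \<sigma> bYO i \<longrightarrow> D (\<tau> bBI 0) j \<le> D i j))"
proof -
  let ?P = "\<lambda>x \<tau>. (\<tau> bBF 0 = 0 \<and> (\<forall>i<x. \<not> \<sigma> bXO (i * n + j) < \<sigma> bYO i)) \<or>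
    (\<tau> bBF 0 = 1 \<and> \<tau> bBI 0 < m \<and> \<tau> bBD 0 = D (\<tau> bBI 0) j \<and> \<sigma> bXO (\<tau> bBI 0 * n + j) < \<sigma> bYO (\<tau> bBI 0) \<and>
     (\<forall>i<x. \<sigma> bXO (i * n + j) < \<sigma> bYO i \<longrightarrow> D (\<tau> bBI 0) j \<le> D i j))"
  have "?P (ev inp \<sigma> (Var bNS)) \<tau>"
    unfolding \<tau>_def con_search_def
  proof (rule sem_For_frame[where P = ?P], goal_cases)
    case (3 x \<tau>)
    have fr: "\<tau> l = \<sigma> l" if "l \<notin> {vI, bBF, bBD, bBI}" for l by (rule 3(3)) (use that in simp)
    have x: "x < m" using 3(1) ok by (simp add: ok_dataD)
    have d: "\<sigma> bD (x * n + j) = D x j" and n: "\<sigma> bNC 0 = n" using ok x j by (simp_all add: ok_dataD)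
    let ?e = "Less (Cell2 bXO (Var vI) (Var vJ)) (Cell bYO (Var vI)) \<otimes>
           (Neg (Var bBF) \<oplus> Less (Cell2 bD (Var vI) (Var vJ)) (Var bBD))"
    let ?c = "SetV bBF (Num 1) ;; SetV bBD (Cell2 bD (Var vI) (Var vJ)) ;; SetV bBI (Var vI)"
    have test: "ev inp \<tau> ?e \<noteq> 0 \<longleftrightarrow> \<sigma> bXO (x * n + j) < \<sigma> bYO x \<and> (\<tau> bBF 0 = 0 \<or> D x j < \<tau> bBD 0)"
      using 3(2) j d n by (auto simp: fr)
    show ?case
    proof (cases "\<sigma> bXO (x * n + j) < \<sigma> bYO x \<and> (\<tau> bBF 0 = 0 \<or> D x j < \<tau> bBD 0)")
      case True
      hence e: "ev inp \<tau> ?e \<noteq> 0" using test by blast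
      have b: "sem inp (When ?e ?c) \<tau> = sem inp ?c \<tau>" using e by (simp only: sem.simps if_True simp_thms)
      have v: "bump vI (sem inp ?c \<tau>) bBF 0 = 1" "bump vI (sem inp ?c \<tau>) bBD 0 = D x j" "bump vI (sem inp ?c \<tau>) bBI 0 = x"
        using 3(2) j d n by (simp_all add: fr)
      have "D x j \<le> D i j" if "i < x" "\<sigma> bXO (i * n + j) < \<sigma> bYO i" for i
      proof -
        have "\<tau> bBF 0 \<noteq> 0" using 3(4) that by auto
        hence "D x j < \<tau> bBD 0" "\<tau> bBD 0 \<le> D i j" using 3(4) that True by auto
        thus ?thesis by simp
      qed
      thus ?thesis unfolding b v using True x by (auto simp: less_Suc_eq)
    next
      case False
      hence e0: "ev inp \<tau> ?e = 0" using test by blast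
      have b: "sem inp (When ?e ?c) \<tau> = \<tau>" using e0 by (simp only: sem.simps if_False simp_thms)
      show ?thesis unfolding b using 3(4) False by (auto simp: less_Suc_eq)
    qed
  qed (use 0 in simp_all)
  thus ?thesis using ok by (auto simp: ok_dataD)
qed

theorem sem_prog_connect:
  assumes ok: "ok_data \<sigma>" and zero: "\<sigma> bXO = (\<lambda>_. 0)" and RR: "\<And>j. j < n \<Longrightarrow> \<sigma> bRR j \<le> n * NN" and j: "j < n"
  shows "greedy_inv (\<sigma> bYO) j (\<sigma> bRR j) (\<lambda>i. sem inp prog_connect \<sigma> bXO (i * n + j))"
proof -
  let ?P = "\<lambda>x \<tau>. (\<forall>j<n. j < x \<longrightarrow> greedy_inv (\<sigma> bYO) j (\<sigma> bRR j) (\<lambda>i. \<tau> bXO (i * n + j))) \<and>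
    (\<forall>j<n. x \<le> j \<longrightarrow> (\<forall>i. \<tau> bXO (i * n + j) = 0))"
  have "?P (ev inp \<sigma> (Var bNC)) (sem inp prog_connect \<sigma>)"
    unfolding prog_connect_def
  proof (rule sem_For_frame[where P = ?P], goal_cases)
    case 1 show ?case by (simp add: con_search_def)
  next
    case 2 show ?case using zero by simp
  next
    case (3 c \<tau>)
    have fr: "\<tau> l = \<sigma> l" if "l \<notin> {vJ, vK, vI, bBF, bBD, bBI, bXO}" for l
      by (rule 3(3)) (use that in \<open>simp add: con_search_def\<close>)
    have ok': "ok_data \<tau>" by (rule ok_data_frame[OF ok fr]) auto
    have c: "c < n" using 3(1) ok by (simp add: ok_dataD)
    let ?B = "SetV bBF (Num 0) ;; con_search ;; When (Var bBF) (Incr bXO (Var bBI \<otimes> Var bNC \<oplus> Var vJ) (Num 1))"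
    let ?L = "For vK (Var bKN) (When (Less (Var vK) (Cell bRR (Var vJ))) ?B)"
    let ?Q = "\<lambda>y \<rho>. greedy_inv (\<sigma> bYO) c (min y (\<sigma> bRR c)) (\<lambda>i. \<rho> bXO (i * n + c)) \<and>
      (\<forall>i. \<forall>j<n. j \<noteq> c \<longrightarrow> \<rho> bXO (i * n + j) = \<tau> bXO (i * n + j))"
    have "?Q (ev inp \<tau> (Var bKN)) (sem inp ?L \<tau>)"
    proof (rule sem_For_frame[where P = ?Q], goal_cases)
      case 1 show ?case by (simp add: con_search_def)
    next
      case 2
      have "greedy_inv (\<sigma> bYO) c 0 (\<lambda>i. \<tau> bXO (i * n + c))"
        using 3(4) c by (auto simp: greedy_inv_def intro!: exI[of _ 0])
      thus ?case by simp
    next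
      case (3 y \<rho>)
      have frr: "\<rho> l = \<tau> l" if "l \<notin> {vK, vI, bBF, bBD, bBI, bXO}" for l
        by (rule 3(3)) (use that in \<open>simp add: con_search_def\<close>)
      have okr: "ok_data \<rho>" by (rule ok_data_frame[OF ok' frr]) auto
      have vJ: "\<rho> vJ 0 = c" using \<open>\<tau> vJ 0 = c\<close> by (simp add: frr)
      have test: "ev inp \<rho> (Less (Var vK) (Cell bRR (Var vJ))) \<noteq> 0 \<longleftrightarrow> y < \<sigma> bRR c"
        using 3(2) vJ by (simp add: frr fr not_le)
      show ?case
      proof (cases "y < \<sigma> bRR c")
        case False
        hence e0: "ev inp \<rho> (Less (Var vK) (Cell bRR (Var vJ))) = 0" using test by blast
        have b: "sem inp (When (Less (Var vK) (Cell bRR (Var vJ))) c) \<rho> = \<rho>" for c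
          using e0 by (simp only: sem.simps if_False simp_thms)
        have "min (Suc y) (\<sigma> bRR c) = min y (\<sigma> bRR c)" using False by simp
        thus ?thesis unfolding b using 3(4) by simp
      next
        case True
        hence e: "ev inp \<rho> (Less (Var vK) (Cell bRR (Var vJ))) \<noteq> 0" using test by blast
        have b: "sem inp (When (Less (Var vK) (Cell bRR (Var vJ))) c) \<rho> = sem inp c \<rho>" for c
          using e by (simp only: sem.simps if_True simp_thms)
        define \<rho>1 where "\<rho>1 = sem inp con_search (sem inp (SetV bBF (Num 0)) \<rho>)"
        have ok0: "ok_data (sem inp (SetV bBF (Num 0)) \<rho>)" by (rule ok_data_frame[OF okr]) auto
        have fr1: "\<rho>1 l = \<rho> l" if "l \<notin> {vI, bBF, bBD, bBI}" for l
          unfolding \<rho>1_def by (subst sem_unwritten) (use that in \<open>simp_all add: con_search_def\<close>)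
        have YO: "\<rho> bYO = \<sigma> bYO" by (simp add: frr fr)
        have cs: "(\<rho>1 bBF 0 = 0 \<and> (\<forall>i<m. \<not> \<rho> bXO (i * n + c) < \<sigma> bYO i)) \<or>
          (\<rho>1 bBF 0 = 1 \<and> \<rho>1 bBI 0 < m \<and> \<rho> bXO (\<rho>1 bBI 0 * n + c) < \<sigma> bYO (\<rho>1 bBI 0) \<and>
           (\<forall>i<m. \<rho> bXO (i * n + c) < \<sigma> bYO i \<longrightarrow> D (\<rho>1 bBI 0) c \<le> D i c))"
          using sem_con_search[OF ok0, of c inp] vJ c YO by (simp add: \<rho>1_def)
        have body: "sem inp ?B \<rho> = (if \<rho>1 bBF 0 = 0 then \<rho>1 else
            sem inp (Incr bXO (Var bBI \<otimes> Var bNC \<oplus> Var vJ) (Num 1)) \<rho>1)"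
          unfolding \<rho>1_def by (rule sem_Then_When)
        have mins: "min y (\<sigma> bRR c) = y" "min (Suc y) (\<sigma> bRR c) = Suc y" using True by auto
        have g: "greedy_inv (\<sigma> bYO) c y (\<lambda>i. \<rho> bXO (i * n + c))" using 3(4) mins by simp
        show ?thesis
        proof (cases "\<rho>1 bBF 0 = 0")
          case True
          have "greedy_inv (\<sigma> bYO) c (Suc y) (\<lambda>i. \<rho> bXO (i * n + c))"
            by (rule greedy_inv_stuck[OF g]) (use cs True in auto)
          thus ?thesis unfolding b body mins using True 3(4) by (simp add: fr1)
        next
          case False
          let ?i = "\<rho>1 bBI 0"
          have g': "greedy_inv (\<sigma> bYO) c (Suc y) ((\<lambda>i. \<rho> bXO (i * n + c))(?i := Suc (\<rho> bXO (?i * n + c))))"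
            by (rule greedy_inv_step[OF g]) (use cs False in auto)
          let ?\<rho>' = "bump vK (sem inp (Incr bXO (Var bBI \<otimes> Var bNC \<oplus> Var vJ) (Num 1)) \<rho>1)"
          have XO: "?\<rho>' bXO = (\<rho> bXO)(?i * n + c := Suc (\<rho> bXO (?i * n + c)))"
            using okr vJ by (auto simp: fr1 ok_dataD fun_eq_iff)
          have "(\<lambda>i. ?\<rho>' bXO (i * n + c)) = (\<lambda>i. \<rho> bXO (i * n + c))(?i := Suc (\<rho> bXO (?i * n + c)))"
            unfolding XO using c by (auto simp: fun_eq_iff)
          moreover have "?\<rho>' bXO (i * n + j) = \<rho> bXO (i * n + j)" if "j < n" "j \<noteq> c" for i j
            unfolding XO using that c by (simp add: idx_eq)
          ultimately have "?Q (Suc y) ?\<rho>'" unfolding mins using g' 3(4) by simp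
          thus ?thesis unfolding b body using False by simp
        qed
      qed
    qed
    hence Q: "?Q (n * NN) (sem inp ?L \<tau>)" using ok' by (simp add: ok_dataD)
    have mn: "min (n * NN) (\<sigma> bRR c) = \<sigma> bRR c" using RR[OF c] by simp
    let ?\<tau>' = "bump vJ (sem inp ?L \<tau>)"
    have XO': "?\<tau>' bXO = sem inp ?L \<tau> bXO" by (rule bump_other) simp
    have oth: "?\<tau>' bXO (i * n + j) = \<tau> bXO (i * n + j)" if "j < n" "j \<noteq> c" for i j
      unfolding XO' using Q that by blast
    have new: "greedy_inv (\<sigma> bYO) c (\<sigma> bRR c) (\<lambda>i. ?\<tau>' bXO (i * n + c))"
      unfolding XO' using Q mn by simp
    show ?case
    proof (intro conjI allI impI)
      fix j assume j: "j < n" "j < Suc c"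
      show "greedy_inv (\<sigma> bYO) j (\<sigma> bRR j) (\<lambda>i. ?\<tau>' bXO (i * n + j))"
      proof (cases "j = c")
        case True thus ?thesis using new by simp
      next
        case False
        thus ?thesis using 3(4) j unfolding oth[OF j(1) False] by simp
      qed
    next
      fix j i assume "j < n" "Suc c \<le> j"
      thus "?\<tau>' bXO (i * n + j) = 0" using oth[of j i] 3(4) by simp
    qed
  qed
  thus ?thesis using ok j by (simp add: ok_dataD)
qed

lemma sem_prog_output:
  assumes ok: "ok_data \<sigma>"
  shows "i < m \<Longrightarrow> sem inp prog_output \<sigma> bOUT i = \<sigma> bY i + \<sigma> bYO i"
    and "t < m * n \<Longrightarrow> sem inp prog_output \<sigma> bOUT (m + t) = \<sigma> bX t + \<sigma> bXO t"
proof -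
  let ?A = "For vI (Var bNS) (Store bOUT (Var vI) (Cell bY (Var vI) \<oplus> Cell bYO (Var vI)))"
  let ?B = "For vI (Var bNM) (Store bOUT (Var bNS \<oplus> Var vI) (Cell bX (Var vI) \<oplus> Cell bXO (Var vI)))"
  define sA where "sA = sem inp ?A \<sigma>"
  have st: "sem inp prog_output \<sigma> = sem inp ?B sA" by (simp only: prog_output_def sem.simps sA_def)
  have "\<forall>x<ev inp \<sigma> (Var bNS). sA bOUT x = \<sigma> bY x + \<sigma> bYO x" unfolding sA_def
  proof (rule sem_For_frame[where P = "\<lambda>i \<tau>. \<forall>x<i. \<tau> bOUT x = \<sigma> bY x + \<sigma> bYO x"], goal_cases)
    case (3 i \<tau>)
    thus ?case by (auto simp: less_Suc_eq)
  qed simp_all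
  hence A: "\<forall>x<m. sA bOUT x = \<sigma> bY x + \<sigma> bYO x" using ok by (simp add: ok_dataD)
  have frA: "sA l = \<sigma> l" if "l \<notin> {vI, bOUT}" for l unfolding sA_def by (rule sem_unwritten) (use that in simp)
  have "(\<forall>x<m. sem inp ?B sA bOUT x = sA bOUT x) \<and>
     (\<forall>x<ev inp sA (Var bNM). sem inp ?B sA bOUT (m + x) = \<sigma> bX x + \<sigma> bXO x)"
  proof (rule sem_For_frame[where P = "\<lambda>i \<tau>. (\<forall>x<m. \<tau> bOUT x = sA bOUT x) \<and> (\<forall>x<i. \<tau> bOUT (m + x) = \<sigma> bX x + \<sigma> bXO x)"],
      goal_cases)
    case (3 i \<tau>)
    thus ?case using ok by (auto simp: less_Suc_eq frA ok_dataD)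
  qed simp_all
  thus "i < m \<Longrightarrow> sem inp prog_output \<sigma> bOUT i = \<sigma> bY i + \<sigma> bYO i"
    "t < m * n \<Longrightarrow> sem inp prog_output \<sigma> bOUT (m + t) = \<sigma> bX t + \<sigma> bXO t"
    unfolding st using A ok by (simp_all add: frA ok_dataD)
qed

end

section \<open>Random draws and output on the machine\<close>

abbreviation "aU \<equiv> cell_addr vU (Const 0)"

definition draw_test :: expr where "draw_test = Sub (cexpr (Var bJN)) (Mem aU)"
definition draw_addr :: expr where "draw_addr = cell_addr bRD (Mem aU)"
definition draw_range :: expr where "draw_range = Sub (cexpr (Var bLL)) (Const 1)"
definition next_index :: expr where "next_index = Add (Mem aU) (Const 1)"

definition draw_loop :: com where
  "draw_loop = While draw_test (Seq (Draw draw_addr draw_range) (Assign aU next_index))"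

definition draw_com :: com where
  "draw_com = Seq (Assign aU (Const 0)) draw_loop"

definition drawn :: "banks \<Rightarrow> nat \<Rightarrow> nat \<Rightarrow> (nat \<Rightarrow> nat) \<Rightarrow> banks" where
  "drawn \<tau> a J \<omega> = put vU 0 J (\<tau>(bRD := (\<lambda>x. if a \<le> x \<and> x < J then \<omega> x else \<tau> bRD x)))"

definition draw_cost :: nat where
  "draw_cost = ecost draw_test + ecost draw_addr + ecost draw_range + ecost aU + ecost next_index + ecost (Const 0)"

lemma vU_less: "vU < nbanks" "bRD < nbanks" "bJN < nbanks" "bLL < nbanks"
  by (simp_all add: nbanks_def)

lemma flat_vU: "flat inp \<tau> (base inp + vU) = \<tau> vU 0"
  using flat_cell[OF vU_less(1), of inp \<tau> 0] by simp

lemma eval_vU: "eval (flat inp \<tau>) (Mem aU) = \<tau> vU 0" "eval (flat inp \<tau>) aU = base inp + (nbanks * 0 + vU)"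
  using flat_cell[OF vU_less(1), of inp \<tau> 0] by (simp_all add: eval_cell_addr)

text \<open>An iteration takes four machine steps whatever is drawn, so that after a fixed number of
  steps the configuration is a function of the vector of draws. Time, in contrast, is only bounded,
  separately for each outcome.\<close>

lemma run_draw_loop:
  assumes "\<forall>k i. \<tau> k i \<le> 2 ^ b" "\<forall>a. inp a \<le> 2 ^ b" "\<tau> vU 0 + y = J" "\<tau> bJN 0 = J" "\<tau> bLL 0 = L" "0 < L"
  shows "\<exists>f. run (4 * y + 1) (draw_loop # ks, flat inp \<tau>, t0)
      = map_pmf f (Pi_pmf {J - y..<J} 0 (\<lambda>_. pmf_of_set {0..L - 1})) \<and>
    (\<forall>\<omega>\<in>set_pmf (Pi_pmf {J - y..<J} 0 (\<lambda>_. pmf_of_set {0..L - 1})).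
       \<exists>t \<le> (4 * y + 1) * (1 + draw_cost * (b + 1)). f \<omega> = (ks, flat inp (drawn \<tau> (J - y) J \<omega>), t0 + t))"
  using assms
proof (induction y arbitrary: \<tau> t0)
  case 0
  let ?m = "flat inp \<tau>"
  have "eval ?m draw_test = 0"
    unfolding draw_test_def using 0 eval_cexpr[of "Var bJN" inp \<tau>] vU_less by (simp add: eval_vU flat_vU del: cexpr.simps)
  hence "run (4 * 0 + 1) (draw_loop # ks, ?m, t0) = return_pmf (ks, ?m, t0 + (1 + eval_cost ?m draw_test))"
    by (simp add: draw_loop_def bind_return_pmf)
  moreover have "drawn \<tau> (J - 0) J \<omega> = \<tau>" for \<omega>
    using 0(3) by (auto simp: drawn_def put_def fun_eq_iff)
  moreover have "1 + eval_cost ?m draw_test \<le> 1 + draw_cost * (b + 1)"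
  proof -
    have "eval_cost ?m draw_test \<le> ecost draw_test * (b + 1)" by (rule eval_cost_flat_le[OF 0(1,2)]) simp
    also have "\<dots> \<le> draw_cost * (b + 1)" by (rule mult_le_mono1) (simp add: draw_cost_def)
    finally show ?thesis by simp
  qed
  ultimately show ?case
    by (intro exI[of _ "\<lambda>_. (ks, ?m, t0 + (1 + eval_cost ?m draw_test))"]) auto
next
  case (Suc y)
  let ?m = "flat inp \<tau>"
  define x where "x = J - Suc y"
  have x: "\<tau> vU 0 = x" "x < J" "J - y = Suc x" using Suc.prems(3) by (auto simp: x_def)
  let ?u = "pmf_of_set {0..L - 1}"
  define \<tau>1 where "\<tau>1 v = put bRD x v \<tau>" for v
  define \<tau>2 where "\<tau>2 v = put vU 0 (Suc x) (\<tau>1 v)" for v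
  define c1 where "c1 = 1 + eval_cost ?m draw_test"
  define c2 where "c2 = 1 + eval_cost ?m draw_addr + eval_cost ?m draw_range"
  define c3 where "c3 v = 1 + eval_cost (flat inp (\<tau>1 v)) aU + eval_cost (flat inp (\<tau>1 v)) next_index" for v
  have J2: "J \<le> 2 ^ b" "L \<le> 2 ^ b" using Suc.prems(1,4,5) by metis+
  have e1: "eval ?m draw_test = J - x"
    unfolding draw_test_def using Suc.prems(4) x eval_cexpr[of "Var bJN" inp \<tau>] vU_less
    by (simp add: eval_vU flat_vU del: cexpr.simps)
  have e2: "eval ?m draw_addr = base inp + (nbanks * x + bRD)"
    unfolding draw_addr_def using x eval_vU(1) by (simp add: eval_cell_addr)
  have e3: "eval ?m draw_range = L - 1"
    unfolding draw_range_def using Suc.prems(5) eval_cexpr[of "Var bLL" inp \<tau>] vU_less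
    by (simp del: cexpr.simps)
  have e4: "eval (flat inp (\<tau>1 v)) next_index = Suc x" for v
    unfolding next_index_def using x eval_vU(1)[of inp "\<tau>1 v"] by (simp add: \<tau>1_def)
  have f1: "?m(base inp + (nbanks * x + bRD) := v) = flat inp (\<tau>1 v)" for v
    unfolding \<tau>1_def by (rule flat_put[symmetric]) (rule vU_less)
  have f2: "(flat inp (\<tau>1 v))(base inp + (nbanks * 0 + vU) := Suc x) = flat inp (\<tau>2 v)" for v
    unfolding \<tau>2_def by (rule flat_put[symmetric]) (rule vU_less)
  have run: "run (4 * Suc y + 1) (draw_loop # ks, ?m, t0) =
      bind_pmf ?u (\<lambda>v. run (4 * y + 1) (draw_loop # ks, flat inp (\<tau>2 v), t0 + (c1 + 1 + c2 + c3 v)))"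
  proof -
    have "4 * Suc y + 1 = Suc (Suc (Suc (Suc (4 * y + 1))))" by simp
    hence "run (4 * Suc y + 1) (draw_loop # ks, ?m, t0) =
        run (Suc (Suc (Suc (Suc (4 * y + 1))))) (draw_loop # ks, ?m, t0)" by (simp only:)
    also have "\<dots> = run (Suc (Suc (4 * y + 1))) (Draw draw_addr draw_range # Assign aU next_index # draw_loop # ks, ?m, t0 + c1 + 1)"
      using e1 x(2) by (simp add: draw_loop_def bind_return_pmf c1_def)
    also have "\<dots> = bind_pmf ?u (\<lambda>v. run (Suc (4 * y + 1)) (Assign aU next_index # draw_loop # ks, flat inp (\<tau>1 v), t0 + c1 + 1 + c2))"
      by (simp only: run.simps step.simps bind_map_pmf e2 e3 f1 c2_def add.assoc)
    also have "\<dots> = bind_pmf ?u (\<lambda>v. run (4 * y + 1) (draw_loop # ks, flat inp (\<tau>2 v), t0 + (c1 + 1 + c2 + c3 v)))"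
      by (simp only: run.simps(2)[of "4 * y + 1"] step.simps bind_return_pmf eval_vU(2) e4 f2 c3_def add.assoc)
    finally show ?thesis .
  qed
  have v_le: "v \<le> 2 ^ b" if "v \<in> {0..L - 1}" for v using that J2(2) by simp
  have \<tau>1b: "\<forall>k i. \<tau>1 v k i \<le> 2 ^ b" if "v \<in> {0..L - 1}" for v
    using Suc.prems(1) v_le[OF that] by (simp add: \<tau>1_def put_def)
  have \<tau>2b: "\<forall>k i. \<tau>2 v k i \<le> 2 ^ b" if "v \<in> {0..L - 1}" for v
    using \<tau>1b[OF that] x(2) J2(1) by (simp add: \<tau>2_def put_def)
  let ?K = "1 + draw_cost * (b + 1)"
  have c: "c1 + 1 + c2 + c3 v \<le> 4 * ?K" if v: "v \<in> {0..L - 1}" for v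
  proof -
    note k = eval_cost_flat_le[OF Suc.prems(1,2) order_refl] eval_cost_flat_le[OF \<tau>1b[OF v] Suc.prems(2) order_refl]
    have "c1 + 1 + c2 + c3 v \<le> 4 + (ecost draw_test * (b + 1) + ecost draw_addr * (b + 1) + ecost draw_range * (b + 1)
        + ecost aU * (b + 1) + ecost next_index * (b + 1))"
      using k(1)[of draw_test] k(1)[of draw_addr] k(1)[of draw_range] k(2)[of aU] k(2)[of next_index]
      unfolding c1_def c2_def c3_def by linarith
    also have "\<dots> \<le> 4 + draw_cost * (b + 1)"
      unfolding draw_cost_def add_mult_distrib by simp
    also have "\<dots> \<le> 4 * ?K" by simp
    finally show ?thesis .
  qed
  let ?S = "Pi_pmf {J - y..<J} 0 (\<lambda>_. ?u)"
  have IH: "\<forall>v\<in>{0..L - 1}. \<exists>f. run (4 * y + 1) (draw_loop # ks, flat inp (\<tau>2 v), t0 + (c1 + 1 + c2 + c3 v)) = map_pmf f ?S \<and>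
    (\<forall>\<omega>\<in>set_pmf ?S. \<exists>t \<le> (4 * y + 1) * ?K.
       f \<omega> = (ks, flat inp (drawn (\<tau>2 v) (J - y) J \<omega>), t0 + (c1 + 1 + c2 + c3 v) + t))"
  proof
    fix v assume v: "v \<in> {0..L - 1}"
    show "\<exists>f. run (4 * y + 1) (draw_loop # ks, flat inp (\<tau>2 v), t0 + (c1 + 1 + c2 + c3 v)) = map_pmf f ?S \<and>
    (\<forall>\<omega>\<in>set_pmf ?S. \<exists>t \<le> (4 * y + 1) * ?K.
       f \<omega> = (ks, flat inp (drawn (\<tau>2 v) (J - y) J \<omega>), t0 + (c1 + 1 + c2 + c3 v) + t))"
      by (rule Suc.IH[OF \<tau>2b[OF v] Suc.prems(2)])
        (use Suc.prems x in \<open>auto simp: \<tau>2_def \<tau>1_def\<close>)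
  qed
  then obtain g where g: "\<And>v. v \<in> {0..L - 1} \<Longrightarrow>
      run (4 * y + 1) (draw_loop # ks, flat inp (\<tau>2 v), t0 + (c1 + 1 + c2 + c3 v)) = map_pmf (g v) ?S"
    "\<And>v \<omega>. v \<in> {0..L - 1} \<Longrightarrow> \<omega> \<in> set_pmf ?S \<Longrightarrow> \<exists>t \<le> (4 * y + 1) * ?K.
       g v \<omega> = (ks, flat inp (drawn (\<tau>2 v) (J - y) J \<omega>), t0 + (c1 + 1 + c2 + c3 v) + t)"
    by (atomize_elim) (metis (no_types, lifting))
  have ins: "{J - Suc y..<J} = insert x {J - y..<J}" using x by auto
  have Pi: "Pi_pmf {J - Suc y..<J} 0 (\<lambda>_. ?u) = map_pmf (\<lambda>(v, w). w(x := v)) (pair_pmf ?u ?S)"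
    unfolding ins by (rule Pi_pmf_insert) (use x in auto)
  have setu: "set_pmf ?u = {0..L - 1}" by (simp add: set_pmf_of_set)
  have restore: "((\<omega>)(x := v))(x := 0) = \<omega>" if "\<omega> \<in> set_pmf ?S" for \<omega> v
  proof -
    have "\<omega> x = 0" using set_Pi_pmf_subset[of "{J - y..<J}" 0 "\<lambda>_. ?u"] that x by auto
    thus ?thesis by auto
  qed
  \<comment> \<open>The vector of the later draws is 0 at \<open>x\<close>, so resetting
    \<open>\<omega> x\<close> to 0 recovers it; hence the configuration can be read off the whole
    vector.\<close>
  define f where "f \<omega> = g (\<omega> x) ((\<omega>)(x := 0))" for \<omega>
  have "run (4 * Suc y + 1) (draw_loop # ks, ?m, t0) = bind_pmf ?u (\<lambda>v. map_pmf (g v) ?S)"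
    unfolding run by (rule bind_pmf_cong[OF refl]) (use g(1) setu in simp)
  also have "\<dots> = bind_pmf ?u (\<lambda>v. map_pmf (\<lambda>\<omega>. f ((\<omega>)(x := v))) ?S)"
    by (intro bind_pmf_cong[OF refl] map_pmf_cong[OF refl]) (simp only: f_def restore fun_upd_same)
  also have "\<dots> = map_pmf f (Pi_pmf {J - Suc y..<J} 0 (\<lambda>_. ?u))"
    unfolding Pi by (simp add: pair_pmf_def map_pmf_def bind_assoc_pmf bind_return_pmf)
  finally have r: "run (4 * Suc y + 1) (draw_loop # ks, ?m, t0) = map_pmf f (Pi_pmf {J - Suc y..<J} 0 (\<lambda>_. ?u))" .
  moreover have "\<exists>t \<le> (4 * Suc y + 1) * ?K. f \<omega> = (ks, flat inp (drawn \<tau> (J - Suc y) J \<omega>), t0 + t)"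
    if w: "\<omega> \<in> set_pmf (Pi_pmf {J - Suc y..<J} 0 (\<lambda>_. ?u))" for \<omega>
  proof -
    obtain v \<omega>' where v: "v \<in> {0..L - 1}" and w': "\<omega>' \<in> set_pmf ?S" and \<omega>: "\<omega> = (\<omega>')(x := v)"
      using w unfolding Pi by (auto simp: setu)
    obtain t where t: "t \<le> (4 * y + 1) * ?K"
      "g v \<omega>' = (ks, flat inp (drawn (\<tau>2 v) (J - y) J \<omega>'), t0 + (c1 + 1 + c2 + c3 v) + t)"
      using g(2)[OF v w'] by blast
    have "f \<omega> = g v \<omega>'" unfolding f_def \<omega> using restore[OF w'] by simp
    moreover have "drawn (\<tau>2 v) (J - y) J \<omega>' = drawn \<tau> (J - Suc y) J \<omega>"
      using x unfolding \<omega> by (auto simp: drawn_def \<tau>2_def \<tau>1_def put_def fun_eq_iff x_def[symmetric])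
    moreover have "(c1 + 1 + c2 + c3 v) + t \<le> (4 * Suc y + 1) * ?K"
    proof -
      have "(c1 + 1 + c2 + c3 v) + t \<le> 4 * ?K + (4 * y + 1) * ?K" using c[OF v] t(1) by (rule add_mono)
      also have "\<dots> = (4 * Suc y + 1) * ?K" by (simp add: algebra_simps)
      finally show ?thesis .
    qed
    ultimately show ?thesis using t(2) by (intro exI[of _ "(c1 + 1 + c2 + c3 v) + t"]) (simp add: add.assoc)
  qed
  ultimately show ?case by blast
qed

lemma run_draw_com:
  assumes b: "\<forall>k i. \<sigma> k i \<le> 2 ^ b" "\<forall>a. inp a \<le> 2 ^ b"
    and v: "\<sigma> bJN 0 = J" "\<sigma> bLL 0 = L" "0 < L" "\<sigma> bRD = (\<lambda>_. 0)"
  shows "\<exists>f. run (4 * J + 3) (draw_com # ks, flat inp \<sigma>, t0) = map_pmf f (draws J L) \<and>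
    (\<forall>\<omega>\<in>set_pmf (draws J L). \<exists>t \<le> (4 * J + 3) * (1 + draw_cost * (b + 1)).
       f \<omega> = (ks, flat inp (put vU 0 J (\<sigma>(bRD := \<omega>))), t0 + t))"
proof -
  let ?K = "1 + draw_cost * (b + 1)"
  define \<tau> where "\<tau> = put vU 0 0 \<sigma>"
  have \<tau>b: "\<forall>k i. \<tau> k i \<le> 2 ^ b" using b by (simp add: \<tau>_def put_def)
  define c where "c = 2 + eval_cost (flat inp \<sigma>) aU + eval_cost (flat inp \<sigma>) (Const 0)"
  have f: "(flat inp \<sigma>)(base inp + (nbanks * 0 + vU) := 0) = flat inp \<tau>"
    unfolding \<tau>_def by (rule flat_put[symmetric]) (rule vU_less)
  have "4 * J + 3 = Suc (Suc (4 * J + 1))" by simp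
  hence "run (4 * J + 3) (draw_com # ks, flat inp \<sigma>, t0) = run (Suc (Suc (4 * J + 1))) (draw_com # ks, flat inp \<sigma>, t0)" by (simp only:)
  also have "\<dots> = run (4 * J + 1) (draw_loop # ks, flat inp \<tau>, t0 + c)"
    using f eval_vU(2)[of inp \<sigma>] by (simp add: draw_com_def bind_return_pmf c_def add.assoc)
  finally have r1: "run (4 * J + 3) (draw_com # ks, flat inp \<sigma>, t0) = run (4 * J + 1) (draw_loop # ks, flat inp \<tau>, t0 + c)" .
  have "\<exists>f. run (4 * J + 1) (draw_loop # ks, flat inp \<tau>, t0 + c)
      = map_pmf f (Pi_pmf {J - J..<J} 0 (\<lambda>_. pmf_of_set {0..L - 1})) \<and>
    (\<forall>\<omega>\<in>set_pmf (Pi_pmf {J - J..<J} 0 (\<lambda>_. pmf_of_set {0..L - 1})).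
       \<exists>t \<le> (4 * J + 1) * ?K. f \<omega> = (ks, flat inp (drawn \<tau> (J - J) J \<omega>), t0 + c + t))"
    by (rule run_draw_loop[OF \<tau>b b(2)]) (use v in \<open>auto simp: \<tau>_def\<close>)
  moreover have dr: "Pi_pmf {J - J..<J} 0 (\<lambda>_. pmf_of_set {0..L - 1}) = draws J L"
    by (simp add: draws_def lessThan_atLeast0)
  ultimately obtain f where f: "run (4 * J + 1) (draw_loop # ks, flat inp \<tau>, t0 + c) = map_pmf f (draws J L)"
    "\<And>\<omega>. \<omega> \<in> set_pmf (draws J L) \<Longrightarrow> \<exists>t \<le> (4 * J + 1) * ?K. f \<omega> = (ks, flat inp (drawn \<tau> 0 J \<omega>), t0 + c + t)"
    by auto
  have c: "c \<le> 2 * ?K"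
  proof -
    note k = eval_cost_flat_le[OF b order_refl]
    have "c \<le> 2 + (ecost aU * (b + 1) + ecost (Const 0) * (b + 1))"
      using k[of aU] k[of "Const 0"] unfolding c_def by linarith
    also have "\<dots> \<le> 2 + draw_cost * (b + 1)" unfolding draw_cost_def add_mult_distrib by simp
    finally show ?thesis by simp
  qed
  have "\<exists>t \<le> (4 * J + 3) * ?K. f \<omega> = (ks, flat inp (put vU 0 J (\<sigma>(bRD := \<omega>))), t0 + t)"
    if w: "\<omega> \<in> set_pmf (draws J L)" for \<omega>
  proof -
    obtain t where t: "t \<le> (4 * J + 1) * ?K" "f \<omega> = (ks, flat inp (drawn \<tau> 0 J \<omega>), t0 + c + t)"
      using f(2)[OF w] by blast
    \<comment> \<open>The default value 0 of \<open>draws\<close> agrees with the cells of the bank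
      that the loop does not reach, so the bank is exactly \<omega>.\<close>
    have "\<omega> x = 0" if "\<not> x < J" for x using w that unfolding set_draws PiE_dflt_def by auto
    hence "drawn \<tau> 0 J \<omega> = put vU 0 J (\<sigma>(bRD := \<omega>))"
      using v(4) by (auto simp: drawn_def \<tau>_def put_def fun_eq_iff)
    moreover have "c + t \<le> (4 * J + 3) * ?K"
    proof -
      have "c + t \<le> 2 * ?K + (4 * J + 1) * ?K" using c t(1) by (rule add_mono)
      also have "\<dots> = (4 * J + 3) * ?K" by (simp add: algebra_simps)
      finally show ?thesis .
    qed
    ultimately show ?thesis using t(2) by (intro exI[of _ "c + t"]) (simp add: add.assoc)
  qed
  thus ?thesis using r1 f(1) by auto
qed

section \<open>Copying the output to the front of the memory\<close>

definition copy_test :: expr where "copy_test = Sub (cexpr (Var bNS \<oplus> Var bNM)) (Mem aU)"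
definition copy_value :: expr where "copy_value = cexpr (Cell bOUT (Var vU))"

definition copy_loop :: com where
  "copy_loop = While copy_test (Seq (Assign (Mem aU) copy_value) (Assign aU next_index))"

abbreviation "final1 \<equiv> Mem (Add (mem_at 1) (Const bOUT))"
abbreviation "final2 \<equiv> Mem (Add (mem_at 1) (Const (nbanks + bOUT)))"

text \<open>
  The dimensions in cells 0 and 1 locate all banks, so these two cells are overwritten last;
  cell 1 temporarily holds the base address.
\<close>

definition out_com :: com where
  "out_com = Seq (Assign aU (Const 2)) (Seq copy_loop
     (Seq (Assign (Const 1) base_expr) (Seq (Assign (Const 0) final1) (Assign (Const 1) final2))))"

definition out_cost :: nat where
  "out_cost = ecost copy_test + ecost (Mem aU) + ecost copy_value + ecost aU + ecost next_index + ecost (Const 2) +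
     ecost (Const 1) + ecost base_expr + ecost (Const 0) + ecost final1 + ecost (Const 1) + ecost final2"

lemma base_upd: "2 \<le> a \<Longrightarrow> base (inp(a := v)) = base inp"
  by (simp add: base_def)

lemma flat_inp_upd:
  assumes "2 \<le> a" "a < base inp"
  shows "(flat inp \<sigma>)(a := v) = flat (inp(a := v)) \<sigma>"
  using assms by (auto simp: flat_def fun_eq_iff base_upd)

text \<open>Copying starts at address 2, since cells 0 and 1 determine \<open>base\<close>. Only
  input cells below \<open>base\<close> are overwritten, so the banks remain readable
  throughout.\<close>

lemma exec_copy_loop:
  assumes "\<forall>k i. \<tau> k i \<le> 2 ^ b" "\<forall>a. inp a \<le> 2 ^ b" "\<tau> bNS 0 + \<tau> bNM 0 = M" "M \<le> base inp" "M \<le> 2 ^ b"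
    and "\<tau> vU 0 = u" "2 \<le> u" "y = M - u"
  shows "\<exists>t \<le> (4 * y + 1) * (1 + out_cost * (b + 1)).
    exec copy_loop (flat inp \<tau>) (flat (\<lambda>a. if u \<le> a \<and> a < M then \<tau> bOUT a else inp a) (put vU 0 (u + y) \<tau>)) t"
  using assms
proof (induction y arbitrary: \<tau> inp u)
  case 0
  let ?m = "flat inp \<tau>"
  have test: "eval ?m copy_test = 0"
    unfolding copy_test_def using 0 eval_cexpr[of "Var bNS \<oplus> Var bNM" inp \<tau>]
    by (simp add: eval_vU flat_vU nbanks_def del: cexpr.simps)
  have "exec copy_loop ?m ?m (1 + eval_cost ?m copy_test)"
    unfolding copy_loop_def by (rule exec_While_False[OF test])
  moreover have "(\<lambda>a. if u \<le> a \<and> a < M then \<tau> bOUT a else inp a) = inp" using 0(8) by auto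
  moreover have "put vU 0 (u + 0) \<tau> = \<tau>" using 0(6) by (auto simp: put_def)
  moreover have "1 + eval_cost ?m copy_test \<le> (4 * 0 + 1) * (1 + out_cost * (b + 1))"
  proof -
    have "eval_cost ?m copy_test \<le> ecost copy_test * (b + 1)" by (rule eval_cost_flat_le[OF 0(1,2)]) simp
    also have "\<dots> \<le> out_cost * (b + 1)" by (rule mult_le_mono1) (simp add: out_cost_def)
    finally show ?thesis by simp
  qed
  ultimately show ?case by metis
next
  case (Suc y)
  let ?m = "flat inp \<tau>" and ?K = "1 + out_cost * (b + 1)"
  have u: "u < M" "y = M - Suc u" using Suc.prems(8) by auto
  have test: "eval ?m copy_test \<noteq> 0"
    unfolding copy_test_def using Suc.prems(3,6) u eval_cexpr[of "Var bNS \<oplus> Var bNM" inp \<tau>]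
    by (simp add: eval_vU flat_vU nbanks_def del: cexpr.simps)
  define inp' where "inp' = inp(u := \<tau> bOUT u)"
  have val: "eval ?m copy_value = \<tau> bOUT u"
    unfolding copy_value_def using Suc.prems(6) eval_cexpr[of "Cell bOUT (Var vU)" inp \<tau>]
    by (simp add: nbanks_def del: cexpr.simps)
  have m1: "?m(eval ?m (Mem aU) := eval ?m copy_value) = flat inp' \<tau>"
    unfolding eval_vU(1) val Suc.prems(6) inp'_def by (rule flat_inp_upd) (use Suc.prems(4,7) u in auto)
  have base': "base inp' = base inp" unfolding inp'_def by (rule base_upd) (rule Suc.prems)
  have inp'b: "\<forall>a. inp' a \<le> 2 ^ b" using Suc.prems(1,2) by (simp add: inp'_def)
  define \<tau>' where "\<tau>' = put vU 0 (Suc u) \<tau>"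
  have e2: "eval (flat inp' \<tau>) next_index = Suc u"
    unfolding next_index_def using Suc.prems(6) eval_vU(1)[of inp' \<tau>] by simp
  have m2: "(flat inp' \<tau>)(eval (flat inp' \<tau>) aU := eval (flat inp' \<tau>) next_index) = flat inp' \<tau>'"
    unfolding eval_vU(2) e2 \<tau>'_def by (rule flat_put[symmetric]) (rule vU_less)
  have \<tau>'b: "\<forall>k i. \<tau>' k i \<le> 2 ^ b" using Suc.prems(1,5) u by (simp add: \<tau>'_def put_def)
  have "\<exists>t \<le> (4 * y + 1) * ?K. exec copy_loop (flat inp' \<tau>')
      (flat (\<lambda>a. if Suc u \<le> a \<and> a < M then \<tau>' bOUT a else inp' a) (put vU 0 (Suc u + y) \<tau>')) t"
    by (rule Suc.IH[OF \<tau>'b inp'b]) (use Suc.prems u base' in \<open>auto simp: \<tau>'_def\<close>)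
  then obtain t where t: "t \<le> (4 * y + 1) * ?K" "exec copy_loop (flat inp' \<tau>')
      (flat (\<lambda>a. if Suc u \<le> a \<and> a < M then \<tau>' bOUT a else inp' a) (put vU 0 (Suc u + y) \<tau>')) t" by blast
  have eq: "(\<lambda>a. if Suc u \<le> a \<and> a < M then \<tau>' bOUT a else inp' a) = (\<lambda>a. if u \<le> a \<and> a < M then \<tau> bOUT a else inp a)"
    "put vU 0 (Suc u + y) \<tau>' = put vU 0 (u + Suc y) \<tau>"
    using u by (auto simp: \<tau>'_def inp'_def put_def fun_eq_iff)
  have "exec (Assign (Mem aU) copy_value) ?m (flat inp' \<tau>) (1 + eval_cost ?m (Mem aU) + eval_cost ?m copy_value)"
    using exec_Assign[of "Mem aU" copy_value ?m] unfolding m1 .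
  moreover have "exec (Assign aU next_index) (flat inp' \<tau>) (flat inp' \<tau>')
      (1 + eval_cost (flat inp' \<tau>) aU + eval_cost (flat inp' \<tau>) next_index)"
    using exec_Assign[of aU next_index "flat inp' \<tau>"] unfolding m2 .
  ultimately have body: "exec (Seq (Assign (Mem aU) copy_value) (Assign aU next_index)) ?m (flat inp' \<tau>')
     (1 + (1 + eval_cost ?m (Mem aU) + eval_cost ?m copy_value) +
      (1 + eval_cost (flat inp' \<tau>) aU + eval_cost (flat inp' \<tau>) next_index))" by (rule exec_Seq)
  let ?c = "1 + eval_cost ?m copy_test + (1 + (1 + eval_cost ?m (Mem aU) + eval_cost ?m copy_value) +
      (1 + eval_cost (flat inp' \<tau>) aU + eval_cost (flat inp' \<tau>) next_index))"
  have "exec copy_loop ?m (flat (\<lambda>a. if u \<le> a \<and> a < M then \<tau> bOUT a else inp a) (put vU 0 (u + Suc y) \<tau>)) (?c + t)"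
    using exec_While_True[OF test body t(2)[unfolded eq copy_loop_def]] unfolding copy_loop_def .
  moreover have "?c + t \<le> (4 * Suc y + 1) * ?K"
  proof -
    note k1 = eval_cost_flat_le[OF Suc.prems(1,2) order_refl] and k2 = eval_cost_flat_le[OF Suc.prems(1) inp'b order_refl]
    have "?c \<le> 4 + (ecost copy_test * (b + 1) + ecost (Mem aU) * (b + 1) + ecost copy_value * (b + 1) +
        ecost aU * (b + 1) + ecost next_index * (b + 1))"
      using k1[of copy_test] k1[of "Mem aU"] k1[of copy_value] k2[of aU] k2[of next_index] by linarith
    also have "\<dots> \<le> 4 + out_cost * (b + 1)" unfolding out_cost_def add_mult_distrib by simp
    also have "\<dots> \<le> 4 * ?K" by simp
    finally have "?c + t \<le> 4 * ?K + (4 * y + 1) * ?K" using t(1) by (rule add_mono)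
    also have "\<dots> = (4 * Suc y + 1) * ?K" by (simp add: algebra_simps)
    finally show ?thesis .
  qed
  ultimately show ?case by blast
qed

lemma exec_out_com:
  assumes b: "\<forall>k i. \<sigma> k i \<le> 2 ^ b" "\<forall>a. inp a \<le> 2 ^ b" "1 \<le> b" "base inp \<le> 2 ^ b"
    and M: "\<sigma> bNS 0 + \<sigma> bNM 0 = M" "M \<le> base inp"
  shows "\<exists>mem. \<exists>t \<le> (4 * M + 9) * (1 + out_cost * (b + 1)). exec out_com (flat inp \<sigma>) mem t \<and>
    (\<forall>a<M. mem a = \<sigma> bOUT a)"
proof -
  let ?K = "1 + out_cost * (b + 1)"
  define \<tau> where "\<tau> = put vU 0 2 \<sigma>"
  have two: "2 \<le> (2::nat) ^ b" using b(3) by (cases b) auto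
  have \<tau>b: "\<forall>k i. \<tau> k i \<le> 2 ^ b" using b(1) two by (simp add: \<tau>_def put_def)
  have M2: "M \<le> 2 ^ b" using M(2) b(4) by simp
  have e1: "exec (Assign aU (Const 2)) (flat inp \<sigma>) (flat inp \<tau>) (1 + eval_cost (flat inp \<sigma>) aU + eval_cost (flat inp \<sigma>) (Const 2))"
  proof -
    have "(flat inp \<sigma>)(eval (flat inp \<sigma>) aU := eval (flat inp \<sigma>) (Const 2)) = flat inp \<tau>"
      unfolding eval_vU(2) \<tau>_def eval.simps by (rule flat_put[symmetric]) (rule vU_less)
    thus ?thesis using exec_Assign[of aU "Const 2" "flat inp \<sigma>"] by simp
  qed
  define inp' where "inp' = (\<lambda>a. if 2 \<le> a \<and> a < M then \<tau> bOUT a else inp a)"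
  define \<tau>' where "\<tau>' = put vU 0 (2 + (M - 2)) \<tau>"
  obtain t where t: "t \<le> (4 * (M - 2) + 1) * ?K" "exec copy_loop (flat inp \<tau>) (flat inp' \<tau>') t"
    using exec_copy_loop[OF \<tau>b b(2) _ M(2) M2, of 2 "M - 2"] M(1) unfolding inp'_def \<tau>'_def by (auto simp: \<tau>_def)
  have \<tau>'b: "\<forall>k i. \<tau>' k i \<le> 2 ^ b" using \<tau>b M2 two by (simp add: \<tau>'_def put_def)
  have inp'b: "\<forall>a. inp' a \<le> 2 ^ b" using \<tau>b b(2) by (simp add: inp'_def)
  have base': "base inp' = base inp" by (simp add: base_def inp'_def)
  let ?B = "base inp"
  have B2: "2 \<le> ?B" by (rule base_ge)
  let ?m0 = "flat inp' \<tau>'"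
  have m0b: "\<forall>a. ?m0 a \<le> 2 ^ b" by (rule flat_le[OF \<tau>'b inp'b])
  define m1 where "m1 = ?m0(1 := ?B)"
  define m2 where "m2 = m1(0 := \<sigma> bOUT 0)"
  define m3 where "m3 = m2(1 := \<sigma> bOUT 1)"
  have m1b: "\<forall>a. m1 a \<le> 2 ^ b" using m0b b(4) by (simp add: m1_def)
  have m2b: "\<forall>a. m2 a \<le> 2 ^ b" using m1b b(1) by (simp add: m2_def)
  have cell: "?m0 (?B + (nbanks * i + bOUT)) = \<sigma> bOUT i" for i
    using flat_cell[of bOUT inp' \<tau>' i] base' by (simp add: nbanks_def \<tau>'_def \<tau>_def)
  have x1: "exec (Assign (Const 1) base_expr) ?m0 m1 (1 + eval_cost ?m0 (Const 1) + eval_cost ?m0 base_expr)"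
    using exec_Assign[of "Const 1" base_expr ?m0] eval_base_expr[of inp' \<tau>'] base' by (simp add: m1_def)
  have x2: "exec (Assign (Const 0) final1) m1 m2 (1 + eval_cost m1 (Const 0) + eval_cost m1 final1)"
    using exec_Assign[of "Const 0" final1 m1] cell[of 0] B2 by (simp add: m2_def m1_def)
  have x3: "exec (Assign (Const 1) final2) m2 m3 (1 + eval_cost m2 (Const 1) + eval_cost m2 final2)"
    using exec_Assign[of "Const 1" final2 m2] cell[of 1] B2 by (simp add: m3_def m2_def m1_def)
  note ex = exec_Seq[OF e1 exec_Seq[OF t(2) exec_Seq[OF x1 exec_Seq[OF x2 x3]]]]
  let ?e1 = "1 + eval_cost (flat inp \<sigma>) aU + eval_cost (flat inp \<sigma>) (Const 2)"
  let ?e2 = "1 + eval_cost ?m0 (Const 1) + eval_cost ?m0 base_expr"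
  let ?e3 = "1 + eval_cost m1 (Const 0) + eval_cost m1 final1"
  let ?e4 = "1 + eval_cost m2 (Const 1) + eval_cost m2 final2"
  have "1 + ?e1 + (1 + t + (1 + ?e2 + (1 + ?e3 + ?e4))) \<le> (4 * M + 9) * ?K"
  proof -
    have k: "eval_cost m e \<le> ecost e * (b + 1)" if "\<forall>a. m a \<le> 2 ^ b" for m e
      unfolding ecost_def by (rule eval_cost_le[OF that])
    note k0 = k[OF flat_le[OF b(1,2)]] and k1 = k[OF m0b] and k2 = k[OF m1b] and k3 = k[OF m2b]
    have "1 + ?e1 + (1 + t + (1 + ?e2 + (1 + ?e3 + ?e4))) \<le> 8 + t + (ecost aU * (b + 1) + ecost (Const 2) * (b + 1) +
        ecost (Const 1) * (b + 1) + ecost base_expr * (b + 1) + ecost (Const 0) * (b + 1) + ecost final1 * (b + 1) +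
        ecost (Const 1) * (b + 1) + ecost final2 * (b + 1))"
      using k0[of aU] k0[of "Const 2"] k1[of "Const 1"] k1[of base_expr] k2[of "Const 0"] k2[of final1]
        k3[of "Const 1"] k3[of final2] by linarith
    also have "\<dots> \<le> 8 + t + out_cost * (b + 1)" unfolding out_cost_def add_mult_distrib by simp
    also have "\<dots> \<le> 8 * ?K + (4 * (M - 2) + 1) * ?K" using t(1) by simp
    also have "\<dots> = (4 * (M - 2) + 9) * ?K" by (simp add: algebra_simps)
    also have "\<dots> \<le> (4 * M + 9) * ?K" by (rule mult_le_mono1) simp
    finally show ?thesis .
  qed
  moreover have "m3 a = \<sigma> bOUT a" if "a < M" for a
  proof -
    have "a < base inp'" using that M(2) base' by simp
    hence "?m0 a = inp' a" by simp
    thus ?thesis using that by (cases "a = 0"; cases "a = 1") (auto simp: m3_def m2_def m1_def inp'_def \<tau>_def)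
  qed
  ultimately show ?thesis using ex unfolding out_com_def by blast
qed

section \<open>Feasibility and expected cost\<close>

lemma sum_swap_select:
  fixes g :: "nat \<Rightarrow> nat \<Rightarrow> 'a :: comm_monoid_add"
  assumes "\<And>k. k < K \<Longrightarrow> s k < m \<or> (\<forall>i. g i k = 0)"
  shows "(\<Sum>i<m. \<Sum>k<K. if s k = i then g i k else 0) = (\<Sum>k<K. g (s k) k)"
proof -
  have "(\<Sum>i<m. \<Sum>k<K. if s k = i then g i k else 0) = (\<Sum>k<K. \<Sum>i<m. if s k = i then g i k else 0)"
    by (rule sum.swap)
  also have "\<dots> = (\<Sum>k<K. g (s k) k)"
  proof (rule sum.cong[OF refl])
    fix k assume "k \<in> {..<K}"
    hence "s k < m \<or> (\<forall>i. g i k = 0)" using assms by simp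
    thus "(\<Sum>i<m. if s k = i then g i k else 0) = g (s k) k"
    proof
      assume "s k < m"
      thus ?thesis by (simp add: sum.delta')
    next
      assume z: "\<forall>i. g i k = 0"
      have "(\<Sum>i<m. if s k = i then g i k else 0) = 0" by (rule sum.neutral) (use z in simp)
      thus ?thesis using z by simp
    qed
  qed
  finally show ?thesis .
qed

text \<open>Turns an assignment of demands to distinct atoms into numbers of connections per site,
  the form in which it competes with the greedy solution.\<close>

lemma counted_assignment:
  fixes a :: "nat \<Rightarrow> nat"
  assumes "inj_on a {..<r}" "\<And>k. k < r \<Longrightarrow> a k \<in> A" "finite A" "\<And>t. t \<in> A \<Longrightarrow> site t < (m::nat)"
  defines "x \<equiv> (\<lambda>i. card {k. k < r \<and> site (a k) = i})"
  shows "x i \<le> card {t \<in> A. site t = i}" "(\<Sum>i<m. x i) = r"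
    "(\<Sum>i<m. d i * x i) = (\<Sum>k<r. (d (site (a k)) :: nat))"
proof -
  have "x i = card (a ` {k. k < r \<and> site (a k) = i})"
    unfolding x_def by (rule card_image[symmetric]) (use assms(1) in \<open>auto simp: inj_on_def\<close>)
  also have "\<dots> \<le> card {t \<in> A. site t = i}" using assms(2,3) by (intro card_mono) auto
  finally show "x i \<le> card {t \<in> A. site t = i}" .
  have s: "(\<Sum>i<m. \<Sum>k\<in>{k \<in> {..<r}. site (a k) = i}. g i) = (\<Sum>k<r. g (site (a k)))" for g :: "nat \<Rightarrow> nat"
  proof -
    have "(\<Sum>i<m. \<Sum>k\<in>{k \<in> {..<r}. site (a k) = i}. g i) = (\<Sum>i<m. \<Sum>k\<in>{k \<in> {..<r}. site (a k) = i}. g (site (a k)))"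
      by (intro sum.cong refl) auto
    also have "\<dots> = (\<Sum>k<r. g (site (a k)))" by (rule sum.group) (use assms(2,4) in auto)
    finally show ?thesis .
  qed
  show "(\<Sum>i<m. x i) = r" using s[of "\<lambda>_. 1"] by (simp add: x_def)
  show "(\<Sum>i<m. d i * x i) = (\<Sum>k<r. d (site (a k)))" using s[of d] by (simp add: x_def mult.commute)
qed

context ftfp_data
begin

text \<open>Lowering the demand by \<open>am k div NN\<close> gives up
  \<open>NN * (am k div NN)\<close> units of coverage, exactly the part not contained in the
  remainders. If the integral parts already exceed the demand, truncation makes the left side
  0.\<close>

lemma residual_count:
  assumes "\<And>k. k < K \<Longrightarrow> am k = (NN * (am k div NN)) + am k mod NN" "NN * r j \<le> (\<Sum>k<K. if Q k then am k else 0)"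
  shows "NN * (r j - (\<Sum>k<K. if Q k then am k div NN else 0)) \<le> (\<Sum>k<K. if Q k then am k mod NN else 0)"
proof -
  have "(\<Sum>k<K. if Q k then am k else 0) =
      NN * (\<Sum>k<K. if Q k then am k div NN else 0) + (\<Sum>k<K. if Q k then am k mod NN else 0)"
    unfolding sum_distrib_left sum.distrib[symmetric] by (rule sum.cong) auto
  thus ?thesis using assms(2) by (simp add: diff_mult_distrib2)
qed

definition J_total :: nat where "J_total = n * NN * NN + n * (n * NN)"

text \<open>All costs are accounted per star. In expectation an atom pays at most
  \<open>1 / LL\<close> of the cost of its star, and the integral copies pay no more than that rate.
  So the total cost of the stars divided by \<open>LL\<close> is a bound, and the weights phase has
  estimated it in terms of \<open>Z\<close>.\<close>

theorem rounding:
  fixes inp :: memory and \<sigma> :: banks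
  assumes ok: "ok_data \<sigma>" and W: "\<And>j. j < n \<Longrightarrow> \<sigma> bW j = RP div r j"
    and zero: "\<And>l. l \<notin> {2..21} \<union> {23, 24} \<Longrightarrow> \<sigma> l = (\<lambda>_. 0)"
    and Z: "0 \<le> Z" "dual_bound Z"
  defines "\<sigma>9 \<equiv> sem inp prog_cluster (sem inp prog_atoms (sem inp prog_split (sem inp prog_mwu \<sigma>)))"
  defines "fin \<equiv> (\<lambda>\<omega>. sem inp prog_output (sem inp prog_connect (sem inp prog_open
     (put vU 0 J_total (\<sigma>9(bRD := \<omega>))))))"
  shows "\<omega> \<in> set_pmf (draws J_total LL) \<Longrightarrow> i < m \<Longrightarrow> j < n \<Longrightarrow> fin \<omega> bOUT (m + (i * n + j)) \<le> fin \<omega> bOUT i"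
    and "\<omega> \<in> set_pmf (draws J_total LL) \<Longrightarrow> j < n \<Longrightarrow> r j \<le> (\<Sum>i<m. fin \<omega> bOUT (m + (i * n + j)))"
    and "measure_pmf.expectation (draws J_total LL)
       (\<lambda>\<omega>. real (\<Sum>i<m. F i * fin \<omega> bOUT i) + real (\<Sum>i<m. \<Sum>j<n. D i j * fin \<omega> bOUT (m + (i * n + j))))
       \<le> 19 / 11 * (1 + 1 / 500 + 1 / 10000) * Z"
proof -
  define K where "K = n * NN"
  define T where "T = n * NN * NN"
  define SN where "SN = n * (n * NN)"
  have JT: "J_total = T + SN" by (simp add: J_total_def T_def SN_def)
  have TK: "T = K * NN" by (simp add: T_def K_def)
  define \<sigma>6 where "\<sigma>6 = sem inp prog_mwu \<sigma>"
  define \<sigma>7 where "\<sigma>7 = sem inp prog_split \<sigma>6"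
  define \<sigma>8 where "\<sigma>8 = sem inp prog_atoms \<sigma>7"
  have \<sigma>9: "\<sigma>9 = sem inp prog_cluster \<sigma>8" by (simp add: \<sigma>9_def \<sigma>8_def \<sigma>7_def \<sigma>6_def)
  have fr6: "\<sigma>6 l = \<sigma> l" if "l \<notin> {21..35}" for l
    unfolding \<sigma>6_def by (rule sem_unwritten) (use that in \<open>auto simp: prog_defs\<close>)
  have fr7: "\<sigma>7 l = \<sigma>6 l" if "l \<notin> {vK, vJ, bQQ, bY, bX, bCV}" for l
    unfolding \<sigma>7_def by (rule sem_unwritten) (use that in \<open>auto simp: prog_defs\<close>)
  have fr8: "\<sigma>8 l = \<sigma>7 l" if "l \<notin> {vI, vJ, bOK, bAS, bP, bRR}" for l
    unfolding \<sigma>8_def by (rule sem_unwritten) (use that in \<open>auto simp: prog_defs\<close>)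
  have fr9: "\<sigma>9 l = \<sigma>8 l" if "l \<notin> {vK, vP, vI, vV, bBF, bCNT, bBD, bBP, bKP, bCL, bRK, bP, bKJ}" for l
    unfolding \<sigma>9 by (rule sem_unwritten) (use that in \<open>auto simp: prog_defs\<close>)
  have ok6: "ok_data \<sigma>6" by (rule ok_data_frame[OF ok fr6]) auto
  have ok7: "ok_data \<sigma>7" by (rule ok_data_frame[OF ok6 fr7]) auto
  have ok8: "ok_data \<sigma>8" by (rule ok_data_frame[OF ok7 fr8]) auto
  have ok9: "ok_data \<sigma>9" by (rule ok_data_frame[OF ok8 fr9]) auto
  have hist: "hist_inv K \<sigma>6"
    unfolding K_def \<sigma>6_def by (rule sem_prog_mwu[OF ok W]) (auto intro!: zero)
  define am where "am = \<sigma>6 bAM"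
  define st where "st = \<sigma>6 bST"
  define mem where "mem = members \<sigma>6"
  have mwu: "mwu_inv Z K (\<sigma>6 bW) (\<sigma>6 bH) (total_cost \<sigma>6 K)" using hist Z by (simp add: hist_inv_def)
  note mend = mwu_inv_end[OF mwu[unfolded K_def], folded K_def]
  have stm: "am k = 0 \<or> st k < m" for k using hist by (auto simp: hist_inv_def am_def st_def)
  have memn: "mem k \<subseteq> {..<n}" for k by (auto simp: mem_def members_def)
  have cov: "NN * r j \<le> (\<Sum>k<K. if j \<in> mem k then am k else 0)" if "j < n" for j
  proof -
    have "j \<notin> active (\<sigma>6 bH)" using mend(1) by simp
    hence "NN * r j \<le> \<sigma>6 bH j" using that by (simp add: active_def)
    thus ?thesis unfolding am_def mem_def using hist that by (simp add: hist_inv_def)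
  qed
  have z6: "\<sigma>6 bY = (\<lambda>_. 0)" "\<sigma>6 bX = (\<lambda>_. 0)" "\<sigma>6 bCV = (\<lambda>_. 0)" by (simp_all add: fr6 zero)
  define q where "q k = am k div NN" for k
  have Y7: "\<sigma>7 bY i = (\<Sum>k<K. if st k = i then q k else 0)" for i
    unfolding \<sigma>7_def K_def st_def q_def am_def by (rule sem_prog_split(1)[OF ok6 z6])
  have X7: "\<sigma>7 bX (i * n + j) = (\<Sum>k<K. if st k = i then (if j \<in> mem k then q k else 0) else 0)" if "j < n" for i j
    unfolding \<sigma>7_def sem_prog_split(2)[OF ok6 z6 that]
    by (auto simp: K_def st_def q_def am_def mem_def intro!: sum.cong)
  have CV7: "\<sigma>7 bCV j = (\<Sum>k<K. if j \<in> mem k then q k else 0)" if "j < n" for j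
    unfolding \<sigma>7_def K_def q_def am_def mem_def by (rule sem_prog_split(3)[OF ok6 z6 that])
  have z7: "\<sigma>7 bOK = (\<lambda>_. 0)" "\<sigma>7 bP = (\<lambda>_. 0)" by (simp_all add: fr7 fr6 zero)
  define valid where "valid t \<longleftrightarrow> t mod NN < am (t div NN) mod NN" for t
  have va: "valid_atom \<sigma>7 t \<longleftrightarrow> valid t" for t by (simp add: valid_atom_def valid_def fr7 am_def)
  have mem7: "members \<sigma>7 k = mem k" for k by (simp add: members_def mem_def fr7)
  define RR where "RR j = r j - (\<Sum>k<K. if j \<in> mem k then q k else 0)" for j
  define P0 where "P0 j = {t. t < T \<and> valid t \<and> j \<in> mem (t div NN)}" for j
  \<comment> \<open>Invalid atoms get the impossible site \<open>m\<close>, so that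
    \<open>site t < m\<close> expresses validity inside the locale.\<close>
  define site where "site t = (if valid t then st (t div NN) else m)" for t
  note at = sem_prog_atoms[OF ok7 z7, where inp = inp, folded \<sigma>8_def T_def, unfolded va mem7]
  have site_valid: "site t < m \<longleftrightarrow> valid t" for t
  proof -
    have "st (t div NN) < m" if "valid t"
    proof -
      have "am (t div NN) \<noteq> 0" using that by (intro notI) (simp add: valid_def)
      thus ?thesis using stm[of "t div NN"] by simp
    qed
    thus ?thesis by (auto simp: site_def)
  qed
  have blocks: "(\<Sum>t<T. if valid t then g (t div NN) else 0) = (\<Sum>k<K. of_nat (am k mod NN) * g k)"
    for g :: "nat \<Rightarrow> 'a :: comm_semiring_1"
    unfolding valid_def TK using NN_pos by (intro sum_blocks) (auto simp: less_imp_le)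
  have cardP0: "card (P0 j) = (\<Sum>k<K. if j \<in> mem k then am k mod NN else 0)" for j
  proof -
    have "card (P0 j) = (\<Sum>t<T. if valid t then (if j \<in> mem (t div NN) then 1 else 0) else 0)"
      unfolding card_eq_sum by (rule sum.mono_neutral_cong_left) (auto simp: P0_def)
    also have "\<dots> = (\<Sum>k<K. of_nat (am k mod NN) * (if j \<in> mem k then 1 else 0))" by (rule blocks)
    also have "\<dots> = (\<Sum>k<K. if j \<in> mem k then am k mod NN else 0)" by (rule sum.cong) auto
    finally show ?thesis .
  qed
  have P0c: "NN * RR j \<le> card (P0 j)" if "j < n" for j
    unfolding cardP0 RR_def q_def by (rule residual_count[OF _ cov[OF that]]) simp
  interpret A: ftfp_atoms n m F D r T site P0 RR
  proof
    show "P0 j \<subseteq> {..<T}" for j by (auto simp: P0_def)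
    show "site t < m" if "t \<in> P0 j" for j t using that by (simp add: P0_def site_valid)
    show "NN * RR j \<le> card (P0 j)" if "j < n" for j by (rule P0c[OF that])
  qed
  have okA: "A.ok_atoms \<sigma>8"
    unfolding A.ok_atoms_def
  proof (intro conjI allI impI ballI)
    show "ok_data \<sigma>8" by (rule ok8)
    show "T = n * NN * NN" by (rule T_def)
    fix j assume j: "j < n"
    show "\<sigma>8 bRR j = RR j" using at(4)[OF j] CV7[OF j] by (simp add: RR_def)
    fix t assume t: "t \<in> P0 j"
    hence "t < T" "valid t" by (auto simp: P0_def)
    thus "\<sigma>8 bAS t = site t" using at(2) by (simp add: site_def st_def fr7)
  qed
  have pool8: "A.pool \<sigma>8 j = P0 j" if "j < n" for j
    using at(3)[OF _ that] by (auto simp: A.pool_def P0_def)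
  have z8: "\<sigma>8 bKJ = (\<lambda>_. 0)" "\<sigma>8 bCL = (\<lambda>_. 0)" by (simp_all add: fr8 fr7 fr6 zero)
  obtain PP KJ where clinv: "A.cl_inv SN PP (\<sigma>9 bCL) (\<sigma>9 bRK) KJ"
    using A.sem_prog_cluster[OF okA pool8 z8, of inp] unfolding \<sigma>9 SN_def by blast
  define CL where "CL = \<sigma>9 bCL"
  define RK where "RK = \<sigma>9 bRK"
  have RRK: "RR j \<le> K" if "j < n" for j
  proof -
    have "card (P0 j) \<le> card {..<T}" by (rule card_mono) (auto simp: P0_def)
    hence "NN * RR j \<le> card {..<T}" using P0c[OF that] by linarith
    hence "NN * RR j \<le> NN * K" by (simp add: TK mult.commute)
    thus ?thesis using NN_pos by simp
  qed
  have sRR: "(\<Sum>j<n. RR j) \<le> SN"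
    using sum_bounded_above[of "{..<n}" RR K] RRK by (simp add: SN_def K_def)
  note cend = A.cl_inv_end[OF clinv sRR, folded CL_def RK_def]
  note cbij = A.cl_inv_bij[OF clinv, folded CL_def RK_def]
  \<comment> \<open>Which draw and which value open an atom, as in \<open>prog_open\<close>. The
    pair is injective because ranks are distinct within a cluster.\<close>
  define slot where "slot t = (if CL t = 0 then t else T + (CL t - 1))" for t
  define val where "val t = (if CL t = 0 then 0 else RK t)" for t
  define s\<omega> where "s\<omega> \<omega> = put vU 0 J_total (\<sigma>9(bRD := \<omega>))" for \<omega>
  have frw: "s\<omega> \<omega> l = \<sigma>9 l" if "l \<notin> {vU, bRD}" for l \<omega> using that by (simp add: s\<omega>_def)
  have okw: "ok_data (s\<omega> \<omega>)" for \<omega> by (rule ok_data_frame[OF ok9 frw]) auto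
  define Op where "Op \<omega> = {t. t < T \<and> valid t \<and> \<omega> (slot t) = val t}" for \<omega>
  have opened: "opened (s\<omega> \<omega>) t \<longleftrightarrow> valid t \<and> \<omega> (slot t) = val t" if "t < T" for \<omega> t
    using at(1)[OF that] by (auto simp: opened_def frw fr9 slot_def val_def CL_def RK_def T_def s\<omega>_def)
  define s10 where "s10 \<omega> = sem inp prog_open (s\<omega> \<omega>)" for \<omega>
  define s11 where "s11 \<omega> = sem inp prog_connect (s10 \<omega>)" for \<omega>
  have fin: "fin \<omega> = sem inp prog_output (s11 \<omega>)" for \<omega> by (simp add: fin_def s11_def s10_def s\<omega>_def)
  have fr10: "s10 \<omega> l = s\<omega> \<omega> l" if "l \<notin> {vI, bYO}" for l \<omega>
    unfolding s10_def by (rule sem_unwritten) (use that in \<open>auto simp: prog_defs\<close>)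
  have fr11: "s11 \<omega> l = s10 \<omega> l" if "l \<notin> {vJ, vK, vI, bBF, bBD, bBI, bXO}" for l \<omega>
    unfolding s11_def by (rule sem_unwritten) (use that in \<open>auto simp: prog_defs\<close>)
  have ok10: "ok_data (s10 \<omega>)" for \<omega> by (rule ok_data_frame[OF okw fr10]) auto
  have ok11: "ok_data (s11 \<omega>)" for \<omega> by (rule ok_data_frame[OF ok10 fr11]) auto
  define YO where "YO \<omega> i = card {t \<in> Op \<omega>. site t = i}" for \<omega> i
  have YO: "s10 \<omega> bYO i = YO \<omega> i" if "i < m" for \<omega> i
  proof -
    have "s\<omega> \<omega> bYO = (\<lambda>_. 0)" by (simp add: frw fr9 fr8 fr7 fr6 zero)
    from sem_prog_open[OF okw this] have "s10 \<omega> bYO i = card {t. t < T \<and> opened (s\<omega> \<omega>) t \<and> s\<omega> \<omega> bAS t = i}"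
      by (simp add: s10_def T_def)
    also have "{t. t < T \<and> opened (s\<omega> \<omega>) t \<and> s\<omega> \<omega> bAS t = i} = {t \<in> Op \<omega>. site t = i}"
      using opened at(2) by (auto simp: Op_def frw fr9 site_def st_def fr7)
    finally show ?thesis by (simp add: YO_def)
  qed
  define XO where "XO \<omega> i j = s11 \<omega> bXO (i * n + j)" for \<omega> i j
  have greedy: "greedy_inv (s10 \<omega> bYO) j (RR j) (\<lambda>i. XO \<omega> i j)" if j: "j < n" for \<omega> j
  proof -
    have z: "s10 \<omega> bXO = (\<lambda>_. 0)" by (simp add: fr10 frw fr9 fr8 fr7 fr6 zero)
    have RR': "s10 \<omega> bRR j = RR j" if "j < n" for j
      using A.ok_atomsD(3)[OF okA that] by (simp add: fr10 frw fr9)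
    have "greedy_inv (s10 \<omega> bYO) j (s10 \<omega> bRR j) (\<lambda>i. sem inp prog_connect (s10 \<omega>) bXO (i * n + j))"
      by (rule sem_prog_connect[OF ok10 z _ j]) (use RR' RRK in \<open>simp add: K_def\<close>)
    thus ?thesis using RR'[OF j] by (simp add: XO_def s11_def)
  qed
  have outY: "fin \<omega> bOUT i = \<sigma>7 bY i + YO \<omega> i" if "i < m" for \<omega> i
    unfolding fin using sem_prog_output(1)[OF ok11 that] YO[OF that]
    by (simp add: fr11 fr10 frw fr9 fr8)
  have outX: "fin \<omega> bOUT (m + (i * n + j)) = \<sigma>7 bX (i * n + j) + XO \<omega> i j" if "i < m" "j < n" for \<omega> i j
    unfolding fin using sem_prog_output(2)[OF ok11 index_less[OF that]]
    by (simp add: XO_def fr11 fr10 frw fr9 fr8)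
  have finOp: "finite (Op \<omega>)" for \<omega> by (simp add: Op_def)
  have siteOp: "site t < m" if "t \<in> Op \<omega>" for t \<omega> using that by (auto simp: Op_def site_valid)
  have LLp: "0 < LL" by (rule LL_pos)
  txt \<open>A demand that finds no nearby open atom can always use the open atom of its cluster.\<close>
  have cluster_open: "\<exists>t \<in> A.cluster CL c. t \<in> Op \<omega>"
    if c: "0 < c" "bij_betw RK (A.cluster CL c) {..<LL}" "\<forall>t \<in> A.cluster CL c. site t < m"
      and w: "\<omega> \<in> set_pmf (draws J_total LL)" for c \<omega>
  proof -
    have ne: "A.cluster CL c \<noteq> {}" using c(2) LLp by (auto simp: bij_betw_def)
    then obtain t0 where t0: "t0 < T" "CL t0 = c" by (auto simp: A.cluster_def)
    have cSN: "c \<le> SN" 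
    proof -
      have "0 < n" using t0(1) by (cases n) (auto simp: T_def)
      thus ?thesis using cend[of 0] t0 by auto
    qed
    have "T + (c - 1) < J_total" using c(1) cSN by (simp add: JT)
    hence "\<omega> (T + (c - 1)) < LL" using draws_less[OF w] LLp by blast
    then obtain t where t: "t \<in> A.cluster CL c" "RK t = \<omega> (T + (c - 1))"
      using c(2) unfolding bij_betw_def by (metis imageE lessThan_iff)
    hence "t \<in> Op \<omega>" using c(1,3) site_valid[of t] by (auto simp: Op_def A.cluster_def slot_def val_def)
    thus ?thesis using t by blast
  qed
  \<comment> \<open>Any injective assignment to open atoms shows two things at once: enough
    facilities are open, and the greedy connection is no more expensive.\<close>
  have assign: "(\<Sum>i<m. XO \<omega> i j) = RR j \<and> (\<Sum>i<m. D i j * XO \<omega> i j) \<le> (\<Sum>k<RR j. A.\<delta> j (a k))"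
    if j: "j < n" and a: "inj_on a {..<RR j}" "\<And>k. k < RR j \<Longrightarrow> a k \<in> Op \<omega>" for \<omega> j a
  proof -
    note ca = counted_assignment(1,2)[where site = site, OF a finOp siteOp]
      counted_assignment(3)[where site = site and d = "\<lambda>i. D i j", OF a finOp siteOp]
    let ?x = "\<lambda>i. card {k. k < RR j \<and> site (a k) = i}"
    have xY: "?x i \<le> s10 \<omega> bYO i" if "i < m" for i using ca(1)[where i = i] YO[OF that] by (simp add: YO_def)
    have "(\<Sum>i<m. ?x i) \<le> (\<Sum>i<m. s10 \<omega> bYO i)" by (rule sum_mono) (use xY in simp)
    hence "RR j \<le> (\<Sum>i<m. s10 \<omega> bYO i)" using ca(2) by simp
    hence "(\<Sum>i<m. XO \<omega> i j) = RR j" using greedy[OF j] by (simp add: greedy_inv_def)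
    moreover have "(\<Sum>i<m. D i j * XO \<omega> i j) \<le> (\<Sum>i<m. D i j * ?x i)"
      by (rule greedy_inv_optimal[OF greedy[OF j] xY ca(2)])
    ultimately show ?thesis using ca(3) by (simp add: A.\<delta>_def)
  qed
  \<comment> \<open>The open atoms of the \<open>RR j\<close> distinct clusters of \<open>j\<close>
    form such an assignment. Hence feasibility holds for every outcome and not only on
    average.\<close>
  have conn_full: "(\<Sum>i<m. XO \<omega> i j) = RR j" if j: "j < n" and w: "\<omega> \<in> set_pmf (draws J_total LL)" for \<omega> j
  proof -
    obtain kap bet where kap: "inj_on kap {..<RR j}" "\<And>k. k < RR j \<Longrightarrow> 0 < kap k \<and>
      (\<forall>t\<in>A.cluster CL (kap k). A.\<delta> j t \<le> 3 * bet k \<and> site t < m) \<and>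
      bij_betw RK (A.cluster CL (kap k)) {..<LL}" using cend[OF j] by blast
    have "\<exists>t. t \<in> A.cluster CL (kap k) \<and> t \<in> Op \<omega>" if "k < RR j" for k
    proof -
      have "0 < kap k" "bij_betw RK (A.cluster CL (kap k)) {..<LL}" "\<forall>t\<in>A.cluster CL (kap k). site t < m"
        using kap(2)[OF that] by simp_all
      from cluster_open[OF this w] show ?thesis by auto
    qed
    then obtain a where a: "\<And>k. k < RR j \<Longrightarrow> a k \<in> A.cluster CL (kap k) \<and> a k \<in> Op \<omega>" by metis
    have "inj_on a {..<RR j}"
    proof (rule inj_onI)
      fix k l assume kl: "k \<in> {..<RR j}" "l \<in> {..<RR j}" "a k = a l"
      have "CL (a k) = kap k" "CL (a l) = kap l" using a[of k] a[of l] kl(1,2) by (simp_all add: A.cluster_def)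
      thus "k = l" using kap(1) kl by (auto simp: inj_on_def)
    qed
    thus ?thesis using assign[OF j, of a \<omega>] a by blast
  qed
  have XOle: "XO \<omega> i j \<le> YO \<omega> i" if "i < m" "j < n" for \<omega> i j
    using greedy[OF that(2), of \<omega>] that(1) unfolding greedy_inv_def YO[OF that(1), symmetric] by blast
  show "fin \<omega> bOUT (m + (i * n + j)) \<le> fin \<omega> bOUT i" if "i < m" "j < n" for \<omega> i j
    unfolding outX[OF that] outY[OF that(1)] Y7 X7[OF that(2)]
    by (intro add_mono sum_mono XOle that) auto
  have sumX: "(\<Sum>i<m. \<sigma>7 bX (i * n + j)) = (\<Sum>k<K. if j \<in> mem k then q k else 0)" if "j < n" for j
    unfolding X7[OF that] by (rule sum_swap_select) (use stm in \<open>force simp: q_def\<close>)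
  show "r j \<le> (\<Sum>i<m. fin \<omega> bOUT (m + (i * n + j)))" if w: "\<omega> \<in> set_pmf (draws J_total LL)" and j: "j < n" for \<omega> j
  proof -
    have "(\<Sum>i<m. fin \<omega> bOUT (m + (i * n + j))) = (\<Sum>i<m. \<sigma>7 bX (i * n + j)) + (\<Sum>i<m. XO \<omega> i j)"
      using outX[OF _ j] by (simp add: sum.distrib)
    thus ?thesis unfolding sumX[OF j] conn_full[OF j w] RR_def by simp
  qed
  let ?p = "draws J_total LL"
  have CLs: "CL t \<le> SN" if "t < T" for t
  proof -
    have "0 < n" using that by (cases n) (auto simp: T_def)
    thus ?thesis using cend[of 0] that by auto
  qed
  have slotval: "slot t < J_total \<and> val t < LL" if "t < T" for t
  proof (cases "CL t = 0")
    case True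
    thus ?thesis using that LLp by (simp add: slot_def val_def JT)
  next
    case False
    have "t \<in> A.cluster CL (CL t)" using that by (simp add: A.cluster_def)
    hence "RK t < LL" using cbij[of "CL t"] False by (auto simp: bij_betw_def)
    thus ?thesis using False CLs[OF that] by (simp add: slot_def val_def JT)
  qed
  have inj: "inj_on (\<lambda>t. (slot t, val t)) {..<T}"
  proof (rule inj_onI)
    fix s t assume st: "s \<in> {..<T}" "t \<in> {..<T}" "(slot s, val s) = (slot t, val t)"
    show "s = t"
    proof (cases "CL s = 0 \<or> CL t = 0")
      case True
      thus ?thesis using st by (auto simp: slot_def split: if_splits)
    next
      case False
      hence "CL s = CL t" "RK s = RK t" using st by (auto simp: slot_def val_def)
      moreover have "s \<in> A.cluster CL (CL t)" "t \<in> A.cluster CL (CL t)"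
        using st calculation by (auto simp: A.cluster_def)
      ultimately show ?thesis using cbij[of "CL t"] False by (auto simp: bij_betw_def inj_on_def)
    qed
  qed
  have Econn: "measure_pmf.expectation ?p (\<lambda>\<omega>. real (\<Sum>i<m. D i j * XO \<omega> i j)) \<le> (\<Sum>t\<in>P0 j. real (A.\<delta> j t)) / real LL"
    if j: "j < n" for j
  proof -
    obtain kap bet where kap: "inj_on kap {..<RR j}" "\<And>k. k < RR j \<Longrightarrow> 0 < kap k \<and>
      (\<forall>t\<in>A.cluster CL (kap k). A.\<delta> j t \<le> 3 * bet k \<and> site t < m) \<and>
      bij_betw RK (A.cluster CL (kap k)) {..<LL} \<and> card {t \<in> P0 j. A.\<delta> j t < bet k} < Suc k * LL"
      using cend[OF j] by blast
    show ?thesis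
    proof (rule client_expected_cost[OF MM_pos NN_def LL_def, where r = "RR j" and slot = slot and val = val
        and C = "\<lambda>k. A.cluster CL (kap k)" and bet = bet])
      show "finite (P0 j)" by (simp add: P0_def)
      show "RR j * NN \<le> card (P0 j)" using P0c[OF j] by (simp add: mult.commute)
      show "slot t < J_total \<and> val t < LL" if "t \<in> P0 j" for t using slotval that by (simp add: P0_def)
      show "inj_on (\<lambda>t. (slot t, val t)) (P0 j)" by (rule inj_on_subset[OF inj]) (auto simp: P0_def)
      show "finite (A.cluster CL (kap k)) \<and> card (A.cluster CL (kap k)) = LL" if "k < RR j" for k
        using bij_betw_same_card[of RK "A.cluster CL (kap k)" "{..<LL}"] kap(2)[OF that] by simp
      show "A.cluster CL (kap k) \<inter> A.cluster CL (kap l) = {}" if "k < RR j" "l < RR j" "k \<noteq> l" for k l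
        using kap(1) that by (auto simp: A.cluster_def inj_on_def)
      show "\<exists>t\<in>A.cluster CL (kap k). \<omega> (slot t) = val t" if "k < RR j" "\<omega> \<in> set_pmf ?p" for k \<omega>
        using cluster_open[of "kap k", OF _ _ _ that(2)] kap(2)[OF that(1)] by (auto simp: Op_def)
      show "A.\<delta> j t \<le> 3 * bet k" if "k < RR j" "t \<in> A.cluster CL (kap k)" for k t using kap(2)[OF that(1)] that(2) by blast
      show "card {t \<in> P0 j. A.\<delta> j t < bet k} < Suc k * LL" if "k < RR j" for k using kap(2)[OF that] by blast
      show "(\<Sum>i<m. D i j * XO \<omega> i j) \<le> (\<Sum>k<RR j. A.\<delta> j (a k))"
        if "\<omega> \<in> set_pmf ?p" "inj_on a {..<RR j}"
          "\<And>k. k < RR j \<Longrightarrow> \<omega> (slot (a k)) = val (a k) \<and> a k \<in> P0 j \<union> (\<Union>k<RR j. A.cluster CL (kap k))" for \<omega> a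
      proof -
        have "a k \<in> Op \<omega>" if k: "k < RR j" for k
        proof -
          have h: "\<omega> (slot (a k)) = val (a k)" "a k \<in> P0 j \<union> (\<Union>k<RR j. A.cluster CL (kap k))"
            using that(1) \<open>\<And>k. k < RR j \<Longrightarrow> \<omega> (slot (a k)) = val (a k) \<and> a k \<in> P0 j \<union> (\<Union>k<RR j. A.cluster CL (kap k))\<close>[OF k] by auto
          have "a k < T \<and> valid (a k)"
            using h(2)
          proof
            assume "a k \<in> P0 j" thus ?thesis by (simp add: P0_def)
          next
            assume "a k \<in> (\<Union>k<RR j. A.cluster CL (kap k))"
            then obtain l where "l < RR j" "a k \<in> A.cluster CL (kap l)" by auto
            thus ?thesis using kap(2)[of l] site_valid[of "a k"] by (auto simp: A.cluster_def)
          qed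
          thus ?thesis using h(1) by (simp add: Op_def)
        qed
        thus ?thesis using assign[OF j that(2)] by blast
      qed
    qed
  qed
  \<comment> \<open>Linearity of expectation: every valid atom is open with probability
    \<open>1 / LL\<close>, and the dependence inside a cluster does not affect the sum.\<close>
  have Efac: "measure_pmf.expectation ?p (\<lambda>\<omega>. real (\<Sum>i<m. F i * YO \<omega> i)) = (\<Sum>t<T. if valid t then real (F (st (t div NN))) else 0) / real LL"
  proof -
    have pw: "real (\<Sum>i<m. F i * YO \<omega> i) = (\<Sum>t<T. (if valid t then real (F (st (t div NN))) else 0) * of_bool (\<omega> (slot t) = val t))" for \<omega>
    proof -
      have "(\<Sum>i<m. F i * YO \<omega> i) = (\<Sum>i<m. \<Sum>t\<in>{t \<in> Op \<omega>. site t = i}. F (site t))"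
        by (intro sum.cong refl) (simp add: YO_def)
      also have "\<dots> = (\<Sum>t\<in>Op \<omega>. F (site t))" by (rule sum.group) (use finOp siteOp in auto)
      finally have "real (\<Sum>i<m. F i * YO \<omega> i) = (\<Sum>t\<in>Op \<omega>. real (F (site t)))" by simp
      also have "\<dots> = (\<Sum>t<T. (if valid t then real (F (st (t div NN))) else 0) * of_bool (\<omega> (slot t) = val t))"
        by (rule sum.mono_neutral_cong_left) (auto simp: Op_def site_def)
      finally show ?thesis .
    qed
    have "measure_pmf.expectation ?p (\<lambda>\<omega>. real (\<Sum>i<m. F i * YO \<omega> i)) =
       (\<Sum>t<T. (if valid t then real (F (st (t div NN))) else 0) * measure_pmf.prob ?p {\<omega>. \<omega> (slot t) = val t})"
      unfolding pw expectation_sum_finite[OF finite_set_draws] by (simp add: expectation_of_bool)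
    also have "\<dots> = (\<Sum>t<T. (if valid t then real (F (st (t div NN))) else 0) * (1 / real LL))"
      by (intro sum.cong refl) (use slotval prob_draw_eq[OF LLp] in simp)
    finally show ?thesis by (simp add: sum_divide_distrib)
  qed
  have sumP0: "(\<Sum>t\<in>P0 j. real (A.\<delta> j t)) = (\<Sum>k<K. real (am k mod NN) * (if j \<in> mem k then real (D (st k) j) else 0))" for j
  proof -
    have "(\<Sum>t\<in>P0 j. real (A.\<delta> j t)) = (\<Sum>t<T. if valid t then (if j \<in> mem (t div NN) then real (D (st (t div NN)) j) else 0) else 0)"
      by (rule sum.mono_neutral_cong_left) (auto simp: P0_def A.\<delta>_def site_def)
    also have "\<dots> = (\<Sum>k<K. of_nat (am k mod NN) * (if j \<in> mem k then real (D (st k) j) else 0))" by (rule blocks)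
    finally show ?thesis .
  qed
  have sc: "real (star_cost (st k) (mem k)) = real (F (st k)) + (\<Sum>j<n. if j \<in> mem k then real (D (st k) j) else 0)" for k
  proof -
    have "(\<Sum>j<n. if j \<in> mem k then real (D (st k) j) else 0) = (\<Sum>j\<in>mem k. real (D (st k) j))"
      by (rule sum.mono_neutral_cong_right) (use memn in auto)
    thus ?thesis by (simp add: star_cost_def)
  qed
  have fixed: "real (\<Sum>i<m. F i * \<sigma>7 bY i) + real (\<Sum>i<m. \<Sum>j<n. D i j * \<sigma>7 bX (i * n + j)) =
      (\<Sum>k<K. real (q k) * real (star_cost (st k) (mem k)))"
  proof -
    have stq: "st k < m \<or> q k = 0" for k using stm[of k] by (auto simp: q_def)
    have a: "(\<Sum>i<m. F i * \<sigma>7 bY i) = (\<Sum>k<K. F (st k) * q k)"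
    proof -
      have "(\<Sum>i<m. F i * \<sigma>7 bY i) = (\<Sum>i<m. \<Sum>k<K. if st k = i then F i * q k else 0)"
        unfolding Y7 sum_distrib_left by (intro sum.cong refl) auto
      also have "\<dots> = (\<Sum>k<K. F (st k) * q k)" by (rule sum_swap_select) (use stq in force)
      finally show ?thesis .
    qed
    have b: "(\<Sum>i<m. \<Sum>j<n. D i j * \<sigma>7 bX (i * n + j)) = (\<Sum>k<K. \<Sum>j<n. D (st k) j * (if j \<in> mem k then q k else 0))"
    proof -
      have "(\<Sum>i<m. D i j * \<sigma>7 bX (i * n + j)) = (\<Sum>k<K. D (st k) j * (if j \<in> mem k then q k else 0))" if "j < n" for j
      proof -
        have "(\<Sum>i<m. D i j * \<sigma>7 bX (i * n + j)) = (\<Sum>i<m. \<Sum>k<K. if st k = i then D i j * (if j \<in> mem k then q k else 0) else 0)"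
          unfolding X7[OF that] sum_distrib_left by (intro sum.cong refl) auto
        also have "\<dots> = (\<Sum>k<K. D (st k) j * (if j \<in> mem k then q k else 0))" by (rule sum_swap_select) (use stq in force)
        finally show ?thesis .
      qed
      hence "(\<Sum>j<n. \<Sum>i<m. D i j * \<sigma>7 bX (i * n + j)) = (\<Sum>j<n. \<Sum>k<K. D (st k) j * (if j \<in> mem k then q k else 0))" by simp
      thus ?thesis by (subst (1 2) sum.swap) simp
    qed
    show ?thesis unfolding a b of_nat_sum sum.distrib[symmetric] sc
      by (intro sum.cong refl) (simp add: algebra_simps sum_distrib_left if_distrib cong: if_cong)
  qed
  have resid: "(\<Sum>t<T. if valid t then real (F (st (t div NN))) else 0) + (\<Sum>j<n. \<Sum>t\<in>P0 j. real (A.\<delta> j t)) =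
      (\<Sum>k<K. real (am k mod NN) * real (star_cost (st k) (mem k)))"
  proof -
    have "(\<Sum>t<T. if valid t then real (F (st (t div NN))) else 0) = (\<Sum>k<K. of_nat (am k mod NN) * real (F (st k)))"
      by (rule blocks)
    moreover have "(\<Sum>j<n. \<Sum>t\<in>P0 j. real (A.\<delta> j t)) =
        (\<Sum>k<K. \<Sum>j<n. real (am k mod NN) * (if j \<in> mem k then real (D (st k) j) else 0))"
      unfolding sumP0 by (rule sum.swap)
    ultimately show ?thesis unfolding sc by (simp only: distrib_left sum_distrib_left sum.distrib)
  qed
  have tc: "real (total_cost \<sigma>6 K) = (\<Sum>k<K. real (am k) * real (star_cost (st k) (mem k)))"
    unfolding total_cost_def am_def st_def mem_def by (simp add: mult.commute)
  let ?C = "\<lambda>k. real (star_cost (st k) (mem k))"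
  have cost_eq: "real (\<Sum>i<m. F i * fin \<omega> bOUT i) + real (\<Sum>i<m. \<Sum>j<n. D i j * fin \<omega> bOUT (m + (i * n + j))) =
      (\<Sum>k<K. real (q k) * ?C k) + (real (\<Sum>i<m. F i * YO \<omega> i) + (\<Sum>j<n. real (\<Sum>i<m. D i j * XO \<omega> i j)))" for \<omega>
  proof -
    have "(\<Sum>i<m. F i * fin \<omega> bOUT i) = (\<Sum>i<m. F i * \<sigma>7 bY i) + (\<Sum>i<m. F i * YO \<omega> i)"
      unfolding sum.distrib[symmetric] by (intro sum.cong refl) (simp add: outY algebra_simps)
    moreover have "(\<Sum>i<m. \<Sum>j<n. D i j * fin \<omega> bOUT (m + (i * n + j))) =
        (\<Sum>i<m. \<Sum>j<n. D i j * \<sigma>7 bX (i * n + j)) + (\<Sum>i<m. \<Sum>j<n. D i j * XO \<omega> i j)"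
      unfolding sum.distrib[symmetric] by (intro sum.cong refl) (simp only: outX lessThan_iff distrib_left)
    moreover have "(\<Sum>i<m. \<Sum>j<n. D i j * XO \<omega> i j) = (\<Sum>j<n. \<Sum>i<m. D i j * XO \<omega> i j)" by (rule sum.swap)
    ultimately show ?thesis using fixed by simp
  qed
  have int: "integrable (measure_pmf ?p) (f :: (nat \<Rightarrow> nat) \<Rightarrow> real)" for f
    by (rule integrable_measure_pmf_finite[OF finite_set_draws])
  have "measure_pmf.expectation ?p
       (\<lambda>\<omega>. real (\<Sum>i<m. F i * fin \<omega> bOUT i) + real (\<Sum>i<m. \<Sum>j<n. D i j * fin \<omega> bOUT (m + (i * n + j)))) =
     (\<Sum>k<K. real (q k) * ?C k) + (measure_pmf.expectation ?p (\<lambda>\<omega>. real (\<Sum>i<m. F i * YO \<omega> i)) +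
       (\<Sum>j<n. measure_pmf.expectation ?p (\<lambda>\<omega>. real (\<Sum>i<m. D i j * XO \<omega> i j))))"
    unfolding cost_eq Bochner_Integration.integral_add[OF int int] expectation_sum_finite[OF finite_set_draws] by simp
  also have "\<dots> \<le> (\<Sum>k<K. real (q k) * ?C k) + ((\<Sum>t<T. if valid t then real (F (st (t div NN))) else 0) / real LL +
       (\<Sum>j<n. (\<Sum>t\<in>P0 j. real (A.\<delta> j t)) / real LL))"
    unfolding Efac by (intro add_left_mono sum_mono Econn) simp
  also have "\<dots> = (\<Sum>k<K. real (q k) * ?C k) + (\<Sum>k<K. real (am k mod NN) * ?C k) / real LL"
    unfolding resid[symmetric] add_divide_distrib sum_divide_distrib ..
  \<comment> \<open>A copy opened outright is paid once, which is at most the factor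
    \<open>NN / LL\<close> paid on the fractional rest. This brings both parts to the same
    rate.\<close>
  also have "\<dots> \<le> (\<Sum>k<K. real NN * real (q k) * ?C k) / real LL + (\<Sum>k<K. real (am k mod NN) * ?C k) / real LL"
  proof -
    have "real (q k) * ?C k \<le> real NN * real (q k) * ?C k / real LL" for k
    proof -
      have "1 \<le> real NN / real LL" using LLp by (simp add: NN_def LL_def MM_def)
      hence "(real (q k) * ?C k) * 1 \<le> (real (q k) * ?C k) * (real NN / real LL)" by (intro mult_left_mono) auto
      thus ?thesis by (simp add: ac_simps)
    qed
    thus ?thesis unfolding sum_divide_distrib by (intro add_right_mono sum_mono)
  qed
  also have "\<dots> = real (total_cost \<sigma>6 K) / real LL"
  proof -
    have "real (am k) = real NN * real (q k) + real (am k mod NN)" for k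
    proof -
      have "am k = NN * q k + am k mod NN" by (simp add: q_def)
      thus ?thesis by (metis of_nat_add of_nat_mult)
    qed
    thus ?thesis unfolding tc add_divide_distrib[symmetric] sum.distrib[symmetric] by (simp add: algebra_simps)
  qed
  also have "\<dots> \<le> Z * (1000 * real n + real NN * (1002 / 1000) + 1) / real LL"
    using mend(2) by (intro divide_right_mono) auto
  also have "\<dots> \<le> Z * (19 / 11 * (1 + 1 / 500 + 1 / 10000))"
  proof -
    have "(1000 * real n + real NN * (1002 / 1000) + 1) / real LL \<le> 19 / 11 * (1 + 1 / 500 + 1 / 10000)"
      by (simp add: NN_def LL_def MM_def field_simps)
    from mult_left_mono[OF this Z(1)] show ?thesis by simp
  qed
  finally show "measure_pmf.expectation ?p
       (\<lambda>\<omega>. real (\<Sum>i<m. F i * fin \<omega> bOUT i) + real (\<Sum>i<m. \<Sum>j<n. D i j * fin \<omega> bOUT (m + (i * n + j))))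
       \<le> 19 / 11 * (1 + 1 / 500 + 1 / 10000) * Z" by (simp add: mult.commute)
qed

end

section \<open>Assembly\<close>

text \<open>Nested enumerations with rows of equal length become one indexed list, so that positions
  in the encoding can be computed by division.\<close>

lemma concat_map_blocks:
  "concat (map (\<lambda>i. map (g i) [0..<w]) [0..<k]) = map (\<lambda>t. g (t div w) (t mod w)) [0..<k * w]"
proof (induction k)
  case (Suc k)
  have "map (\<lambda>t. g (t div w) (t mod w)) [k * w..<k * w + w] = map (g k) [0..<w]"
    by (rule nth_equalityI) auto
  moreover have "[0..<Suc k * w] = [0..<k * w] @ [k * w..<k * w + w]"
    using upt_add_eq_append[of 0 "k * w" w] by (simp add: add.commute)
  ultimately show ?case using Suc by simp
qed simp

definition rat_part :: "rat \<Rightarrow> nat \<Rightarrow> nat" where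
  "rat_part q b = (if b = 0 then nat (fst (quotient_of q)) else nat (snd (quotient_of q)))"

lemma encode_rat_map: "encode_rat q = map (rat_part q) [0..<2]"
  by (simp add: encode_rat_def rat_part_def upt_rec)

lemma encode_blocks:
  "encode I = [num_sites I, num_clients I] @
     map (\<lambda>t. rat_part (open_cost I (t div 2)) (t mod 2)) [0..<num_sites I * 2] @
     map (\<lambda>s. rat_part (conn_cost I (s div (num_clients I * 2)) (s mod (num_clients I * 2) div 2))
        (s mod (num_clients I * 2) mod 2)) [0..<num_sites I * (num_clients I * 2)] @
     map (demand I) [0..<num_clients I]"
  unfolding encode_def encode_rat_map concat_map_blocks ..

lemma length_encode:
  "length (encode I) = 2 + (2 * num_sites I + (2 * (num_sites I * num_clients I) + num_clients I))"
  by (simp add: encode_blocks)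

definition inp_of :: "ftfp \<Rightarrow> memory" where
  "inp_of I = (\<lambda>a. if a < length (encode I) then encode I ! a else 0)"

lemma pair_index_less: "i < m \<Longrightarrow> j < n \<Longrightarrow> i * n + j < m * (n :: nat)"
proof -
  assume "i < m" "j < n"
  have "i * n + j < Suc i * n" using \<open>j < n\<close> by simp
  also have "\<dots> \<le> m * n" using \<open>i < m\<close> by (intro mult_le_mono1) simp
  finally show ?thesis .
qed

lemma inp_of_values:
  fixes I :: ftfp
  defines "m \<equiv> num_sites I" and "n \<equiv> num_clients I" and "inp \<equiv> inp_of I"
  shows "inp 0 = m" "inp 1 = n"
    and "i < m \<Longrightarrow> b < 2 \<Longrightarrow> inp (2 + 2 * i + b) = rat_part (open_cost I i) b"
    and "i < m \<Longrightarrow> j < n \<Longrightarrow> b < 2 \<Longrightarrow> inp (2 + 2 * m + 2 * (i * n + j) + b) = rat_part (conn_cost I i j) b"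
    and "j < n \<Longrightarrow> inp (2 + 2 * m + 2 * (m * n) + j) = demand I j"
proof -
  let ?A = "[num_sites I, num_clients I]"
  let ?B = "map (\<lambda>t. rat_part (open_cost I (t div 2)) (t mod 2)) [0..<num_sites I * 2]"
  let ?C = "map (\<lambda>s. rat_part (conn_cost I (s div (num_clients I * 2)) (s mod (num_clients I * 2) div 2))
        (s mod (num_clients I * 2) mod 2)) [0..<num_sites I * (num_clients I * 2)]"
  let ?E = "map (demand I) [0..<num_clients I]"
  have enc: "encode I = ?A @ ?B @ ?C @ ?E" by (rule encode_blocks)
  have len: "length (encode I) = 2 + (2 * m + (2 * (m * n) + n))" using length_encode by (simp add: m_def n_def)
  have inp: "inp a = (?A @ ?B @ ?C @ ?E) ! a" if "a < 2 + (2 * m + (2 * (m * n) + n))" for a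
    using that len by (simp add: inp_def inp_of_def enc)
  show "inp 0 = m" using inp[of 0] by (simp add: m_def)
  show "inp 1 = n" using inp[of 1] by (simp add: n_def)
  show "inp (2 + 2 * i + b) = rat_part (open_cost I i) b" if "i < m" "b < 2"
  proof -
    have "inp (2 + 2 * i + b) = (?A @ ?B @ ?C @ ?E) ! (2 + (2 * i + b))" using inp[of "2 + (2 * i + b)"] that by simp
    also have "\<dots> = (?B @ ?C @ ?E) ! (2 * i + b)" by simp
    also have "\<dots> = ?B ! (2 * i + b)" using that by (subst nth_append) (simp add: m_def)
    also have "\<dots> = rat_part (open_cost I i) b" using that by (simp add: m_def)
    finally show ?thesis .
  qed
  show "inp (2 + 2 * m + 2 * (i * n + j) + b) = rat_part (conn_cost I i j) b" if h: "i < m" "j < n" "b < 2"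
  proof -
    have "2 * t + b < 2 * u" if "t < u" for t u using that h(3) by simp
    from this[OF pair_index_less[OF h(1,2)]] have lt: "2 * (i * n + j) + b < m * (n * 2)" by (simp add: ac_simps)
    define t where "t = 2 * (i * n + j) + b"
    have "inp (2 + 2 * m + 2 * (i * n + j) + b) = inp (2 + (2 * m + t))" by (simp add: t_def add.assoc)
    also have "\<dots> = (?A @ ?B @ ?C @ ?E) ! (2 + (2 * m + t))"
      using lt by (intro inp) (simp add: t_def ac_simps)
    also have "\<dots> = (?B @ ?C @ ?E) ! (2 * m + t)" by simp
    also have "\<dots> = (?C @ ?E) ! t" by (subst nth_append) (simp add: m_def)
    also have "\<dots> = ?C ! t" using lt by (subst nth_append) (simp add: m_def n_def t_def)
    also have "\<dots> = rat_part (conn_cost I i j) b"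
    proof -
      have e: "t = i * (n * 2) + (2 * j + b)" by (simp add: t_def algebra_simps)
      have l2: "2 * j + b < n * 2" using h by simp
      have "t div (n * 2) = i" "t mod (n * 2) = 2 * j + b"
        unfolding e using l2 by simp_all
      moreover have "?C ! t = rat_part (conn_cost I (t div (n * 2)) (t mod (n * 2) div 2)) (t mod (n * 2) mod 2)"
        using lt by (simp add: m_def n_def t_def)
      ultimately show ?thesis using h(3) by simp
    qed
    finally show ?thesis .
  qed
  show "inp (2 + 2 * m + 2 * (m * n) + j) = demand I j" if "j < n"
  proof -
    have e: "2 + 2 * m + 2 * (m * n) + j = 2 + (2 * m + (m * (n * 2) + j))" by simp
    have "inp (2 + 2 * m + 2 * (m * n) + j) = (?A @ ?B @ ?C @ ?E) ! (2 + (2 * m + (m * (n * 2) + j)))"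
      unfolding e using that by (intro inp) simp
    also have "\<dots> = (?B @ ?C @ ?E) ! (2 * m + (m * (n * 2) + j))" by simp
    also have "\<dots> = (?C @ ?E) ! (m * (n * 2) + j)" by (subst nth_append) (simp add: m_def)
    also have "\<dots> = ?E ! j" by (subst nth_append) (simp add: m_def n_def)
    finally show ?thesis using that by (simp add: n_def)
  qed
qed

lemma rat_part_pos: "0 < rat_part q 1"
  using quotient_of_denom_pos'[of q] by (simp add: rat_part_def)

lemma real_of_rat_parts: "0 \<le> q \<Longrightarrow> real_of_rat q = real (rat_part q 0) / real (rat_part q 1)"
proof -
  assume q: "0 \<le> q"
  obtain a d where ad: "quotient_of q = (a, d)" by (cases "quotient_of q")
  have d: "0 < d" using quotient_of_denom_pos[OF ad] .
  have qd: "q = of_int a / of_int d" by (rule quotient_of_div[OF ad])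
  have "0 \<le> a" using q d unfolding qd by (simp add: zero_le_divide_iff)
  moreover have "real_of_rat q = of_int a / of_int d" by (simp add: qd of_rat_divide)
  ultimately show ?thesis using d by (simp add: rat_part_def ad)
qed

section \<open>From an encoded instance to integer data and LP bounds\<close>

locale ftfp_encoded =
  fixes I :: ftfp
  assumes inst: "ftfp_instance I"
begin

abbreviation "m \<equiv> num_sites I"
abbreviation "n \<equiv> num_clients I"
abbreviation "inp \<equiv> inp_of I"

definition Q :: nat where "Q = st_prods inp bQ 0"
definition Fc :: "nat \<Rightarrow> nat" where "Fc i = inp (2 + 2 * i) * (Q div inp (3 + 2 * i))"
definition Dc :: "nat \<Rightarrow> nat \<Rightarrow> nat" where
  "Dc i j = inp (2 + 2 * m + 2 * (i * n + j)) * (Q div inp (3 + 2 * m + 2 * (i * n + j)))"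

lemmas iv = inp_of_values[where I = I]

lemma f_parts: "i < m \<Longrightarrow> inp (2 + 2 * i) = rat_part (open_cost I i) 0"
  "i < m \<Longrightarrow> inp (3 + 2 * i) = rat_part (open_cost I i) 1"
  using iv(3)[of i 0] iv(3)[of i 1] by (simp_all add: numeral_3_eq_3 numeral_2_eq_2)

lemma d_parts: "i < m \<Longrightarrow> j < n \<Longrightarrow> inp (2 + 2 * m + 2 * (i * n + j)) = rat_part (conn_cost I i j) 0"
  "i < m \<Longrightarrow> j < n \<Longrightarrow> inp (3 + 2 * m + 2 * (i * n + j)) = rat_part (conn_cost I i j) 1"
  using iv(4)[of i j 0] iv(4)[of i j 1] by (simp_all add: numeral_3_eq_3 numeral_2_eq_2)

lemma d_index: "t < m * n \<Longrightarrow> \<exists>i<m. \<exists>j<n. t = i * n + j"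
proof -
  assume t: "t < m * n"
  hence "0 < n" by (cases n) auto
  thus ?thesis using t by (intro exI[of _ "t div n"] conjI exI[of _ "t mod n"]) (auto simp: less_mult_imp_div_less)
qed

lemma Q_eq: "Q = (\<Prod>i<m. inp (3 + 2 * i)) * (\<Prod>t<m * n. inp (3 + 2 * m + 2 * t))"
  unfolding Q_def by (rule st_prods_values(1)[OF iv(1,2)])

lemma Q_pos: "0 < Q"
proof -
  have "0 < inp (3 + 2 * m + 2 * t)" if "t < m * n" for t
    using d_index[OF that] d_parts(2) rat_part_pos by auto
  thus ?thesis unfolding Q_eq using f_parts(2) rat_part_pos by (auto intro!: prod_pos)
qed

lemma scaled: "d dvd Q \<Longrightarrow> 0 < d \<Longrightarrow> real (a * (Q div d)) = real Q * (real a / real d)"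
  by (simp add: real_of_nat_div)

lemma Fc_real: "i < m \<Longrightarrow> real (Fc i) = real Q * real_of_rat (open_cost I i)"
proof -
  assume i: "i < m"
  have "inp (3 + 2 * i) dvd (\<Prod>i<m. inp (3 + 2 * i))" using i by (intro dvd_prodI) auto
  hence dv: "inp (3 + 2 * i) dvd Q" unfolding Q_eq by (rule dvd_mult2)
  have "0 \<le> open_cost I i" using inst i by (simp add: ftfp_instance_def)
  note parts = real_of_rat_parts[OF this]
  show ?thesis unfolding parts Fc_def f_parts[OF i] by (rule scaled[OF dv[unfolded f_parts[OF i]] rat_part_pos])
qed

lemma metric: "is_metric_on (points I) (distance I)"
  using inst by (simp add: ftfp_instance_def)

lemma Inl_point: "i < m \<Longrightarrow> Inl i \<in> points I" and Inr_point: "j < n \<Longrightarrow> Inr j \<in> points I"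
  by (auto simp: points_def)

lemma conn_nonneg:
  assumes "i < m" "j < n"
  shows "0 \<le> conn_cost I i j"
  using metric Inl_point[OF assms(1)] Inr_point[OF assms(2)] unfolding is_metric_on_def by blast

lemma Dc_real: "i < m \<Longrightarrow> j < n \<Longrightarrow> real (Dc i j) = real Q * real_of_rat (conn_cost I i j)"
proof -
  assume i: "i < m" and j: "j < n"
  let ?t = "i * n + j"
  have "inp (3 + 2 * m + 2 * ?t) dvd (\<Prod>t<m * n. inp (3 + 2 * m + 2 * t))"
    using pair_index_less[OF i j] by (intro dvd_prodI) auto
  hence dv: "inp (3 + 2 * m + 2 * ?t) dvd Q" unfolding Q_eq by (rule dvd_mult)
  show ?thesis unfolding real_of_rat_parts[OF conn_nonneg[OF i j]] Dc_def d_parts[OF i j]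
    by (rule scaled[OF dv[unfolded d_parts[OF i j]] rat_part_pos])
qed

sublocale ftfp_data n m Fc Dc "demand I"
proof
  show "0 < demand I j" if "j < n" for j using inst that by (simp add: ftfp_instance_def)
  show "0 < m" if "0 < n" using inst that by (simp add: ftfp_instance_def)
  show "Dc i j \<le> Dc i j' + Dc i' j' + Dc i' j" if h: "i < m" "i' < m" "j < n" "j' < n" for i i' j j'
  proof -
    note p = Inl_point[OF h(1)] Inl_point[OF h(2)] Inr_point[OF h(3)] Inr_point[OF h(4)]
    \<comment> \<open>The path runs from \<open>i\<close> through \<open>j'\<close> and
      \<open>i'\<close> to \<open>j\<close>; the client-client distance is an intermediate quantity
      that the next inequality eliminates.\<close>
    have t1: "distance I (Inl i) (Inr j) \<le> distance I (Inl i) (Inr j') + distance I (Inr j') (Inr j)"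
      using metric p unfolding is_metric_on_def by blast
    have t2: "distance I (Inr j') (Inr j) \<le> distance I (Inr j') (Inl i') + distance I (Inl i') (Inr j)"
      using metric p unfolding is_metric_on_def by blast
    have t3: "distance I (Inr j') (Inl i') = distance I (Inl i') (Inr j')"
      using metric p unfolding is_metric_on_def by blast
    have "conn_cost I i j \<le> conn_cost I i j' + conn_cost I i' j' + conn_cost I i' j" using t1 t2 t3 by linarith
    hence "real_of_rat (conn_cost I i j) \<le> real_of_rat (conn_cost I i j' + conn_cost I i' j' + conn_cost I i' j)"
      by (simp only: of_rat_less_eq)
    hence "real Q * real_of_rat (conn_cost I i j) \<le>
        real Q * real_of_rat (conn_cost I i j') + real Q * real_of_rat (conn_cost I i' j') + real Q * real_of_rat (conn_cost I i' j)"
      using mult_left_mono[of _ _ "real Q"] by (simp add: of_rat_add distrib_left[symmetric])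
    hence "real (Dc i j) \<le> real (Dc i j') + real (Dc i' j') + real (Dc i' j)"
      using h by (simp add: Dc_real)
    thus ?thesis by linarith
  qed
qed

lemma st_scale_params: "k \<in> {2..10} \<Longrightarrow> st_scale inp k = st_params inp k"
  by (simp add: st_scale_unwritten st_prods_unwritten st_input_unwritten)

lemma RP_eq: "st_prods inp bRP 0 = RP"
  unfolding st_prods_values(2)[OF iv(1,2)] RP_def by (intro prod.cong refl) (simp only: iv(5) lessThan_iff)

lemma st_scale_ok: "ok_data (st_scale inp)"
  unfolding ok_data_def
proof (intro conjI allI impI)
  note v = st_params_values[OF iv(1,2)]
  show "st_scale inp bNS 0 = m" "st_scale inp bNC 0 = n" "st_scale inp bNM 0 = m * n" "st_scale inp bNN 0 = NN"
    "st_scale inp bLL 0 = LL" "st_scale inp bKN 0 = n * NN" "st_scale inp bTN 0 = n * NN * NN"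
    "st_scale inp bSN 0 = n * (n * NN)"
    by (simp_all add: st_scale_params v NN_def LL_def MM_def)
  show "st_scale inp bRP 0 = RP" by (simp add: st_scale_unwritten RP_eq)
  show "st_scale inp bR j = demand I j" if "j < n" for j
    using st_input_values(5)[OF iv(1,2) that] iv(5)[OF that] by (simp add: st_scale_unwritten st_prods_unwritten)
  show "st_scale inp bF i = Fc i" if "i < m" for i
    using st_scale_values(1)[OF iv(1,2) that] by (simp add: Fc_def Q_def)
  show "st_scale inp bD (i * n + j) = Dc i j" if "i < m" "j < n" for i j
    using st_scale_values(2)[OF iv(1,2) pair_index_less[OF that]] by (simp add: Dc_def Q_def)
  show "st_scale inp bG j = RP div demand I j" if "j < n" for j
    using st_scale_values(3)[OF iv(1,2) that] iv(5)[OF that] by (simp add: RP_eq)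
qed

lemma st_scale_W: "j < n \<Longrightarrow> st_scale inp bW j = RP div demand I j"
  using st_scale_values(4)[OF iv(1,2)] iv(5) by (simp add: RP_eq)

lemma st_scale_zero: "l \<notin> {2..21} \<union> {23, 24} \<Longrightarrow> st_scale inp l = (\<lambda>_. 0)"
proof -
  assume l: "l \<notin> {2..21} \<union> {23, 24}"
  have "st_scale inp l = st_prods inp l" by (rule st_scale_unwritten) (use l in auto)
  also have "\<dots> = st_input inp l" by (rule st_prods_unwritten) (use l in auto)
  also have "\<dots> = st_params inp l" by (rule st_input_unwritten) (use l in auto)
  also have "\<dots> = (\<lambda>_. 0)" by (rule st_params_zero) (use l in auto)
  finally show ?thesis .
qed

lemma scaled_cost:
  "real Q * cost I y x = (\<Sum>i<m. real (Fc i) * y i) + (\<Sum>i<m. \<Sum>j<n. real (Dc i j) * x i j)"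
  unfolding cost_def distrib_left sum_distrib_left by (simp add: Fc_real Dc_real mult.assoc)

text \<open>Weak duality, term by term: \<open>x i j \<le> y i\<close> gives \<open>x i j * \<alpha>
  j \<le> D * x i j + max 0 (\<alpha> j - D) * y i\<close> for \<open>D = Dc i j\<close>, and dual
  feasibility sums the second terms to at most the opening costs.\<close>

lemma feasible_dual_bound:
  assumes "feasible I y (x :: nat \<Rightarrow> nat \<Rightarrow> real)"
  shows "dual_bound (real Q * cost I y x)" "0 \<le> real Q * cost I y x"
proof -
  have y: "\<And>i. i < m \<Longrightarrow> 0 \<le> y i" and x: "\<And>i j. i < m \<Longrightarrow> j < n \<Longrightarrow> 0 \<le> x i j \<and> x i j \<le> y i"
    and d: "\<And>j. j < n \<Longrightarrow> real (demand I j) \<le> (\<Sum>i<m. x i j)"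
    using assms unfolding feasible_def by auto
  show "0 \<le> real Q * cost I y x"
    unfolding scaled_cost using x y by (auto intro!: add_nonneg_nonneg sum_nonneg)
  show "dual_bound (real Q * cost I y x)"
    unfolding dual_bound_def
  proof (intro allI impI)
    fix \<alpha> :: "nat \<Rightarrow> real"
    assume a: "\<forall>j<n. 0 \<le> \<alpha> j" and dual: "\<forall>i<m. (\<Sum>j<n. max 0 (\<alpha> j - real (Dc i j))) \<le> real (Fc i)"
    have "(\<Sum>j<n. real (demand I j) * \<alpha> j) \<le> (\<Sum>j<n. (\<Sum>i<m. x i j) * \<alpha> j)"
      using a d by (intro sum_mono mult_right_mono) auto
    also have "\<dots> = (\<Sum>i<m. \<Sum>j<n. x i j * \<alpha> j)" unfolding sum_distrib_right by (rule sum.swap)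
    also have "\<dots> \<le> (\<Sum>i<m. \<Sum>j<n. real (Dc i j) * x i j + max 0 (\<alpha> j - real (Dc i j)) * y i)"
    proof (intro sum_mono)
      fix i j assume "i \<in> {..<m}" "j \<in> {..<n}"
      hence h: "0 \<le> x i j" "x i j \<le> y i" using x by auto
      have "x i j * \<alpha> j \<le> x i j * (real (Dc i j) + max 0 (\<alpha> j - real (Dc i j)))"
        using h by (intro mult_left_mono) auto
      also have "\<dots> \<le> real (Dc i j) * x i j + max 0 (\<alpha> j - real (Dc i j)) * y i"
        using mult_left_mono[OF h(2), of "max 0 (\<alpha> j - real (Dc i j))"] by (simp add: algebra_simps)
      finally show "x i j * \<alpha> j \<le> real (Dc i j) * x i j + max 0 (\<alpha> j - real (Dc i j)) * y i" .
    qed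
    also have "\<dots> = (\<Sum>i<m. \<Sum>j<n. real (Dc i j) * x i j) + (\<Sum>i<m. (\<Sum>j<n. max 0 (\<alpha> j - real (Dc i j))) * y i)"
      by (simp add: sum.distrib sum_distrib_right)
    also have "\<dots> \<le> (\<Sum>i<m. \<Sum>j<n. real (Dc i j) * x i j) + (\<Sum>i<m. real (Fc i) * y i)"
      using dual y by (intro add_left_mono sum_mono mult_right_mono) auto
    finally show "(\<Sum>j<n. real (demand I j) * \<alpha> j) \<le> real Q * cost I y x"
      unfolding scaled_cost by simp
  qed
qed

text \<open>Ensures that the infima in \<open>LP_opt\<close> and \<open>OPT\<close> are taken over
  nonempty sets.\<close>

lemma int_feasible_ex: "\<exists>y x. feasible I (y :: nat \<Rightarrow> nat) x"
proof -
  have "feasible I (\<lambda>_. \<Sum>j<n. demand I j) (\<lambda>i j. if i = 0 then demand I j else 0)"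
    unfolding feasible_def
  proof (intro conjI allI impI)
    fix i j assume "i < m" "j < n"
    show "(if i = 0 then demand I j else 0) \<le> (\<Sum>j<n. demand I j)"
      using member_le_sum[of j "{..<n}" "demand I"] \<open>j < n\<close> by simp
  next
    fix j assume "j < n"
    hence "0 < m" using sites_ne by auto
    thus "of_nat (demand I j) \<le> (\<Sum>i<m. if i = 0 then demand I j else 0)" by simp
  qed auto
  thus ?thesis by blast
qed

lemma int_feasible_real: "feasible I (y :: nat \<Rightarrow> nat) x \<Longrightarrow> feasible I (\<lambda>i. real (y i)) (\<lambda>i j. real (x i j))"
  unfolding feasible_def by (auto simp flip: of_nat_sum)

lemma LP_opt_le_OPT: "LP_opt I \<le> OPT I"
  unfolding LP_opt_def OPT_def
proof (rule cInf_superset_mono)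
  show "{int_cost I y x |y x. feasible I y x} \<noteq> {}" using int_feasible_ex by blast
  show "bdd_below {cost I y x |y x. feasible I y x}"
  proof (rule bdd_belowI)
    fix c assume "c \<in> {cost I y x |y x. feasible I y x}"
    then obtain y x where "c = cost I y x" "feasible I y x" by blast
    thus "0 \<le> c" using feasible_dual_bound(2)[of y x] Q_pos by (simp add: zero_le_mult_iff)
  qed
  show "{int_cost I y x |y x. feasible I y x} \<subseteq> {cost I y x |y x. feasible I y x}"
    unfolding int_cost_def using int_feasible_real by blast
qed

end

section \<open>Composition of the phases and polynomial running time\<close>

primrec seq_com :: "bcom list \<Rightarrow> com" where
  "seq_com [] = Skip"
| "seq_com (c # cs) = Seq (ccom c) (seq_com cs)"

primrec sems :: "memory \<Rightarrow> bcom list \<Rightarrow> banks \<Rightarrow> banks" where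
  "sems inp [] \<sigma> = \<sigma>"
| "sems inp (c # cs) \<sigma> = sems inp cs (sem inp c \<sigma>)"

primrec list_bits :: "bcom list \<Rightarrow> nat \<Rightarrow> nat \<Rightarrow> nat" where
  "list_bits [] U b = b"
| "list_bits (c # cs) U b = list_bits cs U (phase_bits c U b)"

primrec list_time :: "bcom list \<Rightarrow> nat \<Rightarrow> nat \<Rightarrow> nat" where
  "list_time [] U b = 1"
| "list_time (c # cs) U b = 1 + phase_time c U b + list_time cs U (phase_bits c U b)"

definition size_exprs :: "bexpr set" where
  "size_exprs = {Var bNS, Var bNC, Var bNM, Var bKN, Var bTN, Var bSN}"

text \<open>Banks 2 to 9 hold the dimensions and loop ranges. As no such phase writes them, one
  bound \<open>U\<close> serves all loops of all these phases.\<close>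

definition sized :: "bcom \<Rightarrow> bool" where
  "sized c \<longleftrightarrow> wf (written c) c \<and> written c \<inter> {2..9} = {} \<and> loop_bounds c \<subseteq> size_exprs"

lemma le_phase_bits: "b \<le> phase_bits c U b"
  by (simp add: phase_bits_def)

lemma le_list_bits: "b \<le> list_bits cs U b"
proof (induction cs arbitrary: b)
  case (Cons c cs)
  show ?case using Cons[of "phase_bits c U b"] le_phase_bits[of b c U] by simp
qed simp

lemma sems_unwritten: "(\<And>c. c \<in> set cs \<Longrightarrow> k \<notin> written c) \<Longrightarrow> sems inp cs \<sigma> k = \<sigma> k"
  by (induction cs arbitrary: \<sigma>) (auto simp: sem_unwritten)

lemma exec_seq_com:
  assumes "\<And>c. c \<in> set cs \<Longrightarrow> sized c" "\<forall>k i. \<sigma> k i \<le> 2 ^ b" "\<forall>a. inp a \<le> 2 ^ b"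
    and "\<And>e. e \<in> size_exprs \<Longrightarrow> ev inp \<sigma> e \<le> U"
  shows "(\<exists>t \<le> list_time cs U b. exec (seq_com cs) (flat inp \<sigma>) (flat inp (sems inp cs \<sigma>)) t) \<and>
    (\<forall>k i. sems inp cs \<sigma> k i \<le> 2 ^ list_bits cs U b)"
  using assms
proof (induction cs arbitrary: \<sigma> b)
  case Nil
  show ?case using exec_Skip[of "flat inp \<sigma>"] Nil.prems(2) by auto
next
  case (Cons c cs)
  have c: "wf (written c) c" "written c \<inter> {2..9} = {}" "loop_bounds c \<subseteq> size_exprs"
    using Cons.prems(1)[of c] by (auto simp: sized_def)
  let ?\<tau> = "sem inp c \<sigma>" and ?b = "phase_bits c U b"
  have lb: "ev inp \<sigma> e \<le> U" if "e \<in> loop_bounds c" for e using Cons.prems(4) c(3) that by blast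
  note ph = exec_phase[OF c(1) Cons.prems(2,3) lb]
  obtain t where t: "t \<le> phase_time c U b" "exec (ccom c) (flat inp \<sigma>) (flat inp ?\<tau>) t" using ph(1) by blast
  have "(\<exists>t \<le> list_time cs U ?b. exec (seq_com cs) (flat inp ?\<tau>) (flat inp (sems inp cs ?\<tau>)) t) \<and>
    (\<forall>k i. sems inp cs ?\<tau> k i \<le> 2 ^ list_bits cs U ?b)"
  proof (rule Cons.IH)
    show "sized d" if "d \<in> set cs" for d using Cons.prems(1) that by simp
    show "\<forall>k i. ?\<tau> k i \<le> 2 ^ ?b" by (rule ph(2))
    show "\<forall>a. inp a \<le> 2 ^ ?b" using Cons.prems(3) le_two_power_mono le_phase_bits by blast
    show "ev inp ?\<tau> e \<le> U" if e: "e \<in> size_exprs" for e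
    proof -
      have "ev inp ?\<tau> e = ev inp \<sigma> e"
      proof (rule ev_cong)
        fix k assume "k \<in> bank_set e"
        hence "k \<in> {2..9}" using e by (auto simp: size_exprs_def)
        thus "?\<tau> k = \<sigma> k" using c(2) by (intro sem_unwritten) auto
      qed
      thus ?thesis using Cons.prems(4)[OF e] by simp
    qed
  qed
  then obtain t' where t': "t' \<le> list_time cs U ?b" "exec (seq_com cs) (flat inp ?\<tau>) (flat inp (sems inp cs ?\<tau>)) t'"
    and bits: "\<forall>k i. sems inp cs ?\<tau> k i \<le> 2 ^ list_bits cs U ?b" by blast
  have "exec (seq_com (c # cs)) (flat inp \<sigma>) (flat inp (sems inp (c # cs) \<sigma>)) (1 + t + t')"
    using exec_Seq[OF t(2) t'(2)] by simp
  moreover have "1 + t + t' \<le> list_time (c # cs) U b" using t(1) t'(1) by simp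
  ultimately show ?case using bits by auto
qed

definition pre_list :: "bcom list" where
  "pre_list = [prog_input, prog_prods, prog_scale, prog_mwu, prog_split, prog_atoms, prog_cluster]"

definition post_list :: "bcom list" where
  "post_list = [prog_open, prog_connect, prog_output]"

definition pre_com :: com where
  "pre_com = Seq (ccom prog_dims) (Seq (ccom prog_params) (seq_com pre_list))"

definition post_com :: com where
  "post_com = Seq (seq_com post_list) out_com"

definition main_com :: com where
  "main_com = Seq pre_com (Seq draw_com post_com)"

lemma sized_lists: "c \<in> set pre_list \<Longrightarrow> sized c" "c \<in> set post_list \<Longrightarrow> sized c"
proof -
  have "sized prog_input" "sized prog_prods" "sized prog_scale" "sized prog_mwu" "sized prog_split"
    "sized prog_atoms" "sized prog_cluster" "sized prog_open" "sized prog_connect" "sized prog_output"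
    unfolding sized_def by (auto simp: wf_progs) (auto simp: prog_defs size_exprs_def)
  thus "c \<in> set pre_list \<Longrightarrow> sized c" "c \<in> set post_list \<Longrightarrow> sized c"
    by (auto simp: pre_list_def post_list_def)
qed

definition loop_limit :: "nat \<Rightarrow> nat" where
  "loop_limit s = s + (s * (19 * (1000000 * (s + 1))) * (19 * (1000000 * (s + 1))) + s * (s * (19 * (1000000 * (s + 1)))))"

definition bits1 :: "nat \<Rightarrow> nat" where "bits1 s = phase_bits prog_dims 0 s"
definition bits2 :: "nat \<Rightarrow> nat" where "bits2 s = phase_bits prog_params 0 (bits1 s)"
definition bits3 :: "nat \<Rightarrow> nat" where "bits3 s = list_bits pre_list (loop_limit s) (bits2 s)"
definition bits4 :: "nat \<Rightarrow> nat" where "bits4 s = list_bits post_list (loop_limit s) (bits3 s)"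

definition pre_time :: "nat \<Rightarrow> nat" where
  "pre_time s = 1 + phase_time prog_dims 0 s + (1 + phase_time prog_params 0 (bits1 s) + list_time pre_list (loop_limit s) (bits2 s))"
definition draw_time :: "nat \<Rightarrow> nat" where
  "draw_time s = (4 * loop_limit s + 3) * (1 + draw_cost * (bits3 s + 1))"
definition post_time :: "nat \<Rightarrow> nat" where
  "post_time s = 1 + list_time post_list (loop_limit s) (bits3 s) + (4 * s + 9) * (1 + out_cost * (bits4 s + 1))"
definition main_time :: "nat \<Rightarrow> nat" where
  "main_time s = 2 + pre_time s + draw_time s + post_time s"

lemma poly_bounded_list_bits:
  "poly_bounded u \<Longrightarrow> poly_bounded f \<Longrightarrow> poly_bounded (\<lambda>x. list_bits cs (u x) (f x))"
  by (induction cs arbitrary: f) (auto intro: poly_bounded_phase_bits)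

lemma poly_bounded_list_time:
  "poly_bounded u \<Longrightarrow> poly_bounded f \<Longrightarrow> poly_bounded (\<lambda>x. list_time cs (u x) (f x))"
proof (induction cs arbitrary: f)
  case (Cons c cs)
  show ?case unfolding list_time.simps
    by (intro poly_bounded_add poly_bounded_const poly_bounded_phase_time Cons poly_bounded_phase_bits)
qed (simp add: poly_bounded_const)

lemma poly_bounded_main_time: "poly_bounded main_time"
proof -
  have l: "poly_bounded loop_limit" unfolding loop_limit_def by (intro poly_bounded_intros)
  have b1: "poly_bounded bits1" unfolding bits1_def by (intro poly_bounded_phase_bits poly_bounded_intros)
  have b2: "poly_bounded bits2" unfolding bits2_def by (intro poly_bounded_phase_bits poly_bounded_const b1)
  have b3: "poly_bounded bits3" unfolding bits3_def by (intro poly_bounded_list_bits l b2)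
  have b4: "poly_bounded bits4" unfolding bits4_def by (intro poly_bounded_list_bits l b3)
  show ?thesis unfolding main_time_def pre_time_def draw_time_def post_time_def
    by (intro poly_bounded_add poly_bounded_mult poly_bounded_const poly_bounded_phase_time poly_bounded_list_time
        l b1 b2 b3 b4 poly_bounded_id)
qed

text \<open>Up to the end of the draws the number of machine steps is the same for all outcomes.
  Afterwards it may vary, but halted configurations stay put, so all outcomes can be run up to a
  common \<open>T\<close>.\<close>

lemma run_main:
  assumes pre: "exec pre_com m0 (flat inp \<sigma>) t1" "t1 \<le> T1"
    and b: "\<forall>k i. \<sigma> k i \<le> 2 ^ b" "\<forall>a. inp a \<le> 2 ^ b"
    and v: "\<sigma> bJN 0 = J" "\<sigma> bLL 0 = L" "0 < L" "\<sigma> bRD = (\<lambda>_. 0)"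
    and post: "\<And>\<omega>. \<omega> \<in> set_pmf (draws J L) \<Longrightarrow>
      \<exists>t \<le> T3. exec post_com (flat inp (put vU 0 J (\<sigma>(bRD := \<omega>)))) (mem \<omega>) t"
    and T: "2 + T1 + (4 * J + 3) * (1 + draw_cost * (b + 1)) + T3 \<le> T"
  shows "\<exists>f. run T ([main_com], m0, 0) = map_pmf f (draws J L) \<and>
    (\<forall>\<omega>\<in>set_pmf (draws J L). \<exists>t \<le> T. f \<omega> = ([], mem \<omega>, t))"
proof -
  let ?K = "1 + draw_cost * (b + 1)"
  obtain s1 where s1: "s1 \<le> t1" "\<And>k t0. run s1 (pre_com # k, m0, t0) = return_pmf (k, flat inp \<sigma>, t0 + t1)"
    using pre(1) by (auto simp: exec_def)
  obtain f where f: "run (4 * J + 3) (draw_com # [post_com], flat inp \<sigma>, 2 + t1) = map_pmf f (draws J L)"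
    "\<And>\<omega>. \<omega> \<in> set_pmf (draws J L) \<Longrightarrow> \<exists>t \<le> (4 * J + 3) * ?K.
       f \<omega> = ([post_com], flat inp (put vU 0 J (\<sigma>(bRD := \<omega>))), 2 + t1 + t)"
    using run_draw_com[OF b v, of "[post_com]" "2 + t1"] by blast
  have JK: "4 * J + 3 \<le> (4 * J + 3) * ?K" by simp
  define R where "R = T - (2 + s1 + (4 * J + 3))"
  have TR: "T = Suc (s1 + Suc ((4 * J + 3) + R))" and RT: "T3 \<le> R"
    using T s1(1) pre(2) JK unfolding R_def by linarith+
  have r1: "run T ([main_com], m0, 0) = bind_pmf (draws J L) (\<lambda>\<omega>. run R (f \<omega>))"
  proof -
    have "run T ([main_com], m0, 0) = run (s1 + Suc ((4 * J + 3) + R)) ([pre_com, Seq draw_com post_com], m0, 1)"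
      unfolding TR main_com_def by (simp only: run.simps(2)) (simp add: bind_return_pmf)
    also have "\<dots> = run (Suc ((4 * J + 3) + R)) ([Seq draw_com post_com], flat inp \<sigma>, 1 + t1)"
      unfolding run_add[of s1] s1(2) by (simp only: bind_return_pmf)
    also have "\<dots> = run ((4 * J + 3) + R) ([draw_com, post_com], flat inp \<sigma>, 2 + t1)"
      by (simp only: run.simps(2)) (simp add: bind_return_pmf)
    also have "\<dots> = bind_pmf (draws J L) (\<lambda>\<omega>. run R (f \<omega>))"
      unfolding run_add[of "4 * J + 3" R] f(1) by (simp add: bind_map_pmf)
    finally show ?thesis .
  qed
  have "\<exists>t \<le> T. run R (f \<omega>) = return_pmf ([], mem \<omega>, t)" if w: "\<omega> \<in> set_pmf (draws J L)" for \<omega>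
  proof -
    obtain t where t: "t \<le> (4 * J + 3) * ?K" "f \<omega> = ([post_com], flat inp (put vU 0 J (\<sigma>(bRD := \<omega>))), 2 + t1 + t)"
      using f(2)[OF w] by blast
    obtain t' where t': "t' \<le> T3" "exec post_com (flat inp (put vU 0 J (\<sigma>(bRD := \<omega>)))) (mem \<omega>) t'"
      using post[OF w] by blast
    obtain s3 where s3: "s3 \<le> t'" "\<And>k t0. run s3 (post_com # k, flat inp (put vU 0 J (\<sigma>(bRD := \<omega>))), t0) = return_pmf (k, mem \<omega>, t0 + t')"
      using t'(2) by (auto simp: exec_def)
    have "R = s3 + (R - s3)" using s3(1) t'(1) RT by simp
    hence "run R (f \<omega>) = bind_pmf (run s3 (f \<omega>)) (run (R - s3))" using run_add by metis
    also have "\<dots> = return_pmf ([], mem \<omega>, 2 + t1 + t + t')"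
      unfolding t(2) s3(2) by (simp add: bind_return_pmf run_halted)
    finally have "run R (f \<omega>) = return_pmf ([], mem \<omega>, 2 + t1 + t + t')" .
    moreover have "2 + t1 + t + t' \<le> T" using t(1) t'(1) pre(2) T by linarith
    ultimately show ?thesis by blast
  qed
  then obtain tt where tt: "\<And>\<omega>. \<omega> \<in> set_pmf (draws J L) \<Longrightarrow> tt \<omega> \<le> T \<and> run R (f \<omega>) = return_pmf ([], mem \<omega>, tt \<omega>)"
    by metis
  have "run T ([main_com], m0, 0) = bind_pmf (draws J L) (\<lambda>\<omega>. return_pmf ([], mem \<omega>, tt \<omega>))"
    unfolding r1 by (rule bind_pmf_cong[OF refl]) (use tt in simp)
  also have "\<dots> = map_pmf (\<lambda>\<omega>. ([], mem \<omega>, tt \<omega>)) (draws J L)" by (simp add: map_pmf_def)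
  finally show ?thesis using tt by blast
qed

text \<open>Halted configurations are fixed by \<open>run\<close>, so any halting bound yields the
  same distribution as the least one, whose value remains unknown.\<close>

lemma outcome_eq:
  assumes "halts_within P xs T"
  shows "outcome P xs = map_pmf (\<lambda>(k, m, t). m) (run T (init_config P xs))"
proof -
  define T0 where "T0 = (LEAST T. halts_within P xs T)"
  have h: "halts_within P xs T0" unfolding T0_def by (rule LeastI[of _ T]) (rule assms)
  have le: "T0 \<le> T" unfolding T0_def by (rule Least_le) (rule assms)
  have "run T (init_config P xs) = bind_pmf (run T0 (init_config P xs)) (run (T - T0))"
    using run_add[of T0 "T - T0"] le by simp
  also have "\<dots> = bind_pmf (run T0 (init_config P xs)) return_pmf"
  proof (rule bind_pmf_cong[OF refl])
    fix c assume c: "c \<in> set_pmf (run T0 (init_config P xs))"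
    obtain k m t where kmt: "c = (k, m, t)" by (cases c)
    have "k = []" using h c unfolding halts_within_def kmt by auto
    thus "run (T - T0) c = return_pmf c" unfolding kmt by (simp add: run_halted)
  qed
  finally show ?thesis by (simp add: outcome_def T0_def bind_return_pmf')
qed

lemma le_input_size: "x \<in> set xs \<Longrightarrow> x \<le> 2 ^ input_size xs"
proof -
  assume x: "x \<in> set xs"
  have "nat_size x \<le> input_size xs" unfolding input_size_def using x by (intro member_le_sum_list) auto
  moreover have "x < 2 ^ nat_size x"
  proof -
    have "x < 2 ^ (floorlog 2 x)" if "0 < x" using floorlog_bounds[OF that, of 2] by simp
    thus ?thesis by (cases "x = 0") (auto simp: nat_size_def)
  qed
  ultimately show ?thesis using le_two_power_mono[of x "nat_size x" "input_size xs"] by simp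
qed

lemma length_le_input_size: "length xs \<le> input_size xs"
  unfolding input_size_def by (induction xs) (auto simp: nat_size_def)

section \<open>Running time and correctness on one instance\<close>

context ftfp_encoded
begin

definition size_I :: nat where "size_I = input_size (encode I)"

abbreviation "st_final \<equiv> sems inp pre_list (st_params inp)"
abbreviation "drawn_state \<omega> \<equiv> put vU 0 J_total (st_final(bRD := \<omega>))"

lemma base_inp: "base inp = length (encode I)"
  unfolding base_def iv(1,2) length_encode ..

lemma base_le: "base inp \<le> size_I"
  unfolding base_inp size_I_def by (rule length_le_input_size)

lemma inp_le: "size_I \<le> b \<Longrightarrow> inp a \<le> 2 ^ b"
  using le_input_size[of "encode I ! a" "encode I"] le_two_power_mono[of _ size_I b]
  by (auto simp: inp_of_def size_I_def)

text \<open>The encoding lists all pairs of a site and a client, and every number contributes at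
  least 1 to the input size. So dimensions, unlike demands and costs, are bounded by the size itself
  and may serve as loop ranges.\<close>

lemma dims_le: "m \<le> size_I" "n \<le> size_I" "m * n \<le> size_I" "m + m * n \<le> base inp"
  using base_le unfolding base_inp length_encode by simp_all

lemma params_le:
  assumes "e \<in> size_exprs" "\<And>k. k \<in> {2..9} \<Longrightarrow> \<sigma> k = st_params inp k"
  shows "ev inp \<sigma> e \<le> loop_limit size_I"
proof -
  note v = st_params_values[OF iv(1,2)]
  let ?N = "19 * (1000000 * (size_I + 1))"
  have N: "19 * (1000000 * (n + 1)) \<le> ?N" using dims_le(2) by simp
  have a: "n * (19 * (1000000 * (n + 1))) * (19 * (1000000 * (n + 1))) \<le> size_I * ?N * ?N"
    by (rule mult_le_mono[OF mult_le_mono[OF dims_le(2) N] N])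
  have b: "n * (n * (19 * (1000000 * (n + 1)))) \<le> size_I * (size_I * ?N)"
    by (rule mult_le_mono[OF dims_le(2) mult_le_mono[OF dims_le(2) N]])
  have c: "n * (19 * (1000000 * (n + 1))) \<le> size_I * ?N * ?N"
  proof -
    have "n * (19 * (1000000 * (n + 1))) \<le> size_I * ?N * 1" unfolding mult_1_right by (rule mult_le_mono[OF dims_le(2) N])
    also have "\<dots> \<le> size_I * ?N * ?N" by (intro mult_le_mono) auto
    finally show ?thesis .
  qed
  have "ev inp \<sigma> e \<in> {m, n, m * n, n * (19 * (1000000 * (n + 1))),
      n * (19 * (1000000 * (n + 1))) * (19 * (1000000 * (n + 1))), n * (n * (19 * (1000000 * (n + 1))))}"
    using assms v unfolding size_exprs_def by auto
  thus ?thesis unfolding loop_limit_def using dims_le a b c by (elim insertE emptyE) linarith+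
qed

lemma J_le: "J_total \<le> loop_limit size_I"
proof -
  have N: "19 * (1000000 * (n + 1)) \<le> 19 * (1000000 * (size_I + 1))" using dims_le(2) by simp
  have "n * NN * NN + n * (n * NN) \<le> size_I * (19 * (1000000 * (size_I + 1))) * (19 * (1000000 * (size_I + 1))) +
      size_I * (size_I * (19 * (1000000 * (size_I + 1))))"
    unfolding NN_def MM_def by (rule add_mono[OF mult_le_mono[OF mult_le_mono[OF dims_le(2) N] N]
          mult_le_mono[OF dims_le(2) mult_le_mono[OF dims_le(2) N]]])
  thus ?thesis unfolding J_total_def loop_limit_def by linarith
qed

lemma exec_pre:
  shows "\<exists>t \<le> pre_time size_I. exec pre_com (flat inp init_banks) (flat inp st_final) t"
    and "\<forall>k i. st_final k i \<le> 2 ^ bits3 size_I"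
proof -
  have i0: "\<forall>k i. init_banks k i \<le> 2 ^ size_I" by (simp add: init_banks_def)
  have in0: "\<forall>a. inp a \<le> 2 ^ size_I" using inp_le by blast
  have nl: "e \<in> loop_bounds prog_dims \<Longrightarrow> ev inp s e \<le> 0" "e \<in> loop_bounds prog_params \<Longrightarrow> ev inp s e \<le> 0" for e s
    by (simp_all add: prog_dims_def prog_params_def)
  note d = exec_phase[OF wf_progs(1) i0 in0 nl(1), folded bits1_def]
  have in1: "\<forall>a. inp a \<le> 2 ^ bits1 size_I" unfolding bits1_def using inp_le le_phase_bits by blast
  note p = exec_phase[OF wf_progs(2) d(2) in1 nl(2), folded bits2_def st_params_def]
  have in2: "\<forall>a. inp a \<le> 2 ^ bits2 size_I"
    using in1 le_two_power_mono le_phase_bits unfolding bits2_def by blast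
  have s: "(\<exists>t \<le> list_time pre_list (loop_limit size_I) (bits2 size_I).
      exec (seq_com pre_list) (flat inp (st_params inp)) (flat inp st_final) t) \<and>
    (\<forall>k i. st_final k i \<le> 2 ^ bits3 size_I)"
    unfolding bits3_def by (rule exec_seq_com[OF sized_lists(1) p(2) in2]) (auto intro: params_le)
  obtain t1 where t1: "t1 \<le> phase_time prog_dims 0 size_I" "exec (ccom prog_dims) (flat inp init_banks) (flat inp (sem inp prog_dims init_banks)) t1"
    using d(1) by blast
  obtain t2 where t2: "t2 \<le> phase_time prog_params 0 (bits1 size_I)"
    "exec (ccom prog_params) (flat inp (sem inp prog_dims init_banks)) (flat inp (st_params inp)) t2" using p(1) by blast
  obtain t3 where t3: "t3 \<le> list_time pre_list (loop_limit size_I) (bits2 size_I)"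
    "exec (seq_com pre_list) (flat inp (st_params inp)) (flat inp st_final) t3" using s by blast
  have "exec pre_com (flat inp init_banks) (flat inp st_final) (1 + t1 + (1 + t2 + t3))"
    unfolding pre_com_def by (rule exec_Seq[OF t1(2) exec_Seq[OF t2(2) t3(2)]])
  moreover have "1 + t1 + (1 + t2 + t3) \<le> pre_time size_I" unfolding pre_time_def using t1(1) t2(1) t3(1) by linarith
  ultimately show "\<exists>t \<le> pre_time size_I. exec pre_com (flat inp init_banks) (flat inp st_final) t" by blast
  show "\<forall>k i. st_final k i \<le> 2 ^ bits3 size_I" using s by blast
qed

lemma st_final_params: "k \<in> {2..10} \<Longrightarrow> st_final k = st_params inp k"
  by (rule sems_unwritten) (auto simp: pre_list_def prog_defs)

lemma st_final_RD: "st_final bRD = (\<lambda>_. 0)"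
proof -
  have "st_final bRD = st_params inp bRD" by (rule sems_unwritten) (auto simp: pre_list_def prog_defs)
  thus ?thesis by (simp add: st_params_zero)
qed

lemma st_final_values: "st_final bJN 0 = J_total" "st_final bLL 0 = LL" "st_final bNS 0 = m" "st_final bNM 0 = m * n"
  using st_params_values[OF iv(1,2)] by (simp_all add: st_final_params J_total_def NN_def LL_def MM_def)

lemma exec_post:
  assumes w: "\<omega> \<in> set_pmf (draws J_total LL)"
  shows "\<exists>mem. \<exists>t \<le> post_time size_I. exec post_com (flat inp (drawn_state \<omega>)) mem t \<and>
    (\<forall>a<m + m * n. mem a = sems inp post_list (drawn_state \<omega>) bOUT a)"
proof -
  let ?s = "drawn_state \<omega>"
  note b3 = exec_pre(2)
  have J: "J_total \<le> 2 ^ bits3 size_I" "LL \<le> 2 ^ bits3 size_I" using b3 st_final_values by metis+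
  have \<omega>: "\<omega> x \<le> 2 ^ bits3 size_I" for x
  proof (cases "x < J_total")
    case True
    thus ?thesis using draws_less[OF w True LL_pos] J(2) by simp
  next
    case False
    hence "\<omega> x = 0" using w unfolding set_draws PiE_dflt_def by auto
    thus ?thesis by simp
  qed
  have sb: "\<forall>k i. ?s k i \<le> 2 ^ bits3 size_I" using b3 \<omega> J(1) by (simp add: put_def)
  have s3: "size_I \<le> bits3 size_I"
    unfolding bits3_def bits2_def bits1_def using le_list_bits le_phase_bits by (meson order_trans)
  have in3: "\<forall>a. inp a \<le> 2 ^ bits3 size_I" using inp_le[OF s3] by blast
  have lp: "ev inp ?s e \<le> loop_limit size_I" if "e \<in> size_exprs" for e
    by (rule params_le[OF that]) (auto simp: st_final_params)
  let ?f = "sems inp post_list ?s"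
  have e: "(\<exists>t \<le> list_time post_list (loop_limit size_I) (bits3 size_I). exec (seq_com post_list) (flat inp ?s) (flat inp ?f) t) \<and>
     (\<forall>k i. ?f k i \<le> 2 ^ bits4 size_I)"
    unfolding bits4_def by (rule exec_seq_com[OF sized_lists(2) sb in3 lp])
  have s4: "size_I \<le> bits4 size_I" unfolding bits4_def using s3 le_list_bits by (meson order_trans)
  have in4: "\<forall>a. inp a \<le> 2 ^ bits4 size_I" using inp_le[OF s4] by blast
  have one: "1 \<le> bits4 size_I" using s4 base_le base_ge[of inp] by linarith
  have bs: "base inp \<le> 2 ^ bits4 size_I" using base_le s4 nat_le_two_power[of "bits4 size_I"] by linarith
  have un: "?f k = ?s k" if "k \<in> {bNS, bNM}" for k
    by (rule sems_unwritten) (use that in \<open>auto simp: post_list_def prog_defs\<close>)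
  have M: "?f bNS 0 + ?f bNM 0 = m + m * n" using st_final_values by (simp add: un)
  obtain mem t where t: "t \<le> (4 * (m + m * n) + 9) * (1 + out_cost * (bits4 size_I + 1))"
    "exec out_com (flat inp ?f) mem t" "\<forall>a<m + m * n. mem a = ?f bOUT a"
    using exec_out_com[OF conjunct2[OF e] in4 one bs M dims_le(4)] by blast
  obtain t' where t': "t' \<le> list_time post_list (loop_limit size_I) (bits3 size_I)" "exec (seq_com post_list) (flat inp ?s) (flat inp ?f) t'"
    using e by blast
  have "exec post_com (flat inp ?s) mem (1 + t' + t)" unfolding post_com_def by (rule exec_Seq[OF t'(2) t(2)])
  moreover have "1 + t' + t \<le> post_time size_I"
  proof -
    have "m + m * n \<le> size_I" using dims_le(4) base_le by simp
    hence "(4 * (m + m * n) + 9) * (1 + out_cost * (bits4 size_I + 1)) \<le> (4 * size_I + 9) * (1 + out_cost * (bits4 size_I + 1))"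
      by (intro mult_le_mono1) simp
    thus ?thesis unfolding post_time_def using t(1) t'(1) by linarith
  qed
  ultimately show ?thesis using t(3) by blast
qed

lemma main_halts_outcome:
  "\<exists>mem. (\<forall>T \<ge> main_time size_I. halts_within main_com (encode I) T) \<and>
     outcome main_com (encode I) = map_pmf mem (draws J_total LL) \<and>
     (\<forall>\<omega>\<in>set_pmf (draws J_total LL). \<forall>a<m + m * n. mem \<omega> a = sems inp post_list (drawn_state \<omega>) bOUT a)"
proof -
  obtain mem where mem: "\<And>\<omega>. \<omega> \<in> set_pmf (draws J_total LL) \<Longrightarrow> \<exists>t \<le> post_time size_I. exec post_com (flat inp (drawn_state \<omega>)) (mem \<omega>) t"
    "\<And>\<omega> a. \<omega> \<in> set_pmf (draws J_total LL) \<Longrightarrow> a < m + m * n \<Longrightarrow> mem \<omega> a = sems inp post_list (drawn_state \<omega>) bOUT a"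
    using exec_post by metis
  obtain t1 where t1: "t1 \<le> pre_time size_I" "exec pre_com (flat inp init_banks) (flat inp st_final) t1"
    using exec_pre(1) by blast
  have s3: "size_I \<le> bits3 size_I"
    unfolding bits3_def bits2_def bits1_def using le_list_bits le_phase_bits by (meson order_trans)
  have in3: "\<forall>a. inp a \<le> 2 ^ bits3 size_I" using inp_le[OF s3] by blast
  have init: "init_config main_com (encode I) = ([main_com], flat inp init_banks, 0)"
    unfolding init_config_def flat_def base_inp by (auto simp: inp_of_def init_banks_def fun_eq_iff)
  have run: "\<exists>f. run T (init_config main_com (encode I)) = map_pmf f (draws J_total LL) \<and>
      (\<forall>\<omega>\<in>set_pmf (draws J_total LL). \<exists>t \<le> T. f \<omega> = ([], mem \<omega>, t))" if T: "main_time size_I \<le> T" for T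
    unfolding init
  proof (rule run_main[OF t1(2,1) exec_pre(2) in3 st_final_values(1,2) LL_pos st_final_RD mem(1)])
    have "(4 * J_total + 3) * (1 + draw_cost * (bits3 size_I + 1)) \<le> draw_time size_I"
      unfolding draw_time_def using J_le by (intro mult_le_mono1) simp
    thus "2 + pre_time size_I + (4 * J_total + 3) * (1 + draw_cost * (bits3 size_I + 1)) + post_time size_I \<le> T"
      using T unfolding main_time_def by linarith
  qed
  have halts: "halts_within main_com (encode I) T" if T: "main_time size_I \<le> T" for T
  proof -
    obtain f where f: "run T (init_config main_com (encode I)) = map_pmf f (draws J_total LL)"
      "\<forall>\<omega>\<in>set_pmf (draws J_total LL). \<exists>t \<le> T. f \<omega> = ([], mem \<omega>, t)" using run[OF T] by blast
    show ?thesis unfolding halts_within_def f(1) using f(2) by fastforce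
  qed
  have "outcome main_com (encode I) = map_pmf mem (draws J_total LL)"
  proof -
    obtain f where f: "run (main_time size_I) (init_config main_com (encode I)) = map_pmf f (draws J_total LL)"
      "\<forall>\<omega>\<in>set_pmf (draws J_total LL). \<exists>t \<le> main_time size_I. f \<omega> = ([], mem \<omega>, t)" using run[OF order_refl] by blast
    show ?thesis unfolding outcome_eq[OF halts[OF order_refl]] f(1) pmf.map_comp
      by (rule map_pmf_cong[OF refl]) (use f(2) in force)
  qed
  thus ?thesis using halts mem(2) by blast
qed

definition result :: "(nat \<Rightarrow> nat) \<Rightarrow> nat \<Rightarrow> nat" where
  "result \<omega> = sems inp post_list (drawn_state \<omega>) bOUT"

lemma result_rounding:
  assumes "0 \<le> Z" "dual_bound Z"
  shows "\<omega> \<in> set_pmf (draws J_total LL) \<Longrightarrow> i < m \<Longrightarrow> j < n \<Longrightarrow> result \<omega> (m + (i * n + j)) \<le> result \<omega> i"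
    and "\<omega> \<in> set_pmf (draws J_total LL) \<Longrightarrow> j < n \<Longrightarrow> demand I j \<le> (\<Sum>i<m. result \<omega> (m + (i * n + j)))"
    and "measure_pmf.expectation (draws J_total LL)
       (\<lambda>\<omega>. real (\<Sum>i<m. Fc i * result \<omega> i) + real (\<Sum>i<m. \<Sum>j<n. Dc i j * result \<omega> (m + (i * n + j))))
       \<le> 19 / 11 * (1 + 1 / 500 + 1 / 10000) * Z"
proof -
  have eq: "result = (\<lambda>\<omega>. sem inp prog_output (sem inp prog_connect (sem inp prog_open
     (put vU 0 J_total ((sem inp prog_cluster (sem inp prog_atoms (sem inp prog_split (sem inp prog_mwu (st_scale inp)))))(bRD := \<omega>))))) bOUT)"
    by (simp add: result_def fun_eq_iff post_list_def pre_list_def st_scale_def st_prods_def st_input_def)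
  note rd = rounding[where inp = inp, OF st_scale_ok st_scale_W st_scale_zero assms]
  show "\<omega> \<in> set_pmf (draws J_total LL) \<Longrightarrow> i < m \<Longrightarrow> j < n \<Longrightarrow> result \<omega> (m + (i * n + j)) \<le> result \<omega> i"
    unfolding eq by (rule rd(1))
  show "\<omega> \<in> set_pmf (draws J_total LL) \<Longrightarrow> j < n \<Longrightarrow> demand I j \<le> (\<Sum>i<m. result \<omega> (m + (i * n + j)))"
    unfolding eq by (rule rd(2))
  show "measure_pmf.expectation (draws J_total LL)
       (\<lambda>\<omega>. real (\<Sum>i<m. Fc i * result \<omega> i) + real (\<Sum>i<m. \<Sum>j<n. Dc i j * result \<omega> (m + (i * n + j))))
       \<le> 19 / 11 * (1 + 1 / 500 + 1 / 10000) * Z"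
    unfolding eq by (rule rd(3))
qed

text \<open>The rounding bound is applied to each feasible fractional solution separately, with its
  cost scaled by \<open>Q\<close> as \<open>Z\<close>; only then is the infimum taken.\<close>

lemma main_correct:
  shows "m' \<in> set_pmf (outcome main_com (encode I)) \<Longrightarrow> feasible I (out_y I m') (out_x I m')"
    and "measure_pmf.expectation (outcome main_com (encode I)) (\<lambda>m. int_cost I (out_y I m) (out_x I m))
      \<le> (1 + 2 / exp 1) * LP_opt I"
proof -
  obtain mem where out: "outcome main_com (encode I) = map_pmf mem (draws J_total LL)"
    and mem: "\<And>\<omega> a. \<omega> \<in> set_pmf (draws J_total LL) \<Longrightarrow> a < m + m * n \<Longrightarrow> mem \<omega> a = result \<omega> a"
    using main_halts_outcome unfolding result_def by blast
  have y: "out_y I (mem \<omega>) i = result \<omega> i" if "\<omega> \<in> set_pmf (draws J_total LL)" "i < m" for \<omega> i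
    using mem[OF that(1), of i] that(2) by (simp add: out_y_def)
  have x: "out_x I (mem \<omega>) i j = result \<omega> (m + (i * n + j))" if "\<omega> \<in> set_pmf (draws J_total LL)" "i < m" "j < n" for \<omega> i j
    using mem[OF that(1), of "m + (i * n + j)"] pair_index_less[OF that(2,3)] by (simp add: out_x_def add.assoc)
  obtain y0 x0 where "feasible I (y0 :: nat \<Rightarrow> nat) x0" using int_feasible_ex by blast
  note f0 = int_feasible_real[OF this]
  note rr = result_rounding[OF feasible_dual_bound(2,1)[OF f0]]
  show "feasible I (out_y I m') (out_x I m')" if mm: "m' \<in> set_pmf (outcome main_com (encode I))"
  proof -
    obtain \<omega> where w: "\<omega> \<in> set_pmf (draws J_total LL)" "m' = mem \<omega>" using mm unfolding out by auto
    show ?thesis unfolding feasible_def w(2)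
      using rr(1,2)[OF w(1)] y[OF w(1)] x[OF w(1)] by simp
  qed
  let ?E = "measure_pmf.expectation (draws J_total LL)
       (\<lambda>\<omega>. real (\<Sum>i<m. Fc i * result \<omega> i) + real (\<Sum>i<m. \<Sum>j<n. Dc i j * result \<omega> (m + (i * n + j))))"
  have Qp: "0 < real Q" using Q_pos by simp
  have Eeq: "measure_pmf.expectation (outcome main_com (encode I)) (\<lambda>m. int_cost I (out_y I m) (out_x I m)) = ?E / real Q"
  proof -
    have "measure_pmf.expectation (outcome main_com (encode I)) (\<lambda>m. int_cost I (out_y I m) (out_x I m)) =
        measure_pmf.expectation (draws J_total LL) (\<lambda>\<omega>. int_cost I (out_y I (mem \<omega>)) (out_x I (mem \<omega>)))"
      unfolding out by simp
    also have "\<dots> = measure_pmf.expectation (draws J_total LL)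
       (\<lambda>\<omega>. (real (\<Sum>i<m. Fc i * result \<omega> i) + real (\<Sum>i<m. \<Sum>j<n. Dc i j * result \<omega> (m + (i * n + j)))) / real Q)"
    proof (rule integral_cong_AE)
      show "AE \<omega> in measure_pmf (draws J_total LL). int_cost I (out_y I (mem \<omega>)) (out_x I (mem \<omega>)) =
         (real (\<Sum>i<m. Fc i * result \<omega> i) + real (\<Sum>i<m. \<Sum>j<n. Dc i j * result \<omega> (m + (i * n + j)))) / real Q"
        unfolding AE_measure_pmf_iff
      proof
        fix \<omega> assume w: "\<omega> \<in> set_pmf (draws J_total LL)"
        have "real Q * int_cost I (out_y I (mem \<omega>)) (out_x I (mem \<omega>)) =
          real (\<Sum>i<m. Fc i * result \<omega> i) + real (\<Sum>i<m. \<Sum>j<n. Dc i j * result \<omega> (m + (i * n + j)))"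
          unfolding int_cost_def scaled_cost using y[OF w] x[OF w] by simp
        thus "int_cost I (out_y I (mem \<omega>)) (out_x I (mem \<omega>)) =
         (real (\<Sum>i<m. Fc i * result \<omega> i) + real (\<Sum>i<m. \<Sum>j<n. Dc i j * result \<omega> (m + (i * n + j)))) / real Q"
          using Qp by (simp add: field_simps)
      qed
    qed simp_all
    finally show ?thesis by simp
  qed
  have e1: "0 < 1 + 2 / exp (1::real)" by (simp add: add_pos_pos)
  have c: "?E / real Q / (1 + 2 / exp 1) \<le> cost I y x" if fe: "feasible I y x" for y x
  proof -
    note db = feasible_dual_bound[OF fe]
    have "?E \<le> 19 / 11 * (1 + 1 / 500 + 1 / 10000) * (real Q * cost I y x)"
      by (rule result_rounding(3)[OF db(2,1)])
    also have "\<dots> \<le> (1 + 2 / exp 1) * (real Q * cost I y x)"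
      by (rule mult_right_mono[OF ratio_const db(2)])
    finally have "?E / real Q \<le> (1 + 2 / exp 1) * cost I y x" using Qp by (simp add: field_simps)
    thus ?thesis unfolding pos_divide_le_eq[OF e1] by (simp only: mult.commute)
  qed
  have "?E / real Q / (1 + 2 / exp 1) \<le> LP_opt I"
    unfolding LP_opt_def by (rule cInf_greatest) (use f0 c in blast)+
  thus "measure_pmf.expectation (outcome main_com (encode I)) (\<lambda>m. int_cost I (out_y I m) (out_x I m))
      \<le> (1 + 2 / exp 1) * LP_opt I"
    unfolding Eeq pos_divide_le_eq[OF e1] by (simp only: mult.commute)
qed

end

theorem theorem12:
  "\<exists>P :: com.
     poly_time_on (encode ` {I. ftfp_instance I}) P \<and>
     (\<forall>I. ftfp_instance I \<longrightarrow>
        (\<forall>m \<in> set_pmf (outcome P (encode I)). feasible I (out_y I m) (out_x I m)) \<and>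
        measure_pmf.expectation (outcome P (encode I)) (\<lambda>m. int_cost I (out_y I m) (out_x I m))
          \<le> (1 + 2 / exp 1) * LP_opt I \<and>
        (1 + 2 / exp 1) * LP_opt I \<le> (1 + 2 / exp 1) * OPT I)"
proof (intro exI[of _ main_com] conjI allI impI ballI)
  obtain p :: "nat poly" where p: "\<And>x. main_time x \<le> poly p x"
    using poly_bounded_main_time unfolding poly_bounded_def by blast
  show "poly_time_on (encode ` {I. ftfp_instance I}) main_com"
    unfolding poly_time_on_def
  proof (intro exI[of _ p] ballI)
    fix xs assume "xs \<in> encode ` {I. ftfp_instance I}"
    then obtain I where I: "ftfp_instance I" "xs = encode I" by auto
    interpret ftfp_encoded I by unfold_locales (rule I(1))
    show "halts_within main_com xs (poly p (input_size xs))"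
      using main_halts_outcome p[of size_I] unfolding I(2) size_I_def by blast
  qed
next
  fix I assume I: "ftfp_instance I"
  interpret ftfp_encoded I by unfold_locales (rule I)
  show "feasible I (out_y I m') (out_x I m')" if "m' \<in> set_pmf (outcome main_com (encode I))" for m'
    by (rule main_correct(1)[OF that])
  show "measure_pmf.expectation (outcome main_com (encode I)) (\<lambda>m. int_cost I (out_y I m) (out_x I m))
      \<le> (1 + 2 / exp 1) * LP_opt I"
    by (rule main_correct(2))
  show "(1 + 2 / exp 1) * LP_opt I \<le> (1 + 2 / exp 1) * OPT I"
    by (rule mult_left_mono[OF LP_opt_le_OPT]) (simp add: add_nonneg_nonneg)
qed

end
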